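(* Let $F$ be a non-discrete locally compact non-archimedean field of characteristic $\neq 2$, with residue field of characteristic $p$ and cardinality $q$. Let $R$ be an integral domain with $p\in R^\times$ and with a fixed square root $q^{1/2}$ of $q$ in $R$, and let $\chi:F\to R^\times$ be a non-trivial smooth character. Then the map $f\mapsto\gamma(f)$, sending a non-degenerate quadratic form over $F$ to its Weil factor, is an $R$-character of the Witt group of $F$; that is, $\gamma(f)$ depends only on the Witt equivalence class of $f$, and $\gamma$ induces a group homomorphism from the Witt group of $F$ to $R^\times$.
   Context: Witt group: for non-degenerate quadratic forms $f_1,f_2$ on finite-dimensional $F$-vector spaces $G_1,G_2$, let $(f_1\oplus f_2)(x_1\oplus x_2)=f_1(x_1)+f_2(x_2)$ on $G_1\times G_2$. The forms $f_1,f_2$ are equivalent if (up to isometry) one is obtained from the other by adding a hyperbolic quadratic form $h(\mathbf x)=\sum_{i=1}^nx_ix_{i+n}$ of dimension $2n=|\dim G_1-\dim G_2|$. The Witt group of $F$ is the set of equivalence classes of non-degenerate quadratic forms over $F$ with the operation induced by $\oplus$. A smooth character of $F$ is a group homomorphism $F\to R^\times$ with open kernel. For a finite-dimensional $F$-vector space $X$ let $X^*=\mathrm{Hom}_F(X,F)$, $\langle x,x^*\rangle=\chi(x^*(x))$, and identify $X^{**}=X$. $\mathcal S(X)$ is the $R$-module of locally constant compactly supported functions $X\to R$. An $R$-valued Haar measure on $X$ is a non-zero translation-invariant $R$-linear functional $\Phi\mapsto\int_X\Phi(x)dx$ on $\mathcal S(X)$; the volume of a compact open set is the integral of its characteristic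 function. Normalization: fix an $\mathcal O_F$-lattice $L\subset X$ and put $L_*=\{x^*\in X^*:\langle x,x^*\rangle=1\ \forall x\in L\}$, an $\mathcal O_F$-lattice of $X^*$. Let $dx$, $dx^*$ be the $R$-valued Haar measures on $X$, $X^*$ giving $L$, $L_*$ volume $1$. For an $F$-linear isomorphism $\nu:G\to H$ with $G,H\in\{X,X^*\}$ and corresponding lattices $L_G,L_H\in\{L,L_*\}$, let $a\in\mathbb Z$ be given by $q^a=[\nu(L_G):\nu(L_G)\cap L_H]/[L_H:\nu(L_G)\cap L_H]$, and put $|\nu|=q^a\in R$, $|\nu|^{1/2}=(q^{1/2})^a$; thus $\int_H\Phi(y)dy=|\nu|\int_G\Phi(\nu(x))dx$. Fourier transform: $\mathscr F\Phi(x^* )=\int_X\Phi(x)\langle x,x^*\rangle dx$ for $\Phi\in\mathcal S(X)$. For an isomorphism $\beta:X^*\to X$, $\mathbf d_0'(\beta)\in\mathrm{Aut}(\mathcal S(X))$ is $\mathbf d_0'(\beta)\Phi=|\beta|^{-1/2}(\mathscr F\Phi\circ\beta^{-1})$. For a quadratic form $f$ on $X$, $\mathbf t_0(f)\Phi=(\chi\circ f)\cdot\Phi$. To a quadratic form $f$ on $X$ is associated the symmetric homomorphism $\rho:X\to X^*$, $\rho(x)(y)=f(x+y)-f(x)-f(y)$; $f$ is non-degenerate if $\rho$ is an isomorphism. For non-degenerate $f$, the Weil factor $\gamma(f)\in R^\times$ is the unique element such that $$\mathbf d_0'(\rho^{-1})\mathbf t_0(f)\mathbf d_0'(-\rho^{-1})\mathbf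 t_0(f)=\gamma(f)\,\mathbf t_0(-f)\mathbf d_0'(\rho^{-1})$$ in $\mathrm{Aut}(\mathcal S(X))$; it does not depend on the choice of $L$. *)

theory Defs
  imports
    "HOL-Analysis.Analysis"
    "HOL-Algebra.Group"
    "HOL-Library.Function_Algebras"
begin

section \<open>The base field\<close>

text \<open>
  The absolute value \<open>absval\<close> only serves to define the topology and the ring of integers,
  which depend on it only up to equivalence of absolute values.
\<close>

class nonarch_local_field = field + metric_space +
  fixes absval :: "'a \<Rightarrow> real"
  assumes dist_absval: "dist x y = absval (x - y)"
    and absval_mult: "absval (x * y) = absval x * absval y"
    and absval_ultrametric: "absval (x + y) \<le> max (absval x) (absval y)"
    and non_discrete: "\<exists>x. \<not> open {x}"
    and locally_compact: "\<exists>U K. open U \<and> compact K \<and> x \<in> U \<and> U \<subseteq> K"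

definition integers :: "'f::nonarch_local_field set" where
  "integers = {x. absval x \<le> 1}"

definition max_ideal :: "'f::nonarch_local_field set" where
  "max_ideal = {x. absval x < 1}"

definition residue_field :: "'f::nonarch_local_field set set" where
  "residue_field = integers // {(x, y). x \<in> integers \<and> y \<in> integers \<and> x - y \<in> max_ideal}"

definition residue_card :: "'f::nonarch_local_field itself \<Rightarrow> nat" where
  "residue_card _ = card (residue_field :: 'f set set)"

text \<open>The same recipe as \<^const>\<open>semiring_char\<close>, applied to the residue field.\<close>

definition residue_char :: "'f::nonarch_local_field itself \<Rightarrow> nat" where
  "residue_char _ = Gcd {n. (of_nat n :: 'f) \<in> max_ideal}"

definition unit_group :: "'r::comm_ring_1 monoid" where
  "unit_group = units_of \<lparr>carrier = UNIV, monoid.mult = (*), one = 1\<rparr>"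

definition smooth_character :: "('f::nonarch_local_field \<Rightarrow> 'r::idom) \<Rightarrow> bool" where
  "smooth_character chi \<longleftrightarrow>
     (\<forall>x. chi x dvd 1) \<and> (\<forall>x y. chi (x + y) = chi x * chi y) \<and> open {x. chi x = 1}"

section \<open>Finite-dimensional vector spaces, their duals and lattices\<close>

text \<open>
  A finite-dimensional space is a subspace \<open>X\<close> of a type carrying a scalar multiplication \<open>s\<close>.
  Functions on \<open>X\<close> with values in the field or in \<open>R\<close> are represented by their extension by zero
  when equality of such functions matters (elements of the dual and of the Schwartz space).
\<close>

definition fd_space :: "('f::field \<Rightarrow> 'v::ab_group_add \<Rightarrow> 'v) \<Rightarrow> 'v set \<Rightarrow> bool" where
  "fd_space s X \<longleftrightarrow> vector_space s \<and> module.subspace s X \<and>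
     (\<exists>B. finite B \<and> module.span s B = X)"

definition linear_map ::
    "('f::field \<Rightarrow> 'v::ab_group_add \<Rightarrow> 'v) \<Rightarrow> 'v set \<Rightarrow>
     ('f \<Rightarrow> 'w::ab_group_add \<Rightarrow> 'w) \<Rightarrow> 'w set \<Rightarrow> ('v \<Rightarrow> 'w) \<Rightarrow> bool" where
  "linear_map s X s' Y h \<longleftrightarrow> h ` X \<subseteq> Y \<and>
     (\<forall>x\<in>X. \<forall>y\<in>X. h (x + y) = h x + h y) \<and> (\<forall>c. \<forall>x\<in>X. h (s c x) = s' c (h x))"

definition linear_iso ::
    "('f::field \<Rightarrow> 'v::ab_group_add \<Rightarrow> 'v) \<Rightarrow> 'v set \<Rightarrow>
     ('f \<Rightarrow> 'w::ab_group_add \<Rightarrow> 'w) \<Rightarrow> 'w set \<Rightarrow> ('v \<Rightarrow> 'w) \<Rightarrow> bool" where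
  "linear_iso s X s' Y h \<longleftrightarrow> linear_map s X s' Y h \<and> bij_betw h X Y"

definition fun_scale :: "'f::field \<Rightarrow> ('i \<Rightarrow> 'f) \<Rightarrow> ('i \<Rightarrow> 'f)" where
  "fun_scale c u = (\<lambda>i. c * u i)"

definition prod_scale ::
    "('f \<Rightarrow> 'v \<Rightarrow> 'v) \<Rightarrow> ('f \<Rightarrow> 'w \<Rightarrow> 'w) \<Rightarrow> 'f \<Rightarrow> 'v \<times> 'w \<Rightarrow> 'v \<times> 'w" where
  "prod_scale s s' c = map_prod (s c) (s' c)"

definition coord_space :: "nat \<Rightarrow> (nat \<Rightarrow> 'f::field) set" where
  "coord_space n = {x. \<forall>i\<ge>n. x i = 0}"

definition dual :: "('f::field \<Rightarrow> 'v::ab_group_add \<Rightarrow> 'v) \<Rightarrow> 'v set \<Rightarrow> ('v \<Rightarrow> 'f) set" where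
  "dual s X = {u. linear_map s X (*) UNIV u \<and> (\<forall>x. x \<notin> X \<longrightarrow> u x = 0)}"

text \<open>
  The coarsest topology on \<open>X\<close> making all linear functionals continuous; on a finite-dimensional
  space it is the product topology transported along any basis.
\<close>

definition vs_topology ::
    "('f::nonarch_local_field \<Rightarrow> 'v::ab_group_add \<Rightarrow> 'v) \<Rightarrow> 'v set \<Rightarrow> 'v topology" where
  "vs_topology s X = topology_generated_by {{x \<in> X. u x \<in> U} | u U. u \<in> dual s X \<and> open U}"

definition ring_lattice ::
    "('f::nonarch_local_field \<Rightarrow> 'v::ab_group_add \<Rightarrow> 'v) \<Rightarrow> 'v set \<Rightarrow> 'v set \<Rightarrow> bool" where
  "ring_lattice s X L \<longleftrightarrow> (\<exists>B. finite B \<and> \<not> module.dependent s B \<and> module.span s B = X \<and>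
     L = {\<Sum>b\<in>B. s (c b) b | c. \<forall>b\<in>B. c b \<in> integers})"

definition dual_lattice ::
    "('f::nonarch_local_field \<Rightarrow> 'r::idom) \<Rightarrow> ('f \<Rightarrow> 'v::ab_group_add \<Rightarrow> 'v) \<Rightarrow> 'v set \<Rightarrow>
     'v set \<Rightarrow> ('v \<Rightarrow> 'f) set" where
  "dual_lattice chi s X L = {u \<in> dual s X. \<forall>x\<in>L. chi (u x) = 1}"

definition coset_index :: "'v::ab_group_add set \<Rightarrow> 'v set \<Rightarrow> nat" where
  "coset_index A B = card ((\<lambda>a. (+) a ` B) ` A)"

text \<open>
  For an isomorphism \<open>h\<close> and lattices \<open>L\<close>, \<open>M\<close> of its source and target, the exponent \<open>a\<close> with
  \<open>|h| = q^a\<close>.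
\<close>

definition modulus_exp ::
    "'f::nonarch_local_field itself \<Rightarrow> ('v::ab_group_add \<Rightarrow> 'w::ab_group_add) \<Rightarrow>
     'v set \<Rightarrow> 'w set \<Rightarrow> int" where
  "modulus_exp F h L M = (THE a. real (residue_card F) powi a =
     real (coset_index (h ` L) (h ` L \<inter> M)) / real (coset_index M (h ` L \<inter> M)))"

section \<open>Schwartz space, Haar measure and Fourier transform\<close>

definition schwartz ::
    "('f::nonarch_local_field \<Rightarrow> 'v::ab_group_add \<Rightarrow> 'v) \<Rightarrow> 'v set \<Rightarrow> ('v \<Rightarrow> 'r::idom) set" where
  "schwartz s X = {\<Phi>.
     (\<forall>x. x \<notin> X \<longrightarrow> \<Phi> x = 0) \<and>
     (\<forall>x\<in>X. \<exists>U. openin (vs_topology s X) U \<and> x \<in> U \<and> (\<forall>y\<in>U. \<Phi> y = \<Phi> x)) \<and>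
     compactin (vs_topology s X) (vs_topology s X closure_of {x \<in> X. \<Phi> x \<noteq> 0})}"

definition haar_measure ::
    "('f::nonarch_local_field \<Rightarrow> 'v::ab_group_add \<Rightarrow> 'v) \<Rightarrow> 'v set \<Rightarrow>
     (('v \<Rightarrow> 'r::idom) \<Rightarrow> 'r) \<Rightarrow> bool" where
  "haar_measure s X \<mu> \<longleftrightarrow>
     (\<forall>\<Phi>\<in>schwartz s X. \<forall>\<Psi>\<in>schwartz s X. \<mu> (\<lambda>x. \<Phi> x + \<Psi> x) = \<mu> \<Phi> + \<mu> \<Psi>) \<and>
     (\<forall>c. \<forall>\<Phi>\<in>schwartz s X. \<mu> (\<lambda>x. c * \<Phi> x) = c * \<mu> \<Phi>) \<and>
     (\<forall>a\<in>X. \<forall>\<Phi>\<in>schwartz s X. \<mu> (\<lambda>x. \<Phi> (x + a)) = \<mu> \<Phi>) \<and>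
     (\<exists>\<Phi>\<in>schwartz s X. \<mu> \<Phi> \<noteq> 0)"

text \<open>
  Integration against the Haar measure giving \<open>L\<close> volume 1. The choice operator is harmless: the
  normalized Haar measure is unique on the Schwartz space, and only its values there are used.
\<close>

definition haar_integral ::
    "('f::nonarch_local_field \<Rightarrow> 'v::ab_group_add \<Rightarrow> 'v) \<Rightarrow> 'v set \<Rightarrow> 'v set \<Rightarrow>
     ('v \<Rightarrow> 'r::idom) \<Rightarrow> 'r" where
  "haar_integral s X L = (SOME \<mu>. haar_measure s X \<mu> \<and> \<mu> (indicator L) = 1)"

definition fourier ::
    "('f::nonarch_local_field \<Rightarrow> 'r::idom) \<Rightarrow> ('f \<Rightarrow> 'v::ab_group_add \<Rightarrow> 'v) \<Rightarrow> 'v set \<Rightarrow> 'v set \<Rightarrow>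
     ('v \<Rightarrow> 'r) \<Rightarrow> ('v \<Rightarrow> 'f) \<Rightarrow> 'r" where
  "fourier chi s X L \<Phi> u = haar_integral s X L (\<lambda>x. \<Phi> x * chi (u x))"

text \<open>
  \<open>sq\<close> is the square root of \<open>q\<close>, and \<open>|\<beta>|^(-1/2) = sq^(-a)\<close> is an integer power in the
  group of units.
\<close>

definition d0' ::
    "('f::nonarch_local_field \<Rightarrow> 'r::idom) \<Rightarrow> 'r \<Rightarrow> ('f \<Rightarrow> 'v::ab_group_add \<Rightarrow> 'v) \<Rightarrow> 'v set \<Rightarrow>
     'v set \<Rightarrow> (('v \<Rightarrow> 'f) \<Rightarrow> 'v) \<Rightarrow> ('v \<Rightarrow> 'r) \<Rightarrow> 'v \<Rightarrow> 'r" where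
  "d0' chi sq s X L \<beta> \<Phi> = (\<lambda>x. if x \<in> X
     then (sq [^]\<^bsub>unit_group\<^esub> (- modulus_exp TYPE('f) \<beta> (dual_lattice chi s X L) L))
            * fourier chi s X L \<Phi> (inv_into (dual s X) \<beta> x)
     else 0)"

definition t0 :: "('f \<Rightarrow> 'r::idom) \<Rightarrow> ('v \<Rightarrow> 'f) \<Rightarrow> ('v \<Rightarrow> 'r) \<Rightarrow> 'v \<Rightarrow> 'r" where
  "t0 chi f \<Phi> = (\<lambda>x. chi (f x) * \<Phi> x)"

section \<open>Quadratic forms and the Weil factor\<close>

definition polar :: "'v::ab_group_add set \<Rightarrow> ('v \<Rightarrow> 'f::field) \<Rightarrow> 'v \<Rightarrow> 'v \<Rightarrow> 'f" where
  "polar X f x = (\<lambda>y. if y \<in> X then f (x + y) - f x - f y else 0)"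

definition quadratic_form ::
    "('f::field \<Rightarrow> 'v::ab_group_add \<Rightarrow> 'v) \<Rightarrow> 'v set \<Rightarrow> ('v \<Rightarrow> 'f) \<Rightarrow> bool" where
  "quadratic_form s X f \<longleftrightarrow> (\<forall>c. \<forall>x\<in>X. f (s c x) = c\<^sup>2 * f x) \<and>
     linear_map s X fun_scale (dual s X) (polar X f)"

definition nondegenerate_form ::
    "('f::field \<Rightarrow> 'v::ab_group_add \<Rightarrow> 'v) \<Rightarrow> 'v set \<Rightarrow> ('v \<Rightarrow> 'f) \<Rightarrow> bool" where
  "nondegenerate_form s X f \<longleftrightarrow> quadratic_form s X f \<and>
     linear_iso s X fun_scale (dual s X) (polar X f)"

text \<open>
  The lattice \<open>L\<close> normalizes the Haar measures entering \<^const>\<open>d0'\<close>; the Weil factor is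
  independent of it. The function \<open>\<beta>\<close> is the inverse of the isomorphism \<open>X \<rightarrow> X*\<close> attached
  to \<open>f\<close>.
\<close>

definition weil_factor ::
    "('f::nonarch_local_field \<Rightarrow> 'r::idom) \<Rightarrow> 'r \<Rightarrow> ('f \<Rightarrow> 'v::ab_group_add \<Rightarrow> 'v) \<Rightarrow> 'v set \<Rightarrow>
     'v set \<Rightarrow> ('v \<Rightarrow> 'f) \<Rightarrow> 'r" where
  "weil_factor chi sq s X L f =
     (let \<beta> = inv_into X (polar X f); d = d0' chi sq s X L; t = t0 chi in
      THE c. c dvd 1 \<and>
        (\<forall>\<Phi>\<in>schwartz s X. d \<beta> (t f (d (- \<beta>) (t f \<Phi>))) = (\<lambda>x. c * t (- f) (d \<beta> \<Phi>) x)))"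

section \<open>The Witt group\<close>

definition isometric ::
    "('f::field \<Rightarrow> 'v::ab_group_add \<Rightarrow> 'v) \<Rightarrow> 'v set \<Rightarrow> ('v \<Rightarrow> 'f) \<Rightarrow>
     ('f \<Rightarrow> 'w::ab_group_add \<Rightarrow> 'w) \<Rightarrow> 'w set \<Rightarrow> ('w \<Rightarrow> 'f) \<Rightarrow> bool" where
  "isometric s X f s' Y g \<longleftrightarrow> (\<exists>h. linear_iso s X s' Y h \<and> (\<forall>x\<in>X. g (h x) = f x))"

definition form_sum :: "('v \<Rightarrow> 'f::plus) \<Rightarrow> ('w \<Rightarrow> 'f) \<Rightarrow> 'v \<times> 'w \<Rightarrow> 'f" where
  "form_sum f g = (\<lambda>(x, y). f x + g y)"

definition hyperbolic :: "nat \<Rightarrow> (nat \<Rightarrow> 'f::field) \<Rightarrow> 'f" where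
  "hyperbolic n x = (\<Sum>i<n. x i * x (i + n))"

definition witt_equiv ::
    "('f::field \<Rightarrow> 'v::ab_group_add \<Rightarrow> 'v) \<Rightarrow> 'v set \<Rightarrow> ('v \<Rightarrow> 'f) \<Rightarrow>
     ('f \<Rightarrow> 'w::ab_group_add \<Rightarrow> 'w) \<Rightarrow> 'w set \<Rightarrow> ('w \<Rightarrow> 'f) \<Rightarrow> bool" where
  "witt_equiv s X f s' Y g \<longleftrightarrow>
     (\<exists>n. int (2 * n) = \<bar>int (vector_space.dim s X) - int (vector_space.dim s' Y)\<bar> \<and>
        (isometric s X f
           (prod_scale s' fun_scale) (Y \<times> coord_space (2 * n)) (form_sum g (hyperbolic n)) \<or>
         isometric s' Y g
           (prod_scale s fun_scale) (X \<times> coord_space (2 * n)) (form_sum f (hyperbolic n))))"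

text \<open>
  To obtain a set, the members of an equivalence class are taken to be the pairs \<open>(n, g)\<close> with
  \<open>g\<close> a non-degenerate form on \<open>coord_space n\<close>. Forms on other spaces have a class
  as well, because \<^const>\<open>witt_equiv\<close> compares forms on spaces of different types.
\<close>

type_synonym 'f witt_class = "(nat \<times> ((nat \<Rightarrow> 'f) \<Rightarrow> 'f)) set"

definition witt_class ::
    "('f::field \<Rightarrow> 'v::ab_group_add \<Rightarrow> 'v) \<Rightarrow> 'v set \<Rightarrow> ('v \<Rightarrow> 'f) \<Rightarrow> 'f witt_class" where
  "witt_class s X f = {(n, g). nondegenerate_form fun_scale (coord_space n) g \<and>
     witt_equiv s X f fun_scale (coord_space n) g}"

definition witt_group :: "'f::field witt_class monoid" where
  "witt_group =
     \<lparr>carrier = {witt_class fun_scale (coord_space n) f | n f.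
                   nondegenerate_form fun_scale (coord_space n) f},
      monoid.mult = (\<lambda>A B. THE C. \<exists>n f m g. (n, f) \<in> A \<and> (m, g) \<in> B \<and>
        C = witt_class (prod_scale fun_scale fun_scale) (coord_space n \<times> coord_space m)
              (form_sum f g)),
      one = witt_class fun_scale (coord_space 0) (\<lambda>_. 0)\<rparr>"

definition witt_weil ::
    "('f::nonarch_local_field \<Rightarrow> 'r::idom) \<Rightarrow> 'r \<Rightarrow> 'f witt_class \<Rightarrow> 'r" where
  "witt_weil chi sq A = (THE c. \<exists>n f L. (n, f) \<in> A \<and> ring_lattice fun_scale (coord_space n) L \<and>
     c = weil_factor chi sq fun_scale (coord_space n) L f)"

end

theory Submission
  imports Defs
begin

text \<open>
  Completing the square in the relation defining \<open>\<gamma>(f)\<close> identifies it with a normalized Gauss sum: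
  writing \<open>B\<close> for the polar form and \<open>N\<^sup>\<bottom> = {y. \<chi>(B(x, y)) = 1 for all x \<in> N}\<close>, one has
  \<open>\<gamma>(f) = [N : N\<^sup>\<bottom>]\<^sup>-\<^sup>1\<^sup>/\<^sup>2 \<Sum>x\<in>N/N\<^sup>\<bottom>. \<chi>(f(x))\<close> for every sufficiently large lattice \<open>N\<close>. The normalizing lattice \<open>L\<close>
  has disappeared because \<open>[K\<^sup>\<bottom> : N\<^sup>\<bottom>] = [N : K]\<close>; invariance under isometries and multiplicativity
  for orthogonal sums can be read off, and \<open>\<gamma>(f) \<gamma>(-f) = 1\<close> is the usual evaluation of the absolute
  square of a Gauss sum. Hyperbolic planes are sums of \<open>t\<^sup>2\<close> and \<open>-t\<^sup>2\<close>, so their Weil factor is 1.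
  Witt cancellation (by reflections) shows that Witt equivalence is isometry after adding
  hyperbolic planes on both sides, hence compatible with orthogonal sums, and \<open>-f\<close> represents the
  inverse of \<open>f\<close> in the Witt group.
\<close>

section \<open>Sums over cosets\<close>

text \<open>The coefficient ring \<open>R\<close> is only a domain, so there are no estimates, no
  limits and no complex conjugation. Integrals become finite sums over the cosets of one lattice in
  a larger one, times a power of \<open>sq\<close>; the analysis is confined to showing that
  Schwartz functions and Haar functionals have this form. What remains delicate is the exponent of
  \<open>sq\<close>: different lattices may have equal volumes in \<open>R\<close>, so exponents are
  compared as integers \<open>ex\<close> and only then turned into elements of \<open>R\<close>. The
  sum with \<open>chi (- f x)\<close> stands in for the conjugate sum, and its product with the
  Gauss sum also supplies the invertibility of the Weil factor, without recourse to Fourier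
  inversion. As 2 may be a non-unit among the integers of the field, a form is not controlled by its
  polar form on the same lattice; lattices are therefore taken large enough rather than self-dual.
  Witt equivalence as defined adds a hyperbolic form of prescribed rank to one side only, so that
  transitivity is not formal and has to be extracted from cancellation.\<close>

definition add_subgroup :: "'a::ab_group_add set \<Rightarrow> bool" where
  "add_subgroup A \<longleftrightarrow> 0 \<in> A \<and> (\<forall>x\<in>A. \<forall>y\<in>A. x - y \<in> A)"

lemma add_subgroup_zero: "add_subgroup A \<Longrightarrow> 0 \<in> A"
  by (simp add: add_subgroup_def)

lemma add_subgroup_diff: "add_subgroup A \<Longrightarrow> x \<in> A \<Longrightarrow> y \<in> A \<Longrightarrow> x - y \<in> A"
  by (simp add: add_subgroup_def)

lemma add_subgroup_uminus: "add_subgroup A \<Longrightarrow> x \<in> A \<Longrightarrow> - x \<in> A"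
  using add_subgroup_diff[of A 0 x] add_subgroup_zero[of A] by simp

lemma add_subgroup_uminus_iff: "add_subgroup A \<Longrightarrow> - x \<in> A \<longleftrightarrow> x \<in> A"
  using add_subgroup_uminus[of A x] add_subgroup_uminus[of A "- x"] by auto

lemma add_subgroup_add: "add_subgroup A \<Longrightarrow> x \<in> A \<Longrightarrow> y \<in> A \<Longrightarrow> x + y \<in> A"
  using add_subgroup_diff[of A x "- y"] add_subgroup_uminus[of A y] by simp

lemma add_subgroup_add_cancel: "add_subgroup A \<Longrightarrow> y \<in> A \<Longrightarrow> x + y \<in> A \<longleftrightarrow> x \<in> A"
  using add_subgroup_add[of A x y] add_subgroup_diff[of A "x + y" y] by auto

lemma add_subgroup_diff_commute: "add_subgroup A \<Longrightarrow> x - y \<in> A \<longleftrightarrow> y - x \<in> A"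
  using add_subgroup_uminus_iff[of A "x - y"] by simp

lemma add_subgroup_Int: "add_subgroup A \<Longrightarrow> add_subgroup B \<Longrightarrow> add_subgroup (A \<inter> B)"
  by (simp add: add_subgroup_def)

lemma add_subgroup_Times: "add_subgroup A \<Longrightarrow> add_subgroup B \<Longrightarrow> add_subgroup (A \<times> B)"
  by (auto simp add: add_subgroup_def zero_prod_def)

text \<open>For a subgroup \<open>A\<close> the chosen property depends on \<open>x\<close> only
  through its coset, so all elements of a coset receive the same representative. The system of
  representatives lives on the whole type and is shared by all groups \<open>B\<close> above
  \<open>A\<close>.\<close>

definition coset_rep :: "'a::ab_group_add set \<Rightarrow> 'a \<Rightarrow> 'a" where
  "coset_rep A x = (SOME y. y - x \<in> A)"

definition reps :: "'a::ab_group_add set \<Rightarrow> 'a set \<Rightarrow> 'a set" where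
  "reps B A = coset_rep A ` B"

text \<open>Meant for functions invariant under \<open>A\<close>, where the choice of
  representatives is immaterial. Over infinitely many cosets the value is 0 by the convention of
  \<open>sum\<close>, and reindexing along bijections stays valid there.\<close>

definition csum :: "'a::ab_group_add set \<Rightarrow> 'a set \<Rightarrow> ('a \<Rightarrow> 'b::comm_monoid_add) \<Rightarrow> 'b" where
  "csum B A \<Phi> = sum \<Phi> (reps B A)"

definition inv_under :: "'a::ab_group_add set \<Rightarrow> 'a set \<Rightarrow> ('a \<Rightarrow> 'b) \<Rightarrow> bool" where
  "inv_under B A \<Phi> \<longleftrightarrow> (\<forall>x\<in>B. \<forall>a\<in>A. \<Phi> (x + a) = \<Phi> x)"

lemma inv_under_mono: "inv_under B A \<Phi> \<Longrightarrow> A' \<subseteq> A \<Longrightarrow> B' \<subseteq> B \<Longrightarrow> inv_under B' A' \<Phi>"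
  unfolding inv_under_def by blast

lemma inv_underD: "inv_under B A \<Phi> \<Longrightarrow> x \<in> B \<Longrightarrow> y - x \<in> A \<Longrightarrow> \<Phi> y = \<Phi> x"
  unfolding inv_under_def by (metis add.commute diff_add_cancel)

lemma coset_rep_diff: "add_subgroup A \<Longrightarrow> coset_rep A x - x \<in> A"
  unfolding coset_rep_def by (rule someI[of _ x]) (simp add: add_subgroup_zero)

lemma coset_rep_eq_iff:
  assumes "add_subgroup A"
  shows "coset_rep A x = coset_rep A y \<longleftrightarrow> x - y \<in> A"
proof
  assume "coset_rep A x = coset_rep A y"
  then show "x - y \<in> A"
    using add_subgroup_diff[OF assms coset_rep_diff[OF assms, of y] coset_rep_diff[OF assms, of x]]
    by simp
next
  assume xy: "x - y \<in> A"
  have "z - x \<in> A \<longleftrightarrow> z - y \<in> A" for z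
    using add_subgroup_add_cancel[OF assms xy, of "z - x"] by simp
  then show "coset_rep A x = coset_rep A y"
    unfolding coset_rep_def by simp
qed

lemma coset_rep_in:
  assumes "add_subgroup A" "add_subgroup B" "A \<subseteq> B" "x \<in> B"
  shows "coset_rep A x \<in> B"
  using add_subgroup_add[OF assms(2) _ assms(4), of "coset_rep A x - x"]
    coset_rep_diff[OF assms(1), of x] assms(3) by auto

lemma coset_rep_idem: "add_subgroup A \<Longrightarrow> coset_rep A (coset_rep A x) = coset_rep A x"
  by (simp add: coset_rep_eq_iff coset_rep_diff)

lemma reps_subset: "add_subgroup A \<Longrightarrow> add_subgroup B \<Longrightarrow> A \<subseteq> B \<Longrightarrow> reps B A \<subseteq> B"
  unfolding reps_def using coset_rep_in by blast

lemma reps_fixed: "add_subgroup A \<Longrightarrow> t \<in> reps B A \<Longrightarrow> coset_rep A t = t"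
  unfolding reps_def by (auto simp add: coset_rep_idem)

lemma reps_eqI:
  "add_subgroup A \<Longrightarrow> t \<in> reps B A \<Longrightarrow> u \<in> reps B A \<Longrightarrow> t - u \<in> A \<Longrightarrow> t = u"
  by (metis coset_rep_eq_iff reps_fixed)

lemma add_image_eq_iff:
  assumes "add_subgroup A"
  shows "(+) x ` A = (+) y ` A \<longleftrightarrow> x - y \<in> A"
proof
  assume "(+) x ` A = (+) y ` A"
  then have "x \<in> (+) y ` A"
    using add_subgroup_zero[OF assms] by (metis add.right_neutral imageI)
  then show "x - y \<in> A" by auto
next
  have *: "(+) x ` A \<subseteq> (+) y ` A" if "x - y \<in> A" for x y
  proof
    fix z assume "z \<in> (+) x ` A"
    then obtain a where "a \<in> A" "z = x + a" by auto
    then have "z = y + ((x - y) + a)" "(x - y) + a \<in> A"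
      using add_subgroup_add[OF assms that] by auto
    then show "z \<in> (+) y ` A" by blast
  qed
  assume "x - y \<in> A"
  then show "(+) x ` A = (+) y ` A"
    using *[of x y] *[of y x] add_subgroup_diff_commute[OF assms, of x y] by blast
qed

lemma bij_betw_reps_cosets:
  assumes "add_subgroup A" "add_subgroup B" "A \<subseteq> B"
  shows "bij_betw (\<lambda>a. (+) a ` A) (reps B A) ((\<lambda>a. (+) a ` A) ` B)"
  unfolding bij_betw_def
proof
  show "inj_on (\<lambda>a. (+) a ` A) (reps B A)"
    using reps_eqI[OF assms(1)] by (auto simp add: inj_on_def add_image_eq_iff[OF assms(1)])
  have "(+) x ` A = (+) (coset_rep A x) ` A" for x
    using coset_rep_diff[OF assms(1), of x] add_image_eq_iff[OF assms(1), of "coset_rep A x" x] by simp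
  then show "(\<lambda>a. (+) a ` A) ` reps B A = (\<lambda>a. (+) a ` A) ` B"
    unfolding reps_def image_image by simp
qed

lemma coset_index_reps:
  assumes "add_subgroup A" "add_subgroup B" "A \<subseteq> B"
  shows "coset_index B A = card (reps B A)"
  unfolding coset_index_def using bij_betw_same_card[OF bij_betw_reps_cosets[OF assms]] by simp

text \<open>The condition on differences says that \<open>h\<close> induces a well-defined injection
  of cosets. No additivity of \<open>h\<close> enters, so translations, linear isomorphisms and
  parametrizations of modules are all covered. Since \<open>h t\<close> need not be a chosen
  representative, \<open>coset_rep A'\<close> is applied to it.\<close>

lemma csum_reindex:
  assumes "add_subgroup A" "add_subgroup B" "A \<subseteq> B"
    and "add_subgroup A'" "add_subgroup B'" "A' \<subseteq> B'"
    and "h ` B = B'" "\<And>x y. x \<in> B \<Longrightarrow> y \<in> B \<Longrightarrow> h x - h y \<in> A' \<longleftrightarrow> x - y \<in> A"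
    and "inv_under B' A' \<Phi>"
  shows "csum B' A' \<Phi> = csum B A (\<lambda>x. \<Phi> (h x))"
proof -
  have "bij_betw (\<lambda>t. coset_rep A' (h t)) (reps B A) (reps B' A')"
    unfolding bij_betw_def
  proof
    show "inj_on (\<lambda>t. coset_rep A' (h t)) (reps B A)"
    proof (rule inj_onI)
      fix t u assume t: "t \<in> reps B A" "u \<in> reps B A"
        and "coset_rep A' (h t) = coset_rep A' (h u)"
      then have "h t - h u \<in> A'" by (simp add: coset_rep_eq_iff[OF assms(4)])
      then have "t - u \<in> A" using assms(8) t reps_subset[OF assms(1-3)] by blast
      then show "t = u" by (rule reps_eqI[OF assms(1) t])
    qed
    have "coset_rep A' (h (coset_rep A x)) = coset_rep A' (h x)" if "x \<in> B" for x
      using assms(8)[OF coset_rep_in[OF assms(1-3) that] that] coset_rep_diff[OF assms(1)]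
      by (simp add: coset_rep_eq_iff[OF assms(4)])
    then show "(\<lambda>t. coset_rep A' (h t)) ` reps B A = reps B' A'"
      unfolding reps_def image_image assms(7)[symmetric] by simp
  qed
  then have "csum B' A' \<Phi> = sum (\<lambda>t. \<Phi> (coset_rep A' (h t))) (reps B A)"
    unfolding csum_def by (rule sum.reindex_bij_betw[symmetric])
  also have "\<dots> = csum B A (\<lambda>x. \<Phi> (h x))"
    unfolding csum_def
  proof (rule sum.cong)
    fix t assume "t \<in> reps B A"
    then have "h t \<in> B'" using reps_subset[OF assms(1-3)] assms(7) by blast
    then show "\<Phi> (coset_rep A' (h t)) = \<Phi> (h t)"
      by (rule inv_underD[OF assms(9)]) (rule coset_rep_diff[OF assms(4)])
  qed simp
  finally show ?thesis .
qed

lemma csum_cong: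
  assumes "add_subgroup A" "add_subgroup B" "A \<subseteq> B" "\<And>x. x \<in> B \<Longrightarrow> \<Phi> x = \<Psi> x"
  shows "csum B A \<Phi> = csum B A \<Psi>"
  unfolding csum_def using reps_subset[OF assms(1-3)] assms(4) by (intro sum.cong) auto

lemma csum_translate:
  assumes "add_subgroup A" "add_subgroup B" "A \<subseteq> B" "inv_under B A \<Phi>" "b \<in> B"
  shows "csum B A (\<lambda>x. \<Phi> (x + b)) = csum B A \<Phi>"
proof (rule csum_reindex[symmetric, OF assms(1-3) assms(1-3)])
  show "(\<lambda>x. x + b) ` B = B"
  proof
    show "(\<lambda>x. x + b) ` B \<subseteq> B" using add_subgroup_add[OF assms(2) _ assms(5)] by auto
    show "B \<subseteq> (\<lambda>x. x + b) ` B"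
    proof
      fix x assume "x \<in> B"
      then have "x - b \<in> B" using add_subgroup_diff[OF assms(2) _ assms(5)] by auto
      then show "x \<in> (\<lambda>x. x + b) ` B" by (metis diff_add_cancel imageI)
    qed
  qed
qed (use assms(4) in auto)

text \<open>The sums \<open>r + a\<close> of representatives meet every coset of \<open>A\<close> in
  \<open>C\<close> exactly once; invariance under \<open>A\<close> absorbs the correction to the
  chosen representative.\<close>

lemma csum_tower:
  assumes "add_subgroup A" "add_subgroup B" "add_subgroup C" "A \<subseteq> B" "B \<subseteq> C"
    and "inv_under C A \<Phi>"
  shows "csum C A \<Phi> = csum C B (\<lambda>x. csum B A (\<lambda>y. \<Phi> (x + y)))"
proof -
  note sub = reps_subset[OF assms(1,2,4)] reps_subset[OF assms(2,3,5)]
  let ?h = "\<lambda>(r, a). coset_rep A (r + a)"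
  have AC: "A \<subseteq> C" using assms by blast
  have "bij_betw ?h (reps C B \<times> reps B A) (reps C A)"
    unfolding bij_betw_def
  proof
    show "inj_on ?h (reps C B \<times> reps B A)"
    proof (rule inj_onI, clarify)
      fix r a r' a'
      assume r: "r \<in> reps C B" "r' \<in> reps C B" and a: "a \<in> reps B A" "a' \<in> reps B A"
        and eq: "coset_rep A (r + a) = coset_rep A (r' + a')"
      then have d: "(r + a) - (r' + a') \<in> A" by (simp add: coset_rep_eq_iff[OF assms(1)])
      have "a' - a \<in> B" using a sub add_subgroup_diff[OF assms(2)] by blast
      \<comment> \<open>The element written here is \<open>r - r'\<close>, so \<open>r\<close> and
        \<open>r'\<close> represent the same coset of \<open>B\<close>.\<close>
      then have "((r + a) - (r' + a')) + (a' - a) \<in> B"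
        using d assms(4) add_subgroup_add[OF assms(2)] by blast
      then have rr: "r = r'" using reps_eqI[OF assms(2) r] by (simp add: algebra_simps)
      then have "a = a'" using reps_eqI[OF assms(1) a] d by (simp add: algebra_simps)
      with rr show "r = r' \<and> a = a'" by simp
    qed
    show "?h ` (reps C B \<times> reps B A) = reps C A"
    proof
      show "?h ` (reps C B \<times> reps B A) \<subseteq> reps C A"
      proof clarify
        fix r a assume "r \<in> reps C B" "a \<in> reps B A"
        then have "r + a \<in> C" using sub assms(5) add_subgroup_add[OF assms(3)] by blast
        then show "coset_rep A (r + a) \<in> reps C A" unfolding reps_def by blast
      qed
      show "reps C A \<subseteq> ?h ` (reps C B \<times> reps B A)"
      proof
        fix t assume "t \<in> reps C A"
        then obtain x where x: "x \<in> C" "t = coset_rep A x" unfolding reps_def by auto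
        define r where "r = coset_rep B x"
        define a where "a = coset_rep A (x - r)"
        have "x - r \<in> B" using coset_rep_diff[OF assms(2), of x] add_subgroup_diff_commute[OF assms(2)]
          unfolding r_def by blast
        then have ra: "(r, a) \<in> reps C B \<times> reps B A"
          using x(1) unfolding reps_def r_def a_def by auto
        have "coset_rep A (r + a) = t"
          unfolding x(2) coset_rep_eq_iff[OF assms(1)]
          using coset_rep_diff[OF assms(1), of "x - r"] unfolding a_def by (simp add: algebra_simps)
        then show "t \<in> ?h ` (reps C B \<times> reps B A)" using ra by (metis (mono_tags) case_prod_conv imageI)
      qed
    qed
  qed
  then have "csum C A \<Phi> = sum (\<lambda>p. \<Phi> (?h p)) (reps C B \<times> reps B A)"
    unfolding csum_def by (rule sum.reindex_bij_betw[symmetric])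
  also have "\<dots> = sum (\<lambda>(r, a). \<Phi> (r + a)) (reps C B \<times> reps B A)"
  proof (rule sum.cong, simp, clarify)
    fix r a assume "r \<in> reps C B" "a \<in> reps B A"
    then have "r + a \<in> C" using sub assms(5) add_subgroup_add[OF assms(3)] by blast
    then show "\<Phi> (coset_rep A (r + a)) = \<Phi> (r + a)"
      by (rule inv_underD[OF assms(6)]) (rule coset_rep_diff[OF assms(1)])
  qed
  also have "\<dots> = csum C B (\<lambda>x. csum B A (\<lambda>y. \<Phi> (x + y)))"
    unfolding csum_def by (rule sum.cartesian_product[symmetric])
  finally show ?thesis .
qed

text \<open>In the tower formula the inner sum is now constant, equal to the index times the
  value.\<close>

lemma csum_refine:
  fixes \<Phi> :: "'a::ab_group_add \<Rightarrow> 'b::comm_semiring_1"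
  assumes "add_subgroup A" "add_subgroup B" "add_subgroup C" "A \<subseteq> B" "B \<subseteq> C"
    and "inv_under C B \<Phi>"
  shows "csum C A \<Phi> = of_nat (coset_index B A) * csum C B \<Phi>"
proof -
  have "csum C A \<Phi> = csum C B (\<lambda>x. csum B A (\<lambda>y. \<Phi> (x + y)))"
    using assms inv_under_mono[OF assms(6,4) subset_refl] by (intro csum_tower) auto
  also have "\<dots> = csum C B (\<lambda>x. of_nat (coset_index B A) * \<Phi> x)"
  proof (rule csum_cong[OF assms(2,3,5)])
    fix x assume "x \<in> C"
    then have "csum B A (\<lambda>y. \<Phi> (x + y)) = csum B A (\<lambda>y. \<Phi> x)"
      using assms(6) by (intro csum_cong[OF assms(1,2,4)]) (simp add: inv_under_def)
    then show "csum B A (\<lambda>y. \<Phi> (x + y)) = of_nat (coset_index B A) * \<Phi> x"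
      by (simp add: coset_index_reps[OF assms(1,2,4)] csum_def)
  qed
  also have "\<dots> = of_nat (coset_index B A) * csum C B \<Phi>"
    unfolding csum_def by (simp add: sum_distrib_left)
  finally show ?thesis .
qed

lemma csum_const_1: "add_subgroup A \<Longrightarrow> add_subgroup B \<Longrightarrow> A \<subseteq> B \<Longrightarrow>
    csum B A (\<lambda>_. 1) = (of_nat (coset_index B A) :: 'b::comm_semiring_1)"
  by (simp add: csum_def coset_index_reps)

lemma coset_index_mult:
  assumes "add_subgroup A" "add_subgroup B" "add_subgroup C" "A \<subseteq> B" "B \<subseteq> C"
  shows "coset_index C A = coset_index C B * coset_index B A"
proof -
  have "csum C A (\<lambda>_. 1::nat) = of_nat (coset_index B A) * csum C B (\<lambda>_. 1)"
    using assms by (intro csum_refine) (auto simp add: inv_under_def)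
  then show ?thesis using assms by (auto simp add: csum_def coset_index_reps)
qed

lemma coset_index_reindex:
  assumes "add_subgroup A" "add_subgroup B" "A \<subseteq> B"
    and "add_subgroup A'" "add_subgroup B'" "A' \<subseteq> B'"
    and "h ` B = B'" "\<And>x y. x \<in> B \<Longrightarrow> y \<in> B \<Longrightarrow> h x - h y \<in> A' \<longleftrightarrow> x - y \<in> A"
  shows "coset_index B' A' = coset_index B A"
proof -
  have "csum B' A' (\<lambda>_. 1::nat) = csum B A (\<lambda>_. 1)"
    using assms by (intro csum_reindex[where h = h]) (auto simp add: inv_under_def)
  then show ?thesis using assms by (simp add: csum_def coset_index_reps)
qed

text \<open>A chosen representative depends only on its coset, so \<open>reps B A\<close> consists
  of the members of \<open>reps C A\<close> that lie in \<open>B\<close>; the other terms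
  vanish.\<close>

lemma csum_support:
  assumes "add_subgroup A" "add_subgroup B" "add_subgroup C" "A \<subseteq> B" "B \<subseteq> C"
    and "finite (reps C A)" "\<And>x. x \<in> C \<Longrightarrow> x \<notin> B \<Longrightarrow> \<Phi> x = 0"
  shows "csum C A \<Phi> = csum B A \<Phi>"
  unfolding csum_def
proof (rule sum.mono_neutral_right[OF assms(6)])
  show "reps B A \<subseteq> reps C A" using assms(5) unfolding reps_def by blast
  show "\<forall>t\<in>reps C A - reps B A. \<Phi> t = 0"
  proof
    fix t assume t: "t \<in> reps C A - reps B A"
    then have "t \<notin> B" using reps_fixed[OF assms(1), of t C] unfolding reps_def by (metis DiffD1 DiffD2 imageI)
    moreover have "t \<in> C" using t reps_subset[OF assms(1,3)] assms(4,5) by blast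
    ultimately show "\<Phi> t = 0" using assms(7) by blast
  qed
qed

lemma csum_Times:
  fixes \<Phi> :: "'a::ab_group_add \<times> 'b::ab_group_add \<Rightarrow> 'c::comm_monoid_add"
  assumes "add_subgroup A" "add_subgroup B" "A \<subseteq> B"
    and "add_subgroup A'" "add_subgroup B'" "A' \<subseteq> B'"
    and "inv_under (B \<times> B') (A \<times> A') \<Phi>"
  shows "csum (B \<times> B') (A \<times> A') \<Phi> = csum B A (\<lambda>x. csum B' A' (\<lambda>y. \<Phi> (x, y)))"
proof -
  note AA = add_subgroup_Times[OF assms(1,4)]
  let ?h = "coset_rep (A \<times> A')"
  have "bij_betw ?h (reps B A \<times> reps B' A') (reps (B \<times> B') (A \<times> A'))"
    unfolding bij_betw_def
  proof
    show "inj_on ?h (reps B A \<times> reps B' A')"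
      using reps_eqI[OF assms(1)] reps_eqI[OF assms(4)]
      by (auto simp add: inj_on_def coset_rep_eq_iff[OF AA])
    have e: "?h (coset_rep A x, coset_rep A' y) = ?h (x, y)" for x y
      using coset_rep_diff[OF assms(1), of x] coset_rep_diff[OF assms(4), of y]
      by (simp add: coset_rep_eq_iff[OF AA])
    show "?h ` (reps B A \<times> reps B' A') = reps (B \<times> B') (A \<times> A')"
    proof
      show "?h ` (reps B A \<times> reps B' A') \<subseteq> reps (B \<times> B') (A \<times> A')"
        unfolding reps_def using e by fastforce
      show "reps (B \<times> B') (A \<times> A') \<subseteq> ?h ` (reps B A \<times> reps B' A')"
      proof
        fix t assume "t \<in> reps (B \<times> B') (A \<times> A')"
        then obtain x y where "x \<in> B" "y \<in> B'" "t = ?h (x, y)" unfolding reps_def by auto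
        then have "t = ?h (coset_rep A x, coset_rep A' y)"
          "(coset_rep A x, coset_rep A' y) \<in> reps B A \<times> reps B' A'"
          using e unfolding reps_def by auto
        then show "t \<in> ?h ` (reps B A \<times> reps B' A')" by blast
      qed
    qed
  qed
  then have "csum (B \<times> B') (A \<times> A') \<Phi> = sum (\<lambda>p. \<Phi> (?h p)) (reps B A \<times> reps B' A')"
    unfolding csum_def by (rule sum.reindex_bij_betw[symmetric])
  also have "\<dots> = sum (\<lambda>(x, y). \<Phi> (x, y)) (reps B A \<times> reps B' A')"
  proof (rule sum.cong, simp, clarify)
    fix x y assume "x \<in> reps B A" "y \<in> reps B' A'"
    then have "(x, y) \<in> B \<times> B'"
      using reps_subset[OF assms(1-3)] reps_subset[OF assms(4-6)] by blast
    then show "\<Phi> (?h (x, y)) = \<Phi> (x, y)"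
      by (rule inv_underD[OF assms(7)]) (rule coset_rep_diff[OF AA])
  qed
  also have "\<dots> = csum B A (\<lambda>x. csum B' A' (\<lambda>y. \<Phi> (x, y)))"
    unfolding csum_def by (rule sum.cartesian_product[symmetric])
  finally show ?thesis .
qed

lemma coset_index_Times:
  assumes "add_subgroup A" "add_subgroup B" "A \<subseteq> B"
    and "add_subgroup A'" "add_subgroup B'" "A' \<subseteq> B'"
  shows "coset_index (B \<times> B') (A \<times> A') = coset_index B A * coset_index B' A'"
proof -
  have "csum (B \<times> B') (A \<times> A') (\<lambda>_. 1::nat) = csum B A (\<lambda>x. csum B' A' (\<lambda>y. 1))"
    by (rule csum_Times[OF assms]) (simp add: inv_under_def)
  then show ?thesis
    using csum_const_1[OF add_subgroup_Times[OF assms(1,4)] add_subgroup_Times[OF assms(2,5)] Sigma_mono,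
        where 'b = nat] assms
    by (simp add: csum_def coset_index_reps)
qed

text \<open>Translation by \<open>b\<close> multiplies the sum by \<open>\<psi> b\<close>, and a
  domain has no zero divisors.\<close>

lemma csum_character_eq_0:
  fixes \<psi> :: "'a::ab_group_add \<Rightarrow> 'b::idom"
  assumes "add_subgroup A" "add_subgroup B" "A \<subseteq> B" "inv_under B A \<psi>"
    and "\<And>x y. x \<in> B \<Longrightarrow> y \<in> B \<Longrightarrow> \<psi> (x + y) = \<psi> x * \<psi> y" "b \<in> B" "\<psi> b \<noteq> 1"
  shows "csum B A \<psi> = 0"
proof -
  have "csum B A \<psi> = csum B A (\<lambda>x. \<psi> (x + b))"
    by (rule csum_translate[symmetric, OF assms(1-4,6)])
  also have "\<dots> = csum B A (\<lambda>x. \<psi> x * \<psi> b)"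
    using assms(5,6) by (intro csum_cong[OF assms(1-3)]) auto
  also have "\<dots> = csum B A \<psi> * \<psi> b"
    unfolding csum_def by (simp add: sum_distrib_right)
  finally have "csum B A \<psi> * (1 - \<psi> b) = 0" by (simp add: algebra_simps)
  then show ?thesis using assms(7) by simp
qed

section \<open>Finiteness and positivity of indices\<close>

lemma reps_mono: "B \<subseteq> C \<Longrightarrow> reps B A \<subseteq> reps C A"
  unfolding reps_def by blast

lemma reps_finite_coarse:
  assumes "add_subgroup A" "add_subgroup B" "A \<subseteq> B" "finite (reps C A)"
  shows "finite (reps C B)"
proof -
  have "coset_rep B x = coset_rep B (coset_rep A x)" for x
    using coset_rep_diff[OF assms(1), of x] assms(3) coset_rep_eq_iff[OF assms(2)]
      add_subgroup_diff_commute[OF assms(2)] by blast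
  then have "reps C B = coset_rep B ` reps C A" unfolding reps_def image_image by simp
  then show ?thesis using assms(4) by simp
qed

lemma reps_finite_trans:
  assumes "add_subgroup A" "add_subgroup B" "add_subgroup C" "A \<subseteq> B" "B \<subseteq> C"
    and "finite (reps C B)" "finite (reps B A)"
  shows "finite (reps C A)"
proof -
  have "reps C A \<subseteq> (\<lambda>(r, a). coset_rep A (r + a)) ` (reps C B \<times> reps B A)"
  proof
    fix t assume "t \<in> reps C A"
    then obtain x where x: "x \<in> C" "t = coset_rep A x" unfolding reps_def by auto
    define r where "r = coset_rep B x"
    define a where "a = coset_rep A (x - r)"
    have "x - r \<in> B" using coset_rep_diff[OF assms(2), of x] add_subgroup_diff_commute[OF assms(2)]
      unfolding r_def by blast
    then have ra: "(r, a) \<in> reps C B \<times> reps B A"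
      using x(1) unfolding reps_def r_def a_def by auto
    have "coset_rep A (r + a) = t"
      unfolding x(2) coset_rep_eq_iff[OF assms(1)]
      using coset_rep_diff[OF assms(1), of "x - r"] unfolding a_def by (simp add: algebra_simps)
    then show "t \<in> (\<lambda>(r, a). coset_rep A (r + a)) ` (reps C B \<times> reps B A)" using ra
      by (metis (mono_tags) case_prod_conv imageI)
  qed
  then show ?thesis using assms(6,7) finite_subset by blast
qed

lemma reps_nonempty: "add_subgroup B \<Longrightarrow> reps B A \<noteq> {}"
  unfolding reps_def using add_subgroup_zero by blast

lemma coset_index_pos:
  assumes "add_subgroup A" "add_subgroup B" "A \<subseteq> B" "finite (reps B A)"
  shows "coset_index B A > 0"
  using assms reps_nonempty by (simp add: coset_index_reps card_gt_0_iff)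

lemma coset_index_self: "add_subgroup A \<Longrightarrow> coset_index A A = 1"
proof -
  assume A: "add_subgroup A"
  have "reps A A = {coset_rep A 0}"
    unfolding reps_def using A add_subgroup_zero[OF A] coset_rep_eq_iff[OF A, of _ 0] by auto
  then show ?thesis using A by (simp add: coset_index_reps)
qed

lemma coset_index_eq_1:
  assumes "add_subgroup A" "add_subgroup B" "A \<subseteq> B" "coset_index B A = 1"
  shows "A = B"
proof
  show "B \<subseteq> A"
  proof
    fix x assume "x \<in> B"
    then have "coset_rep A x = coset_rep A 0"
      using assms add_subgroup_zero[OF assms(2)] card_1_singletonE
      unfolding coset_index_reps[OF assms(1-3)] reps_def by (metis imageI singletonD)
    then show "x \<in> A" by (simp add: coset_rep_eq_iff[OF assms(1)])
  qed
qed (fact assms(3))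

section \<open>The local field\<close>

lemma absval_zero [simp]: "absval (0::'f::nonarch_local_field) = 0"
  using dist_absval[of "0::'f" 0] by simp

lemma absval_nonneg [simp]: "0 \<le> absval (x::'f::nonarch_local_field)"
  using dist_absval[of x 0] zero_le_dist[of x 0] by simp

lemma absval_eq_0_iff [simp]: "absval (x::'f::nonarch_local_field) = 0 \<longleftrightarrow> x = 0"
  using dist_absval[of x 0] dist_eq_0_iff[of x 0] by simp

lemma absval_pos_iff [simp]: "0 < absval (x::'f::nonarch_local_field) \<longleftrightarrow> x \<noteq> 0"
  using absval_nonneg[of x] absval_eq_0_iff[of x] by linarith

lemma absval_le_0_iff [simp]: "absval (x::'f::nonarch_local_field) \<le> 0 \<longleftrightarrow> x = 0"
  using absval_nonneg[of x] absval_eq_0_iff[of x] by linarith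

lemma absval_one [simp]: "absval (1::'f::nonarch_local_field) = 1"
  using absval_mult[of "1::'f" 1] by auto

lemma absval_uminus [simp]: "absval (- x) = absval (x::'f::nonarch_local_field)"
  using dist_absval[of 0 x] dist_absval[of x 0] dist_commute[of x 0] by simp

lemma absval_diff_le: "absval (x - y) \<le> max (absval x) (absval (y::'f::nonarch_local_field))"
  using absval_ultrametric[of x "- y"] by simp

lemma absval_inverse: "absval (inverse x) = inverse (absval (x::'f::nonarch_local_field))"
proof (cases "x = 0")
  case False
  then have "absval x * absval (inverse x) = 1"
    using absval_mult[of x "inverse x"] by simp
  then show ?thesis by (simp add: inverse_unique)
qed simp

lemma absval_divide: "absval (x / y) = absval x / absval (y::'f::nonarch_local_field)"
  by (simp add: divide_inverse absval_mult absval_inverse)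

lemma absval_power: "absval (x ^ n) = absval (x::'f::nonarch_local_field) ^ n"
  by (induction n) (simp_all add: absval_mult)

lemma integers_add: "x \<in> integers \<Longrightarrow> y \<in> integers \<Longrightarrow> x + y \<in> integers"
  unfolding integers_def using absval_ultrametric[of x y] by simp

lemma integers_mult: "x \<in> integers \<Longrightarrow> y \<in> integers \<Longrightarrow> x * y \<in> integers"
  unfolding integers_def by (simp add: absval_mult mult_le_one)

lemma integers_zero [simp]: "0 \<in> integers" and integers_one [simp]: "1 \<in> integers"
  unfolding integers_def by simp_all

lemma add_subgroup_integers: "add_subgroup integers"
  unfolding add_subgroup_def integers_def using absval_diff_le order.trans by fastforce

lemma add_subgroup_max_ideal: "add_subgroup max_ideal"
  unfolding add_subgroup_def max_ideal_def using absval_diff_le order.strict_trans1 by fastforce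

lemma integers_uminus_iff [simp]: "- x \<in> integers \<longleftrightarrow> x \<in> integers"
  unfolding integers_def by simp

lemma integers_diff: "x \<in> integers \<Longrightarrow> y \<in> integers \<Longrightarrow> x - y \<in> integers"
  by (rule add_subgroup_diff[OF add_subgroup_integers])

lemma max_ideal_subset: "max_ideal \<subseteq> integers"
  unfolding max_ideal_def integers_def by auto

lemma max_ideal_mult: "c \<in> integers \<Longrightarrow> x \<in> max_ideal \<Longrightarrow> c * x \<in> max_ideal"
  using mult_left_le_one_le[of "absval x" "absval c"]
  by (simp add: integers_def max_ideal_def absval_mult)

lemma integers_sum: "(\<And>i. i \<in> I \<Longrightarrow> g i \<in> integers) \<Longrightarrow> sum g I \<in> integers"
  by (induction I rule: infinite_finite_induct) (simp_all add: integers_add)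

section \<open>Compactness, uniformizer and residue field\<close>

lemma small_element:
  assumes "r > 0"
  obtains t :: "'f::nonarch_local_field" where "t \<noteq> 0" "absval t < r"
proof -
  obtain x :: 'f where "\<not> open {x}" using non_discrete by auto
  then have "\<not> ball x r \<subseteq> {x}"
    using centre_in_ball[of x r] assms open_ball[of x r] by (metis empty_iff subset_singletonD)
  then obtain y where "y \<noteq> x" "dist x y < r" by (auto simp add: subset_iff)
  then show ?thesis using that[of "x - y"] by (simp add: dist_absval)
qed

lemma continuous_absval: "continuous_on A (absval :: 'f::nonarch_local_field \<Rightarrow> real)"
proof -
  have "continuous_on A (\<lambda>x::'f. dist x 0)" by (intro continuous_intros)
  then show ?thesis by (simp add: dist_absval)
qed

lemma continuous_mult_const: "continuous_on A (\<lambda>x. c * x :: 'f::nonarch_local_field)"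
proof -
  have "(absval c)-lipschitz_on A (\<lambda>x. c * x)"
    by (rule lipschitz_onI) (simp_all add: dist_absval absval_mult right_diff_distrib[symmetric])
  then show ?thesis by (rule lipschitz_on_continuous_on)
qed

text \<open>By the ultrametric inequality addition does not increase distances, so it is continuous
  on the product of the field with itself.\<close>

lemma continuous_add_field:
  assumes "continuous_map T euclidean g" "continuous_map T euclidean h"
  shows "continuous_map T euclidean (\<lambda>x. g x + h x :: 'f::nonarch_local_field)"
proof -
  have "continuous_on UNIV (\<lambda>p::'f \<times> 'f. fst p + snd p)"
    unfolding continuous_on_iff
  proof (intro ballI allI impI)
    fix p :: "'f \<times> 'f" and e :: real assume "e > 0"
    have "dist (fst p' + snd p') (fst p + snd p) < e" if "dist p' p < e" for p'
    proof -
      have "dist (fst p' + snd p') (fst p + snd p) = absval ((fst p' - fst p) + (snd p' - snd p))"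
        by (simp add: dist_absval algebra_simps)
      also have "\<dots> \<le> max (dist (fst p') (fst p)) (dist (snd p') (snd p))"
        unfolding dist_absval by (rule absval_ultrametric)
      also have "\<dots> \<le> dist p' p" by (simp add: dist_fst_le dist_snd_le)
      finally show ?thesis using that by simp
    qed
    then show "\<exists>d>0. \<forall>p'\<in>UNIV. dist p' p < d \<longrightarrow> dist (fst p' + snd p') (fst p + snd p) < e"
      using \<open>e > 0\<close> by blast
  qed
  then have c: "continuous_map euclidean euclidean (\<lambda>p::'f \<times> 'f. fst p + snd p)" by simp
  have "continuous_map T (prod_topology euclidean euclidean) (\<lambda>x. (g x, h x))"
    by (rule continuous_map_pairedI[OF assms])
  from continuous_map_compose[OF this, of euclidean "\<lambda>p. fst p + snd p"] c show ?thesis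
    by (simp add: o_def)
qed

text \<open>Local compactness puts a small closed ball around 0 into a compact set. If its radius is
  the absolute value of some nonzero \<open>t\<close>, division by \<open>t\<close> maps the ball
  onto the integers.\<close>

lemma compact_integers: "compact (integers :: 'f::nonarch_local_field set)"
proof -
  obtain U K where UK: "open U" "compact K" "(0::'f) \<in> U" "U \<subseteq> K"
    using locally_compact by blast
  then obtain r where r: "r > 0" "ball 0 r \<subseteq> U" using openE by blast
  obtain t :: 'f where t: "t \<noteq> 0" "absval t < r" using small_element[OF r(1)] .
  have "cball 0 (absval t) \<subseteq> K" using r(2) UK(4) t(2) by (auto simp add: subset_iff)
  then have "compact (cball (0::'f) (absval t))"
    using compact_Int_closed[OF UK(2) closed_cball, of 0 "absval t"] by (simp add: inf.absorb2)
  then have "compact ((\<lambda>x. inverse t * x) ` cball 0 (absval t))"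
    by (rule compact_continuous_image[OF continuous_mult_const])
  moreover have "(\<lambda>x. inverse t * x) ` cball 0 (absval t) = integers"
  proof
    show "(\<lambda>x. inverse t * x) ` cball 0 (absval t) \<subseteq> integers"
      unfolding integers_def using t(1)
      by (auto simp add: dist_absval absval_mult absval_divide inverse_eq_divide divide_le_eq_1)
    show "integers \<subseteq> (\<lambda>x. inverse t * x) ` cball 0 (absval t)"
    proof
      fix x :: 'f assume "x \<in> integers"
      then have "t * x \<in> cball 0 (absval t)" 
        unfolding integers_def by (simp add: dist_absval absval_mult mult_left_le)
      then show "x \<in> (\<lambda>x. inverse t * x) ` cball 0 (absval t)"
        using t(1) by (intro image_eqI[of _ _ "t * x"]) auto
    qed
  qed
  ultimately show ?thesis by simp
qed

text \<open>The maximal ideal is closed, since its complement is stable under translations by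
  elements of absolute value below 1. Hence it is compact and the absolute value attains a maximum
  on it, which is positive because the field is not discrete.\<close>

lemma uniformizer_exists:
  "\<exists>w::'f::nonarch_local_field. w \<noteq> 0 \<and> absval w < 1 \<and> (\<forall>x\<in>(max_ideal::'f set). absval x \<le> absval w)"
proof -
  have "closed (max_ideal :: 'f set)"
    unfolding closed_def open_dist
  proof (intro ballI exI[of _ 1] conjI allI impI)
    fix x y :: 'f assume "x \<in> - max_ideal" "dist y x < 1"
    then show "y \<in> - max_ideal"
      using absval_diff_le[of y "y - x"] by (auto simp add: max_ideal_def dist_absval)
  qed simp
  then have "compact (max_ideal :: 'f set)"
    using compact_Int_closed[OF compact_integers, of max_ideal]
    by (simp add: inf.absorb2 max_ideal_subset)
  moreover have "(0::'f) \<in> max_ideal" by (simp add: max_ideal_def)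
  ultimately obtain w :: 'f where w: "w \<in> max_ideal" "\<forall>x\<in>(max_ideal::'f set). absval x \<le> absval w"
    using continuous_attains_sup[of "max_ideal::'f set", OF _ _ continuous_absval] by blast
  obtain t :: 'f where t: "t \<noteq> 0" "absval t < 1" using small_element[OF zero_less_one] .
  then have "absval t \<le> absval w" using w(2) by (simp add: max_ideal_def)
  then have "w \<noteq> 0" using t(1) by auto
  then show ?thesis using w unfolding max_ideal_def by auto
qed

definition unif :: "'f::nonarch_local_field" where
  "unif = (SOME w. w \<noteq> 0 \<and> absval w < 1 \<and> (\<forall>x\<in>(max_ideal::'f set). absval x \<le> absval w))"

lemma unif_nonzero [simp]: "(unif::'f::nonarch_local_field) \<noteq> 0"
  and absval_unif_less: "absval (unif::'f) < 1"
  and absval_le_unif: "x \<in> max_ideal \<Longrightarrow> absval (x::'f) \<le> absval (unif::'f)"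
  using someI_ex[OF uniformizer_exists[where 'f = 'f], folded unif_def] by blast+

lemma unif_max_ideal: "unif \<in> max_ideal"
  by (simp add: max_ideal_def absval_unif_less)

lemma unif_integers: "unif \<in> integers"
  using unif_max_ideal max_ideal_subset by blast

lemma max_ideal_eq: "x \<in> max_ideal \<longleftrightarrow> (\<exists>c\<in>integers. x = unif * c)"
proof
  assume "x \<in> max_ideal"
  from absval_le_unif[OF this] have "absval (x / unif) \<le> 1"
    by (simp add: absval_divide divide_le_eq_1)
  then show "\<exists>c\<in>integers. x = unif * c"
    by (intro bexI[of _ "x / unif"]) (auto simp add: integers_def)
next
  assume "\<exists>c\<in>integers. x = unif * c"
  then show "x \<in> max_ideal"
    using max_ideal_mult[OF _ unif_max_ideal] by (auto simp add: mult.commute)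
qed

lemma unif_power_small:
  assumes "r > 0"
  obtains k :: nat where "absval (unif ^ k :: 'f::nonarch_local_field) < r"
  using real_arch_pow_inv[OF assms absval_unif_less[where 'f = 'f]]
  unfolding absval_power by blast

lemma unif_power_mult_integers: "\<exists>k::nat. unif ^ k * (x::'f::nonarch_local_field) \<in> integers"
proof -
  obtain k where k: "absval (unif ^ k :: 'f) < 1 / (absval x + 1)"
    using unif_power_small[of "1 / (absval x + 1)"] by (auto simp add: add_nonneg_pos)
  have "absval (unif ^ k * x) \<le> 1 / (absval x + 1) * absval x"
    unfolding absval_mult by (intro mult_right_mono less_imp_le[OF k]) simp
  also have "\<dots> \<le> 1" using absval_nonneg[of x] by (simp add: divide_le_eq_1 add_nonneg_pos)
  finally show ?thesis unfolding integers_def by auto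
qed

lemma unif_powi_integers: "k \<ge> 0 \<Longrightarrow> unif powi k \<in> integers"
  using unif_integers by (auto simp add: power_int_def integers_def absval_power intro!: power_le_one)

lemma residue_field_eq: "residue_field = (\<lambda>a. (+) a ` max_ideal) ` integers"
proof -
  have "{(x, y). x \<in> integers \<and> y \<in> integers \<and> x - y \<in> max_ideal} `` {a} = (+) a ` max_ideal"
    if a: "a \<in> integers" for a :: 'a
  proof
    show "{(x, y). x \<in> integers \<and> y \<in> integers \<and> x - y \<in> max_ideal} `` {a} \<subseteq> (+) a ` max_ideal"
    proof
      fix y assume "y \<in> {(x, y). x \<in> integers \<and> y \<in> integers \<and> x - y \<in> max_ideal} `` {a}"
      then have "y - a \<in> max_ideal" using add_subgroup_diff_commute[OF add_subgroup_max_ideal] by auto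
      then show "y \<in> (+) a ` max_ideal" by (intro image_eqI[of _ _ "y - a"]) auto
    qed
    show "(+) a ` max_ideal \<subseteq> {(x, y). x \<in> integers \<and> y \<in> integers \<and> x - y \<in> max_ideal} `` {a}"
      using a max_ideal_subset integers_add add_subgroup_uminus[OF add_subgroup_max_ideal] by auto
  qed
  then show ?thesis unfolding residue_field_def quotient_def by auto
qed

lemma residue_card_index:
  "residue_card TYPE('f::nonarch_local_field) = coset_index (integers::'f set) max_ideal"
  by (simp add: residue_card_def coset_index_def residue_field_eq)

text \<open>The open unit balls that cover the compact ring of integers are cosets of the maximal
  ideal, so a finite subcover bounds the number of cosets.\<close>

lemma finite_reps_residue: "finite (reps (integers::'f::nonarch_local_field set) max_ideal)"
proof -
  have "(integers::'f set) \<subseteq> (\<Union>x\<in>integers. ball x 1)" by auto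
  then obtain D where D: "D \<subseteq> integers" "finite D" "(integers::'f set) \<subseteq> (\<Union>x\<in>D. ball x 1)"
    using compactE_image[OF compact_integers, of integers "\<lambda>x. ball x 1"] by auto
  have "reps integers max_ideal \<subseteq> coset_rep max_ideal ` D"
  proof
    fix t :: 'f assume "t \<in> reps integers max_ideal"
    then obtain x where x: "x \<in> integers" "t = coset_rep max_ideal x" unfolding reps_def by auto
    then obtain d where "d \<in> D" "dist d x < 1" using D(3) by auto
    then have "d \<in> D" "t = coset_rep max_ideal d"
      using x coset_rep_eq_iff[OF add_subgroup_max_ideal, of x d]
      by (auto simp add: max_ideal_def dist_absval[symmetric] dist_commute)
    then show "t \<in> coset_rep max_ideal ` D" by blast
  qed
  then show ?thesis using D(2) finite_subset by blast
qed

lemma residue_card_gt_1: "residue_card TYPE('f::nonarch_local_field) > 1"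
proof -
  have "coset_index (integers::'f set) max_ideal > 0"
    using coset_index_pos[OF add_subgroup_max_ideal add_subgroup_integers max_ideal_subset
        finite_reps_residue] .
  moreover have "coset_index (integers::'f set) max_ideal \<noteq> 1"
  proof
    assume "coset_index (integers::'f set) max_ideal = 1"
    then have "max_ideal = (integers::'f set)"
      by (rule coset_index_eq_1[OF add_subgroup_max_ideal add_subgroup_integers max_ideal_subset])
    moreover have "(1::'f) \<notin> max_ideal" by (simp add: max_ideal_def)
    ultimately show False using integers_one by blast
  qed
  ultimately show ?thesis unfolding residue_card_index by linarith
qed

text \<open>By Bezout the natural numbers lying in the maximal ideal are closed under
  \<open>gcd\<close>; since 0 is among them, their common divisor \<open>Gcd\<close> is one of
  them.\<close>

lemma residue_char_max_ideal: "of_nat (residue_char TYPE('f)) \<in> (max_ideal::'f::nonarch_local_field set)"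
proof -
  let ?A = "{n. (of_nat n :: 'f) \<in> max_ideal}"
  have int: "(of_int k :: 'f) \<in> integers" for k
  proof -
    have n: "(of_nat n :: 'f) \<in> integers" for n by (induction n) (simp_all add: integers_add)
    show ?thesis by (cases k) (simp_all add: n del: of_nat_Suc)
  qed
  have "gcd a b \<in> ?A" if "a \<in> ?A" "b \<in> ?A" for a b
  proof -
    obtain u v where "u * int a + v * int b = gcd (int a) (int b)" using bezout_int by blast
    then have "(of_int (gcd (int a) (int b)) :: 'f) = of_int u * of_nat a + of_int v * of_nat b"
      by (metis of_int_add of_int_mult of_int_of_nat_eq)
    then have "(of_nat (gcd a b) :: 'f) = of_int u * of_nat a + of_int v * of_nat b"
      by (simp add: gcd_int_int_eq)
    moreover have "of_int u * of_nat a + of_int v * of_nat b \<in> (max_ideal::'f set)"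
      using that int max_ideal_mult add_subgroup_add[OF add_subgroup_max_ideal] by blast
    ultimately show ?thesis by simp
  qed
  moreover have "0 \<in> ?A" by (simp add: max_ideal_def)
  ultimately have "Gcd ?A \<in> ?A" using Gcd_in by blast
  then show ?thesis by (simp add: residue_char_def)
qed

text \<open>A finite group killed by \<open>p\<close> has order dividing a power of
  \<open>p\<close>. The induction adjoins one element \<open>b\<close> outside \<open>A\<close>: the
  quotient of \<open>A1\<close> by \<open>A\<close> is cyclic of order \<open>d\<close> dividing
  \<open>p\<close>, and the index of \<open>A1\<close> in \<open>B\<close> is smaller.\<close>

lemma coset_index_dvd_power:
  fixes A B :: "'a::comm_ring_1 set"
  assumes "add_subgroup A" "add_subgroup B" "A \<subseteq> B" "finite (reps B A)" "p > 0"
    and "\<And>b. b \<in> B \<Longrightarrow> of_nat p * b \<in> A"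
  shows "\<exists>n. coset_index B A dvd p ^ n"
  using assms
proof (induction "coset_index B A" arbitrary: A rule: less_induct)
  case less
  note A = less.prems
  show ?case
  proof (cases "A = B")
    case True
    then show ?thesis using coset_index_self[OF A(2)] by simp
  next
    case False
    then obtain b where b: "b \<in> B" "b \<notin> A" using A(3) by blast
    define A1 where "A1 = {of_int k * b + a | k a. a \<in> A}"
    have mB: "of_int k * x \<in> B" if "x \<in> B" for k :: int and x
    proof -
      have n: "of_nat n * x \<in> B" for n
        by (induction n) (use that add_subgroup_zero[OF A(2)] add_subgroup_add[OF A(2)]
            in \<open>auto simp add: algebra_simps\<close>)
      show ?thesis
        by (cases k) (use n add_subgroup_uminus[OF A(2)] in \<open>auto simp del: of_nat_Suc\<close>)
    qed
    have mA: "of_int k * x \<in> A" if "x \<in> A" for k :: int and x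
    proof -
      have n: "of_nat n * x \<in> A" for n
        by (induction n) (use that add_subgroup_zero[OF A(1)] add_subgroup_add[OF A(1)]
            in \<open>auto simp add: algebra_simps\<close>)
      show ?thesis
        by (cases k) (use n add_subgroup_uminus[OF A(1)] in \<open>auto simp del: of_nat_Suc\<close>)
    qed
    have A1: "add_subgroup A1"
      unfolding add_subgroup_def
    proof (intro conjI ballI)
      have "0 = of_int 0 * b + 0" by simp
      then show "0 \<in> A1" unfolding A1_def using add_subgroup_zero[OF A(1)] by blast
      fix x y assume "x \<in> A1" "y \<in> A1"
      then obtain k a l c where "x = of_int k * b + a" "y = of_int l * b + c" "a \<in> A" "c \<in> A"
        unfolding A1_def by blast
      then have "x - y = of_int (k - l) * b + (a - c)" "a - c \<in> A"
        using add_subgroup_diff[OF A(1)] by (auto simp add: algebra_simps)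
      then show "x - y \<in> A1" unfolding A1_def by blast
    qed
    have AA1: "A \<subseteq> A1"
    proof
      fix a assume "a \<in> A"
      then have "a = of_int 0 * b + a" "a \<in> A" by simp_all
      then show "a \<in> A1" unfolding A1_def by blast
    qed
    have A1B: "A1 \<subseteq> B"
      unfolding A1_def using mB[OF b(1)] A(3) add_subgroup_add[OF A(2)] by auto
    have "b = of_int 1 * b + 0" by simp
    then have bA1: "b \<in> A1" unfolding A1_def using add_subgroup_zero[OF A(1)] by blast
    have mult: "coset_index B A = coset_index B A1 * coset_index A1 A"
      by (rule coset_index_mult[OF A(1) A1 A(2) AA1 A1B])
    have fin1: "finite (reps A1 A)" using A(4) reps_mono[OF A1B] finite_subset by blast
    have pos: "coset_index A1 A > 0" by (rule coset_index_pos[OF A(1) A1 AA1 fin1])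
    have pos': "coset_index B A > 0" by (rule coset_index_pos[OF A(1-4)])
    have "coset_index A1 A \<noteq> 1"
      using coset_index_eq_1[OF A(1) A1 AA1] b(2) bA1 by blast
    then have "coset_index B A1 < coset_index B A" using mult pos pos' by simp
    moreover have "finite (reps B A1)" by (rule reps_finite_coarse[OF A(1) A1 AA1 A(4)])
    ultimately obtain n where n: "coset_index B A1 dvd p ^ n"
      using less.hyps[of A1] A1 A(2,5,6) A1B AA1 by blast
    \<comment> \<open>The order of \<open>b\<close> modulo \<open>A\<close>; it exists because the
      multiple of \<open>b\<close> by \<open>p\<close> lies in \<open>A\<close>.\<close>
    define d where "d = (LEAST d. d > 0 \<and> of_nat d * b \<in> A)"
    have d: "d > 0" "of_nat d * b \<in> A"
      using LeastI[of "\<lambda>d. d > 0 \<and> of_nat d * b \<in> A" p] A(5,6) b(1) unfolding d_def by auto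
    have dle: "d \<le> e" if "e > 0" "of_nat e * b \<in> A" for e
      unfolding d_def by (rule Least_le) (use that in simp)
    have red: "of_int k * b - of_nat (nat (k mod int d)) * b \<in> A" for k
    proof -
      have "(of_int k :: 'a) = of_int (int d * (k div int d) + k mod int d)"
        by (simp only: mult_div_mod_eq)
      also have "\<dots> = of_int (k div int d) * of_nat d + of_int (k mod int d)"
        by (simp only: of_int_add of_int_mult of_int_of_nat_eq mult.commute)
      also have "of_int (k mod int d) = (of_nat (nat (k mod int d)) :: 'a)"
        using d(1) by (simp add: of_nat_nat)
      finally have "(of_int k :: 'a) = of_int (k div int d) * of_nat d + of_nat (nat (k mod int d))" .
      then have "of_int k * b - of_nat (nat (k mod int d)) * b = of_int (k div int d) * (of_nat d * b)"
        by (simp add: algebra_simps)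
      then show ?thesis using mA[OF d(2)] by simp
    qed
    have ord: "k mod int d = 0" if "of_int k * b \<in> A" for k
    proof (rule ccontr)
      assume "k mod int d \<noteq> 0"
      moreover have "0 \<le> k mod int d" "k mod int d < int d" using d(1) by simp_all
      ultimately have "nat (k mod int d) > 0" "nat (k mod int d) < d" by linarith+
      moreover have "of_nat (nat (k mod int d)) * b \<in> A"
        using add_subgroup_diff[OF A(1) that red[of k]] by simp
      ultimately show False using dle[of "nat (k mod int d)"] by linarith
    qed
    have "reps A1 A = (\<lambda>i. coset_rep A (of_nat i * b)) ` {..<d}"
    proof
      show "reps A1 A \<subseteq> (\<lambda>i. coset_rep A (of_nat i * b)) ` {..<d}"
      proof
        fix t assume "t \<in> reps A1 A"
        then obtain k a where ka: "a \<in> A" "t = coset_rep A (of_int k * b + a)"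
          unfolding reps_def A1_def by blast
        have "(of_int k * b - of_nat (nat (k mod int d)) * b) + a \<in> A"
          using add_subgroup_add[OF A(1) red ka(1)] .
        then have "t = coset_rep A (of_nat (nat (k mod int d)) * b)"
          unfolding ka(2) coset_rep_eq_iff[OF A(1)] by (simp add: algebra_simps)
        moreover have "nat (k mod int d) < d" using d(1) by (simp add: nat_less_iff)
        ultimately show "t \<in> (\<lambda>i. coset_rep A (of_nat i * b)) ` {..<d}" by blast
      qed
      have "of_nat i * b \<in> A1" for i
      proof -
        have "of_nat i * b = of_int (int i) * b + 0" by simp
        then show ?thesis unfolding A1_def using add_subgroup_zero[OF A(1)] by blast
      qed
      then show "(\<lambda>i. coset_rep A (of_nat i * b)) ` {..<d} \<subseteq> reps A1 A"
        unfolding reps_def by blast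
    qed
    moreover have "inj_on (\<lambda>i. coset_rep A (of_nat i * b)) {..<d}"
    proof (rule inj_onI)
      fix i j assume ij: "i \<in> {..<d}" "j \<in> {..<d}"
        "coset_rep A (of_nat i * b) = coset_rep A (of_nat j * b)"
      then have "of_int (int i - int j) * b \<in> A"
        by (simp add: coset_rep_eq_iff[OF A(1)] algebra_simps)
      then have "(int i - int j) mod int d = 0" by (rule ord)
      then have "int d dvd int i - int j" by blast
      then show "i = j" using ij(1,2) zdvd_imp_le[of "int d" "int i - int j"]
          zdvd_imp_le[of "int d" "int j - int i"] by (cases i j rule: linorder_cases) (auto simp add: dvd_diff_commute)
    qed
    ultimately have "coset_index A1 A = d"
      by (simp add: coset_index_reps[OF A(1) A1 AA1] card_image)
    moreover have "d dvd p" using ord[of "int p"] A(6)[OF b(1)] by (simp add: mod_eq_0_iff_dvd)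
    ultimately have "coset_index B A dvd p ^ Suc n"
      unfolding mult using mult_dvd_mono[OF n, of d p] by (simp add: mult.commute)
    then show ?thesis by blast
  qed
qed

text \<open>The additive group of the residue field is killed by the residue characteristic, so q
  divides a power of a unit of \<open>R\<close>. This is what makes \<open>sq\<close> invertible and
  its negative powers meaningful.\<close>

lemma residue_card_unit:
  assumes "(of_nat (residue_char TYPE('f::nonarch_local_field)) :: 'r::idom) dvd 1"
  shows "(of_nat (residue_card TYPE('f)) :: 'r) dvd 1"
proof -
  have "residue_char TYPE('f) > 0" using assms by (cases "residue_char TYPE('f)") auto
  moreover have "of_nat (residue_char TYPE('f)) * b \<in> max_ideal" if "b \<in> integers" for b :: 'f
    using max_ideal_mult[OF that residue_char_max_ideal] by (simp add: mult.commute)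
  ultimately obtain n where "residue_card TYPE('f) dvd residue_char TYPE('f) ^ n"
    using coset_index_dvd_power[OF add_subgroup_max_ideal add_subgroup_integers max_ideal_subset
      finite_reps_residue] unfolding residue_card_index by blast
  then obtain m where "residue_char TYPE('f) ^ n = residue_card TYPE('f) * m" by (rule dvdE)
  then have "(of_nat (residue_char TYPE('f)) :: 'r) ^ n = of_nat (residue_card TYPE('f)) * of_nat m"
    by (metis of_nat_mult of_nat_power)
  then have "(of_nat (residue_card TYPE('f)) :: 'r) dvd of_nat (residue_char TYPE('f)) ^ n"
    by simp
  then show ?thesis using dvd_trans[OF _ dvd_power_same[OF assms, of n]] by simp
qed

section \<open>Powers of the square root\<close>

lemma unit_group_simps [simp]:
  "carrier unit_group = {x. x dvd (1::'r::comm_ring_1)}"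
  "x \<otimes>\<^bsub>unit_group\<^esub> y = x * (y::'r)"
  "\<one>\<^bsub>unit_group\<^esub> = (1::'r)"
  by (auto simp add: unit_group_def units_of_def Units_def dvd_def mult.commute)

lemma comm_group_unit_group: "comm_group (unit_group :: 'r::comm_ring_1 monoid)"
proof (rule comm_groupI)
  fix x :: 'r assume "x \<in> carrier unit_group"
  then obtain y where "1 = x * y" by (auto simp add: dvd_def)
  then show "\<exists>y\<in>carrier unit_group. y \<otimes>\<^bsub>unit_group\<^esub> x = \<one>\<^bsub>unit_group\<^esub>"
    by (intro bexI[of _ y]) (auto simp add: mult.commute dvd_def)
next
  fix x y :: 'r assume "x \<in> carrier unit_group" "y \<in> carrier unit_group"
  then show "x \<otimes>\<^bsub>unit_group\<^esub> y \<in> carrier unit_group"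
    using mult_dvd_mono[of x 1 y 1] by simp
qed (auto simp add: ac_simps)

text \<open>Names the integer power that occurs in \<open>d0'\<close>, so that exponents can be
  added and compared.\<close>

definition upow :: "'r::comm_ring_1 \<Rightarrow> int \<Rightarrow> 'r" where
  "upow x k = x [^]\<^bsub>unit_group\<^esub> k"

lemma upow_add: "(x::'r::comm_ring_1) dvd 1 \<Longrightarrow> upow x (k + l) = upow x k * upow x l"
  unfolding upow_def
  using group.int_pow_mult[OF comm_group.axioms(2)[OF comm_group_unit_group], of x k l] by simp

lemma upow_0 [simp]: "upow x 0 = 1"
  unfolding upow_def by simp

lemma upow_1: "(x::'r::comm_ring_1) dvd 1 \<Longrightarrow> upow x 1 = x"
  unfolding upow_def using group.int_pow_1[OF comm_group.axioms(2)[OF comm_group_unit_group], of x] by simp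

lemma upow_unit: "(x::'r::comm_ring_1) dvd 1 \<Longrightarrow> upow x k dvd 1"
  unfolding upow_def
  using group.int_pow_closed[OF comm_group.axioms(2)[OF comm_group_unit_group], of x k] by simp

lemma upow_nat: "(x::'r::comm_ring_1) dvd 1 \<Longrightarrow> upow x (int n) = x ^ n"
  by (induction n) (simp_all add: upow_add upow_1)

section \<open>Smooth characters\<close>

locale nontrivial_character =
  fixes chi :: "'f::nonarch_local_field \<Rightarrow> 'r::idom"
  assumes smooth: "smooth_character chi" and nontrivial: "\<exists>x. chi x \<noteq> 1"
begin

lemma chi_add: "chi (x + y) = chi x * chi y"
  using smooth by (simp add: smooth_character_def)

lemma chi_0 [simp]: "chi 0 = 1"
proof -
  have "chi 0 dvd 1" using smooth by (simp add: smooth_character_def)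
  then have "chi 0 \<noteq> 0" by auto
  then show ?thesis using chi_add[of 0 0] by simp
qed

lemma chi_uminus: "chi x * chi (- x) = 1"
  using chi_add[of x "- x"] by simp

lemma chi_trivial_ball: "\<exists>r>0. \<forall>x. absval x < r \<longrightarrow> chi x = 1"
proof -
  have "open {x. chi x = 1}" "0 \<in> {x. chi x = 1}" using smooth by (simp_all add: smooth_character_def)
  then obtain r where "r > 0" "ball 0 r \<subseteq> {x. chi x = 1}" using openE by blast
  then show ?thesis by (intro exI[of _ r]) (auto simp add: subset_iff dist_absval)
qed

text \<open>The largest \<open>integers\<close>-submodule contained in the kernel of
  \<open>chi\<close>. The kernel itself is only a subgroup, whereas membership here can be tested by
  absolute values.\<close>

definition conductor :: "'f set" where
  "conductor = {x. \<forall>c\<in>integers. chi (c * x) = 1}"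

lemma conductor_mult: "c \<in> integers \<Longrightarrow> x \<in> conductor \<Longrightarrow> c * x \<in> conductor"
  unfolding conductor_def using integers_mult[of _ c] by (auto simp add: mult.assoc[symmetric])

lemma conductor_le: "absval x \<le> absval y \<Longrightarrow> y \<in> conductor \<Longrightarrow> x \<in> conductor"
proof (cases "y = 0")
  case False
  assume "absval x \<le> absval y" "y \<in> conductor"
  then show ?thesis using conductor_mult[of "x / y" y] False
    by (simp add: integers_def absval_divide)
next
  case True
  assume "absval x \<le> absval y" "y \<in> conductor"
  then show ?thesis using True absval_nonneg[of x] by (metis absval_eq_0_iff antisym)
qed

lemma conductor_add: "x \<in> conductor \<Longrightarrow> y \<in> conductor \<Longrightarrow> x + y \<in> conductor"
  unfolding conductor_def by (auto simp add: distrib_left chi_add)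

lemma conductor_zero [simp]: "0 \<in> conductor"
  unfolding conductor_def by simp

text \<open>A small ball lies in the kernel by smoothness, and balls around 0 are stable under
  multiplication by integers.\<close>

lemma conductor_nonzero: "\<exists>k::nat. unif ^ k \<in> conductor"
proof -
  obtain r where r: "r > 0" "\<And>x. absval x < r \<Longrightarrow> chi x = 1" using chi_trivial_ball by blast
  obtain k where "absval (unif ^ k :: 'f) < r" using unif_power_small[OF r(1)] .
  then have "absval (c * unif ^ k) < r" if "c \<in> integers" for c :: 'f
    using that order.strict_trans1[OF mult_left_le_one_le[of "absval (unif ^ k :: 'f)" "absval c"]]
    by (simp add: integers_def absval_mult)
  then have "unif ^ k \<in> conductor"
    unfolding conductor_def using r(2) by blast
  then show ?thesis by blast
qed

text \<open>An element of the conductor that is larger than some \<open>z\<close> with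
  \<open>chi z \<noteq> 1\<close> would force \<open>z\<close> into the conductor.\<close>

lemma conductor_bounded: "\<exists>k::nat. \<forall>x\<in>conductor. unif ^ k * x \<in> integers"
proof -
  obtain z where z: "chi z \<noteq> 1" using nontrivial by blast
  then have "z \<noteq> 0" by auto
  obtain k where k: "unif ^ k * z \<in> integers" using unif_power_mult_integers by blast
  have le: "absval x \<le> absval z" if "x \<in> conductor" for x
  proof (rule ccontr)
    assume "\<not> absval x \<le> absval z"
    then have "z \<in> conductor" using conductor_le[OF _ that, of z] by simp
    then have "chi (1 * z) = 1" unfolding conductor_def using integers_one by blast
    then show False using z by simp
  qed
  then have "unif ^ k * x \<in> integers" if "x \<in> conductor" for x
    using k le[OF that] order.trans[OF mult_left_mono[of "absval x" "absval z" "absval (unif ^ k :: 'f)"]]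
    by (simp add: integers_def absval_mult)
  then show ?thesis by blast
qed

end

section \<open>Lattices\<close>

lemma unif_powi_le: "k \<le> l \<Longrightarrow> unif powi (l - k) \<in> integers"
  by (rule unif_powi_integers) simp

lemma unif_powi_add: "unif powi (k + l) = unif powi k * (unif powi l :: 'f::nonarch_local_field)"
  by (simp add: power_int_add)

lemma finite_unif_power_bound:
  assumes "finite B"
  shows "\<exists>k::nat. \<forall>b\<in>B. unif ^ k * (g b :: 'f::nonarch_local_field) \<in> integers"
  using assms
proof induction
  case (insert b B)
  then obtain k where k: "\<forall>b\<in>B. unif ^ k * g b \<in> integers" by blast
  obtain l where l: "unif ^ l * g b \<in> integers" using unif_power_mult_integers by blast
  have pw: "(unif :: 'f) ^ n \<in> integers" for n using unif_powi_integers[of "int n"] by simp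
  have "unif ^ (k + l) * g b' \<in> integers" if "b' \<in> insert b B" for b'
  proof (cases "b' = b")
    case True
    then show ?thesis using integers_mult[OF pw[of k] l] by (simp add: power_add mult.assoc)
  next
    case False
    then have "unif ^ k * g b' \<in> integers" using that k by blast
    then have "unif ^ l * (unif ^ k * g b') \<in> integers" by (rule integers_mult[OF pw])
    moreover have "unif ^ l * (unif ^ k * g b') = unif ^ (k + l) * g b'"
      by (simp add: power_add ac_simps)
    ultimately show ?thesis by simp
  qed
  then show ?case by blast
qed simp

locale lattice_space = vector_space s
  for s :: "'f::nonarch_local_field \<Rightarrow> 'v::ab_group_add \<Rightarrow> 'v" +
  fixes X L :: "'v set"
  assumes space: "fd_space s X" and lattice: "ring_lattice s X L"
begin

section \<open>Coordinates on a space with a reference lattice\<close>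

lemma subspace_X: "subspace X"
  using space by (simp add: fd_space_def)

lemma X_add: "x \<in> X \<Longrightarrow> y \<in> X \<Longrightarrow> x + y \<in> X"
  and X_diff: "x \<in> X \<Longrightarrow> y \<in> X \<Longrightarrow> x - y \<in> X"
  and X_scale: "x \<in> X \<Longrightarrow> s c x \<in> X"
  and X_zero: "0 \<in> X"
  and X_uminus: "x \<in> X \<Longrightarrow> - x \<in> X"
  using subspace_add[OF subspace_X] subspace_diff[OF subspace_X] subspace_scale[OF subspace_X]
    subspace_0[OF subspace_X] subspace_neg[OF subspace_X] by simp_all

lemma X_sum: "(\<And>i. i \<in> I \<Longrightarrow> g i \<in> X) \<Longrightarrow> sum g I \<in> X"
  by (rule subspace_sum[OF subspace_X])

lemma dual_add: "u \<in> dual s X \<Longrightarrow> x \<in> X \<Longrightarrow> y \<in> X \<Longrightarrow> u (x + y) = u x + u y"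
  and dual_scale: "u \<in> dual s X \<Longrightarrow> x \<in> X \<Longrightarrow> u (s c x) = c * u x"
  by (auto simp add: dual_def linear_map_def)

lemma dual_zero: "u \<in> dual s X \<Longrightarrow> u 0 = 0"
  using dual_scale[of u 0 0] X_zero by simp

lemma dual_diff: "u \<in> dual s X \<Longrightarrow> x \<in> X \<Longrightarrow> y \<in> X \<Longrightarrow> u (x - y) = u x - u y"
  using dual_add[of u "x - y" y] X_diff[of x y] by simp

lemma dual_sum:
  "finite I \<Longrightarrow> u \<in> dual s X \<Longrightarrow> (\<And>i. i \<in> I \<Longrightarrow> g i \<in> X) \<Longrightarrow> u (sum g I) = (\<Sum>i\<in>I. u (g i))"
  by (induction I rule: finite_induct) (simp_all add: dual_zero dual_add X_sum)

text \<open>A basis of \<open>L\<close> together with its dual basis: \<open>u b\<close> is the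
  coordinate at \<open>b\<close>, made an element of \<open>dual s X\<close> by being 0 outside
  \<open>X\<close>. Lattice computations below use these properties in place of
  \<open>representation\<close>.\<close>

definition lattice_basis :: "'v set \<Rightarrow> ('v \<Rightarrow> 'v \<Rightarrow> 'f) \<Rightarrow> bool" where
  "lattice_basis B u \<longleftrightarrow> finite B \<and> B \<subseteq> L \<and> B \<subseteq> X \<and> (\<forall>b\<in>B. u b \<in> dual s X) \<and>
     (\<forall>x\<in>X. x = (\<Sum>b\<in>B. s (u b x) b)) \<and> (\<forall>b\<in>B. \<forall>c. u b (\<Sum>b\<in>B. s (c b) b) = c b) \<and>
     L = {x \<in> X. \<forall>b\<in>B. u b x \<in> integers}"

lemma lattice_basisD:
  assumes "lattice_basis B u"
  shows "finite B" "B \<subseteq> L" "B \<subseteq> X" "\<And>b. b \<in> B \<Longrightarrow> u b \<in> dual s X"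
    "\<And>x. x \<in> X \<Longrightarrow> x = (\<Sum>b\<in>B. s (u b x) b)"
    "\<And>c b. b \<in> B \<Longrightarrow> u b (\<Sum>b\<in>B. s (c b) b) = c b"
    "L = {x \<in> X. \<forall>b\<in>B. u b x \<in> integers}"
  using assms unfolding lattice_basis_def by blast+

lemma lattice_basis_exists: "\<exists>B u. lattice_basis B u"
proof -
  obtain B where B: "finite B" "independent B" "span B = X"
    "L = {\<Sum>b\<in>B. s (c b) b | c. \<forall>b\<in>B. c b \<in> integers}"
    using lattice unfolding ring_lattice_def by blast
  define u where "u b x = (if x \<in> X then representation B x b else 0)" for b x
  have u: "u b \<in> dual s X" for b
    unfolding dual_def linear_map_def u_def
    using B by (auto simp add: X_add X_scale representation_add representation_scale)
  have x: "x = (\<Sum>b\<in>B. s (u b x) b)" if "x \<in> X" for x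
    using sum_representation_eq[OF B(2), of x B] B that by (simp add: u_def)
  have BX: "B \<subseteq> X" using B(3) span_superset by blast
  have c: "u b (\<Sum>b\<in>B. s (c b) b) = c b" if "b \<in> B" for b c
  proof -
    have "u b (\<Sum>b\<in>B. s (c b) b) = (\<Sum>b'\<in>B. c b' * u b b')"
      using BX by (subst dual_sum[OF B(1) u]) (auto intro!: sum.cong simp add: X_scale dual_scale[OF u])
    also have "\<dots> = (\<Sum>b'\<in>B. if b' = b then c b' else 0)"
      using representation_basis[OF B(2)] BX by (intro sum.cong) (auto simp add: u_def)
    also have "\<dots> = c b" using B(1) that by simp
    finally show ?thesis .
  qed
  have L: "L = {x \<in> X. \<forall>b\<in>B. u b x \<in> integers}"
  proof (intro equalityI subsetI)
    fix y assume "y \<in> L"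
    then obtain d where "y = (\<Sum>b\<in>B. s (d b) b)" "\<forall>b\<in>B. d b \<in> integers" using B(4) by blast
    then show "y \<in> {x \<in> X. \<forall>b\<in>B. u b x \<in> integers}"
      using c[of _ d] BX by (auto intro!: X_sum X_scale)
  next
    fix y assume "y \<in> {x \<in> X. \<forall>b\<in>B. u b x \<in> integers}"
    then show "y \<in> L" unfolding B(4) using x[of y] by (intro CollectI exI[of _ "\<lambda>b. u b y"]) auto
  qed
  have "B \<subseteq> L"
  proof
    fix b assume b: "b \<in> B"
    have "(\<Sum>b'\<in>B. s (if b' = b then 1 else 0) b') = (\<Sum>b'\<in>B. if b' = b then b' else 0)"
      by (intro sum.cong) auto
    then have "b = (\<Sum>b'\<in>B. s (if b' = b then 1 else 0) b')" using b B(1) by simp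
    moreover have "\<forall>b'\<in>B. (if b' = b then 1 else 0 :: 'f) \<in> integers" by simp
    ultimately show "b \<in> L" unfolding B(4) by (intro CollectI exI conjI)
  qed
  then have "lattice_basis B u" unfolding lattice_basis_def
    by (intro conjI ballI allI B(1) BX u x c L)
  then show ?thesis by blast
qed

text \<open>The \<open>integers\<close>-submodules of \<open>X\<close>; no rank or finiteness
  condition yet.\<close>

definition omod :: "'v set \<Rightarrow> bool" where
  "omod N \<longleftrightarrow> N \<subseteq> X \<and> add_subgroup N \<and> (\<forall>c\<in>integers. \<forall>x\<in>N. s c x \<in> N)"

lemma omod_subgroup: "omod N \<Longrightarrow> add_subgroup N"
  and omod_subset: "omod N \<Longrightarrow> N \<subseteq> X"
  and omod_scale: "omod N \<Longrightarrow> c \<in> integers \<Longrightarrow> x \<in> N \<Longrightarrow> s c x \<in> N"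
  by (auto simp add: omod_def)

lemma omod_L: "omod L"
proof -
  obtain B u where "lattice_basis B u" using lattice_basis_exists by blast
  note B = lattice_basisD(1,4,7)[OF this]
  show ?thesis unfolding omod_def add_subgroup_def
    using B
    by (auto simp add: integers_diff X_zero X_diff X_scale dual_zero dual_diff dual_scale integers_mult)
qed

lemma L_subset: "L \<subseteq> X"
  using omod_L by (rule omod_subset)

lemma dual_bound_by_basis:
  assumes "lattice_basis B u" "v \<in> dual s X" "\<forall>b\<in>B. unif ^ k * v b \<in> integers" "x \<in> L"
  shows "unif ^ k * v x \<in> integers"
proof -
  note B = lattice_basisD(1,3,4,5,7)[OF assms(1)]
  have x: "x \<in> X" using assms(4) L_subset by blast
  have "v x = v (\<Sum>b\<in>B. s (u b x) b)" using B(4)[OF x] by simp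
  also have "\<dots> = (\<Sum>b\<in>B. u b x * v b)"
    using B(2) by (subst dual_sum[OF B(1) assms(2)])
      (auto intro!: sum.cong simp add: X_scale dual_scale[OF assms(2)])
  finally have "unif ^ k * v x = (\<Sum>b\<in>B. u b x * (unif ^ k * v b))"
    by (simp add: sum_distrib_left ac_simps)
  also have "\<dots> \<in> integers"
  proof (rule integers_sum)
    fix b assume "b \<in> B"
    then show "u b x * (unif ^ k * v b) \<in> integers"
      using assms(3,4) B(5) by (intro integers_mult[of "u b x"]) auto
  qed
  finally show ?thesis .
qed

lemma dual_bounded_lattice:
  assumes "v \<in> dual s X"
  shows "\<exists>k::nat. \<forall>x\<in>L. unif ^ k * v x \<in> integers"
proof -
  obtain B u where B: "lattice_basis B u" using lattice_basis_exists by blast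
  obtain k where "\<forall>b\<in>B. unif ^ k * v b \<in> integers"
    using finite_unif_power_bound[OF lattice_basisD(1)[OF B], of v] by blast
  then show ?thesis using dual_bound_by_basis[OF B assms] by blast
qed

lemma lattice_absorbing:
  assumes "x \<in> X"
  shows "\<exists>k::nat. s (unif ^ k) x \<in> L"
proof -
  obtain B u where "lattice_basis B u" using lattice_basis_exists by blast
  note B = lattice_basisD(1,4,7)[OF this]
  obtain k where "\<forall>b\<in>B. unif ^ k * u b x \<in> integers" using finite_unif_power_bound[OF B(1), of "\<lambda>b. u b x"] by blast
  then have "s (unif ^ k) x \<in> L" using B(2,3) assms by (auto simp add: X_scale dual_scale)
  then show ?thesis by blast
qed

text \<open>Decreasing in \<open>k\<close>, open and compact. These multiples of \<open>L\<close>
  are cofinal among lattices in both directions, so that bounds on lattices, supports and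
  neighbourhoods become bounds on an integer.\<close>

definition Lz :: "int \<Rightarrow> 'v set" where
  "Lz k = s (unif powi k) ` L"

lemma Lz_0 [simp]: "Lz 0 = L"
  by (simp add: Lz_def)

lemma scale_Lz_iff: "s (unif powi k) x \<in> Lz (k + l) \<longleftrightarrow> x \<in> Lz l"
proof -
  have e: "s (unif powi (k + l)) y = s (unif powi k) (s (unif powi l) y)" for y
    by (simp add: unif_powi_add)
  show ?thesis
    unfolding Lz_def image_iff e scale_cancel_left by simp
qed

lemma Lz_iff: "x \<in> Lz k \<longleftrightarrow> s (unif powi (- k)) x \<in> L"
  using scale_Lz_iff[of "- k" x k] by simp

lemma scale_Lz: "s (unif powi k) ` Lz l = Lz (k + l)"
  unfolding Lz_def image_image by (simp add: unif_powi_add)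

lemma Lz_subset: "Lz k \<subseteq> X"
  unfolding Lz_def using L_subset X_scale by blast

lemma omod_scale_image:
  assumes "omod N" shows "omod (s c ` N)"
  unfolding omod_def add_subgroup_def
proof (intro conjI ballI)
  show "s c ` N \<subseteq> X" using omod_subset[OF assms] X_scale by blast
  have "0 = s c 0" by simp
  then show "0 \<in> s c ` N" using add_subgroup_zero[OF omod_subgroup[OF assms]] by blast
next
  fix x y assume "x \<in> s c ` N" "y \<in> s c ` N"
  then obtain a b where "a \<in> N" "b \<in> N" "x = s c a" "y = s c b" by blast
  then have "x - y = s c (a - b)" "a - b \<in> N"
    using add_subgroup_diff[OF omod_subgroup[OF assms]] by (auto simp add: scale_right_diff_distrib)
  then show "x - y \<in> s c ` N" by blast
next
  fix d :: 'f and x assume d: "d \<in> integers" and "x \<in> s c ` N"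
  then obtain a where a: "a \<in> N" "x = s c a" by blast
  then have "s d x = s c (s d a)" by (simp add: mult.commute)
  then show "s d x \<in> s c ` N" using omod_scale[OF assms d a(1)] by blast
qed

lemma omod_Lz: "omod (Lz k)"
  unfolding Lz_def by (rule omod_scale_image[OF omod_L])

lemma Lz_antimono: "k \<le> l \<Longrightarrow> Lz l \<subseteq> Lz k"
proof
  fix x assume kl: "k \<le> l" and "x \<in> Lz l"
  then have "s (unif powi (- l)) x \<in> L" by (simp add: Lz_iff)
  then have "s (unif powi (l - k)) (s (unif powi (- l)) x) \<in> L"
    by (rule omod_scale[OF omod_L unif_powi_le[OF kl]])
  then have "s (unif powi ((l - k) + (- l))) x \<in> L" by (simp only: unif_powi_add scale_scale)
  then show "x \<in> Lz k" by (simp add: Lz_iff)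
qed

text \<open>Reducing the coordinates modulo the maximal ideal embeds the quotient into finitely many
  copies of the finite residue field.\<close>

lemma finite_reps_Lz_Suc: "finite (reps (Lz k) (Lz (k + 1)))"
proof -
  obtain B u where "lattice_basis B u" using lattice_basis_exists by blast
  note B = lattice_basisD(1,4,7)[OF this]
  define g where "g t = restrict (\<lambda>b. coset_rep max_ideal (u b (s (unif powi (- k)) t))) B" for t
  have "inj_on g (reps (Lz k) (Lz (k + 1)))"
  proof (rule inj_onI)
    fix t t' assume t: "t \<in> reps (Lz k) (Lz (k + 1))" "t' \<in> reps (Lz k) (Lz (k + 1))" "g t = g t'"
    have tX: "t \<in> X" "t' \<in> X"
      using t(1,2) reps_subset[OF omod_subgroup[OF omod_Lz] omod_subgroup[OF omod_Lz] Lz_antimono, of k "k + 1"]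
        Lz_subset by auto
    have "u b (s (unif powi (- (k + 1))) (t - t')) \<in> integers" if b: "b \<in> B" for b
    proof -
      have "coset_rep max_ideal (u b (s (unif powi (- k)) t)) = coset_rep max_ideal (u b (s (unif powi (- k)) t'))"
        using fun_cong[OF t(3), of b] b by (simp add: g_def)
      then have "u b (s (unif powi (- k)) t) - u b (s (unif powi (- k)) t') \<in> max_ideal"
        by (simp only: coset_rep_eq_iff[OF add_subgroup_max_ideal])
      then have "unif powi (- k) * u b (t - t') \<in> max_ideal"
        unfolding dual_scale[OF B(2)[OF b] tX(1)] dual_scale[OF B(2)[OF b] tX(2)]
          dual_diff[OF B(2)[OF b] tX] right_diff_distrib .
      then obtain c where c: "c \<in> integers" "unif powi (- k) * u b (t - t') = unif * c"
        unfolding max_ideal_eq by blast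
      \<comment> \<open>One factor \<open>unif\<close> gained from the maximal ideal pays for the
        passage from \<open>k\<close> to \<open>k + 1\<close>.\<close>
      have e: "- (k + 1) = - 1 + - k" by simp
      have "u b (s (unif powi (- (k + 1))) (t - t')) = unif powi (- 1) * (unif powi (- k) * u b (t - t'))"
        unfolding dual_scale[OF B(2)[OF b] X_diff[OF tX]] e by (simp only: unif_powi_add mult.assoc)
      also have "\<dots> = c" unfolding c(2) by (simp add: power_int_minus)
      finally show ?thesis using c(1) by simp
    qed
    then have "s (unif powi (- (k + 1))) (t - t') \<in> {x \<in> X. \<forall>b\<in>B. u b x \<in> integers}"
      using X_scale[OF X_diff[OF tX]] by blast
    then have "t - t' \<in> Lz (k + 1)" by (simp only: Lz_iff B(3)[symmetric])
    then show "t = t'" by (rule reps_eqI[OF omod_subgroup[OF omod_Lz] t(1,2)])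
  qed
  moreover have "g ` reps (Lz k) (Lz (k + 1)) \<subseteq> PiE B (\<lambda>_. reps integers max_ideal)"
  proof
    fix y assume "y \<in> g ` reps (Lz k) (Lz (k + 1))"
    then obtain t where t: "t \<in> reps (Lz k) (Lz (k + 1))" "y = g t" by blast
    then have "t \<in> Lz k"
      using reps_subset[OF omod_subgroup[OF omod_Lz] omod_subgroup[OF omod_Lz] Lz_antimono, of k "k + 1"] by auto
    then have "s (unif powi (- k)) t \<in> L" by (simp only: Lz_iff)
    then have "\<forall>b\<in>B. u b (s (unif powi (- k)) t) \<in> integers" using B(3) by blast
    then show "y \<in> PiE B (\<lambda>_. reps integers max_ideal)" unfolding t(2) g_def reps_def by auto
  qed
  moreover have "finite (PiE B (\<lambda>_. reps integers max_ideal :: 'f set))"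
    using B(1) finite_reps_residue by (intro finite_PiE) auto
  ultimately show ?thesis using finite_imageD[OF finite_subset] by blast
qed

lemma finite_reps_Lz:
  assumes "k \<le> l" shows "finite (reps (Lz k) (Lz l))"
  using assms
proof (induction l rule: int_ge_induct)
  case base
  have "reps (Lz k) (Lz k) = {coset_rep (Lz k) 0}"
    unfolding reps_def using coset_rep_eq_iff[OF omod_subgroup[OF omod_Lz], of k _ 0]
      add_subgroup_zero[OF omod_subgroup[OF omod_Lz], of k] by auto
  then show ?case by simp
next
  case (step l)
  show ?case
    by (rule reps_finite_trans[OF omod_subgroup[OF omod_Lz] omod_subgroup[OF omod_Lz]
          omod_subgroup[OF omod_Lz] _ _ step.IH finite_reps_Lz_Suc]) (use step.hyps in \<open>auto intro: Lz_antimono[THEN subsetD, rotated]\<close>)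
qed

text \<open>Lattices are recognized by commensurability with \<open>L\<close> instead of by a basis.
  In this form the property passes at once to intersections, to modules squeezed between two
  lattices and to orthogonal lattices.\<close>

definition lat :: "'v set \<Rightarrow> bool" where
  "lat N \<longleftrightarrow> omod N \<and> (\<exists>k. Lz k \<subseteq> N) \<and> (\<exists>k. N \<subseteq> Lz k)"

lemma lat_omod: "lat N \<Longrightarrow> omod N"
  and lat_subgroup: "lat N \<Longrightarrow> add_subgroup N"
  and lat_subset: "lat N \<Longrightarrow> N \<subseteq> X"
  by (auto simp add: lat_def omod_def)

lemma lat_Lz [simp]: "lat (Lz k)"
  unfolding lat_def using omod_Lz by blast

lemma lat_L [simp]: "lat L"
  using lat_Lz[of 0] by simp

lemma lat_lower: "lat N \<Longrightarrow> \<exists>k. \<forall>l\<ge>k. Lz l \<subseteq> N"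
  unfolding lat_def using Lz_antimono by blast

lemma lat_upper: "lat N \<Longrightarrow> \<exists>k. \<forall>l\<le>k. N \<subseteq> Lz l"
  unfolding lat_def using Lz_antimono by blast

lemma omod_Int: "omod N \<Longrightarrow> omod M \<Longrightarrow> omod (N \<inter> M)"
  unfolding omod_def using add_subgroup_Int by auto

lemma lat_Int:
  assumes "lat N" "lat M" shows "lat (N \<inter> M)"
proof -
  obtain k l where "\<forall>j\<ge>k. Lz j \<subseteq> N" "\<forall>j\<ge>l. Lz j \<subseteq> M" using assms lat_lower by metis
  then have "Lz (max k l) \<subseteq> N \<inter> M" by simp
  moreover have "\<exists>k. N \<inter> M \<subseteq> Lz k" using assms(1) unfolding lat_def by blast
  ultimately show ?thesis using omod_Int lat_omod assms unfolding lat_def by blast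
qed

lemma lat_between: "lat K \<Longrightarrow> lat N \<Longrightarrow> omod M \<Longrightarrow> K \<subseteq> M \<Longrightarrow> M \<subseteq> N \<Longrightarrow> lat M"
  unfolding lat_def by blast

lemma lat_scale: 
  assumes "lat N" shows "lat (s (unif powi j) ` N)"
proof -
  obtain k l where kl: "Lz k \<subseteq> N" "N \<subseteq> Lz l" using assms unfolding lat_def by blast
  have "Lz (j + k) \<subseteq> s (unif powi j) ` N" "s (unif powi j) ` N \<subseteq> Lz (j + l)"
    unfolding scale_Lz[symmetric] by (intro image_mono kl)+
  then show ?thesis unfolding lat_def using omod_scale_image[OF lat_omod[OF assms]] by blast
qed

lemma finite_reps_lat:
  assumes "lat N" "lat M" "M \<subseteq> N" shows "finite (reps N M)"
proof -
  obtain k l where kl: "\<forall>j\<le>k. N \<subseteq> Lz j" "\<forall>j\<ge>l. Lz j \<subseteq> M" using assms lat_lower lat_upper by metis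
  have "finite (reps (Lz (min k l)) (Lz l))" by (rule finite_reps_Lz) simp
  then have "finite (reps N (Lz l))" using reps_mono[of N "Lz (min k l)" "Lz l"] kl(1) finite_subset[of "reps N (Lz l)"] by simp
  then show ?thesis
    using reps_finite_coarse[OF omod_subgroup[OF omod_Lz] lat_subgroup[OF assms(2)]] kl(2) by blast
qed

lemma coset_index_lat_pos: "lat N \<Longrightarrow> lat M \<Longrightarrow> M \<subseteq> N \<Longrightarrow> coset_index N M > 0"
  using coset_index_pos lat_subgroup finite_reps_lat by blast

lemma coset_index_lat_mult:
  "lat K \<Longrightarrow> lat M \<Longrightarrow> lat N \<Longrightarrow> K \<subseteq> M \<Longrightarrow> M \<subseteq> N \<Longrightarrow>
    coset_index N K = coset_index N M * coset_index M K"
  by (rule coset_index_mult) (auto intro: lat_subgroup)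

text \<open>The module generated by \<open>K\<close> and \<open>b\<close>, written as the image of a
  product so that its cosets can be counted by \<open>coset_index_reindex\<close>.\<close>

definition adjoin :: "'v set \<Rightarrow> 'v \<Rightarrow> 'v set" where
  "adjoin K b = (\<lambda>(c, a). s c b + a) ` (integers \<times> K)"

lemma adjoin_superset: "K \<subseteq> adjoin K b"
  unfolding adjoin_def by (force intro: rev_image_eqI[of "(0, _)"])

lemma adjoin_mem: "omod K \<Longrightarrow> b \<in> adjoin K b"
  unfolding adjoin_def using add_subgroup_zero[OF omod_subgroup]
  by (intro rev_image_eqI[of "(1, 0)"]) auto

lemma adjoin_least: "omod N \<Longrightarrow> K \<subseteq> N \<Longrightarrow> b \<in> N \<Longrightarrow> adjoin K b \<subseteq> N"
  unfolding adjoin_def using omod_scale add_subgroup_add[OF omod_subgroup] by auto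

lemma omod_adjoin:
  assumes "omod K" "b \<in> X" shows "omod (adjoin K b)"
  unfolding omod_def
proof (intro conjI ballI)
  show "adjoin K b \<subseteq> X" 
    unfolding adjoin_def using omod_subset[OF assms(1)] assms(2) X_add X_scale by auto
  show "add_subgroup (adjoin K b)"
    unfolding add_subgroup_def
  proof (intro conjI ballI)
    show "0 \<in> adjoin K b" using adjoin_superset add_subgroup_zero[OF omod_subgroup[OF assms(1)]] by blast
    fix x y assume "x \<in> adjoin K b" "y \<in> adjoin K b"
    then obtain c a d e where "c \<in> integers" "d \<in> integers" "a \<in> K" "e \<in> K"
      "x = s c b + a" "y = s d b + e" unfolding adjoin_def by auto
    then show "x - y \<in> adjoin K b"
      unfolding adjoin_def using add_subgroup_diff[OF omod_subgroup[OF assms(1)]]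
      by (intro rev_image_eqI[of "(c - d, a - e)"]) (auto simp add: scale_left_diff_distrib integers_diff)
  qed
  fix c :: 'f and x assume c: "c \<in> integers" "x \<in> adjoin K b"
  then obtain d a where d: "d \<in> integers" "a \<in> K" "x = s d b + a" unfolding adjoin_def by auto
  have "(c * d, s c a) \<in> integers \<times> K" using integers_mult[OF c(1) d(1)] omod_scale[OF assms(1) c(1) d(2)] by blast
  then show "s c x \<in> adjoin K b"
    unfolding adjoin_def d(3) by (rule rev_image_eqI) (simp add: scale_right_distrib)
qed

text \<open>As \<open>b\<close> lies outside \<open>K\<close> but \<open>s unif b\<close> inside, a
  multiple \<open>s c b\<close> with integral \<open>c\<close> is in \<open>K\<close> exactly if
  \<open>c\<close> is in the maximal ideal. So the quotient is a copy of the residue field.\<close>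

lemma coset_index_adjoin:
  assumes "omod K" "b \<in> X" "b \<notin> K" "s unif b \<in> K"
  shows "coset_index (adjoin K b) K = residue_card TYPE('f)"
proof -
  note K = omod_subgroup[OF assms(1)]
  have iff: "s c b \<in> K \<longleftrightarrow> c \<in> max_ideal" if "c \<in> integers" for c :: 'f
  proof
    assume "s c b \<in> K"
    show "c \<in> max_ideal"
    proof (rule ccontr)
      assume "c \<notin> max_ideal"
      then have "absval c = 1" using that by (auto simp add: integers_def max_ideal_def)
      then have "inverse c \<in> integers" "c \<noteq> 0" by (auto simp add: integers_def absval_inverse)
      then have "s (inverse c) (s c b) \<in> K" using omod_scale[OF assms(1)] \<open>s c b \<in> K\<close> by blast
      then show False using assms(3) \<open>c \<noteq> 0\<close> by simp
    qed
  next
    assume "c \<in> max_ideal"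
    then obtain d where "d \<in> integers" "c = unif * d" unfolding max_ideal_eq by blast
    then show "s c b \<in> K" using omod_scale[OF assms(1) _ assms(4), of d] by (simp add: mult.commute)
  qed
  have "coset_index (adjoin K b) K = coset_index ((integers :: 'f set) \<times> K) (max_ideal \<times> K)"
  proof (rule coset_index_reindex[where h = "\<lambda>(c, a). s c b + a"])
    fix x y :: "'f \<times> 'v" assume "x \<in> integers \<times> K" "y \<in> integers \<times> K"
    then obtain c a d e where xy: "x = (c, a)" "y = (d, e)" "c \<in> integers" "d \<in> integers" "a \<in> K" "e \<in> K"
      by auto
    have "(s c b + a) - (s d b + e) = s (c - d) b + (a - e)"
      by (simp add: scale_left_diff_distrib)
    moreover have "c - d \<in> integers" using xy(3,4) by (rule integers_diff)
    moreover have "a - e \<in> K" using xy add_subgroup_diff[OF K] by blast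
    ultimately have "(s c b + a) - (s d b + e) \<in> K \<longleftrightarrow> c - d \<in> max_ideal"
      using add_subgroup_add_cancel[OF K] iff by metis
    then show "(case x of (c, a) \<Rightarrow> s c b + a) - (case y of (c, a) \<Rightarrow> s c b + a) \<in> K \<longleftrightarrow> x - y \<in> max_ideal \<times> K"
      using xy \<open>a - e \<in> K\<close> by simp
  qed (use K max_ideal_subset adjoin_superset omod_subgroup[OF omod_adjoin[OF assms(1,2)]]
      add_subgroup_Times[OF add_subgroup_max_ideal K] add_subgroup_Times[OF add_subgroup_integers K]
      in \<open>auto simp add: adjoin_def\<close>)
  also have "\<dots> = residue_card TYPE('f)"
    using coset_index_Times[OF add_subgroup_max_ideal add_subgroup_integers max_ideal_subset K K subset_refl]
    by (simp add: residue_card_index coset_index_self[OF K])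
  finally show ?thesis .
qed

text \<open>Multiplication by powers of \<open>unif\<close> eventually moves any \<open>x\<close> of
  \<open>N\<close> into \<open>K\<close>; the last multiple that is still outside serves as
  \<open>b\<close>.\<close>

lemma lat_simple_step:
  assumes "lat K" "lat N" "K \<subset> N"
  obtains b where "b \<in> N" "b \<notin> K" "s unif b \<in> K" "lat (adjoin K b)" "adjoin K b \<subseteq> N"
proof -
  obtain x where x: "x \<in> N" "x \<notin> K" using assms(3) by blast
  then have xX: "x \<in> X" using lat_subset assms(2) by blast
  obtain i where "\<forall>l\<ge>i. Lz l \<subseteq> K" using lat_lower[OF assms(1)] by blast
  then obtain j :: nat where j: "Lz (int j) \<subseteq> K" by (metis int_nat_eq linorder_linear)
  obtain k where k: "s (unif ^ k) x \<in> L" using lattice_absorbing[OF xX] by blast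
  have "s (unif ^ (k + j)) x = s (unif ^ j) (s (unif ^ k) x)"
    by (simp add: power_add mult.commute)
  also have "\<dots> \<in> Lz (int j)"
    using scale_Lz_iff[of "int j" "s (unif ^ k) x" 0] k by simp
  finally have "s (unif ^ (k + j)) x \<in> K" using j by blast
  define n where "n = (LEAST n. s (unif ^ n) x \<in> K)"
  have n: "s (unif ^ n) x \<in> K" unfolding n_def by (rule LeastI) fact
  have "n \<noteq> 0" using n x(2) by (cases n) auto
  then obtain m where m: "n = Suc m" by (cases n) auto
  define b where "b = s (unif ^ m) x"
  have "b \<notin> K" using not_less_Least[of m "\<lambda>n. s (unif ^ n) x \<in> K"] m unfolding n_def b_def by auto
  moreover have "s unif b \<in> K" using n m by (simp add: b_def)
  moreover have "b \<in> N"
    unfolding b_def using omod_scale[OF lat_omod[OF assms(2)] _ x(1)] unif_powi_integers[of "int m"] by simp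
  moreover have "adjoin K b \<subseteq> N"
    using adjoin_least[OF lat_omod[OF assms(2)]] assms(3) \<open>b \<in> N\<close> by blast
  moreover have "lat (adjoin K b)"
    by (rule lat_between[OF assms(1,2) _ adjoin_superset \<open>adjoin K b \<subseteq> N\<close>])
       (rule omod_adjoin[OF lat_omod[OF assms(1)] subsetD[OF lat_subset[OF assms(2)] \<open>b \<in> N\<close>]])
  ultimately show ?thesis using that by blast
qed

text \<open>The induction descends from \<open>N\<close>: a proper sublattice is reduced to one that
  is larger by a simple step, which divides its index in \<open>N\<close> by q.\<close>

lemma lat_chain_induct [consumes 3, case_names refl step]:
  assumes "lat K" "lat N" "K \<subseteq> N"
    and "P N"
    and "\<And>K b. lat K \<Longrightarrow> b \<in> N \<Longrightarrow> b \<notin> K \<Longrightarrow> s unif b \<in> K \<Longrightarrow> lat (adjoin K b) \<Longrightarrow>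
      adjoin K b \<subseteq> N \<Longrightarrow> P (adjoin K b) \<Longrightarrow> P K"
  shows "P K"
  using assms(1,3)
proof (induction "coset_index N K" arbitrary: K rule: less_induct)
  case less
  show ?case
  proof (cases "K = N")
    case False
    then obtain b where b: "b \<in> N" "b \<notin> K" "s unif b \<in> K" "lat (adjoin K b)" "adjoin K b \<subseteq> N"
      using lat_simple_step[OF less.prems(1) assms(2)] less.prems(2) by blast
    have "b \<in> X" using b(1) lat_subset[OF assms(2)] by blast
    have "coset_index N K = coset_index N (adjoin K b) * residue_card TYPE('f)"
      using coset_index_lat_mult[OF less.prems(1) b(4) assms(2) adjoin_superset b(5)]
        coset_index_adjoin[OF lat_omod[OF less.prems(1)] \<open>b \<in> X\<close> b(2,3)] by simp
    then have "coset_index N (adjoin K b) < coset_index N K"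
      using residue_card_gt_1[where 'f = 'f] coset_index_lat_pos[OF assms(2) b(4,5)] by simp
    then have "P (adjoin K b)" using less.hyps b(4,5) by blast
    then show ?thesis using assms(5)[OF less.prems(1) b] by blast
  qed (use assms(4) in simp)
qed

text \<open>Each step of the chain contributes one factor q.\<close>

lemma coset_index_lat_power:
  assumes "lat K" "lat N" "K \<subseteq> N"
  shows "\<exists>m::nat. coset_index N K = residue_card TYPE('f) ^ m"
  using assms
proof (induction rule: lat_chain_induct)
  case refl
  show ?case using coset_index_self[OF lat_subgroup[OF assms(2)]] by (metis power_0)
next
  case (step K b)
  then obtain m where "coset_index N (adjoin K b) = residue_card TYPE('f) ^ m" by blast
  moreover have "b \<in> X" using step(2) lat_subset[OF assms(2)] by blast
  ultimately have "coset_index N K = residue_card TYPE('f) ^ Suc m"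
    using coset_index_lat_mult[OF step(1,5) assms(2) adjoin_superset step(6)]
      coset_index_adjoin[OF lat_omod[OF step(1)] \<open>b \<in> X\<close> step(3,4)] by simp
  then show ?case by blast
qed

text \<open>The generalized index of two lattices, neither of which need contain the other, as an
  exponent of q. It is \<open>modulus_exp\<close> with the map removed, and it turns the bookkeeping
  of powers of \<open>sq\<close> into linear arithmetic.\<close>

definition ex :: "'v set \<Rightarrow> 'v set \<Rightarrow> int" where
  "ex N M = (THE a. real (residue_card TYPE('f)) powi a =
     real (coset_index N (N \<inter> M)) / real (coset_index M (N \<inter> M)))"

lemma residue_powi_inject:
  "real (residue_card TYPE('f)) powi a = real (residue_card TYPE('f)) powi b \<longleftrightarrow> a = b"
  using power_int_strict_increasing[of a b "real (residue_card TYPE('f))"]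
    power_int_strict_increasing[of b a "real (residue_card TYPE('f))"]
    residue_card_gt_1[where 'f = 'f] by (cases a b rule: linorder_cases) auto

text \<open>Any common sublattice \<open>K\<close> computes the exponent, because its index in
  \<open>N \<inter> M\<close> cancels from the quotient.\<close>

lemma ex_eqI:
  assumes "lat N" "lat M" "lat K" "K \<subseteq> N" "K \<subseteq> M"
    and "coset_index N K = residue_card TYPE('f) ^ m" "coset_index M K = residue_card TYPE('f) ^ n"
  shows "ex N M = int m - int n"
proof -
  have q: "real (residue_card TYPE('f)) \<noteq> 0" using residue_card_gt_1[where 'f = 'f] by simp
  have KI: "K \<subseteq> N \<inter> M" using assms by blast
  have IK: "coset_index (N \<inter> M) K > 0" by (rule coset_index_lat_pos[OF lat_Int[OF assms(1,2)] assms(3) KI])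
  have "coset_index N (N \<inter> M) * coset_index (N \<inter> M) K = residue_card TYPE('f) ^ m"
    "coset_index M (N \<inter> M) * coset_index (N \<inter> M) K = residue_card TYPE('f) ^ n"
    using coset_index_lat_mult[OF assms(3) lat_Int[OF assms(1,2)] assms(1) KI]
      coset_index_lat_mult[OF assms(3) lat_Int[OF assms(1,2)] assms(2) KI] assms(6,7) by auto
  then have "real (coset_index N (N \<inter> M)) * real (coset_index (N \<inter> M) K) = real (residue_card TYPE('f)) ^ m"
    "real (coset_index M (N \<inter> M)) * real (coset_index (N \<inter> M) K) = real (residue_card TYPE('f)) ^ n"
    by (metis of_nat_mult of_nat_power)+
  then have "real (coset_index N (N \<inter> M)) / real (coset_index M (N \<inter> M)) =
      real (residue_card TYPE('f)) ^ m / real (residue_card TYPE('f)) ^ n"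
    using IK q by (metis mult_divide_mult_cancel_right of_nat_0_less_iff less_irrefl)
  also have "\<dots> = real (residue_card TYPE('f)) powi (int m - int n)"
    using q by (simp add: power_int_diff)
  finally show ?thesis unfolding ex_def by (simp add: residue_powi_inject)
qed

lemma coset_index_ex:
  assumes "lat N" "lat K" "K \<subseteq> N"
  shows "coset_index N K = residue_card TYPE('f) ^ nat (ex N K)" "ex N K \<ge> 0"
proof -
  obtain m where m: "coset_index N K = residue_card TYPE('f) ^ m"
    using coset_index_lat_power[OF assms(2,1,3)] by blast
  have "coset_index K K = residue_card TYPE('f) ^ 0"
    using coset_index_self[OF lat_subgroup[OF assms(2)]] by simp
  then have "ex N K = int m" using ex_eqI[OF assms(1,2,2,3) subset_refl m, of 0] by simp
  then show "coset_index N K = residue_card TYPE('f) ^ nat (ex N K)" "ex N K \<ge> 0"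
    using m by simp_all
qed

lemma ex_diff:
  assumes "lat N" "lat M" "lat K" "K \<subseteq> N" "K \<subseteq> M"
  shows "ex N M = ex N K - ex M K"
  using ex_eqI[OF assms] coset_index_ex[OF assms(1,3,4)] coset_index_ex[OF assms(2,3,5)] by simp

text \<open>Measured against the intersection of all three lattices, each exponent is a difference,
  and the differences telescope.\<close>

lemma ex_add:
  assumes "lat N" "lat M" "lat K" shows "ex N K = ex N M + ex M K"
proof -
  have J: "lat (N \<inter> M \<inter> K)" using assms lat_Int by blast
  have "ex N K = ex N (N \<inter> M \<inter> K) - ex K (N \<inter> M \<inter> K)"
    "ex N M = ex N (N \<inter> M \<inter> K) - ex M (N \<inter> M \<inter> K)" "ex M K = ex M (N \<inter> M \<inter> K) - ex K (N \<inter> M \<inter> K)"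
    using assms J by (auto intro!: ex_diff)
  then show ?thesis by simp
qed

lemma ex_self: "lat N \<Longrightarrow> ex N N = 0"
  using ex_add[of N N N] by simp

lemma ex_swap: "lat N \<Longrightarrow> lat M \<Longrightarrow> ex N M = - ex M N"
  using ex_add[of N M N] ex_self[of N] by simp

lemma ex_le_iff_index:
  assumes "lat N" "lat K" "K \<subseteq> N" "lat N'" "lat K'" "K' \<subseteq> N'"
    "coset_index N K = coset_index N' K'"
  shows "ex N K = ex N' K'"
proof -
  have "residue_card TYPE('f) ^ nat (ex N K) = residue_card TYPE('f) ^ nat (ex N' K')"
    using coset_index_ex(1)[OF assms(1-3)] coset_index_ex(1)[OF assms(4-6)] assms(7) by simp
  then have "nat (ex N K) = nat (ex N' K')"
    using power_inject_exp[OF residue_card_gt_1[where 'f = 'f]] by blast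
  then show ?thesis using coset_index_ex(2)[OF assms(1-3)] coset_index_ex(2)[OF assms(4-6)] by simp
qed

lemma ex_scale_scale:
  assumes "lat N" "lat M"
  shows "ex (s (unif powi j) ` N) (s (unif powi j) ` M) = ex N M"
proof -
  have *: "ex (s (unif powi j) ` N) (s (unif powi j) ` K) = ex N K"
    if N: "lat N" "lat K" "K \<subseteq> N" for N K
  proof (rule ex_le_iff_index)
    show "coset_index (s (unif powi j) ` N) (s (unif powi j) ` K) = coset_index N K"
    proof (rule coset_index_reindex)
      fix x y assume "x \<in> N" "y \<in> N"
      have "s (unif powi j) x - s (unif powi j) y = s (unif powi j) (x - y)"
        by (simp add: scale_right_diff_distrib)
      then show "s (unif powi j) x - s (unif powi j) y \<in> s (unif powi j) ` K \<longleftrightarrow> x - y \<in> K"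
        by (simp add: image_iff)
    qed (use N lat_subgroup lat_scale in auto)
  qed (use N lat_scale in auto)
  have I: "lat (N \<inter> M)" using assms lat_Int by blast
  show ?thesis
    using ex_diff[OF assms I] *[OF assms(1) I] *[OF assms(2) I]
      ex_diff[OF lat_scale[OF assms(1), of j] lat_scale[OF assms(2), of j] lat_scale[OF I, of j]]
    by (simp add: image_mono)
qed

text \<open>Both sides equal \<open>j\<close> times the dimension of \<open>X\<close>. The dimension
  is avoided by going around the square formed by \<open>N\<close>, \<open>M\<close> and their
  multiples, two sides of which agree by \<open>ex_scale_scale\<close>.\<close>

lemma ex_scale:
  assumes "lat N" "lat M"
  shows "ex N (s (unif powi j) ` N) = ex M (s (unif powi j) ` M)"
  using ex_add[OF assms(1,2) lat_scale[OF assms(2)], of j]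
    ex_add[OF assms(1) lat_scale[OF assms(1)] lat_scale[OF assms(2)], of j j]
    ex_scale_scale[OF assms, of j] by simp

end

section \<open>The Schwartz space and the Haar integral\<close>

context lattice_space
begin

section \<open>The topology of the space described by lattices\<close>

lemma dual_zero_fun: "(\<lambda>_. 0) \<in> dual s X"
  by (simp add: dual_def linear_map_def)

lemma topspace_vs [simp]: "topspace (vs_topology s X) = X"
proof -
  have "X = {x \<in> X. (\<lambda>_. 0 :: 'f) x \<in> UNIV}" by simp
  then have "X \<in> {{x \<in> X. u x \<in> U} | u U. u \<in> dual s X \<and> open U}"
    using dual_zero_fun open_UNIV by blast
  then show ?thesis
    unfolding vs_topology_def topology_generated_by_topspace by blast
qed

lemma openin_dual_preimage:
  "u \<in> dual s X \<Longrightarrow> open U \<Longrightarrow> openin (vs_topology s X) {x \<in> X. u x \<in> U}"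
  unfolding vs_topology_def by (rule topology_generated_by_Basis) blast

lemma open_scaled_translate: "open {t :: 'f::nonarch_local_field. unif powi k * (t - a) \<in> integers}"
  unfolding open_dist
proof (intro ballI exI[of _ "absval (unif powi (- k) :: 'f)"] conjI allI impI)
  fix x y :: 'f assume x: "x \<in> {t. unif powi k * (t - a) \<in> integers}"
    and y: "dist y x < absval (unif powi (- k) :: 'f)"
  have "unif powi k * (y - x) \<in> integers"
  proof -
    have "absval (unif powi k * (y - x)) \<le> absval (unif powi k :: 'f) * absval (unif powi (- k) :: 'f)"
      unfolding absval_mult using y by (intro mult_left_mono) (simp_all add: dist_absval)
    also have "\<dots> = absval (unif powi (k + - k) :: 'f)" by (simp only: unif_powi_add absval_mult)
    finally show ?thesis by (simp add: integers_def)
  qed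
  then have "unif powi k * (y - x) + unif powi k * (x - a) \<in> integers"
    using x by (intro integers_add) simp_all
  then show "y \<in> {t. unif powi k * (t - a) \<in> integers}" by (simp add: algebra_simps)
qed simp

lemma coset_mem_iff: "y \<in> (+) x ` N \<longleftrightarrow> y - x \<in> (N :: 'v set)"
proof
  assume "y - x \<in> N"
  then show "y \<in> (+) x ` N" by (intro image_eqI[of _ _ "y - x"]) simp_all
qed auto

text \<open>Membership in the coset is a finite conjunction of open conditions on the coordinates;
  intersecting with the whole space takes care of an empty basis.\<close>

lemma openin_coset:
  assumes "x \<in> X" shows "openin (vs_topology s X) ((+) x ` Lz k)"
proof -
  obtain B u where "lattice_basis B u" using lattice_basis_exists by blast
  note B = lattice_basisD(1,4,7)[OF this]
  have "y \<in> (+) x ` Lz k \<longleftrightarrow> y \<in> X \<and> (\<forall>b\<in>B. unif powi (- k) * (u b y - u b x) \<in> integers)" for y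
  proof (cases "y \<in> X")
    case True
    have "u b (s (unif powi (- k)) (y - x)) = unif powi (- k) * (u b y - u b x)" if "b \<in> B" for b
      unfolding dual_scale[OF B(2)[OF that] X_diff[OF True assms]] dual_diff[OF B(2)[OF that] True assms] ..
    moreover have "y \<in> (+) x ` Lz k \<longleftrightarrow> s (unif powi (- k)) (y - x) \<in> {x \<in> X. \<forall>b\<in>B. u b x \<in> integers}"
      by (simp only: coset_mem_iff Lz_iff B(3)[symmetric])
    ultimately show ?thesis using True X_scale[OF X_diff[OF True assms]] by auto
  next
    case False
    have "y \<notin> (+) x ` Lz k"
    proof
      assume "y \<in> (+) x ` Lz k"
      then have "y - x \<in> X" unfolding coset_mem_iff using Lz_subset by blast
      then show False using False X_add[OF _ assms, of "y - x"] by simp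
    qed
    then show ?thesis using False by blast
  qed
  then have "(+) x ` Lz k =
      (\<Inter>b\<in>B. {y \<in> X. u b y \<in> {t. unif powi (- k) * (t - u b x) \<in> integers}}) \<inter> topspace (vs_topology s X)"
    by auto
  moreover have "openin (vs_topology s X) \<dots>"
    by (rule openin_INT[OF B(1)]) (rule openin_dual_preimage[OF B(2) open_scaled_translate])
  ultimately show ?thesis by (simp only:)
qed

text \<open>Induction over the generation of the topology. For a generator the point is that a
  functional is bounded on \<open>L\<close>, hence small on a high multiple of
  \<open>L\<close>.\<close>

lemma openin_contains_coset:
  assumes "openin (vs_topology s X) U" "x \<in> U"
  shows "\<exists>k::nat. (+) x ` Lz (int k) \<subseteq> U"
proof -
  have "generate_topology_on {{x \<in> X. u x \<in> U} | u U. u \<in> dual s X \<and> open U} U"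
    using assms(1) unfolding vs_topology_def openin_topology_generated_by_iff .
  then show ?thesis using assms(2)
  proof (induction arbitrary: x)
    case (Int U V)
    then obtain k l where kl: "(+) x ` Lz (int k) \<subseteq> U" "(+) x ` Lz (int l) \<subseteq> V" by blast
    have "(+) x ` Lz (int (max k l)) \<subseteq> (+) x ` Lz (int k)" "(+) x ` Lz (int (max k l)) \<subseteq> (+) x ` Lz (int l)"
      by (intro image_mono Lz_antimono, simp)+
    then show ?case using kl by blast
  next
    case (UN K)
    then obtain V where "V \<in> K" "x \<in> V" by blast
    then show ?case using UN.IH by blast
  next
    case (Basis U)
    then obtain u V where uV: "U = {x \<in> X. u x \<in> V}" "u \<in> dual s X" "open V" by blast
    then obtain r where r: "r > 0" "ball (u x) r \<subseteq> V" using Basis.prems openE[of V "u x"] by auto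
    obtain j where j: "\<forall>x\<in>L. unif ^ j * u x \<in> integers" using dual_bounded_lattice[OF uV(2)] by blast
    \<comment> \<open>On \<open>L\<close> the absolute value of \<open>u\<close> is at most the
      inverse of \<open>absval (unif ^ j)\<close>, so this choice makes \<open>u\<close> smaller
      than \<open>r\<close> on \<open>Lz (int k)\<close>.\<close>
    obtain k where k: "absval (unif ^ k :: 'f) < r * absval (unif ^ j :: 'f)"
      using unif_power_small[of "r * absval (unif ^ j :: 'f)"] r(1) by auto
    have "(+) x ` Lz (int k) \<subseteq> U"
    proof
      fix y assume "y \<in> (+) x ` Lz (int k)"
      then obtain l where l: "l \<in> L" "y = x + s (unif ^ k) l" unfolding Lz_def by auto
      have xX: "x \<in> X" and lX: "l \<in> X" using Basis.prems uV(1) l(1) L_subset by auto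
      have "absval (unif ^ j :: 'f) * absval (u l) \<le> 1"
        using j l(1) by (auto simp add: integers_def absval_mult)
      then have "absval (unif ^ k :: 'f) * (absval (unif ^ j :: 'f) * absval (u l)) \<le> absval (unif ^ k :: 'f)"
        by (intro mult_left_le) auto
      then have "absval (unif ^ j :: 'f) * (absval (unif ^ k :: 'f) * absval (u l)) < absval (unif ^ j :: 'f) * r"
        using k by (simp only: ac_simps)
      then have "absval (unif ^ k :: 'f) * absval (u l) < r"
        by (rule mult_left_less_imp_less) simp
      then have "absval (u (s (unif ^ k) l)) < r"
        unfolding dual_scale[OF uV(2) lX] absval_mult .
      then have "u y \<in> ball (u x) r"
        unfolding l(2) dual_add[OF uV(2) xX X_scale[OF lX]] by (simp add: dist_absval)
      then show "y \<in> U" unfolding uV(1) using r(2) xX lX l(2) by (auto simp add: X_add X_scale)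
    qed
    then show ?case by blast
  qed simp
qed

text \<open>The image of a product of copies of the compact ring of integers. Continuity into a
  generated topology is tested on generators, that is after composition with a functional, where the
  map is a finite sum of scaled coordinates.\<close>

lemma compactin_integer_span:
  assumes "finite B" "\<And>b. b \<in> B \<Longrightarrow> w b \<in> X"
  shows "compactin (vs_topology s X) ((\<lambda>c. \<Sum>b\<in>B. s (c b) (w b)) ` PiE B (\<lambda>_. integers))"
proof (rule image_compactin)
  show "compactin (product_topology (\<lambda>_. euclidean) B) (PiE B (\<lambda>_. integers :: 'f set))"
    unfolding compactin_PiE by (intro disjI2 ballI) (simp add: compact_integers)
  show "continuous_map (product_topology (\<lambda>_. euclidean) B) (vs_topology s X) (\<lambda>c. \<Sum>b\<in>B. s (c b) (w b))"
    unfolding vs_topology_def continuous_on_generated_topo_iff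
  proof (intro conjI allI impI)
    let ?T = "product_topology (\<lambda>_. euclidean :: 'f topology) B"
    fix U assume "U \<in> {{x \<in> X. u x \<in> U} | u U. u \<in> dual s X \<and> open U}"
    then obtain u V where uV: "U = {x \<in> X. u x \<in> V}" "u \<in> dual s X" "open V" by blast
    have "continuous_map ?T euclidean (\<lambda>c. \<Sum>b\<in>A. c b * u (w b))" if "A \<subseteq> B" for A
      using finite_subset[OF that assms(1)] that
    proof (induction A)
      case (insert b A)
      have "continuous_map ?T euclidean (\<lambda>c. c b)"
        using insert.prems by (intro continuous_map_product_projection) blast
      moreover have "continuous_map euclidean euclidean (\<lambda>t. u (w b) * t)"
        using continuous_mult_const by simp
      ultimately have "continuous_map ?T euclidean ((\<lambda>t. u (w b) * t) \<circ> (\<lambda>c. c b))"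
        by (rule continuous_map_compose)
      then have "continuous_map ?T euclidean (\<lambda>c. c b * u (w b))"
        by (simp add: o_def mult.commute)
      then show ?case using insert by (simp add: continuous_add_field)
    qed simp
    then have "continuous_map ?T euclidean (\<lambda>c. \<Sum>b\<in>B. c b * u (w b))" by blast
    then have "openin ?T {c \<in> topspace ?T. (\<Sum>b\<in>B. c b * u (w b)) \<in> V}"
      using uV(3) by (auto simp add: continuous_map_def)
    moreover have "u (\<Sum>b\<in>B. s (c b) (w b)) = (\<Sum>b\<in>B. c b * u (w b))" for c
      using assms(2) by (subst dual_sum[OF assms(1) uV(2)])
        (auto intro!: sum.cong simp add: X_scale dual_scale[OF uV(2)])
    moreover have "(\<Sum>b\<in>B. s (c b) (w b)) \<in> X" for c
      using assms(2) by (intro X_sum X_scale)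
    ultimately show "openin ?T ((\<lambda>c. \<Sum>b\<in>B. s (c b) (w b)) -` U \<inter> topspace ?T)"
      unfolding uV(1) by (simp add: vimage_def Int_def conj_commute)
  next
    have "(\<Sum>b\<in>B. s (c b) (w b)) \<in> X" for c
      using assms(2) by (intro X_sum X_scale)
    moreover have "\<Union> {{x \<in> X. u x \<in> U} | u U. u \<in> dual s X \<and> open U} = X"
      using topspace_vs unfolding vs_topology_def topology_generated_by_topspace .
    ultimately show "(\<lambda>c. \<Sum>b\<in>B. s (c b) (w b)) ` topspace (product_topology (\<lambda>_. euclidean) B)
        \<subseteq> \<Union> {{x \<in> X. u x \<in> U} | u U. u \<in> dual s X \<and> open U}"
      by auto
  qed
qed

lemma compactin_Lz: "compactin (vs_topology s X) (Lz k)"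
proof -
  obtain B u where "lattice_basis B u" using lattice_basis_exists by blast
  note B = lattice_basisD(1,3,4,5,6,7)[OF this]
  have "Lz k = (\<lambda>c. \<Sum>b\<in>B. s (c b) (s (unif powi k) b)) ` PiE B (\<lambda>_. integers)"
  proof
    have e: "s (unif powi k) (\<Sum>b\<in>B. s (c b) b) = (\<Sum>b\<in>B. s (c b) (s (unif powi k) b))" for c
      by (simp add: scale_sum_right mult.commute)
    show "Lz k \<subseteq> (\<lambda>c. \<Sum>b\<in>B. s (c b) (s (unif powi k) b)) ` PiE B (\<lambda>_. integers)"
    proof
      fix x assume "x \<in> Lz k"
      then obtain l where l: "l \<in> L" "x = s (unif powi k) l" unfolding Lz_def by blast
      define c where "c = restrict (\<lambda>b. u b l) B"
      have "c \<in> PiE B (\<lambda>_. integers)" using l(1) B(6) by (auto simp add: c_def)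
      moreover have "l = (\<Sum>b\<in>B. s (u b l) b)" using B(4) l(1) L_subset by blast
      then have "l = (\<Sum>b\<in>B. s (c b) b)" by (simp add: c_def)
      then have "x = (\<Sum>b\<in>B. s (c b) (s (unif powi k) b))" using l(2) e by simp
      ultimately show "x \<in> (\<lambda>c. \<Sum>b\<in>B. s (c b) (s (unif powi k) b)) ` PiE B (\<lambda>_. integers)" by blast
    qed
    show "(\<lambda>c. \<Sum>b\<in>B. s (c b) (s (unif powi k) b)) ` PiE B (\<lambda>_. integers) \<subseteq> Lz k"
    proof
      fix x assume "x \<in> (\<lambda>c. \<Sum>b\<in>B. s (c b) (s (unif powi k) b)) ` PiE B (\<lambda>_. integers)"
      then obtain c where c: "c \<in> PiE B (\<lambda>_. integers)" "x = s (unif powi k) (\<Sum>b\<in>B. s (c b) b)"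
        unfolding e by blast
      have "(\<Sum>b\<in>B. s (c b) b) \<in> X" using B(2) by (intro X_sum X_scale) blast
      moreover have "\<forall>b\<in>B. u b (\<Sum>b\<in>B. s (c b) b) \<in> integers" using B(5)[of _ c] c(1) by auto
      ultimately have "(\<Sum>b\<in>B. s (c b) b) \<in> L" using B(6) by blast
      then show "x \<in> Lz k" unfolding c(2) Lz_def by blast
    qed
  qed
  moreover have "compactin (vs_topology s X) ((\<lambda>c. \<Sum>b\<in>B. s (c b) (s (unif powi k) b)) ` PiE B (\<lambda>_. integers))"
    using B(2) by (intro compactin_integer_span[OF B(1)] X_scale) blast
  ultimately show ?thesis by simp
qed

lemma closedin_Lz: "closedin (vs_topology s X) (Lz k)"
  unfolding closedin_def topspace_vs
proof
  show "openin (vs_topology s X) (X - Lz k)"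
  proof (subst openin_subopen, intro ballI)
    fix x assume x: "x \<in> X - Lz k"
    have "(+) x ` Lz k \<subseteq> X - Lz k"
    proof
      fix y assume "y \<in> (+) x ` Lz k"
      then obtain l where l: "l \<in> Lz k" "y = x + l" by blast
      then have "y \<notin> Lz k" using x add_subgroup_add_cancel[OF omod_subgroup[OF omod_Lz]] by blast
      moreover have "y \<in> X" using x l X_add Lz_subset by blast
      ultimately show "y \<in> X - Lz k" by blast
    qed
    moreover have "x \<in> (+) x ` Lz k"
      unfolding coset_mem_iff using add_subgroup_zero[OF omod_subgroup[OF omod_Lz]] by simp
    ultimately show "\<exists>T. openin (vs_topology s X) T \<and> x \<in> T \<and> T \<subseteq> X - Lz k"
      using openin_coset x by blast
  qed
qed (rule Lz_subset)

text \<open>Says that \<open>\<Phi>\<close> is supported in \<open>N\<close> and comes from a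
  function on the finite quotient of \<open>N\<close> by \<open>M\<close>. Every Schwartz function
  is adapted to some pair, and any larger \<open>N\<close> and smaller \<open>M\<close> will do;
  this takes the place of topology in all later computations.\<close>

definition adapted :: "'v set \<Rightarrow> 'v set \<Rightarrow> ('v \<Rightarrow> 'r::zero) \<Rightarrow> bool" where
  "adapted N M \<Phi> \<longleftrightarrow> lat N \<and> lat M \<and> M \<subseteq> N \<and> (\<forall>x. \<Phi> x \<noteq> 0 \<longrightarrow> x \<in> N) \<and> inv_under N M \<Phi>"

lemma adapted_inv_X:
  assumes "adapted N M \<Phi>" shows "inv_under X M \<Phi>"
  unfolding inv_under_def
proof (intro ballI)
  fix x a assume xa: "x \<in> X" "a \<in> M"
  show "\<Phi> (x + a) = \<Phi> x"
  proof (cases "x \<in> N")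
    case True
    then show ?thesis using assms xa(2) by (simp add: adapted_def inv_under_def)
  next
    case False
    then have "x + a \<notin> N"
      using assms xa(2) add_subgroup_add_cancel[OF lat_subgroup, of N a x] by (auto simp add: adapted_def)
    then have "\<Phi> (x + a) = 0" "\<Phi> x = 0" using assms False by (auto simp add: adapted_def)
    then show ?thesis by simp
  qed
qed

lemma adapted_mono:
  assumes "adapted N M \<Phi>" "lat N'" "lat M'" "N \<subseteq> N'" "M' \<subseteq> M"
  shows "adapted N' M' \<Phi>"
  using assms inv_under_mono[OF adapted_inv_X[OF assms(1)] assms(5) lat_subset[OF assms(2)]]
  unfolding adapted_def by blast

lemma adapted_schwartz:
  fixes \<Phi> :: "'v \<Rightarrow> 'r::idom"
  assumes "adapted N M \<Phi>" shows "\<Phi> \<in> schwartz s X"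
  unfolding schwartz_def
proof (intro CollectI conjI allI ballI impI)
  fix x assume "x \<notin> X"
  then show "\<Phi> x = 0" using assms lat_subset unfolding adapted_def by blast
next
  fix x assume x: "x \<in> X"
  obtain k where k: "Lz k \<subseteq> M" using assms unfolding adapted_def lat_def by blast
  have "\<forall>y\<in>(+) x ` Lz k. \<Phi> y = \<Phi> x"
    using adapted_inv_X[OF assms] k x unfolding inv_under_def by blast
  moreover have "x \<in> (+) x ` Lz k"
    unfolding coset_mem_iff using add_subgroup_zero[OF omod_subgroup[OF omod_Lz]] by simp
  ultimately show "\<exists>U. openin (vs_topology s X) U \<and> x \<in> U \<and> (\<forall>y\<in>U. \<Phi> y = \<Phi> x)"
    using openin_coset[OF x] by blast
next
  obtain k where k: "N \<subseteq> Lz k" using assms unfolding adapted_def lat_def by blast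
  then have "{x \<in> X. \<Phi> x \<noteq> 0} \<subseteq> Lz k" using assms unfolding adapted_def by blast
  then have "vs_topology s X closure_of {x \<in> X. \<Phi> x \<noteq> 0} \<subseteq> Lz k"
    by (rule closure_of_minimal) (rule closedin_Lz)
  then show "compactin (vs_topology s X) (vs_topology s X closure_of {x \<in> X. \<Phi> x \<noteq> 0})"
    by (rule closed_compactin[OF compactin_Lz]) (rule closedin_closure_of)
qed

lemma compactin_subset_Lz:
  assumes "compactin (vs_topology s X) K"
  shows "\<exists>k::nat. K \<subseteq> Lz (- int k)"
proof -
  let ?U = "range (\<lambda>k::nat. Lz (- int k))"
  have "openin (vs_topology s X) (Lz (- int k))" for k
    using openin_coset[OF X_zero, of "- int k"] by simp
  moreover have "K \<subseteq> \<Union> ?U"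
  proof
    fix x assume "x \<in> K"
    then have "x \<in> X" using assms compactin_subset_topspace by fastforce
    then obtain k where "s (unif ^ k) x \<in> L" using lattice_absorbing by blast
    then have "x \<in> Lz (- int k)" by (simp add: Lz_iff)
    then show "x \<in> \<Union> ?U" by blast
  qed
  ultimately obtain F where F: "finite F" "F \<subseteq> ?U" "K \<subseteq> \<Union> F"
    using assms unfolding compactin_def by (metis (no_types, lifting) imageE)
  then obtain I :: "nat set" where I: "finite I" "F = (\<lambda>k. Lz (- int k)) ` I"
    using finite_subset_image[OF F(1,2)] by blast
  \<comment> \<open>Serves as an upper bound of the finite set \<open>I\<close>.\<close>
  define n where "n = \<Sum>I"
  have "K \<subseteq> Lz (- int n)"
  proof
    fix x assume "x \<in> K"
    then obtain i where i: "i \<in> I" "x \<in> Lz (- int i)" using F(3) I(2) by blast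
    have "i \<le> n" using I(1) i(1) member_le_sum[of i I "\<lambda>i. i"] by (simp add: n_def)
    then show "x \<in> Lz (- int n)" using Lz_antimono[of "- int n" "- int i"] i(2) by auto
  qed
  then show ?thesis by blast
qed

text \<open>The closure \<open>K\<close> of the support is compact, hence contained in one lattice
  and covered by finitely many cosets on which \<open>\<Phi>\<close> is constant. The smallest
  lattice occurring in these cosets gives invariance at all points of \<open>K\<close>.\<close>

lemma schwartz_adapted:
  fixes \<Phi> :: "'v \<Rightarrow> 'r::idom"
  assumes "\<Phi> \<in> schwartz s X"
  shows "\<exists>k::nat. adapted (Lz (- int k)) (Lz (int k)) \<Phi>"
proof -
  define K where "K = vs_topology s X closure_of {x \<in> X. \<Phi> x \<noteq> 0}"
  have K: "compactin (vs_topology s X) K" using assms by (simp add: schwartz_def K_def)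
  have zero: "\<Phi> x = 0" if "x \<notin> K" for x
  proof (rule ccontr)
    assume "\<Phi> x \<noteq> 0"
    then have "x \<in> {x \<in> X. \<Phi> x \<noteq> 0}" using assms by (auto simp add: schwartz_def)
    then show False using closure_of_subset[of "{x \<in> X. \<Phi> x \<noteq> 0}" "vs_topology s X"] that
      unfolding K_def by auto
  qed
  obtain k where k: "K \<subseteq> Lz (- int k)" using compactin_subset_Lz[OF K] by blast
  have KX: "K \<subseteq> X" using compactin_subset_topspace[OF K] by simp
  have "\<exists>j::nat. \<forall>y\<in>(+) x ` Lz (int j). \<Phi> y = \<Phi> x" if x: "x \<in> K" for x
  proof -
    have "\<forall>x\<in>X. \<exists>U. openin (vs_topology s X) U \<and> x \<in> U \<and> (\<forall>y\<in>U. \<Phi> y = \<Phi> x)"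
      using assms by (simp add: schwartz_def)
    then obtain U where U: "openin (vs_topology s X) U" "x \<in> U" "\<forall>y\<in>U. \<Phi> y = \<Phi> x"
      using x KX by blast
    then show ?thesis using openin_contains_coset[OF U(1,2)] by blast
  qed
  then obtain j where j: "\<And>x y. x \<in> K \<Longrightarrow> y \<in> (+) x ` Lz (int (j x)) \<Longrightarrow> \<Phi> y = \<Phi> x" by metis
  let ?U = "(\<lambda>x. (+) x ` Lz (int (j x))) ` K"
  have self: "x \<in> (+) x ` Lz l" for x l
    unfolding coset_mem_iff using add_subgroup_zero[OF omod_subgroup[OF omod_Lz]] by simp
  have "\<forall>U\<in>?U. openin (vs_topology s X) U" using openin_coset KX by blast
  moreover have "K \<subseteq> \<Union> ?U" using self by blast
  ultimately obtain F where F: "finite F" "F \<subseteq> ?U" "K \<subseteq> \<Union> F"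
    using K unfolding compactin_def by meson
  then obtain I where I: "finite I" "I \<subseteq> K" "F = (\<lambda>x. (+) x ` Lz (int (j x))) ` I"
    using finite_subset_image[OF F(1,2)] by blast
  \<comment> \<open>An upper bound of \<open>k\<close> and of all \<open>j i\<close> with
    \<open>i\<close> in \<open>I\<close>, so that one index serves for support and
    invariance.\<close>
  define m where "m = k + (\<Sum>i\<in>I. j i)"
  have inv: "\<Phi> (x + a) = \<Phi> x" if x: "x \<in> K" and a: "a \<in> Lz (int m)" for x a
  proof -
    obtain i where i: "i \<in> I" "x \<in> (+) i ` Lz (int (j i))" using F(3) I(3) x by blast
    have "j i \<le> (\<Sum>i\<in>I. j i)" using I(1) i(1) by (intro member_le_sum) auto
    then have "j i \<le> m" by (simp add: m_def)
    then have "a \<in> Lz (int (j i))" using a Lz_antimono[of "int (j i)" "int m"] by auto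
    then have "x + a - i \<in> Lz (int (j i))"
      using add_subgroup_add[OF omod_subgroup[OF omod_Lz], of "x - i" "int (j i)" a] i(2)
      unfolding coset_mem_iff by (simp add: algebra_simps)
    then have "\<Phi> (x + a) = \<Phi> i" using j[of i "x + a"] I(2) i(1) unfolding coset_mem_iff by blast
    moreover have "\<Phi> x = \<Phi> i" using j[of i x] I(2) i by blast
    ultimately show ?thesis by simp
  qed
  have "inv_under X (Lz (int m)) \<Phi>"
    unfolding inv_under_def
  proof (intro ballI)
    fix x a assume xa: "x \<in> X" "a \<in> Lz (int m)"
    \<comment> \<open>Invariance is known at points of \<open>K\<close> only. If it is
      \<open>x + a\<close> that lies in \<open>K\<close>, translation by \<open>- a\<close> leads
      back to \<open>x\<close>; if neither does, both values are 0.\<close>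
    consider "x \<in> K" | "x + a \<in> K" | "x \<notin> K" "x + a \<notin> K" by blast
    then show "\<Phi> (x + a) = \<Phi> x"
    proof cases
      case 2
      have "- a \<in> Lz (int m)" using xa(2) add_subgroup_uminus[OF omod_subgroup[OF omod_Lz]] by blast
      then show ?thesis using inv[OF 2, of "- a"] by simp
    qed (use inv xa(2) zero in auto)
  qed
  moreover have "Lz (- int k) \<subseteq> Lz (- int m)" by (rule Lz_antimono) (simp add: m_def sum_nonneg)
  then have "K \<subseteq> Lz (- int m)" using k by blast
  ultimately have "adapted (Lz (- int m)) (Lz (int m)) \<Phi>"
    unfolding adapted_def using zero Lz_antimono[of "- int m" "int m"]
      inv_under_mono[OF _ subset_refl Lz_subset] lat_Lz by auto
  then show ?thesis by blast
qed

section \<open>Operations on adapted functions\<close>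

lemma adapted_translate:
  assumes "adapted N M \<Phi>" "a \<in> N" shows "adapted N M (\<lambda>x. \<Phi> (x + a))"
  unfolding adapted_def
proof (intro conjI allI impI)
  show "lat N" "lat M" "M \<subseteq> N" using assms(1) by (simp_all add: adapted_def)
  fix x assume "\<Phi> (x + a) \<noteq> 0"
  then have "x + a \<in> N" using assms(1) by (simp add: adapted_def)
  then show "x \<in> N" using add_subgroup_add_cancel[OF lat_subgroup[OF \<open>lat N\<close>] assms(2)] by blast
next
  show "inv_under N M (\<lambda>x. \<Phi> (x + a))"
    unfolding inv_under_def
  proof (intro ballI)
    fix x b assume "x \<in> N" "b \<in> M"
    moreover from this have "x + a \<in> N"
      using assms add_subgroup_add[OF lat_subgroup] by (auto simp add: adapted_def)
    ultimately have "\<Phi> (x + a + b) = \<Phi> (x + a)" using assms(1) by (simp add: adapted_def inv_under_def)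
    then show "\<Phi> (x + b + a) = \<Phi> (x + a)" by (simp add: ac_simps)
  qed
qed

lemma adapted_add:
  fixes \<Phi> \<Psi> :: "'v \<Rightarrow> 'r::idom"
  shows "adapted N M \<Phi> \<Longrightarrow> adapted N M \<Psi> \<Longrightarrow> adapted N M (\<lambda>x. \<Phi> x + \<Psi> x)"
  unfolding adapted_def inv_under_def by (metis add.right_neutral)

lemma adapted_mult:
  fixes \<Phi> :: "'v \<Rightarrow> 'r::idom"
  shows "adapted N M \<Phi> \<Longrightarrow> inv_under N M \<psi> \<Longrightarrow> adapted N M (\<lambda>x. \<psi> x * \<Phi> x)"
  unfolding adapted_def inv_under_def by auto

lemma adapted_indicator:
  assumes "lat N" "lat M" "M \<subseteq> N" shows "adapted N M (indicator N :: 'v \<Rightarrow> 'r::idom)"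
  using assms add_subgroup_add_cancel[OF lat_subgroup[OF assms(1)]]
  unfolding adapted_def inv_under_def by (auto simp add: indicator_def split: if_splits)

end

section \<open>Existence and uniqueness of the normalized Haar functional\<close>

locale haar_space = lattice_space s X L
  for s :: "'f::nonarch_local_field \<Rightarrow> 'v::ab_group_add \<Rightarrow> 'v" and X L :: "'v set" +
  fixes sq :: "'r::idom"
  assumes sq_square: "sq\<^sup>2 = of_nat (residue_card TYPE('f))" and sq_unit: "sq dvd 1"
begin

text \<open>The factor 2 in the exponent comes from q being the square of \<open>sq\<close>.\<close>

lemma of_nat_coset_index:
  assumes "lat N" "lat M" "M \<subseteq> N"
  shows "of_nat (coset_index N M) = upow sq (2 * ex N M)"
proof -
  have "2 * ex N M = int (2 * nat (ex N M))" using coset_index_ex(2)[OF assms] by simp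
  then have "upow sq (2 * ex N M) = sq ^ (2 * nat (ex N M))" by (simp only: upow_nat[OF sq_unit])
  also have "\<dots> = of_nat (residue_card TYPE('f)) ^ nat (ex N M)" by (simp add: power_mult sq_square)
  finally show ?thesis using coset_index_ex(1)[OF assms] by simp
qed

text \<open>The first factor is the volume of \<open>M\<close> when \<open>L\<close> has volume 1;
  the second sums the values of \<open>\<Phi>\<close> on the cosets of \<open>M\<close>.\<close>

definition hval :: "'v set \<Rightarrow> 'v set \<Rightarrow> ('v \<Rightarrow> 'r) \<Rightarrow> 'r" where
  "hval N M \<Phi> = upow sq (2 * ex M L) * csum N M \<Phi>"

text \<open>Enlarging \<open>N\<close> adds zero terms. Shrinking \<open>M\<close> multiplies the
  sum by an index and divides the volume of a coset by the same index.\<close>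

lemma hval_mono:
  assumes "adapted N M \<Phi>" "lat N'" "lat M'" "N \<subseteq> N'" "M' \<subseteq> M"
  shows "hval N' M' \<Phi> = hval N M \<Phi>"
proof -
  have A: "lat N" "lat M" "M \<subseteq> N" "\<And>x. \<Phi> x \<noteq> 0 \<Longrightarrow> x \<in> N" "inv_under N M \<Phi>"
    using assms(1) by (auto simp add: adapted_def)
  have M'N: "M' \<subseteq> N" using A assms(5) by blast
  have "csum N' M' \<Phi> = csum N M' \<Phi>"
    using A(4) by (intro csum_support[OF lat_subgroup[OF assms(3)] lat_subgroup[OF A(1)]
          lat_subgroup[OF assms(2)] M'N assms(4) finite_reps_lat[OF assms(2,3)]]) (use M'N assms(4) in auto)
  also have "\<dots> = of_nat (coset_index M M') * csum N M \<Phi>"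
    by (rule csum_refine[OF lat_subgroup[OF assms(3)] lat_subgroup[OF A(2)] lat_subgroup[OF A(1)]
          assms(5) A(3,5)])
  also have "\<dots> = upow sq (2 * ex M M') * csum N M \<Phi>"
    by (simp add: of_nat_coset_index[OF A(2) assms(3,5)])
  finally have "hval N' M' \<Phi> = upow sq (2 * ex M' L + 2 * ex M M') * csum N M \<Phi>"
    unfolding hval_def by (simp add: upow_add[OF sq_unit])
  also have "2 * ex M' L + 2 * ex M M' = 2 * ex M L"
    using ex_add[OF A(2) assms(3) lat_L] by simp
  finally show ?thesis unfolding hval_def .
qed

lemma adapted_common:
  assumes "adapted N M \<Phi>"
  shows "\<exists>k::nat. \<forall>l\<ge>k. adapted (Lz (- int l)) (Lz (int l)) \<Phi>"
proof -
  have A: "lat N" "lat M" using assms by (auto simp add: adapted_def)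
  obtain i j where ij: "\<forall>l\<le>i. N \<subseteq> Lz l" "\<forall>l\<ge>j. Lz l \<subseteq> M"
    using lat_upper[OF A(1)] lat_lower[OF A(2)] by blast
  have "adapted (Lz (- int l)) (Lz (int l)) \<Phi>" if "l \<ge> nat (max (- i) j)" for l
  proof (rule adapted_mono[OF assms lat_Lz lat_Lz])
    have "- int l \<le> i" "j \<le> int l" using that by linarith+
    then show "N \<subseteq> Lz (- int l)" "Lz (int l) \<subseteq> M" using ij by blast+
  qed
  then show ?thesis by blast
qed

lemma hval_unique:
  assumes "adapted N M \<Phi>" "adapted N' M' \<Phi>"
  shows "hval N M \<Phi> = hval N' M' \<Phi>"
proof -
  have A: "lat N" "lat M" "lat N'" "lat M'" using assms by (auto simp add: adapted_def)
  obtain i j where ij: "\<forall>l\<le>i. N \<subseteq> Lz l" "\<forall>l\<le>j. N' \<subseteq> Lz l"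
    using lat_upper[OF A(1)] lat_upper[OF A(3)] by blast
  have "hval (Lz (min i j)) (M \<inter> M') \<Phi> = hval N M \<Phi>"
    using ij by (intro hval_mono[OF assms(1) lat_Lz lat_Int[OF A(2,4)]]) auto
  moreover have "hval (Lz (min i j)) (M \<inter> M') \<Phi> = hval N' M' \<Phi>"
    using ij by (intro hval_mono[OF assms(2) lat_Lz lat_Int[OF A(2,4)]]) auto
  ultimately show ?thesis by simp
qed

text \<open>The value must depend on \<open>\<Phi>\<close> alone, so it is read off at the first
  adapted pair of the cofinal family; every other adapted pair gives the same value by
  \<open>hval_unique\<close>.\<close>

definition hfun :: "('v \<Rightarrow> 'r) \<Rightarrow> 'r" where
  "hfun \<Phi> = (let k = (LEAST k::nat. adapted (Lz (- int k)) (Lz (int k)) \<Phi>) in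
     hval (Lz (- int k)) (Lz (int k)) \<Phi>)"

lemma hfun_eq:
  assumes "adapted N M \<Phi>" shows "hfun \<Phi> = hval N M \<Phi>"
proof -
  obtain k where "adapted (Lz (- int k)) (Lz (int k)) \<Phi>"
    using adapted_common[OF assms] by blast
  then have "adapted (Lz (- int (LEAST k::nat. adapted (Lz (- int k)) (Lz (int k)) \<Phi>)))
      (Lz (int (LEAST k::nat. adapted (Lz (- int k)) (Lz (int k)) \<Phi>))) \<Phi>"
    by (rule LeastI)
  then show ?thesis unfolding hfun_def Let_def using assms by (rule hval_unique)
qed

lemma schwartz_eventually_adapted:
  fixes \<Phi> :: "'v \<Rightarrow> 'r"
  assumes "\<Phi> \<in> schwartz s X"
  shows "\<exists>k::nat. \<forall>l\<ge>k. adapted (Lz (- int l)) (Lz (int l)) \<Phi>"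
  using schwartz_adapted[OF assms] adapted_common by blast

lemma hfun_haar: "haar_measure s X hfun" and hfun_L: "hfun (indicator L) = 1"
proof -
  show 1: "hfun (indicator L) = 1"
    unfolding hfun_eq[OF adapted_indicator[OF lat_L lat_L subset_refl]] hval_def
  proof -
    have "csum L L (indicator L :: 'v \<Rightarrow> 'r) = csum L L (\<lambda>_. 1)"
      by (rule csum_cong) (simp_all add: lat_subgroup)
    then show "upow sq (2 * ex L L) * csum L L (indicator L :: 'v \<Rightarrow> 'r) = 1"
      by (simp add: ex_self csum_const_1 lat_subgroup coset_index_self)
  qed
  show "haar_measure s X hfun"
    unfolding haar_measure_def
  proof (intro conjI ballI allI)
    fix \<Phi> \<Psi> :: "'v \<Rightarrow> 'r" assume "\<Phi> \<in> schwartz s X" "\<Psi> \<in> schwartz s X"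
    then obtain k l where "\<forall>j\<ge>k. adapted (Lz (- int j)) (Lz (int j)) \<Phi>" "\<forall>j\<ge>l. adapted (Lz (- int j)) (Lz (int j)) \<Psi>"
      using schwartz_eventually_adapted by meson
    then obtain N M where *: "adapted N M \<Phi>" "adapted N M \<Psi>" by (meson nat_le_linear order_refl)
    show "hfun (\<lambda>x. \<Phi> x + \<Psi> x) = hfun \<Phi> + hfun \<Psi>"
      unfolding hfun_eq[OF adapted_add[OF *]] hfun_eq[OF *(1)] hfun_eq[OF *(2)]
      by (simp add: hval_def csum_def sum.distrib distrib_left)
  next
    fix c and \<Phi> :: "'v \<Rightarrow> 'r" assume "\<Phi> \<in> schwartz s X"
    then obtain N M where *: "adapted N M \<Phi>" using schwartz_adapted by blast
    have **: "adapted N M (\<lambda>x. c * \<Phi> x)" by (rule adapted_mult[OF *]) (simp add: inv_under_def)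
    show "hfun (\<lambda>x. c * \<Phi> x) = c * hfun \<Phi>"
      unfolding hfun_eq[OF *] hfun_eq[OF **] by (simp add: hval_def csum_def sum_distrib_left ac_simps)
  next
    fix a and \<Phi> :: "'v \<Rightarrow> 'r" assume a: "a \<in> X" and "\<Phi> \<in> schwartz s X"
    then obtain k where k: "\<forall>l\<ge>k. adapted (Lz (- int l)) (Lz (int l)) \<Phi>"
      using schwartz_eventually_adapted by blast
    obtain j where "s (unif ^ j) a \<in> L" using lattice_absorbing[OF a] by blast
    then have "a \<in> Lz (- int j)" by (simp add: Lz_iff)
    then have aN: "a \<in> Lz (- int (k + j))" using Lz_antimono[of "- int (k + j)" "- int j"] by auto
    have *: "adapted (Lz (- int (k + j))) (Lz (int (k + j))) \<Phi>" using k le_add1 by blast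
    have "csum (Lz (- int (k + j))) (Lz (int (k + j))) (\<lambda>x. \<Phi> (x + a)) = csum (Lz (- int (k + j))) (Lz (int (k + j))) \<Phi>"
      using * aN by (intro csum_translate) (auto simp add: adapted_def lat_subgroup)
    then show "hfun (\<lambda>x. \<Phi> (x + a)) = hfun \<Phi>"
      unfolding hfun_eq[OF *] hfun_eq[OF adapted_translate[OF * aN]] hval_def by simp
  next
    show "\<exists>\<Phi>\<in>schwartz s X. hfun \<Phi> \<noteq> 0"
      using adapted_schwartz[OF adapted_indicator[OF lat_L lat_L subset_refl]] 1
      by (intro bexI[of _ "indicator L"]) auto
  qed
qed

lemma haar_measureD:
  fixes \<Phi> \<Psi> :: "'v \<Rightarrow> 'r"
  assumes "haar_measure s X \<mu>"
  shows "\<Phi> \<in> schwartz s X \<Longrightarrow> \<Psi> \<in> schwartz s X \<Longrightarrow> \<mu> (\<lambda>x. \<Phi> x + \<Psi> x) = \<mu> \<Phi> + \<mu> \<Psi>"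
    "\<Phi> \<in> schwartz s X \<Longrightarrow> \<mu> (\<lambda>x. c * \<Phi> x) = c * \<mu> \<Phi>"
    "a \<in> X \<Longrightarrow> \<Phi> \<in> schwartz s X \<Longrightarrow> \<mu> (\<lambda>x. \<Phi> (x + a)) = \<mu> \<Phi>"
  using assms unfolding haar_measure_def by simp_all

lemma haar_sum:
  assumes "haar_measure s X \<mu>" "finite T" "\<And>t. t \<in> T \<Longrightarrow> G t \<in> schwartz s X"
  shows "(\<lambda>x. \<Sum>t\<in>T. G t x) \<in> schwartz s X \<and> \<mu> (\<lambda>x. \<Sum>t\<in>T. G t x :: 'r) = (\<Sum>t\<in>T. \<mu> (G t))"
  using assms(2,3)
proof (induction T)
  case empty
  \<comment> \<open>The value of \<open>\<mu>\<close> at the zero function comes from homogeneity,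
    applied to 0 times \<open>?I\<close>.\<close>
  let ?I = "indicator L :: 'v \<Rightarrow> 'r"
  have I: "?I \<in> schwartz s X" by (rule adapted_schwartz[OF adapted_indicator[OF lat_L lat_L subset_refl]])
  then have "\<mu> (\<lambda>x. 0 * ?I x) = 0 * \<mu> ?I" by (rule haar_measureD(2)[OF assms(1)])
  moreover have "adapted L L (\<lambda>x. 0 :: 'r)"
    by (simp add: adapted_def inv_under_def)
  ultimately show ?case using adapted_schwartz by simp
next
  case (insert t T)
  then have IH: "(\<lambda>x. \<Sum>t\<in>T. G t x) \<in> schwartz s X" "\<mu> (\<lambda>x. \<Sum>t\<in>T. G t x) = (\<Sum>t\<in>T. \<mu> (G t))"
    and t: "G t \<in> schwartz s X" by auto
  obtain k l where "\<forall>j\<ge>k. adapted (Lz (- int j)) (Lz (int j)) (G t)"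
    "\<forall>j\<ge>l. adapted (Lz (- int j)) (Lz (int j)) (\<lambda>x. \<Sum>t\<in>T. G t x)"
    using schwartz_eventually_adapted[OF t] schwartz_eventually_adapted[OF IH(1)] by blast
  then have "adapted (Lz (- int (max k l))) (Lz (int (max k l))) (\<lambda>x. G t x + (\<Sum>t\<in>T. G t x))"
    by (intro adapted_add) auto
  then have "(\<lambda>x. G t x + (\<Sum>t\<in>T. G t x)) \<in> schwartz s X" by (rule adapted_schwartz)
  moreover have "\<mu> (\<lambda>x. G t x + (\<Sum>t\<in>T. G t x)) = \<mu> (G t) + \<mu> (\<lambda>x. \<Sum>t\<in>T. G t x)"
    by (rule haar_measureD(1)[OF assms(1) t IH(1)])
  ultimately show ?case using insert.hyps IH(2) by simp
qed

text \<open>An adapted function is a finite linear combination of translates of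
  \<open>indicator M\<close>, so linearity and translation invariance leave only the volume of
  \<open>M\<close> undetermined.\<close>

lemma haar_measure_csum:
  assumes \<mu>: "haar_measure s X \<mu>" and A: "adapted N M (\<Phi> :: 'v \<Rightarrow> 'r)"
  shows "\<mu> \<Phi> = csum N M \<Phi> * \<mu> (indicator M)"
proof -
  have N: "lat N" "lat M" "M \<subseteq> N" using A by (auto simp add: adapted_def)
  note sub = reps_subset[OF lat_subgroup[OF N(2)] lat_subgroup[OF N(1)] N(3)]
  have aI: "adapted N M (indicator M :: 'v \<Rightarrow> 'r)"
    by (rule adapted_mono[OF adapted_indicator[OF N(2,2)] N(1,2,3)]) simp_all
  have "\<Phi> x = (\<Sum>t\<in>reps N M. \<Phi> t * indicator M (x + - t))" for x
  proof (cases "x \<in> N")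
    case True
    have "indicator M (x + - t) = (if t = coset_rep M x then 1 else 0 :: 'r)" if "t \<in> reps N M" for t
      using coset_rep_eq_iff[OF lat_subgroup[OF N(2)], of x t] reps_fixed[OF lat_subgroup[OF N(2)] that]
      by (auto simp add: indicator_def)
    then have "(\<Sum>t\<in>reps N M. \<Phi> t * indicator M (x + - t)) =
        (\<Sum>t\<in>reps N M. if t = coset_rep M x then \<Phi> t else 0)"
      by (intro sum.cong) auto
    also have "\<dots> = \<Phi> (coset_rep M x)"
      using finite_reps_lat[OF N] True by (simp add: reps_def)
    also have "\<dots> = \<Phi> x"
      using A True coset_rep_diff[OF lat_subgroup[OF N(2)]] by (intro inv_underD[of N M]) (auto simp add: adapted_def)
    finally show ?thesis by simp
  next
    case False
    have "x + - t \<notin> M" if "t \<in> reps N M" for t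
      using False that sub N(3) add_subgroup_add_cancel[OF lat_subgroup[OF N(1)], of t "x - t"] by auto
    then have "(\<Sum>t\<in>reps N M. \<Phi> t * indicator M (x + - t)) = 0"
      by (intro sum.neutral) (auto simp add: indicator_def)
    moreover have "\<Phi> x = 0" using A False by (auto simp add: adapted_def)
    ultimately show ?thesis by simp
  qed
  then have "\<Phi> = (\<lambda>x. \<Sum>t\<in>reps N M. \<Phi> t * indicator M (x + - t))" by (rule ext)
  then have "\<mu> \<Phi> = \<mu> (\<lambda>x. \<Sum>t\<in>reps N M. \<Phi> t * indicator M (x + - t))" by (rule arg_cong)
  also have "\<dots> = (\<Sum>t\<in>reps N M. \<mu> (\<lambda>x. \<Phi> t * indicator M (x + - t)))"
  proof (rule conjunct2[OF haar_sum[OF \<mu> finite_reps_lat[OF N]]])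
    fix t assume "t \<in> reps N M"
    then have "- t \<in> N" using sub add_subgroup_uminus[OF lat_subgroup[OF N(1)]] by blast
    then have "adapted N M (\<lambda>x. indicator M (x + - t) :: 'r)" by (rule adapted_translate[OF aI])
    then have "adapted N M (\<lambda>x. \<Phi> t * indicator M (x + - t))"
      by (rule adapted_mult) (simp add: inv_under_def)
    then show "(\<lambda>x. \<Phi> t * indicator M (x + - t)) \<in> schwartz s X" by (rule adapted_schwartz)
  qed
  also have "\<dots> = (\<Sum>t\<in>reps N M. \<Phi> t * \<mu> (indicator M))"
  proof (rule sum.cong[OF refl])
    fix t assume "t \<in> reps N M"
    then have tN: "- t \<in> N" using sub add_subgroup_uminus[OF lat_subgroup[OF N(1)]] by blast
    then have "- t \<in> X" using lat_subset[OF N(1)] by blast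
    then have "\<mu> (\<lambda>x. indicator M (x + - t)) = \<mu> (indicator M)"
      by (rule haar_measureD(3)[OF \<mu> _ adapted_schwartz[OF aI]])
    moreover have "\<mu> (\<lambda>x. \<Phi> t * indicator M (x + - t)) = \<Phi> t * \<mu> (\<lambda>x. indicator M (x + - t))"
      by (rule haar_measureD(2)[OF \<mu> adapted_schwartz[OF adapted_translate[OF aI tN]]])
    ultimately show "\<mu> (\<lambda>x. \<Phi> t * indicator M (x + - t)) = \<Phi> t * \<mu> (indicator M)" by simp
  qed
  finally show ?thesis by (simp add: csum_def sum_distrib_right)
qed

text \<open>Both \<open>M\<close> and \<open>L\<close> consist of cosets of
  \<open>M \<inter> L\<close>. Comparing the two decompositions, the normalization at
  \<open>L\<close> determines the volume of \<open>M\<close>.\<close>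

lemma haar_measure_eq:
  assumes \<mu>: "haar_measure s X \<mu>" and "\<mu> (indicator L) = 1" and A: "adapted N M \<Phi>"
  shows "\<mu> \<Phi> = hval N M \<Phi>"
proof -
  have N: "lat N" "lat M" using A by (auto simp add: adapted_def)
  have J: "lat (M \<inter> L)" by (rule lat_Int[OF N(2) lat_L])
  have cs: "csum P Q (indicator P :: 'v \<Rightarrow> 'r) = upow sq (2 * ex P Q)" if "lat P" "lat Q" "Q \<subseteq> P" for P Q
  proof -
    have "csum P Q (indicator P :: 'v \<Rightarrow> 'r) = csum P Q (\<lambda>_. 1)"
      using that by (intro csum_cong) (auto simp add: lat_subgroup)
    then show ?thesis using that by (simp add: csum_const_1 lat_subgroup of_nat_coset_index)
  qed
  have 1: "1 = upow sq (2 * ex L (M \<inter> L)) * \<mu> (indicator (M \<inter> L))"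
    using haar_measure_csum[OF \<mu> adapted_indicator[OF lat_L J]] assms(2) cs[OF lat_L J] by simp
  have "\<mu> (indicator M) = upow sq (2 * ex M (M \<inter> L)) * \<mu> (indicator (M \<inter> L))"
    using haar_measure_csum[OF \<mu> adapted_indicator[OF N(2) J]] cs[OF N(2) J] by simp
  also have "2 * ex M (M \<inter> L) = 2 * ex M L + 2 * ex L (M \<inter> L)"
    using ex_add[OF N(2) lat_L J] by simp
  finally have "\<mu> (indicator M) = upow sq (2 * ex M L)"
    using 1 by (simp add: upow_add[OF sq_unit] mult.assoc)
  then show ?thesis using haar_measure_csum[OF \<mu> A] by (simp add: hval_def mult.commute)
qed

text \<open>By \<open>hfun\<close> the choice in \<open>haar_integral\<close> is made from a
  nonempty set, and by \<open>haar_measure_eq\<close> all candidates agree on adapted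
  functions.\<close>

lemma haar_integral_eq:
  assumes "adapted N M \<Phi>"
  shows "haar_integral s X L \<Phi> = hval N M (\<Phi> :: 'v \<Rightarrow> 'r)"
proof -
  have "\<exists>\<mu>. haar_measure s X \<mu> \<and> \<mu> (indicator L) = (1 :: 'r)"
    using hfun_haar hfun_L by blast
  then have "haar_measure s X (haar_integral s X L :: ('v \<Rightarrow> 'r) \<Rightarrow> 'r) \<and>
      haar_integral s X L (indicator L) = (1 :: 'r)"
    unfolding haar_integral_def by (rule someI_ex)
  then show ?thesis using haar_measure_eq assms by blast
qed

end

section \<open>The Weil factor as a Gauss sum\<close>

lemma two_nonzero:
  assumes "CHAR('f::field) \<noteq> 2" shows "(2::'f) \<noteq> 0"
proof
  assume "(2::'f) = 0"
  then have "(of_nat 2 :: 'f) = 0" by simp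
  then have "CHAR('f) dvd 2" by (simp only: of_nat_eq_0_iff_char_dvd)
  then have "CHAR('f) = 1 \<or> CHAR('f) = 2" using two_is_prime_nat unfolding prime_nat_iff by blast
  then show False using assms by simp
qed

text \<open>\<open>perp chi X f N\<close> is the preimage of the dual lattice \<open>N\<^sub>*\<close> under the isomorphism
  \<open>X \<rightarrow> X*\<close> attached to \<open>f\<close>.\<close>

definition perp :: "('f::nonarch_local_field \<Rightarrow> 'r::idom) \<Rightarrow> 'v::ab_group_add set \<Rightarrow> ('v \<Rightarrow> 'f) \<Rightarrow>
    'v set \<Rightarrow> 'v set" where
  "perp chi X f N = {y \<in> X. \<forall>x\<in>N. chi (polar X f x y) = 1}"

text \<open>Free of the reference lattice and stated outside the locales, so that Gauss sums of
  different spaces can be compared. With \<open>id\<close>, \<open>modulus_exp\<close> is just the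
  exponent of the index of \<open>perp chi X f N\<close> in \<open>N\<close>.\<close>

definition gauss :: "('f::nonarch_local_field \<Rightarrow> 'r::idom) \<Rightarrow> 'r \<Rightarrow> 'v::ab_group_add set \<Rightarrow> ('v \<Rightarrow> 'f) \<Rightarrow>
    'v set \<Rightarrow> 'r" where
  "gauss chi sq X f N = upow sq (- modulus_exp TYPE('f) id N (perp chi X f N)) *
     csum N (perp chi X f N) (\<lambda>x. chi (f x))"

context lattice_space
begin

lemma ex_modulus: "modulus_exp TYPE('f) h A M = ex (h ` A) M"
  unfolding modulus_exp_def ex_def ..

lemma finite_subset_Lz:
  assumes "finite A" "A \<subseteq> X" shows "\<exists>k. A \<subseteq> Lz k"
  using assms
proof induction
  case (insert a A)
  then obtain k where k: "A \<subseteq> Lz k" by blast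
  obtain j where "s (unif ^ j) a \<in> L" using lattice_absorbing insert.prems by blast
  then have "a \<in> Lz (- int j)" by (simp add: Lz_iff)
  then have "insert a A \<subseteq> Lz (min k (- int j))"
    using k Lz_antimono[of "min k (- int j)" k] Lz_antimono[of "min k (- int j)" "- int j"] by auto
  then show ?case by blast
qed simp

lemma Lz_directed:
  assumes "finite A" "\<And>N. N \<in> A \<Longrightarrow> lat N"
  shows "\<exists>k. \<forall>N\<in>A. N \<subseteq> Lz k"
  using assms
proof induction
  case (insert a A)
  then obtain k where k: "\<forall>N\<in>A. N \<subseteq> Lz k" by blast
  obtain j where j: "\<forall>l\<le>j. a \<subseteq> Lz l" using lat_upper insert.prems by blast
  have "\<forall>N\<in>insert a A. N \<subseteq> Lz (min k j)"
    using k j Lz_antimono[of "min k j" k] min.cobounded1[of k j] min.cobounded2[of k j] by blast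
  then show ?case by blast
qed simp

end

locale quadratic_space = lattice_space s X L + nontrivial_character chi
  for s :: "'f::nonarch_local_field \<Rightarrow> 'v::ab_group_add \<Rightarrow> 'v" and X L :: "'v set"
    and chi :: "'f \<Rightarrow> 'r::idom" +
  fixes f :: "'v \<Rightarrow> 'f"
  assumes char_ne_2: "CHAR('f) \<noteq> 2" and nondeg: "nondegenerate_form s X f"
begin

section \<open>The polar form and orthogonal lattices\<close>

abbreviation "bil \<equiv> polar X f"
abbreviation "pr \<equiv> perp chi X f"

lemma bil_dual: "x \<in> X \<Longrightarrow> bil x \<in> dual s X"
  using nondeg by (auto simp add: nondegenerate_form_def linear_iso_def linear_map_def)

lemma bil_add_left: "x \<in> X \<Longrightarrow> y \<in> X \<Longrightarrow> bil (x + y) z = bil x z + bil y z"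
  using nondeg by (auto simp add: nondegenerate_form_def linear_iso_def linear_map_def plus_fun_def)

lemma bil_scale_left: "x \<in> X \<Longrightarrow> bil (s c x) z = c * bil x z"
  using nondeg by (auto simp add: nondegenerate_form_def linear_iso_def linear_map_def fun_scale_def)

lemma bil_commute: "x \<in> X \<Longrightarrow> y \<in> X \<Longrightarrow> bil x y = bil y x"
  by (simp add: polar_def algebra_simps)

lemma bil_add_right: "x \<in> X \<Longrightarrow> y \<in> X \<Longrightarrow> z \<in> X \<Longrightarrow> bil x (y + z) = bil x y + bil x z"
  by (rule dual_add[OF bil_dual])

lemma bil_scale_right: "x \<in> X \<Longrightarrow> y \<in> X \<Longrightarrow> bil x (s c y) = c * bil x y"
  by (rule dual_scale[OF bil_dual])

lemma bil_diff_right: "x \<in> X \<Longrightarrow> y \<in> X \<Longrightarrow> z \<in> X \<Longrightarrow> bil x (y - z) = bil x y - bil x z"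
  by (rule dual_diff[OF bil_dual])

lemma bil_uminus_left: "x \<in> X \<Longrightarrow> bil (- x) z = - bil x z"
  using bil_scale_left[of x "- 1" z] by simp

lemma bil_uminus_right: "x \<in> X \<Longrightarrow> z \<in> X \<Longrightarrow> bil x (- z) = - bil x z"
  using bil_scale_right[of x z "- 1"] by simp

lemma form_scale: "x \<in> X \<Longrightarrow> f (s c x) = c\<^sup>2 * f x"
  using nondeg by (simp add: nondegenerate_form_def quadratic_form_def)

lemma form_add: "x \<in> X \<Longrightarrow> y \<in> X \<Longrightarrow> f (x + y) = f x + f y + bil x y"
  by (simp add: polar_def)

lemma form_uminus: "x \<in> X \<Longrightarrow> f (- x) = f x"
  using form_scale[of x "- 1"] by simp

lemma form_diff: "x \<in> X \<Longrightarrow> y \<in> X \<Longrightarrow> f (x - y) = f x + f y - bil x y"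
  using form_add[of x "- y"] X_uminus[of y] by (simp add: form_uminus bil_uminus_right)

lemma bil_self: "x \<in> X \<Longrightarrow> bil x x = 2 * f x"
proof -
  assume x: "x \<in> X"
  have "s 2 x = x + x" by (metis one_add_one scale_left_distrib scale_one)
  then have "f (x + x) = 2\<^sup>2 * f x" using form_scale[OF x, of 2] by simp
  then show ?thesis using form_add[OF x x] by simp
qed

lemma bij_bil: "bij_betw bil X (dual s X)"
  using nondeg by (simp add: nondegenerate_form_def linear_iso_def)

text \<open>Since \<open>N\<close> is stable under integers, triviality of \<open>chi\<close> at
  \<open>bil x y\<close> for all \<open>x\<close> in \<open>N\<close> includes triviality at all
  integral multiples of \<open>bil x y\<close>.\<close>

lemma omod_perp_iff:
  assumes "omod N" "y \<in> X"
  shows "y \<in> pr N \<longleftrightarrow> (\<forall>x\<in>N. bil x y \<in> conductor)"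
proof
  assume y: "y \<in> pr N"
  show "\<forall>x\<in>N. bil x y \<in> conductor"
    unfolding conductor_def
  proof (intro ballI CollectI)
    fix x c assume "x \<in> N" "c \<in> (integers :: 'f set)"
    then have "s c x \<in> N" "x \<in> X" using omod_scale[OF assms(1)] omod_subset[OF assms(1)] by auto
    then show "chi (c * bil x y) = 1" using y bil_scale_left[of x c y] by (auto simp add: perp_def)
  qed
next
  assume *: "\<forall>x\<in>N. bil x y \<in> conductor"
  have "chi t = 1" if "t \<in> conductor" for t
  proof -
    have "chi (1 * t) = 1" using that integers_one unfolding conductor_def by blast
    then show ?thesis by simp
  qed
  then show "y \<in> pr N" unfolding perp_def using * assms(2) by blast
qed

lemma perp_subset: "pr N \<subseteq> X"
  by (auto simp add: perp_def)

lemma perp_antimono: "N \<subseteq> M \<Longrightarrow> pr M \<subseteq> pr N"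
  by (auto simp add: perp_def)

lemma conductor_diff: "x \<in> conductor \<Longrightarrow> y \<in> conductor \<Longrightarrow> x - y \<in> conductor"
  using conductor_add[of x "- y"] conductor_mult[of "- 1" y] by simp

lemma omod_perp:
  assumes "omod N" shows "omod (pr N)"
proof -
  have iff: "y \<in> pr N \<longleftrightarrow> y \<in> X \<and> (\<forall>x\<in>N. bil x y \<in> conductor)" for y
    using omod_perp_iff[OF assms] perp_subset by blast
  have NX: "x \<in> X" if "x \<in> N" for x using that omod_subset[OF assms] by blast
  show ?thesis
    unfolding omod_def add_subgroup_def
  proof (intro conjI ballI)
    show "pr N \<subseteq> X" by (rule perp_subset)
    show "0 \<in> pr N" unfolding iff using X_zero NX dual_zero[OF bil_dual] by simp
    fix x y assume "x \<in> pr N" "y \<in> pr N"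
    then show "x - y \<in> pr N" unfolding iff using NX by (simp add: X_diff bil_diff_right conductor_diff)
  next
    fix c :: 'f and x assume "c \<in> integers" "x \<in> pr N"
    then show "s c x \<in> pr N" unfolding iff using NX by (simp add: X_scale bil_scale_right conductor_mult)
  qed
qed

lemma perp_scale: "N \<subseteq> X \<Longrightarrow> pr (s (unif powi k) ` N) = s (unif powi (- k)) ` pr N"
proof (intro equalityI subsetI)
  assume N: "N \<subseteq> X"
  fix y assume y: "y \<in> pr (s (unif powi k) ` N)"
  then have yX: "y \<in> X" using perp_subset by blast
  have "chi (bil x (s (unif powi k) y)) = 1" if x: "x \<in> N" for x
  proof -
    have "x \<in> X" using x N by blast
    then have "bil x (s (unif powi k) y) = bil (s (unif powi k) x) y"
      using yX by (simp add: bil_scale_left bil_scale_right)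
    then show ?thesis using y x by (auto simp add: perp_def)
  qed
  then have "s (unif powi k) y \<in> pr N" using X_scale[OF yX] by (auto simp add: perp_def)
  moreover have "y = s (unif powi (- k)) (s (unif powi k) y)"
    by (simp add: power_int_minus)
  ultimately show "y \<in> s (unif powi (- k)) ` pr N" by blast
next
  assume N: "N \<subseteq> X"
  fix y assume "y \<in> s (unif powi (- k)) ` pr N"
  then obtain z where z: "z \<in> pr N" "y = s (unif powi (- k)) z" by blast
  then have zX: "z \<in> X" using perp_subset by blast
  have "chi (bil (s (unif powi k) x) y) = 1" if x: "x \<in> N" for x
  proof -
    have "x \<in> X" using x N by blast
    then have "bil (s (unif powi k) x) y = bil x z"
      unfolding z(2) using zX by (simp add: bil_scale_left bil_scale_right X_scale power_int_minus)
    then show ?thesis using z(1) x by (auto simp add: perp_def)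
  qed
  then show "y \<in> pr (s (unif powi k) ` N)" unfolding perp_def using X_scale[OF zX] z(2) by auto
qed

lemma bil_bounded: "\<exists>k::nat. \<forall>x\<in>L. \<forall>y\<in>L. unif ^ k * bil x y \<in> integers"
proof -
  obtain B u where bas: "lattice_basis B u" using lattice_basis_exists by blast
  note B = lattice_basisD(1,3)[OF bas]
  obtain k where k: "\<forall>p\<in>B \<times> B. unif ^ k * bil (fst p) (snd p) \<in> integers"
    using finite_unif_power_bound[of "B \<times> B" "\<lambda>p. bil (fst p) (snd p)"] B(1) by auto
  have 1: "unif ^ k * bil b y \<in> integers" if "b \<in> B" "y \<in> L" for b y
    using k that B(2) by (intro dual_bound_by_basis[OF bas bil_dual]) auto
  have "unif ^ k * bil x y \<in> integers" if "x \<in> L" "y \<in> L" for x y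
  proof -
    have X: "x \<in> X" "y \<in> X" using that L_subset by auto
    have "\<forall>b\<in>B. unif ^ k * bil y b \<in> integers"
      using 1[OF _ that(2)] bil_commute[OF X(2)] B(2) by auto
    then have "unif ^ k * bil y x \<in> integers" by (rule dual_bound_by_basis[OF bas bil_dual[OF X(2)] _ that(1)])
    then show ?thesis using bil_commute[OF X] by simp
  qed
  then show ?thesis by blast
qed

text \<open>From below: the polar form is bounded on \<open>L\<close>, so a high multiple of
  \<open>L\<close> pairs with \<open>L\<close> into the conductor. From above: by nondegeneracy each
  coordinate \<open>u b\<close> is the pairing with some \<open>e b\<close>, a multiple of which
  lies in \<open>L\<close>; as the conductor is bounded, so are the coordinates of elements of
  \<open>pr L\<close>.\<close>

lemma lat_perp_L: "lat (pr L)"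
  unfolding lat_def
proof (intro conjI)
  show "omod (pr L)" by (rule omod_perp[OF omod_L])
  obtain k where k: "\<forall>x\<in>L. \<forall>y\<in>L. unif ^ k * bil x y \<in> integers" using bil_bounded by blast
  obtain j where j: "unif ^ j \<in> conductor" using conductor_nonzero by blast
  have "Lz (int (k + j)) \<subseteq> pr L"
  proof
    fix y assume y: "y \<in> Lz (int (k + j))"
    then obtain l where l: "l \<in> L" "y = s (unif powi int (k + j)) l" unfolding Lz_def by blast
    then have y': "y = s (unif ^ (k + j)) l" by (simp only: power_int_of_nat)
    have lX: "l \<in> X" using l(1) L_subset by blast
    have "bil x y \<in> conductor" if x: "x \<in> L" for x
    proof -
      have "x \<in> X" using x L_subset by blast
      then have "bil x y = unif ^ k * bil x l * unif ^ j"
        unfolding y' using lX by (simp add: bil_scale_right power_add ac_simps)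
      then show ?thesis using conductor_mult[OF _ j] k x l(1) by simp
    qed
    then show "y \<in> pr L" using omod_perp_iff[OF omod_L] y Lz_subset by blast
  qed
  then show "\<exists>k. Lz k \<subseteq> pr L" by blast
  obtain B u where bas: "lattice_basis B u" using lattice_basis_exists by blast
  note B = lattice_basisD(1,4,7)[OF bas]
  have "\<exists>e\<in>X. bil e = u b" if "b \<in> B" for b
    using B(2)[OF that] bij_bil unfolding bij_betw_def by (metis imageE)
  then obtain e where e: "\<And>b. b \<in> B \<Longrightarrow> e b \<in> X" "\<And>b. b \<in> B \<Longrightarrow> bil (e b) = u b" by metis
  obtain m where "e ` B \<subseteq> Lz m" using finite_subset_Lz[of "e ` B"] B(1) e(1) by blast
  then have m: "s (unif powi (- m)) (e b) \<in> L" if "b \<in> B" for b using that by (auto simp add: Lz_iff)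
  obtain i where i: "\<forall>x\<in>conductor. unif ^ i * x \<in> integers" using conductor_bounded by blast
  have "pr L \<subseteq> Lz (m - int i)"
  proof
    fix y assume y: "y \<in> pr L"
    then have yX: "y \<in> X" using perp_subset by blast
    have "u b (s (unif powi (- (m - int i))) y) \<in> integers" if b: "b \<in> B" for b
    proof -
      have "bil (s (unif powi (- m)) (e b)) y \<in> conductor"
        using omod_perp_iff[OF omod_L yX] y m[OF b] by blast
      then have "unif powi (- m) * u b y \<in> conductor" using bil_scale_left[OF e(1)[OF b]] e(2)[OF b] by simp
      then have "unif ^ i * (unif powi (- m) * u b y) \<in> integers" using i by blast
      moreover have "(unif :: 'f) powi (- (m - int i)) = unif ^ i * unif powi (- m)"
      proof -
        have "- (m - int i) = int i + - m" by simp
        then show ?thesis by (simp only: unif_powi_add power_int_of_nat)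
      qed
      ultimately show ?thesis by (simp add: dual_scale[OF B(2)[OF b] yX] mult.assoc)
    qed
    then have "s (unif powi (- (m - int i))) y \<in> {x \<in> X. \<forall>b\<in>B. u b x \<in> integers}"
      using X_scale[OF yX] by blast
    then show "y \<in> Lz (m - int i)" by (simp only: Lz_iff B(3)[symmetric])
  qed
  then show "\<exists>k. pr L \<subseteq> Lz k" by blast
qed

lemma perp_Lz: "pr (Lz k) = s (unif powi (- k)) ` pr L"
  unfolding Lz_def by (rule perp_scale[OF L_subset])

lemma lat_perp:
  assumes "lat N" shows "lat (pr N)"
proof -
  obtain k l where kl: "Lz k \<subseteq> N" "N \<subseteq> Lz l" using assms unfolding lat_def by blast
  have "lat (pr (Lz j))" for j unfolding perp_Lz by (rule lat_scale[OF lat_perp_L])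
  then show ?thesis
    using lat_between[OF _ _ omod_perp[OF lat_omod[OF assms]] perp_antimono[OF kl(2)] perp_antimono[OF kl(1)]]
    by blast
qed

text \<open>If \<open>y\<close> in \<open>pr K\<close> satisfies \<open>bil b y \<notin> conductor\<close>, then \<open>bil b\<close> maps \<open>pr K\<close> into the
  \<open>integers\<close>-multiples of \<open>bil b y\<close>; hence \<open>y\<close> generates \<open>pr K\<close> over \<open>pr (adjoin K b)\<close>.\<close>

lemma coset_index_perp_adjoin:
  assumes "lat K" "b \<in> X" "s unif b \<in> K" "lat (adjoin K b)"
  shows "coset_index (pr K) (pr (adjoin K b)) \<le> residue_card TYPE('f)"
proof (cases "pr K = pr (adjoin K b)")
  case True
  then show ?thesis
    using coset_index_self[OF lat_subgroup[OF lat_perp[OF assms(1)]]] residue_card_gt_1[where 'f = 'f] by simp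
next
  case False
  have sub: "pr (adjoin K b) \<subseteq> pr K" by (rule perp_antimono[OF adjoin_superset])
  have KX: "x \<in> X" if "x \<in> K" for x using that lat_subset[OF assms(1)] by blast
  have iff: "y \<in> pr (adjoin K b) \<longleftrightarrow> bil b y \<in> conductor" if y: "y \<in> pr K" for y
  proof -
    have yX: "y \<in> X" using y perp_subset by blast
    show ?thesis
    proof
      assume "y \<in> pr (adjoin K b)"
      then show "bil b y \<in> conductor"
        using omod_perp_iff[OF lat_omod[OF assms(4)] yX] adjoin_mem[OF lat_omod[OF assms(1)]] by blast
    next
      assume by0: "bil b y \<in> conductor"
      have "bil x y \<in> conductor" if "x \<in> adjoin K b" for x
      proof -
        obtain c a where ca: "c \<in> integers" "a \<in> K" "x = s c b + a" using \<open>x \<in> adjoin K b\<close>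
          unfolding adjoin_def by auto
        have "bil a y \<in> conductor" using omod_perp_iff[OF lat_omod[OF assms(1)] yX] y ca(2) by blast
        then have "c * bil b y + bil a y \<in> conductor" using conductor_add conductor_mult ca(1) by0 by blast
        then show ?thesis
          unfolding ca(3) using KX[OF ca(2)] assms(2) by (simp add: bil_add_left bil_scale_left X_scale)
      qed
      then show "y \<in> pr (adjoin K b)" using omod_perp_iff[OF lat_omod[OF assms(4)] yX] by blast
    qed
  qed
  have small: "unif * bil b y \<in> conductor" if y: "y \<in> pr K" for y
  proof -
    have "y \<in> X" using y perp_subset by blast
    then have "bil (s unif b) y \<in> conductor" using omod_perp_iff[OF lat_omod[OF assms(1)]] y assms(3) by blast
    then show ?thesis using assms(2) by (simp add: bil_scale_left)
  qed
  obtain y where y: "y \<in> pr K" "y \<notin> pr (adjoin K b)" using False sub by blast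
  have yX: "y \<in> X" using y(1) perp_subset by blast
  have by': "bil b y \<notin> conductor" using iff[OF y(1)] y(2) by simp
  then have nz: "bil b y \<noteq> 0" using conductor_zero by metis
  have "pr K \<subseteq> adjoin (pr (adjoin K b)) y"
  proof
    fix z assume z: "z \<in> pr K"
    then have zX: "z \<in> X" using perp_subset by blast
    define c where "c = bil b z / bil b y"
    have c: "c \<in> integers"
    proof (rule ccontr)
      assume "c \<notin> integers"
      then have "absval (inverse c) < 1"
        by (simp add: integers_def absval_inverse inverse_less_1_iff)
      then have "inverse c \<in> max_ideal" by (simp add: max_ideal_def)
      then obtain d where d: "d \<in> integers" "inverse c = unif * d" unfolding max_ideal_eq by blast
      have "c \<noteq> 0" using \<open>c \<notin> integers\<close> integers_zero by metis
      then have "bil b y = inverse c * bil b z" using nz by (simp add: c_def field_simps)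
      then have "bil b y = d * (unif * bil b z)" unfolding d(2) by simp
      then show False using by' conductor_mult[OF d(1) small[OF z]] by simp
    qed
    have ck: "s c y \<in> pr K" by (rule omod_scale[OF omod_perp[OF lat_omod[OF assms(1)]] c y(1)])
    have "z - s c y \<in> pr K"
      by (rule add_subgroup_diff[OF lat_subgroup[OF lat_perp[OF assms(1)]] z ck])
    moreover have "bil b (z - s c y) = 0"
      using zX yX assms(2) nz by (simp add: bil_diff_right bil_scale_right X_scale c_def)
    ultimately have "z - s c y \<in> pr (adjoin K b)" using iff by simp
    then have "(c, z - s c y) \<in> integers \<times> pr (adjoin K b)" using c by blast
    then show "z \<in> adjoin (pr (adjoin K b)) y"
      unfolding adjoin_def by (rule rev_image_eqI) simp
  qed
  moreover have "adjoin (pr (adjoin K b)) y \<subseteq> pr K"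
    by (rule adjoin_least[OF omod_perp[OF lat_omod[OF assms(1)]] sub y(1)])
  ultimately have eq: "pr K = adjoin (pr (adjoin K b)) y" by blast
  have "s unif y \<in> pr K"
    using omod_scale[OF omod_perp[OF lat_omod[OF assms(1)]] unif_integers y(1)] .
  then have "s unif y \<in> pr (adjoin K b)"
    using iff small[OF y(1)] yX assms(2) by (simp add: bil_scale_right)
  then have "coset_index (adjoin (pr (adjoin K b)) y) (pr (adjoin K b)) = residue_card TYPE('f)"
    by (rule coset_index_adjoin[OF omod_perp[OF lat_omod[OF assms(4)]] yX y(2)])
  then show ?thesis using eq by simp
qed

text \<open>Each step of a chain from \<open>K\<close> to \<open>N\<close> multiplies the index on
  the right by exactly q and the one on the left by at most q.\<close>

lemma coset_index_perp_le:
  assumes "lat K" "lat N" "K \<subseteq> N"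
  shows "coset_index (pr K) (pr N) \<le> coset_index N K"
  using assms
proof (induction rule: lat_chain_induct)
  case refl
  show ?case using coset_index_self lat_subgroup assms(2) lat_perp by (metis order_refl)
next
  case (step K b)
  have bX: "b \<in> X" using step(2) lat_subset[OF assms(2)] by blast
  have "coset_index (pr K) (pr N) =
      coset_index (pr K) (pr (adjoin K b)) * coset_index (pr (adjoin K b)) (pr N)"
    by (rule coset_index_lat_mult[OF lat_perp[OF assms(2)] lat_perp[OF step(5)] lat_perp[OF step(1)]
          perp_antimono[OF step(6)] perp_antimono[OF adjoin_superset]])
  also have "\<dots> \<le> residue_card TYPE('f) * coset_index N (adjoin K b)"
    by (intro mult_le_mono coset_index_perp_adjoin[OF step(1) bX step(4,5)] step(7))
  also have "\<dots> = coset_index N K"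
    using coset_index_lat_mult[OF step(1,5) assms(2) adjoin_superset step(6)]
      coset_index_adjoin[OF lat_omod[OF step(1)] bX step(3,4)] by simp
  finally show ?case .
qed

text \<open>The inequality is an equality because it is one for the two ends of a chain
  \<open>Lz k \<subseteq> K \<subseteq> N \<subseteq> Lz l\<close>.\<close>

lemma ex_perp_subset:
  assumes "lat K" "lat N" "K \<subseteq> N"
  shows "ex (pr K) (pr N) = ex N K"
proof -
  have le: "ex (pr K) (pr N) \<le> ex N K" if "lat K" "lat N" "K \<subseteq> N" for K N
  proof -
    have "residue_card TYPE('f) ^ nat (ex (pr K) (pr N)) \<le> residue_card TYPE('f) ^ nat (ex N K)"
      using coset_index_perp_le[OF that]
      by (simp only: coset_index_ex(1)[OF lat_perp[OF that(1)] lat_perp[OF that(2)] perp_antimono[OF that(3)]]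
          coset_index_ex(1)[OF that(2,1,3)])
    then have "nat (ex (pr K) (pr N)) \<le> nat (ex N K)"
      using power_le_imp_le_exp[OF residue_card_gt_1[where 'f = 'f]] by blast
    then show ?thesis
      using coset_index_ex(2)[OF that(2,1,3)] by linarith
  qed
  obtain k where "\<forall>j\<ge>k. Lz j \<subseteq> K" using lat_lower[OF assms(1)] by blast
  then have k: "Lz k \<subseteq> K" by blast
  obtain l where "\<forall>j\<le>l. N \<subseteq> Lz j" using lat_upper[OF assms(2)] by blast
  then have l: "N \<subseteq> Lz l" by blast
  have 1: "ex (pr K) (pr N) \<le> ex N K" "ex (pr (Lz k)) (pr K) \<le> ex K (Lz k)"
    "ex (pr N) (pr (Lz l)) \<le> ex (Lz l) N"
    using le assms k l by auto
  have s1: "s (unif powi (k - l)) ` pr (Lz k) = pr (Lz l)"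
  proof -
    have "- l = (k - l) + - k" by simp
    then have "unif powi (- l) = unif powi (k - l) * (unif powi (- k) :: 'f)" by (simp only: unif_powi_add)
    then show ?thesis unfolding perp_Lz image_image by simp
  qed
  have s2: "s (unif powi (k - l)) ` Lz l = Lz k" using scale_Lz[of "k - l" l] by simp
  \<comment> \<open>For the ends the equality is a matter of scaling: \<open>pr\<close> exchanges
    multiplication by \<open>unif powi k\<close> with its inverse, and by \<open>ex_scale\<close>
    the exponent of a multiple is the same over every lattice.\<close>
  have "ex (pr (Lz k)) (pr (Lz l)) = ex (Lz l) (Lz k)"
    using ex_scale[OF lat_perp[OF lat_Lz] lat_Lz, of k "k - l" l] unfolding s1 s2 .
  moreover have "ex (pr (Lz k)) (pr (Lz l)) = ex (pr (Lz k)) (pr K) + ex (pr K) (pr N) + ex (pr N) (pr (Lz l))"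
    using ex_add[OF lat_perp[OF lat_Lz] lat_perp[OF assms(1)] lat_perp[OF lat_Lz], of k l]
      ex_add[OF lat_perp[OF assms(1)] lat_perp[OF assms(2)] lat_perp[OF lat_Lz], of l] by simp
  moreover have "ex (Lz l) (Lz k) = ex (Lz l) N + ex N K + ex K (Lz k)"
    using ex_add[OF lat_Lz assms(2) lat_Lz, of l k] ex_add[OF assms(2,1) lat_Lz, of k] by simp
  ultimately show ?thesis using 1 by linarith
qed

lemma ex_perp:
  assumes "lat N" "lat M" shows "ex (pr N) (pr M) = ex M N"
proof -
  have J: "lat (N \<inter> M)" using assms lat_Int by blast
  have "ex (pr (N \<inter> M)) (pr N) = ex N (N \<inter> M)" "ex (pr (N \<inter> M)) (pr M) = ex M (N \<inter> M)"
    using ex_perp_subset J assms by auto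
  then show ?thesis
    using ex_add[OF lat_perp[OF assms(1)] lat_perp[OF J] lat_perp[OF assms(2)]]
      ex_swap[OF lat_perp[OF assms(1)] lat_perp[OF J]] ex_diff[OF assms(2,1) J] by simp
qed

lemma chi_bil_perp: "x \<in> N \<Longrightarrow> y \<in> pr N \<Longrightarrow> chi (bil x y) = 1"
  by (simp add: perp_def)

lemma chi_bil_perp': "N \<subseteq> X \<Longrightarrow> x \<in> N \<Longrightarrow> y \<in> pr N \<Longrightarrow> chi (bil y x) = 1"
  using chi_bil_perp[of x N y] bil_commute[of x y] perp_subset[of N] by (metis subsetD)

text \<open>The conditions under which \<open>chi\<close> composed with \<open>f\<close> is a
  function on the quotient of \<open>N\<close> by \<open>pr N\<close>, so that the Gauss sum does
  not depend on representatives.\<close>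

definition good :: "'v set \<Rightarrow> bool" where
  "good N \<longleftrightarrow> lat N \<and> pr N \<subseteq> N \<and> (\<forall>x\<in>pr N. chi (f x) = 1)"

text \<open>On \<open>L\<close> the form is half of the polar form on the diagonal. Residue
  characteristic 2 is allowed, so the inverse of 2 need not be integral: \<open>i\<close> makes it
  so, \<open>k\<close> bounds the polar form and \<open>j\<close> leads into the conductor.\<close>

lemma chi_form_trivial: "\<exists>k. \<forall>x\<in>Lz k. chi (f x) = 1"
proof -
  have two: "(2::'f) \<noteq> 0" by (rule two_nonzero[OF char_ne_2])
  obtain k where k: "\<forall>x\<in>L. \<forall>y\<in>L. unif ^ k * bil x y \<in> integers" using bil_bounded by blast
  obtain j where j: "unif ^ j \<in> conductor" using conductor_nonzero by blast
  obtain i where i: "unif ^ i * inverse (2::'f) \<in> integers" using unif_power_mult_integers by blast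
  define m where "m = i + j + k"
  have "chi (f x) = 1" if x: "x \<in> Lz (int m)" for x
  proof -
    obtain l where l: "l \<in> L" "x = s (unif ^ m) l" using x unfolding Lz_def by auto
    have lX: "l \<in> X" using l(1) L_subset by blast
    have "f l = inverse 2 * bil l l" using bil_self[OF lX] two by simp
    then have "f x = unif ^ m * ((unif ^ i * inverse 2) * (unif ^ k * bil l l)) * unif ^ j"
      unfolding l(2) form_scale[OF lX] by (simp add: m_def power2_eq_square power_add ac_simps)
    moreover have "(unif :: 'f) ^ m \<in> integers" using unif_powi_integers[of "int m"] by simp
    then have "unif ^ m * ((unif ^ i * inverse 2) * (unif ^ k * bil l l)) \<in> integers"
      using i k l(1) by (intro integers_mult[of "unif ^ m"] integers_mult[of "unif ^ i * inverse 2"]) auto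
    ultimately have "f x \<in> conductor" using conductor_mult[OF _ j] by (simp only:)
    then have "chi (1 * f x) = 1" using integers_one unfolding conductor_def by blast
    then show ?thesis by simp
  qed
  then show ?thesis by blast
qed

lemma good_large: "\<exists>k. \<forall>N. lat N \<and> Lz k \<subseteq> N \<longrightarrow> good N"
proof -
  obtain i where i: "\<forall>x\<in>Lz i. chi (f x) = 1" using chi_form_trivial by blast
  obtain j where "\<forall>l\<le>j. pr L \<subseteq> Lz l" using lat_upper[OF lat_perp_L] by blast
  then have j: "pr L \<subseteq> Lz j" by blast
  \<comment> \<open>\<open>pr (Lz k)\<close> is contained in \<open>Lz (j - k)\<close>. The first
    bound puts this into \<open>Lz i\<close>, where \<open>chi\<close> of the form is trivial; the
    second gives 2k \<le> j and puts it into \<open>Lz k\<close>.\<close>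
  define k where "k = min (j - i) (- \<bar>j\<bar>)"
  have "good N" if N: "lat N" "Lz k \<subseteq> N" for N
  proof -
    have "pr N \<subseteq> pr (Lz k)" by (rule perp_antimono[OF N(2)])
    also have "\<dots> \<subseteq> Lz (j - k)"
      unfolding perp_Lz using image_mono[OF j, of "s (unif powi (- k))"] scale_Lz[of "- k" j] by simp
    finally have sub: "pr N \<subseteq> Lz (j - k)" .
    have "k \<le> j - i" "k \<le> - \<bar>j\<bar>" by (simp_all add: k_def)
    then have "i \<le> j - k" "k \<le> j - k" by linarith+
    then have "Lz (j - k) \<subseteq> Lz i" "Lz (j - k) \<subseteq> Lz k" using Lz_antimono by simp_all
    then show ?thesis unfolding good_def using sub N i by blast
  qed
  then show ?thesis by blast
qed

lemma chi_form_inv: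
  assumes "N \<subseteq> X" "M \<subseteq> pr N" "\<forall>x\<in>M. chi (f x) = 1"
  shows "inv_under N M (\<lambda>x. chi (f x))"
  unfolding inv_under_def
proof (intro ballI)
  fix x y assume xy: "x \<in> N" "y \<in> M"
  then have X: "x \<in> X" "y \<in> X" using assms perp_subset by blast+
  have "chi (bil x y) = 1" using chi_bil_perp[OF xy(1)] xy(2) assms(2) by blast
  then show "chi (f (x + y)) = chi (f x)"
    unfolding form_add[OF X] chi_add using assms(3) xy(2) by simp
qed

lemma good_inv:
  assumes "good N" shows "inv_under N (pr N) (\<lambda>x. chi (f x))"
  using assms chi_form_inv[of N "pr N"] lat_subset unfolding good_def by blast

lemma good_lat: "good N \<Longrightarrow> lat N"
  by (simp add: good_def)

lemma gauss_eq: "good N \<Longrightarrow> gauss chi sq X f N = upow sq (ex (pr N) N) * csum N (pr N) (\<lambda>x. chi (f x))"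
  using ex_swap[OF lat_perp[OF good_lat] good_lat, of N N] by (simp add: gauss_def ex_modulus)

end

section \<open>Gauss sums and their inverses\<close>

locale weil_space = quadratic_space s X L chi f + haar_space s X L sq
  for s :: "'f::nonarch_local_field \<Rightarrow> 'v::ab_group_add \<Rightarrow> 'v" and X L :: "'v set"
    and chi :: "'f \<Rightarrow> 'r::idom" and f :: "'v \<Rightarrow> 'f" and sq :: 'r
begin

text \<open>Substituting \<open>x = y + z\<close> turns the product of the two Gauss sums into
  \<open>\<Sum>y. chi (f y) * (\<Sum>z. chi (bil y z))\<close>, where the inner sum vanishes unless \<open>y \<in> pr N\<close>.\<close>

lemma csum_chi_mult:
  assumes "good N"
  shows "csum N (pr N) (\<lambda>x. chi (f x)) * csum N (pr N) (\<lambda>x. chi (- f x)) = of_nat (coset_index N (pr N))"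
proof -
  have N: "lat N" "pr N \<subseteq> N" "\<And>x. x \<in> pr N \<Longrightarrow> chi (f x) = 1"
    using assms by (auto simp add: good_def)
  note sg = lat_subgroup[OF lat_perp[OF N(1)]] lat_subgroup[OF N(1)]
  note c = sg N(2)
  have NX: "N \<subseteq> X" by (rule lat_subset[OF N(1)])
  have cu: "chi a * chi (- a) = 1" for a by (rule chi_uminus)
  have "csum N (pr N) (\<lambda>x. chi (f x)) * csum N (pr N) (\<lambda>x. chi (- f x)) =
      csum N (pr N) (\<lambda>z. csum N (pr N) (\<lambda>x. chi (f x)) * chi (- f z))"
    unfolding csum_def by (simp add: sum_distrib_left)
  also have "\<dots> = csum N (pr N) (\<lambda>z. csum N (pr N) (\<lambda>y. chi (f y) * chi (bil y z)))"
  proof (rule csum_cong[OF c])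
    fix z assume z: "z \<in> N"
    have "csum N (pr N) (\<lambda>x. chi (f x)) = csum N (pr N) (\<lambda>y. chi (f (y + z)))"
      by (rule csum_translate[symmetric, OF c good_inv[OF assms] z])
    also have "\<dots> * chi (- f z) = csum N (pr N) (\<lambda>y. chi (f (y + z)) * chi (- f z))"
      unfolding csum_def by (simp add: sum_distrib_right)
    also have "\<dots> = csum N (pr N) (\<lambda>y. chi (f y) * chi (bil y z))"
    proof (rule csum_cong[OF c])
      fix y assume "y \<in> N"
      then have "y \<in> X" "z \<in> X" using z NX by auto
      then have "f (y + z) + - f z = f y + bil y z" by (simp add: form_add)
      then show "chi (f (y + z)) * chi (- f z) = chi (f y) * chi (bil y z)"
        by (simp only: chi_add[symmetric])
    qed
    finally show "csum N (pr N) (\<lambda>x. chi (f x)) * chi (- f z) = csum N (pr N) (\<lambda>y. chi (f y) * chi (bil y z))" .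
  qed
  also have "\<dots> = csum N (pr N) (\<lambda>y. csum N (pr N) (\<lambda>z. chi (f y) * chi (bil y z)))"
    unfolding csum_def by (rule sum.swap)
  also have "\<dots> = csum N (pr N) (\<lambda>y. chi (f y) * csum N (pr N) (\<lambda>z. chi (bil y z)))"
    unfolding csum_def by (simp add: sum_distrib_left)
  also have "\<dots> = csum N (pr N) (\<lambda>y. if y \<in> pr N then of_nat (coset_index N (pr N)) else 0)"
  proof (rule csum_cong[OF c])
    fix y assume y: "y \<in> N"
    show "chi (f y) * csum N (pr N) (\<lambda>z. chi (bil y z)) =
        (if y \<in> pr N then of_nat (coset_index N (pr N)) else 0)"
    proof (cases "y \<in> pr N")
      case True
      have "csum N (pr N) (\<lambda>z. chi (bil y z)) = csum N (pr N) (\<lambda>z. 1)"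
        using chi_bil_perp'[OF NX _ True] by (intro csum_cong[OF c])
      then show ?thesis using True N(3) by (simp add: csum_const_1[OF c])
    next
      case False
      have yX: "y \<in> X" using y NX by blast
      have "\<exists>z\<in>N. chi (bil y z) \<noteq> 1"
      proof (rule ccontr)
        assume "\<not> (\<exists>z\<in>N. chi (bil y z) \<noteq> 1)"
        then have "\<forall>z\<in>N. chi (bil z y) = 1" using bil_commute[OF yX] NX by (metis subsetD)
        then show False using False yX by (simp add: perp_def)
      qed
      then obtain b where b: "b \<in> N" "chi (bil y b) \<noteq> 1" by blast
      have "csum N (pr N) (\<lambda>z. chi (bil y z)) = 0"
      proof (rule csum_character_eq_0)
        show "inv_under N (pr N) (\<lambda>z. chi (bil y z))"
          unfolding inv_under_def
        proof (intro ballI)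
          fix x a assume "x \<in> N" "a \<in> pr N"
          then have "x \<in> X" "a \<in> X" "chi (bil y a) = 1"
            using NX perp_subset chi_bil_perp[OF y] by auto
          then show "chi (bil y (x + a)) = chi (bil y x)" using yX by (simp add: bil_add_right chi_add)
        qed
        fix x x' assume "x \<in> N" "x' \<in> N"
        then show "chi (bil y (x + x')) = chi (bil y x) * chi (bil y x')"
          using yX NX by (subst bil_add_right) (auto simp add: chi_add)
      qed (fact c b)+
      then show ?thesis using False by simp
    qed
  qed
  also have "\<dots> = csum (pr N) (pr N) (\<lambda>y. if y \<in> pr N then of_nat (coset_index N (pr N)) else 0)"
    by (rule csum_support[OF sg(1,1,2) subset_refl N(2) finite_reps_lat[OF N(1) lat_perp[OF N(1)] N(2)]]) simp
  also have "\<dots> = csum (pr N) (pr N) (\<lambda>y. of_nat (coset_index N (pr N)))"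
    by (rule csum_cong[OF sg(1,1)]) simp_all
  also have "\<dots> = of_nat (coset_index (pr N) (pr N)) * of_nat (coset_index N (pr N))"
    by (simp add: csum_def coset_index_reps[OF sg(1,1)])
  finally show ?thesis by (simp add: coset_index_self[OF sg(1)])
qed

text \<open>The second factor is the Gauss sum of \<open>- f\<close>, spelled out without an
  instance of the locale for \<open>- f\<close>. The squares of the normalizing powers cancel the
  index found in \<open>csum_chi_mult\<close>.\<close>

lemma gauss_mult_uminus:
  assumes "good N"
  shows "gauss chi sq X f N * (upow sq (ex (pr N) N) * csum N (pr N) (\<lambda>x. chi (- f x))) = 1"
proof -
  have N: "lat N" "lat (pr N)" "pr N \<subseteq> N"
    using assms lat_perp by (auto simp add: good_def)
  have "gauss chi sq X f N * (upow sq (ex (pr N) N) * csum N (pr N) (\<lambda>x. chi (- f x))) =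
      upow sq (ex (pr N) N) * upow sq (ex (pr N) N) *
      (csum N (pr N) (\<lambda>x. chi (f x)) * csum N (pr N) (\<lambda>x. chi (- f x)))"
    unfolding gauss_eq[OF assms] by (simp only: ac_simps)
  also have "\<dots> = upow sq (ex (pr N) N + ex (pr N) N + 2 * ex N (pr N))"
    unfolding csum_chi_mult[OF assms] of_nat_coset_index[OF N] upow_add[OF sq_unit] ..
  also have "ex (pr N) N + ex (pr N) N + 2 * ex N (pr N) = 0"
    using ex_swap[OF N(2,1)] by simp
  finally show ?thesis by simp
qed

lemma gauss_unit: "good N \<Longrightarrow> gauss chi sq X f N dvd 1"
  using gauss_mult_uminus by (metis dvd_triv_left)

section \<open>Fourier transforms carried back to the space by the polar form\<close>

abbreviation "beta \<equiv> inv_into X bil"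

lemma beta_bil: "x \<in> X \<Longrightarrow> beta (bil x) = x"
  using bij_bil by (simp add: bij_betw_def)

lemma inv_beta: "x \<in> X \<Longrightarrow> inv_into (dual s X) beta x = bil x"
proof (rule inv_into_f_eq)
  have "bij_betw beta (dual s X) X" using bij_bil by (rule bij_betw_inv_into)
  then show "inj_on beta (dual s X)" by (simp add: bij_betw_def)
qed (simp_all add: bil_dual beta_bil)

lemma inv_uminus_beta: "x \<in> X \<Longrightarrow> inv_into (dual s X) (- beta) x = bil (- x)"
proof (rule inv_into_f_eq)
  have "bij_betw beta (dual s X) X" using bij_bil by (rule bij_betw_inv_into)
  then show "inj_on (- beta) (dual s X)" by (auto simp add: bij_betw_def inj_on_def)
qed (simp_all add: bil_dual beta_bil X_uminus)

lemma beta_dual_lattice: "beta ` dual_lattice chi s X L = pr L"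
proof (intro equalityI subsetI)
  fix y assume "y \<in> beta ` dual_lattice chi s X L"
  then obtain u where u: "u \<in> dual s X" "\<forall>x\<in>L. chi (u x) = 1" "y = beta u"
    unfolding dual_lattice_def by blast
  then obtain z where z: "z \<in> X" "u = bil z" using bij_bil unfolding bij_betw_def by (metis imageE)
  then have "y = z" using u(3) beta_bil by simp
  have "chi (bil x z) = 1" if "x \<in> L" for x
  proof -
    have "chi (bil z x) = 1" using u(2) that unfolding z(2) by blast
    then show ?thesis using bil_commute[OF z(1) subsetD[OF L_subset that]] by simp
  qed
  then show "y \<in> pr L" using \<open>y = z\<close> z(1) by (simp add: perp_def)
next
  fix y assume y: "y \<in> pr L"
  then have yX: "y \<in> X" using perp_subset by blast
  then have "bil y \<in> dual_lattice chi s X L"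
    unfolding dual_lattice_def using bil_dual chi_bil_perp'[OF L_subset _ y] by blast
  then show "y \<in> beta ` dual_lattice chi s X L" using beta_bil[OF yX] by (metis imageI)
qed

lemma uminus_beta_dual_lattice: "(- beta) ` dual_lattice chi s X L = pr L"
proof -
  have "(- beta) ` dual_lattice chi s X L = uminus ` (beta ` dual_lattice chi s X L)"
    by (simp add: image_image)
  also have "\<dots> = pr L"
    unfolding beta_dual_lattice
  proof (intro equalityI subsetI)
    fix y assume "y \<in> pr L"
    then have "- y \<in> pr L" using add_subgroup_uminus[OF lat_subgroup[OF lat_perp_L]] by blast
    then show "y \<in> uminus ` pr L" by (metis imageI minus_minus)
  qed (use add_subgroup_uminus[OF lat_subgroup[OF lat_perp_L]] in auto)
  finally show ?thesis .
qed

text \<open>The Fourier transform composed with \<open>bil\<close>, hence again a function on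
  \<open>X\<close>. As \<open>bil\<close> is inverse to \<open>beta\<close>, both operators
  \<open>d0'\<close> are this transform up to a constant and, for \<open>- beta\<close>, a sign in
  the argument.\<close>

definition ft :: "('v \<Rightarrow> 'r) \<Rightarrow> 'v \<Rightarrow> 'r" where
  "ft \<Phi> x = haar_integral s X L (\<lambda>y. \<Phi> y * chi (bil x y))"

lemma d0'_beta: "d0' chi sq s X L beta \<Phi> x = (if x \<in> X then upow sq (- ex (pr L) L) * ft \<Phi> x else 0)"
  unfolding d0'_def ex_modulus beta_dual_lattice fourier_def ft_def upow_def
  by (simp add: inv_beta)

lemma d0'_uminus_beta:
  "d0' chi sq s X L (- beta) \<Phi> x = (if x \<in> X then upow sq (- ex (pr L) L) * ft \<Phi> (- x) else 0)"
  unfolding d0'_def ex_modulus uminus_beta_dual_lattice fourier_def ft_def upow_def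
  by (simp add: inv_uminus_beta)

lemma inv_under_chi_bil:
  assumes "N \<subseteq> X" "x \<in> X" "\<And>m. m \<in> M \<Longrightarrow> m \<in> X \<and> chi (bil x m) = 1"
  shows "inv_under N M (\<lambda>y. chi (bil x y))"
  unfolding inv_under_def
proof (intro ballI)
  fix y m assume "y \<in> N" "m \<in> M"
  then have "y \<in> X" "m \<in> X" "chi (bil x m) = 1" using assms by auto
  then show "chi (bil x (y + m)) = chi (bil x y)" using assms(2) by (simp add: bil_add_right chi_add)
qed

lemma adapted_mult_chi_bil:
  assumes "adapted N M \<Phi>" "x \<in> X" "\<And>m. m \<in> M \<Longrightarrow> chi (bil x m) = 1"
  shows "adapted N M (\<lambda>y. \<Phi> y * chi (bil x y) :: 'r)"
proof -
  have "N \<subseteq> X" "M \<subseteq> X" using assms(1) lat_subset by (auto simp add: adapted_def)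
  then have "inv_under N M (\<lambda>y. chi (bil x y))"
    using assms by (intro inv_under_chi_bil) auto
  from adapted_mult[OF assms(1) this] show ?thesis by (simp add: mult.commute)
qed

lemma ft_eq:
  assumes "adapted N M \<Phi>" "x \<in> X" "\<And>m. m \<in> M \<Longrightarrow> chi (bil x m) = 1"
  shows "ft \<Phi> x = upow sq (2 * ex M L) * csum N M (\<lambda>y. \<Phi> y * chi (bil x y))"
proof -
  have "adapted N M (\<lambda>y. \<Phi> y * chi (bil x y))"
    by (rule adapted_mult_chi_bil[OF assms(1,2)]) (rule assms(3))
  then show ?thesis unfolding ft_def hval_def[symmetric] by (rule haar_integral_eq)
qed

lemma mem_Lz: "x \<in> X \<Longrightarrow> \<exists>k. x \<in> Lz k"
  using finite_subset_Lz[of "{x}"] by simp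

text \<open>If some \<open>p\<close> in \<open>M\<close> pairs nontrivially with \<open>x\<close>,
  translation by \<open>p\<close> leaves \<open>\<Phi>\<close> unchanged but multiplies the sum by
  \<open>chi (bil x p)\<close>, so the sum vanishes.\<close>

lemma ft_support:
  assumes A: "adapted N M \<Phi>" and x: "x \<in> X" and "ft \<Phi> x \<noteq> 0"
  shows "x \<in> pr M"
proof (rule ccontr)
  assume "x \<notin> pr M"
  have N: "lat N" "lat M" "M \<subseteq> N" using A by (auto simp add: adapted_def)
  have MX: "M \<subseteq> X" "N \<subseteq> X" using N lat_subset by auto
  obtain p where p0: "p \<in> M" "chi (bil p x) \<noteq> 1"
    using \<open>x \<notin> pr M\<close> x unfolding perp_def by blast
  have p: "p \<in> M" "chi (bil x p) \<noteq> 1"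
    using p0 bil_commute[OF x subsetD[OF MX(1) p0(1)]] by simp_all
  obtain k where k: "x \<in> Lz k" using mem_Lz[OF x] by blast
  \<comment> \<open>The character \<open>chi (bil x y)\<close> is not invariant under
    \<open>M\<close>; the quotient is refined to a sublattice orthogonal to \<open>x\<close> before
    anything is translated.\<close>
  define M' where "M' = M \<inter> pr (Lz k)"
  have M': "lat M'" "M' \<subseteq> M" "M' \<subseteq> N" unfolding M'_def using lat_Int[OF N(2) lat_perp[OF lat_Lz]] N(3) by auto
  have A': "adapted N M' \<Phi>" by (rule adapted_mono[OF A N(1) M'(1) subset_refl M'(2)])
  have triv: "chi (bil x m) = 1" if "m \<in> M'" for m
    using chi_bil_perp[OF k] that by (simp add: M'_def)
  note c = lat_subgroup[OF M'(1)] lat_subgroup[OF N(1)] M'(3)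
  have pN: "p \<in> N" using p(1) N(3) by blast
  let ?S = "csum N M' (\<lambda>y. \<Phi> y * chi (bil x y))"
  have "?S = csum N M' (\<lambda>y. \<Phi> (y + p) * chi (bil x (y + p)))"
    using adapted_mult_chi_bil[OF A' x triv]
    by (intro csum_translate[symmetric, OF c _ pN]) (auto simp add: adapted_def)
  also have "\<dots> = csum N M' (\<lambda>y. \<Phi> y * chi (bil x y) * chi (bil x p))"
  proof (rule csum_cong[OF c])
    fix y assume y: "y \<in> N"
    have "\<Phi> (y + p) = \<Phi> y" using A y p(1) by (simp add: adapted_def inv_under_def)
    moreover have "y \<in> X" "p \<in> X" using y pN MX by auto
    ultimately show "\<Phi> (y + p) * chi (bil x (y + p)) = \<Phi> y * chi (bil x y) * chi (bil x p)"
      using x by (simp add: bil_add_right chi_add mult.assoc)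
  qed
  also have "\<dots> = ?S * chi (bil x p)" unfolding csum_def by (simp add: sum_distrib_right)
  finally have "?S * (1 - chi (bil x p)) = 0" by (simp add: algebra_simps)
  then have "?S = 0" using p(2) by simp
  then show False using assms(3) ft_eq[OF A' x triv] by simp
qed

lemma ft_inv:
  assumes A: "adapted N M \<Phi>" and "x \<in> X" "a \<in> pr N"
  shows "ft \<Phi> (x + a) = ft \<Phi> x"
proof -
  have NX: "N \<subseteq> X" using A lat_subset by (auto simp add: adapted_def)
  have "\<Phi> y * chi (bil (x + a) y) = \<Phi> y * chi (bil x y)" for y
  proof (cases "y \<in> N")
    case True
    then have "chi (bil a y) = 1" using chi_bil_perp'[OF NX] assms(3) by blast
    then show ?thesis
      using assms(2,3) perp_subset[of N] by (subst bil_add_left) (auto simp add: chi_add)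
  next
    case False
    then show ?thesis using A by (auto simp add: adapted_def)
  qed
  then show ?thesis unfolding ft_def by presburger
qed

text \<open>The transform exchanges the two lattices: invariance under \<open>M\<close> bounds the
  support by \<open>pr M\<close>, and support in \<open>N\<close> gives invariance under
  \<open>pr N\<close>. The constant and the sign match \<open>d0'\<close> of
  \<open>- beta\<close>.\<close>

lemma ft_adapted:
  assumes A: "adapted N M \<Phi>"
  shows "adapted (pr M) (pr N) (\<lambda>x. if x \<in> X then c * ft \<Phi> (- x) else 0)"
  unfolding adapted_def
proof (intro conjI allI impI)
  have N: "lat N" "lat M" "M \<subseteq> N" using A by (auto simp add: adapted_def)
  show "lat (pr M)" "lat (pr N)" "pr N \<subseteq> pr M" using N lat_perp perp_antimono by auto
  show "x \<in> pr M" if "(if x \<in> X then c * ft \<Phi> (- x) else 0) \<noteq> 0" for x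
  proof -
    have "x \<in> X" "ft \<Phi> (- x) \<noteq> 0" using that by (auto split: if_splits)
    then have "- x \<in> pr M" using ft_support[OF A X_uminus] by blast
    then show ?thesis using add_subgroup_uminus_iff[OF lat_subgroup[OF lat_perp[OF N(2)]]] by blast
  qed
  show "inv_under (pr M) (pr N) (\<lambda>x. if x \<in> X then c * ft \<Phi> (- x) else 0)"
    unfolding inv_under_def
  proof (intro ballI)
    fix x a assume xa: "x \<in> pr M" "a \<in> pr N"
    have X: "x \<in> X" "a \<in> X" using xa perp_subset by auto
    have "- a \<in> pr N" using xa(2) add_subgroup_uminus[OF lat_subgroup[OF lat_perp[OF N(1)]]] by blast
    then have "ft \<Phi> (- x + - a) = ft \<Phi> (- x)" by (rule ft_inv[OF A X_uminus[OF X(1)]])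
    then show "(if x + a \<in> X then c * ft \<Phi> (- (x + a)) else 0) = (if x \<in> X then c * ft \<Phi> (- x) else 0)"
      using X X_add by (simp add: add.commute)
  qed
qed

lemma adapted_mult_chi_form:
  assumes A: "adapted N M \<Phi>"
  shows "\<exists>k. \<forall>M'. lat M' \<and> M' \<subseteq> M \<and> M' \<subseteq> pr N \<and> M' \<subseteq> Lz k \<longrightarrow> adapted N M' (\<lambda>x. chi (f x) * \<Phi> x)"
proof -
  obtain k where k: "\<forall>x\<in>Lz k. chi (f x) = 1" using chi_form_trivial by blast
  have N: "lat N" "lat M" using A by (auto simp add: adapted_def)
  have "adapted N M' (\<lambda>x. chi (f x) * \<Phi> x)"
    if "lat M'" "M' \<subseteq> M" "M' \<subseteq> pr N" "M' \<subseteq> Lz k" for M'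
  proof (rule adapted_mult)
    show "adapted N M' \<Phi>" by (rule adapted_mono[OF A N(1) that(1) subset_refl that(2)])
    show "inv_under N M' (\<lambda>x. chi (f x))"
      using k that by (intro chi_form_inv lat_subset[OF N(1)]) auto
  qed
  then show ?thesis by blast
qed

text \<open>Completing the square gives
  \<open>f z + f y - bil z y + bil x z = f (z + (x - y)) - f x + bil x y\<close>, and the sum over \<open>z\<close>
  no longer depends on \<open>y\<close> once \<open>N\<close> contains \<open>x\<close> and the support of \<open>\<Phi>\<close>.\<close>

lemma weil_relation_at:
  assumes "\<Phi> \<in> schwartz s X" and x: "x \<in> X"
  shows "\<exists>k. \<forall>N. lat N \<and> Lz k \<subseteq> N \<longrightarrow>
    d0' chi sq s X L beta (t0 chi f (d0' chi sq s X L (- beta) (t0 chi f \<Phi>))) x =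
    gauss chi sq X f N * t0 chi (- f) (d0' chi sq s X L beta \<Phi>) x"
proof -
  obtain P P0 where P: "adapted P P0 \<Phi>" using schwartz_adapted[OF assms(1)] by blast
  have lP: "lat P" "lat P0" using P by (auto simp add: adapted_def)
  obtain k1 where k1: "\<forall>M'. lat M' \<and> M' \<subseteq> P0 \<and> M' \<subseteq> pr P \<and> M' \<subseteq> Lz k1 \<longrightarrow>
      adapted P M' (\<lambda>x. chi (f x) * \<Phi> x)"
    using adapted_mult_chi_form[OF P] by blast
  define P1 where "P1 = P0 \<inter> pr P \<inter> Lz k1"
  have lP1: "lat P1" "P1 \<subseteq> P0" unfolding P1_def using lP lat_Int lat_perp lat_Lz by auto
  define \<Psi> where "\<Psi> = (\<lambda>x. chi (f x) * \<Phi> x)"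
  have \<Psi>: "adapted P P1 \<Psi>" unfolding \<Psi>_def using k1 lP1(1) by (auto simp add: P1_def)
  define c where "c = upow sq (- ex (pr L) L)"
  define g where "g = (\<lambda>z. if z \<in> X then c * ft \<Psi> (- z) else 0)"
  have g: "adapted (pr P1) (pr P) g" unfolding g_def by (rule ft_adapted[OF \<Psi>])
  obtain k2 where k2: "\<forall>M'. lat M' \<and> M' \<subseteq> pr P \<and> M' \<subseteq> pr (pr P1) \<and> M' \<subseteq> Lz k2 \<longrightarrow>
      adapted (pr P1) M' (\<lambda>z. chi (f z) * g z)"
    using adapted_mult_chi_form[OF g] by blast
  define Q where "Q = pr P \<inter> pr (pr P1) \<inter> Lz k2"
  have lQ: "lat Q" unfolding Q_def using lP lP1 lat_Int lat_perp lat_Lz by auto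
  have h: "adapted (pr P1) Q (\<lambda>z. chi (f z) * g z)" using k2 lQ by (auto simp add: Q_def)
  obtain k3 where k3: "\<forall>N. lat N \<and> Lz k3 \<subseteq> N \<longrightarrow> good N" using good_large by blast
  obtain k4 where k4: "x \<in> Lz k4" using mem_Lz[OF x] by blast
  have lat4: "lat N" if "N \<in> {P, pr P1, Lz k3, Lz k4}" for N
    using that lP(1) lat_perp[OF lP1(1)] lat_Lz by auto
  obtain k where k: "\<forall>N\<in>{P, pr P1, Lz k3, Lz k4}. N \<subseteq> Lz k"
    using Lz_directed[of "{P, pr P1, Lz k3, Lz k4}", OF _ lat4] by blast
  show ?thesis
  proof (intro exI[of _ k] allI impI)
    fix N assume N: "lat N \<and> Lz k \<subseteq> N"
    then have lN: "lat N" and sub: "P \<subseteq> N" "pr P1 \<subseteq> N" "x \<in> N" and gN: "good N"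
      using k k3 k4 by auto
    have NX: "N \<subseteq> X" by (rule lat_subset[OF lN])
    \<comment> \<open>One common pair \<open>N\<close>, \<open>M\<close> for all functions involved:
      both transforms become sums over the same finite set of representatives, and their order can
      be interchanged.\<close>
    define M where "M = Q \<inter> P1 \<inter> pr N"
    have lM: "lat M" "M \<subseteq> Q" "M \<subseteq> P1" "M \<subseteq> pr N"
      unfolding M_def using lQ lP1(1) lN lat_Int lat_perp by auto
    have MN: "M \<subseteq> N" using lM(4) gN by (auto simp add: good_def)
    note cs = lat_subgroup[OF lM(1)] lat_subgroup[OF lN] MN
    have triv: "chi (bil z m) = 1" if "z \<in> N" "m \<in> M" for z m
      using chi_bil_perp[OF that(1)] that(2) lM(4) by blast
    have \<Psi>N: "adapted N M \<Psi>" by (rule adapted_mono[OF \<Psi> lN lM(1) sub(1) lM(3)])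
    have hN: "adapted N M (\<lambda>z. chi (f z) * g z)" by (rule adapted_mono[OF h lN lM(1) sub(2) lM(2)])
    have \<Phi>N: "adapted N M \<Phi>"
      by (rule adapted_mono[OF P lN lM(1) sub(1)]) (use lM(3) lP1(2) in blast)
    define v where "v = upow sq (2 * ex M L)"
    have gz: "g z = c * v * csum N M (\<lambda>y. \<Psi> y * chi (bil (- z) y))" if z: "z \<in> N" for z
    proof -
      have "- z \<in> N" using z add_subgroup_uminus[OF lat_subgroup[OF lN]] by blast
      then show ?thesis
        using ft_eq[OF \<Psi>N, of "- z"] triv[of "- z"] NX z by (auto simp add: g_def v_def)
    qed
    have invf: "inv_under N M (\<lambda>z. chi (f z))"
      by (rule inv_under_mono[OF good_inv[OF gN] lM(4) subset_refl])
    define S where "S = csum N M (\<lambda>z. chi (f z))"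
    have key: "chi (f z) * (\<Psi> y * chi (bil (- z) y)) * chi (bil x z) =
        (\<Phi> y * chi (bil x y)) * chi (- f x) * chi (f (z + (x - y)))"
      if "y \<in> N" "z \<in> N" for y z
    proof -
      have X: "y \<in> X" "z \<in> X" using that NX by auto
      have "f z + (f y + (bil (- z) y + bil x z)) = bil x y + (- f x + f (z + (x - y)))"
        using X x by (simp add: form_add form_diff bil_diff_right X_diff bil_uminus_left bil_commute[of x z])
      then have "chi (f z + (f y + (bil (- z) y + bil x z))) = chi (bil x y + (- f x + f (z + (x - y))))"
        by (rule arg_cong)
      then have "chi (f z) * (chi (f y) * (chi (bil (- z) y) * chi (bil x z))) =
          chi (bil x y) * (chi (- f x) * chi (f (z + (x - y))))"
        by (simp only: chi_add)
      then have "\<Phi> y * (chi (f z) * (chi (f y) * (chi (bil (- z) y) * chi (bil x z)))) =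
          \<Phi> y * (chi (bil x y) * (chi (- f x) * chi (f (z + (x - y)))))" by simp
      then show ?thesis unfolding \<Psi>_def by (simp only: ac_simps)
    qed
    have dg: "t0 chi f (d0' chi sq s X L (- beta) (t0 chi f \<Phi>)) = (\<lambda>z. chi (f z) * g z)"
      by (simp add: fun_eq_iff t0_def d0'_uminus_beta g_def c_def \<Psi>_def)
    have "ft (\<lambda>z. chi (f z) * g z) x = v * csum N M (\<lambda>z. chi (f z) * g z * chi (bil x z))"
      unfolding v_def by (rule ft_eq[OF hN x triv[OF sub(3)]])
    also have "csum N M (\<lambda>z. chi (f z) * g z * chi (bil x z)) =
        csum N M (\<lambda>z. c * v * csum N M (\<lambda>y. chi (f z) * (\<Psi> y * chi (bil (- z) y)) * chi (bil x z)))"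
    proof (rule csum_cong[OF cs])
      fix z assume "z \<in> N"
      then show "chi (f z) * g z * chi (bil x z) =
          c * v * csum N M (\<lambda>y. chi (f z) * (\<Psi> y * chi (bil (- z) y)) * chi (bil x z))"
        by (simp add: gz csum_def sum_distrib_left sum_distrib_right ac_simps)
    qed
    also have "\<dots> = c * v * csum N M (\<lambda>z. csum N M (\<lambda>y. chi (f z) * (\<Psi> y * chi (bil (- z) y)) * chi (bil x z)))"
      unfolding csum_def by (simp add: sum_distrib_left)
    also have "csum N M (\<lambda>z. csum N M (\<lambda>y. chi (f z) * (\<Psi> y * chi (bil (- z) y)) * chi (bil x z))) =
        csum N M (\<lambda>y. csum N M (\<lambda>z. chi (f z) * (\<Psi> y * chi (bil (- z) y)) * chi (bil x z)))"
      unfolding csum_def by (rule sum.swap)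
    also have "\<dots> = csum N M (\<lambda>y. (\<Phi> y * chi (bil x y)) * chi (- f x) * S)"
    proof (rule csum_cong[OF cs])
      fix y assume y: "y \<in> N"
      have xy: "x - y \<in> N" by (rule add_subgroup_diff[OF lat_subgroup[OF lN] sub(3) y])
      have "csum N M (\<lambda>z. chi (f z) * (\<Psi> y * chi (bil (- z) y)) * chi (bil x z)) =
          csum N M (\<lambda>z. (\<Phi> y * chi (bil x y)) * chi (- f x) * chi (f (z + (x - y))))"
        by (rule csum_cong[OF cs]) (rule key[OF y])
      also have "\<dots> = (\<Phi> y * chi (bil x y)) * chi (- f x) * csum N M (\<lambda>z. chi (f (z + (x - y))))"
        unfolding csum_def by (simp add: sum_distrib_left)
      also have "csum N M (\<lambda>z. chi (f (z + (x - y)))) = S"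
        unfolding S_def by (rule csum_translate[OF cs invf xy])
      finally show "csum N M (\<lambda>z. chi (f z) * (\<Psi> y * chi (bil (- z) y)) * chi (bil x z)) =
          (\<Phi> y * chi (bil x y)) * chi (- f x) * S" .
    qed
    also have "\<dots> = csum N M (\<lambda>y. \<Phi> y * chi (bil x y)) * (chi (- f x) * S)"
      unfolding csum_def by (simp add: sum_distrib_right mult.assoc)
    finally have lhs: "ft (\<lambda>z. chi (f z) * g z) x =
        v * (c * v * (csum N M (\<lambda>y. \<Phi> y * chi (bil x y)) * (chi (- f x) * S)))" .
    have rhs: "ft \<Phi> x = v * csum N M (\<lambda>y. \<Phi> y * chi (bil x y))"
      unfolding v_def by (rule ft_eq[OF \<Phi>N x triv[OF sub(3)]])
    have S: "S = upow sq (2 * ex (pr N) M) * csum N (pr N) (\<lambda>z. chi (f z))"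
      unfolding S_def
      using csum_refine[OF cs(1) lat_subgroup[OF lat_perp[OF lN]] cs(2) lM(4) _ good_inv[OF gN]]
        of_nat_coset_index[OF lat_perp[OF lN] lM(1,4)] gN by (simp add: good_def)
    have "c * (v * S) = upow sq (- ex (pr L) L + (2 * ex M L + 2 * ex (pr N) M)) *
        csum N (pr N) (\<lambda>z. chi (f z))"
      unfolding S c_def v_def upow_add[OF sq_unit] by (simp only: mult.assoc)
    \<comment> \<open>Here \<open>L\<close> drops out. The terms with factor 2 combine to
      \<open>2 * ex (pr N) L\<close>, and the duality \<open>ex (pr N) (pr L) = ex L N\<close> lets
      one of the two copies, together with \<open>- ex (pr L) L\<close>, contribute
      \<open>ex L N\<close>.\<close>
    also have "- ex (pr L) L + (2 * ex M L + 2 * ex (pr N) M) = ex (pr N) N"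
    proof -
      have "ex (pr N) L = ex (pr N) M + ex M L" by (rule ex_add[OF lat_perp[OF lN] lM(1) lat_L])
      moreover have "ex (pr N) L = ex (pr N) (pr L) + ex (pr L) L"
        by (rule ex_add[OF lat_perp[OF lN] lat_perp_L lat_L])
      moreover have "ex (pr N) (pr L) = ex L N" by (rule ex_perp[OF lN lat_L])
      moreover have "ex (pr N) N = ex (pr N) L + ex L N" by (rule ex_add[OF lat_perp[OF lN] lat_L lN])
      ultimately show ?thesis by linarith
    qed
    finally have G: "c * (v * S) = gauss chi sq X f N" unfolding gauss_eq[OF gN] .
    have "d0' chi sq s X L beta (\<lambda>z. chi (f z) * g z) x = c * ft (\<lambda>z. chi (f z) * g z) x"
      using x by (simp add: d0'_beta c_def)
    also have "\<dots> = (c * (v * S)) * (chi (- f x) * (c * ft \<Phi> x))"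
      unfolding lhs rhs by (simp only: ac_simps)
    also have "c * ft \<Phi> x = d0' chi sq s X L beta \<Phi> x" using x by (simp add: d0'_beta c_def)
    finally show "d0' chi sq s X L beta (t0 chi f (d0' chi sq s X L (- beta) (t0 chi f \<Phi>))) x =
      gauss chi sq X f N * t0 chi (- f) (d0' chi sq s X L beta \<Phi>) x"
      unfolding dg G by (simp add: t0_def)
  qed
qed

text \<open>A test function and a point at which the right-hand side of the defining relation is not
  0, so that the factor can be isolated.\<close>

lemma d0'_indicator_0:
  "d0' chi sq s X L beta (indicator L) 0 = upow sq (- ex (pr L) L)"
proof -
  have A: "adapted L L (indicator L :: 'v \<Rightarrow> 'r)" by (rule adapted_indicator[OF lat_L lat_L subset_refl])
  have b0: "bil 0 y = 0" for y using bil_scale_left[OF X_zero, of 0 y] by simp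
  have "ft (indicator L) 0 = upow sq (2 * ex L L) * csum L L (\<lambda>y. indicator L y * chi (bil 0 y))"
    by (rule ft_eq[OF A X_zero]) (simp add: b0)
  also have "csum L L (\<lambda>y. indicator L y * chi (bil 0 y)) = csum L L (\<lambda>y. 1)"
    by (rule csum_cong) (simp_all add: lat_subgroup b0)
  finally have "ft (indicator L) 0 = 1"
    by (simp add: ex_self csum_const_1 lat_subgroup coset_index_self)
  then show ?thesis by (simp add: d0'_beta X_zero)
qed

lemma unit_nonzero: "(a :: 'r) dvd 1 \<Longrightarrow> a \<noteq> 0"
  by auto

text \<open>The indicator of \<open>L\<close>, evaluated at 0, satisfies the relation with every
  large \<open>N\<close>; cancelling the nonzero common factor shows that the Gauss sums of large
  lattices agree. For any other function and point \<open>N\<close> may then be enlarged as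
  required, and the same cancellation gives uniqueness.\<close>

lemma weil_factor_gauss:
  "\<exists>k. \<forall>N. lat N \<and> Lz k \<subseteq> N \<longrightarrow> good N \<and> weil_factor chi sq s X L f = gauss chi sq X f N"
proof -
  let ?d = "d0' chi sq s X L beta" and ?d' = "d0' chi sq s X L (- beta)"
  let ?I = "indicator L :: 'v \<Rightarrow> 'r"
  have I: "?I \<in> schwartz s X" by (rule adapted_schwartz[OF adapted_indicator[OF lat_L lat_L subset_refl]])
  have f0: "f 0 = 0" using form_scale[OF X_zero, of 0] by simp
  have r0: "t0 chi (- f) (?d ?I) 0 \<noteq> 0"
    using unit_nonzero[OF upow_unit[OF sq_unit]] by (simp add: t0_def d0'_indicator_0 f0)
  obtain k0 where k0: "\<forall>N. lat N \<and> Lz k0 \<subseteq> N \<longrightarrow>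
      ?d (t0 chi f (?d' (t0 chi f ?I))) 0 = gauss chi sq X f N * t0 chi (- f) (?d ?I) 0"
    using weil_relation_at[OF I X_zero] by blast
  obtain k1 where k1: "\<forall>N. lat N \<and> Lz k1 \<subseteq> N \<longrightarrow> good N" using good_large by blast
  define k where "k = min k0 k1"
  have kk: "Lz k0 \<subseteq> Lz k" "Lz k1 \<subseteq> Lz k" by (auto intro!: Lz_antimono simp add: k_def)
  define \<gamma> where "\<gamma> = gauss chi sq X f (Lz k)"
  have \<gamma>: "gauss chi sq X f N = \<gamma>" if "lat N" "Lz k \<subseteq> N" for N
  proof -
    have "Lz k0 \<subseteq> N" using that(2) kk(1) by blast
    then have "?d (t0 chi f (?d' (t0 chi f ?I))) 0 = gauss chi sq X f N * t0 chi (- f) (?d ?I) 0"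
      using k0 that(1) by blast
    moreover have "?d (t0 chi f (?d' (t0 chi f ?I))) 0 = \<gamma> * t0 chi (- f) (?d ?I) 0"
      unfolding \<gamma>_def using k0 kk(1) lat_Lz by blast
    ultimately show ?thesis using r0 by simp
  qed
  have rel: "?d (t0 chi f (?d' (t0 chi f \<Phi>))) = (\<lambda>x. \<gamma> * t0 chi (- f) (?d \<Phi>) x)"
    if \<Phi>: "\<Phi> \<in> schwartz s X" for \<Phi>
  proof
    fix x
    show "?d (t0 chi f (?d' (t0 chi f \<Phi>))) x = \<gamma> * t0 chi (- f) (?d \<Phi>) x"
    proof (cases "x \<in> X")
      case True
      obtain j where j: "\<forall>N. lat N \<and> Lz j \<subseteq> N \<longrightarrow>
          ?d (t0 chi f (?d' (t0 chi f \<Phi>))) x = gauss chi sq X f N * t0 chi (- f) (?d \<Phi>) x"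
        using weil_relation_at[OF \<Phi> True] by blast
      have "Lz j \<subseteq> Lz (min j k)" "Lz k \<subseteq> Lz (min j k)" by (auto intro!: Lz_antimono)
      then have "gauss chi sq X f (Lz (min j k)) = \<gamma>"
        "?d (t0 chi f (?d' (t0 chi f \<Phi>))) x = gauss chi sq X f (Lz (min j k)) * t0 chi (- f) (?d \<Phi>) x"
        using j \<gamma> lat_Lz by blast+
      then show ?thesis by simp
    next
      case False
      then show ?thesis by (simp add: t0_def d0'_beta)
    qed
  qed
  have gk: "good (Lz k)" using k1 kk(2) lat_Lz by blast
  have unit: "\<gamma> dvd 1" unfolding \<gamma>_def by (rule gauss_unit[OF gk])
  have "weil_factor chi sq s X L f = \<gamma>"
    unfolding weil_factor_def Let_def
  proof (rule the_equality)
    show "\<gamma> dvd 1 \<and> (\<forall>\<Phi>\<in>schwartz s X. ?d (t0 chi f (?d' (t0 chi f \<Phi>))) = (\<lambda>x. \<gamma> * t0 chi (- f) (?d \<Phi>) x))"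
      using unit rel by blast
    fix c assume "c dvd 1 \<and> (\<forall>\<Phi>\<in>schwartz s X. ?d (t0 chi f (?d' (t0 chi f \<Phi>))) = (\<lambda>x. c * t0 chi (- f) (?d \<Phi>) x))"
    then have "?d (t0 chi f (?d' (t0 chi f ?I))) = (\<lambda>x. c * t0 chi (- f) (?d ?I) x)"
      using I by blast
    then have "(\<lambda>x. c * t0 chi (- f) (?d ?I) x) = (\<lambda>x. \<gamma> * t0 chi (- f) (?d ?I) x)"
      unfolding rel[OF I] by (rule sym)
    then have "c * t0 chi (- f) (?d ?I) 0 = \<gamma> * t0 chi (- f) (?d ?I) 0" by (rule fun_cong)
    then show "c = \<gamma>" using r0 by simp
  qed
  then have "good N \<and> weil_factor chi sq s X L f = gauss chi sq X f N" if "lat N" "Lz k \<subseteq> N" for N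
    using \<gamma>[OF that] k1 that kk(2) by auto
  then show ?thesis by blast
qed

end

section \<open>Finite-dimensional spaces and coordinates\<close>

lemma vector_space_fun_scale: "vector_space (fun_scale :: 'f::field \<Rightarrow> ('i \<Rightarrow> 'f) \<Rightarrow> ('i \<Rightarrow> 'f))"
  by unfold_locales (simp_all add: fun_scale_def fun_eq_iff algebra_simps)

lemma vector_space_mult: "vector_space ((*) :: 'f::field \<Rightarrow> 'f \<Rightarrow> 'f)"
  by unfold_locales (simp_all add: algebra_simps)

lemma vector_space_prod_scale:
  assumes "vector_space s" "vector_space s'" shows "vector_space (prod_scale s s')"
proof -
  interpret a: vector_space s by fact
  interpret b: vector_space s' by fact
  show ?thesis
    by unfold_locales (auto simp add: prod_scale_def a.scale_right_distrib b.scale_right_distrib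
        a.scale_left_distrib b.scale_left_distrib)
qed

lemma fd_space_vector_space: "fd_space s X \<Longrightarrow> vector_space s"
  by (simp add: fd_space_def)

lemma fd_space_closed:
  assumes "fd_space s X"
  shows "0 \<in> X" "\<And>x y. x \<in> X \<Longrightarrow> y \<in> X \<Longrightarrow> x + y \<in> X" "\<And>c x. x \<in> X \<Longrightarrow> s c x \<in> X"
    "\<And>x y. x \<in> X \<Longrightarrow> y \<in> X \<Longrightarrow> x - y \<in> X" "\<And>x. x \<in> X \<Longrightarrow> - x \<in> X"
proof -
  interpret vector_space s using assms by (rule fd_space_vector_space)
  have "subspace X" using assms by (simp add: fd_space_def)
  then show "0 \<in> X" "\<And>x y. x \<in> X \<Longrightarrow> y \<in> X \<Longrightarrow> x + y \<in> X" "\<And>c x. x \<in> X \<Longrightarrow> s c x \<in> X"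
    "\<And>x y. x \<in> X \<Longrightarrow> y \<in> X \<Longrightarrow> x - y \<in> X" "\<And>x. x \<in> X \<Longrightarrow> - x \<in> X"
    by (simp_all add: subspace_0 subspace_add subspace_scale subspace_diff subspace_neg)
qed

lemma fd_space_sum:
  assumes "fd_space s X" "\<And>i. i \<in> I \<Longrightarrow> g i \<in> X" shows "sum g I \<in> X"
  using assms(2) by (induction I rule: infinite_finite_induct) (simp_all add: fd_space_closed[OF assms(1)])

section \<open>Linear maps between subsets of vector spaces\<close>

lemma linear_map_add: "linear_map s X s' Y h \<Longrightarrow> x \<in> X \<Longrightarrow> y \<in> X \<Longrightarrow> h (x + y) = h x + h y"
  and linear_map_scale: "linear_map s X s' Y h \<Longrightarrow> x \<in> X \<Longrightarrow> h (s c x) = s' c (h x)"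
  and linear_map_mem: "linear_map s X s' Y h \<Longrightarrow> x \<in> X \<Longrightarrow> h x \<in> Y"
  by (auto simp add: linear_map_def)

lemma linear_map_zero:
  assumes "fd_space s X" "linear_map s X s' Y h" shows "h 0 = 0"
  using linear_map_add[OF assms(2) fd_space_closed(1)[OF assms(1)] fd_space_closed(1)[OF assms(1)]] by simp

lemma linear_map_diff:
  assumes "fd_space s X" "linear_map s X s' Y h" "x \<in> X" "y \<in> X" shows "h (x - y) = h x - h y"
  using linear_map_add[OF assms(2) fd_space_closed(4)[OF assms(1,3,4)] assms(4)] by (simp add: algebra_simps)

lemma linear_map_sum:
  assumes "fd_space s X" "linear_map s X s' Y h" "finite I" "\<And>i. i \<in> I \<Longrightarrow> g i \<in> X"
  shows "h (sum g I) = (\<Sum>i\<in>I. h (g i))"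
  using assms(3,4)
proof (induction I)
  case empty
  show ?case by (simp add: linear_map_zero[OF assms(1,2)])
next
  case (insert i I)
  then show ?case using linear_map_add[OF assms(2), of "g i" "sum g I"] fd_space_sum[OF assms(1), of I g] by simp
qed

lemma linear_iso_map: "linear_iso s X s' Y h \<Longrightarrow> linear_map s X s' Y h"
  and linear_iso_bij: "linear_iso s X s' Y h \<Longrightarrow> bij_betw h X Y"
  by (simp_all add: linear_iso_def)

lemma linear_iso_id: "linear_iso s X s X (\<lambda>x. x)"
  by (simp add: linear_iso_def linear_map_def bij_betw_def inj_on_def)

lemma linear_iso_comp:
  "linear_iso s X s' Y h \<Longrightarrow> linear_iso s' Y s'' Z k \<Longrightarrow> linear_iso s X s'' Z (\<lambda>x. k (h x))"
  unfolding linear_iso_def linear_map_def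
  using bij_betw_trans[of h X Y k Z] by (auto simp add: o_def image_subset_iff)

lemma linear_iso_inv:
  assumes "fd_space s X" "linear_iso s X s' Y h"
  shows "linear_iso s' Y s X (inv_into X h)"
proof -
  note b = linear_iso_bij[OF assms(2)] and l = linear_iso_map[OF assms(2)]
  have hi: "h (inv_into X h y) = y" if "y \<in> Y" for y
    using b that by (simp add: bij_betw_def f_inv_into_f)
  have ih: "inv_into X h (h x) = x" if "x \<in> X" for x
    using b that by (simp add: bij_betw_def)
  have m: "inv_into X h y \<in> X" if "y \<in> Y" for y
    using b that by (metis bij_betw_def inv_into_into)
  have "inv_into X h (y + z) = inv_into X h y + inv_into X h z" if yz: "y \<in> Y" "z \<in> Y" for y z
  proof -
    have "h (inv_into X h y + inv_into X h z) = y + z"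
      using linear_map_add[OF l m[OF yz(1)] m[OF yz(2)]] hi yz by simp
    then show ?thesis using ih[OF fd_space_closed(2)[OF assms(1) m[OF yz(1)] m[OF yz(2)]]] by simp
  qed
  moreover have "inv_into X h (s' c y) = s c (inv_into X h y)" if y: "y \<in> Y" for c y
  proof -
    have "h (s c (inv_into X h y)) = s' c y"
      using linear_map_scale[OF l m[OF y]] hi[OF y] by simp
    then show ?thesis using ih[OF fd_space_closed(3)[OF assms(1) m[OF y]]] by metis
  qed
  ultimately show ?thesis
    unfolding linear_iso_def linear_map_def using bij_betw_inv_into[OF b] m by auto
qed

lemma linear_isoI:
  assumes "linear_map s X s' Y h" "\<And>y. y \<in> Y \<Longrightarrow> k y \<in> X" "\<And>x. x \<in> X \<Longrightarrow> k (h x) = x" "\<And>y. y \<in> Y \<Longrightarrow> h (k y) = y"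
  shows "linear_iso s X s' Y h"
  unfolding linear_iso_def using assms linear_map_mem[OF assms(1)]
  by (auto intro!: bij_betw_byWitness[where f' = k])

section \<open>Coordinates and dimension\<close>

definition unit_vec :: "nat \<Rightarrow> nat \<Rightarrow> 'f::field" where
  "unit_vec i = (\<lambda>j. if j = i then 1 else 0)"

lemma unit_vec_coord: "i < n \<Longrightarrow> unit_vec i \<in> coord_space n"
  by (auto simp add: unit_vec_def coord_space_def)

lemma sum_fun: "(\<Sum>i\<in>I. g i) j = (\<Sum>i\<in>I. g i j)"
  by (induction I rule: infinite_finite_induct) simp_all

lemma coord_space_expand:
  assumes "x \<in> coord_space n" shows "x = (\<Sum>i<n. fun_scale (x i) (unit_vec i))"
proof
  fix j
  have "(\<Sum>i<n. fun_scale (x i) (unit_vec i)) j = (\<Sum>i<n. if i = j then x i else 0)"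
    unfolding sum_fun by (intro sum.cong) (auto simp add: fun_scale_def unit_vec_def)
  also have "\<dots> = x j" using assms by (auto simp add: coord_space_def)
  finally show "x j = (\<Sum>i<n. fun_scale (x i) (unit_vec i)) j" ..
qed

lemma subspace_coord: "module.subspace fun_scale (coord_space n)"
proof -
  interpret vector_space fun_scale by (rule vector_space_fun_scale)
  show ?thesis unfolding subspace_def by (auto simp add: coord_space_def fun_scale_def)
qed

lemma fd_space_coord: "fd_space fun_scale (coord_space n :: (nat \<Rightarrow> 'f::field) set)"
proof -
  interpret vector_space "fun_scale :: 'f \<Rightarrow> (nat \<Rightarrow> 'f) \<Rightarrow> _" by (rule vector_space_fun_scale)
  have "span (unit_vec ` {..<n}) = (coord_space n :: (nat \<Rightarrow> 'f) set)"
  proof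
    show "span (unit_vec ` {..<n}) \<subseteq> (coord_space n :: (nat \<Rightarrow> 'f) set)"
      by (rule span_minimal) (auto simp add: subspace_coord unit_vec_coord)
    show "(coord_space n :: (nat \<Rightarrow> 'f) set) \<subseteq> span (unit_vec ` {..<n})"
    proof
      fix x :: "nat \<Rightarrow> 'f" assume "x \<in> coord_space n"
      then have "x = (\<Sum>i<n. fun_scale (x i) (unit_vec i))" by (rule coord_space_expand)
      also have "\<dots> \<in> span (unit_vec ` {..<n})"
        by (intro span_sum span_scale span_base) simp
      finally show "x \<in> span (unit_vec ` {..<n})" .
    qed
  qed
  then show ?thesis unfolding fd_space_def
    using vector_space_fun_scale subspace_coord by (metis finite_imageI finite_lessThan)
qed

text \<open>The images of the unit vectors form a basis. Dimensions of images, products and the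
  field itself are read off from parametrizations by \<open>coord_space\<close> through this
  lemma.\<close>

lemma coord_iso_dim:
  assumes "vector_space s" "linear_iso fun_scale (coord_space n) s X h"
  shows "fd_space s X" "vector_space.dim s X = n"
proof -
  interpret vector_space s by fact
  note l = linear_iso_map[OF assms(2)] and b = linear_iso_bij[OF assms(2)]
  note fd = fd_space_coord[of n, where 'f = 'a]
  let ?b = "\<lambda>i. h (unit_vec i)"
  have img: "h ` coord_space n = X" using b by (simp add: bij_betw_def)
  have hx: "h x = (\<Sum>i<n. s (x i) (?b i))" if "x \<in> coord_space n" for x
  proof -
    have "h x = h (\<Sum>i<n. fun_scale (x i) (unit_vec i))" using coord_space_expand[OF that] by (rule arg_cong)
    also have "\<dots> = (\<Sum>i<n. h (fun_scale (x i) (unit_vec i)))"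
      using unit_vec_coord fd_space_closed(3)[OF fd] by (intro linear_map_sum[OF fd l]) auto
    also have "\<dots> = (\<Sum>i<n. s (x i) (?b i))"
      using linear_map_scale[OF l] unit_vec_coord by (intro sum.cong) auto
    finally show ?thesis .
  qed
  have sub: "subspace X"
    unfolding subspace_def
  proof (intro conjI ballI allI)
    show "0 \<in> X" using linear_map_zero[OF fd l] fd_space_closed(1)[OF fd] img by (metis imageI)
    fix x y assume "x \<in> X" "y \<in> X"
    then obtain x' y' where "x' \<in> coord_space n" "y' \<in> coord_space n" "x = h x'" "y = h y'"
      using img by blast
    then show "x + y \<in> X" using linear_map_add[OF l, of x' y'] fd_space_closed(2)[OF fd] img by (metis imageI)
  next
    fix c x assume "x \<in> X"
    then obtain x' where "x' \<in> coord_space n" "x = h x'" using img by blast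
    then show "s c x \<in> X" using linear_map_scale[OF l, of x' c] fd_space_closed(3)[OF fd] img by (metis imageI)
  qed
  have span: "span (?b ` {..<n}) = X"
  proof
    show "span (?b ` {..<n}) \<subseteq> X"
      using linear_map_mem[OF l] unit_vec_coord by (intro span_minimal[OF _ sub]) auto
    show "X \<subseteq> span (?b ` {..<n})"
    proof
      fix y assume "y \<in> X"
      then obtain x where "x \<in> coord_space n" "y = h x" using img by blast
      then have "y = (\<Sum>i<n. s (x i) (?b i))" using hx by simp
      also have "\<dots> \<in> span (?b ` {..<n})" by (intro span_sum span_scale span_base) simp
      finally show "y \<in> span (?b ` {..<n})" .
    qed
  qed
  then show "fd_space s X" unfolding fd_space_def using assms(1) sub by (metis finite_imageI finite_lessThan)
  have inj: "inj_on ?b {..<n}"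
  proof (rule inj_onI)
    fix i j assume "i \<in> {..<n}" "j \<in> {..<n}" "?b i = ?b j"
    then have "(unit_vec i :: nat \<Rightarrow> 'a) = unit_vec j"
      using b unit_vec_coord unfolding bij_betw_def inj_on_def by blast
    then have "(unit_vec i i :: 'a) = unit_vec j i" by simp
    then show "i = j" by (simp add: unit_vec_def split: if_splits)
  qed
  have "independent (?b ` {..<n})"
  proof
    assume "dependent (?b ` {..<n})"
    then obtain u v where v: "v \<in> ?b ` {..<n}" "u v \<noteq> 0" "(\<Sum>v\<in>?b ` {..<n}. s (u v) v) = 0"
      using dependent_finite[of "?b ` {..<n}"] by auto
    then obtain i where i: "i < n" "v = ?b i" by auto
    define x where "x = (\<lambda>i. if i < n then u (?b i) else 0)"
    have x: "x \<in> coord_space n" by (simp add: x_def coord_space_def)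
    have "h x = (\<Sum>i<n. s (u (?b i)) (?b i))" unfolding hx[OF x] by (intro sum.cong) (auto simp add: x_def)
    also have "\<dots> = (\<Sum>v\<in>?b ` {..<n}. s (u v) v)" by (simp add: sum.reindex[OF inj] o_def)
    finally have "h x = h 0" using v(3) linear_map_zero[OF fd l] by simp
    then have "x = 0" using b x fd_space_closed(1)[OF fd] unfolding bij_betw_def inj_on_def by blast
    then have "x i = 0" by simp
    then show False using v(2) i by (simp add: x_def)
  qed
  then have "dim X = card (?b ` {..<n})" using span dim_span_eq_card_independent by metis
  then show "dim X = n" by (simp add: card_image[OF inj])
qed

lemma fd_space_basis:
  assumes "fd_space s X"
  obtains B where "finite B" "\<not> module.dependent s B" "module.span s B = X" "card B = vector_space.dim s X"
proof -
  interpret vector_space s using assms by (rule fd_space_vector_space)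
  obtain T where T: "finite T" "span T = X" "subspace X" using assms unfolding fd_space_def by blast
  obtain B where B: "B \<subseteq> X" "independent B" "X \<subseteq> span B" "card B = dim X" using basis_exists .
  have "span B = X" using B span_minimal[OF B(1) T(3)] by blast
  moreover have "finite B" using independent_span_bound[OF T(1) B(2)] B(1) T(2) by blast
  ultimately show ?thesis using that B by blast
qed

lemma fd_space_coord_iso:
  assumes "fd_space s X"
  shows "\<exists>h. linear_iso fun_scale (coord_space (vector_space.dim s X)) s X h"
proof -
  interpret vector_space s using assms by (rule fd_space_vector_space)
  obtain B where B: "finite B" "independent B" "span B = X" "card B = dim X"
    by (rule fd_space_basis[OF assms])
  obtain b where b: "bij_betw b {0..<card B} B" using ex_bij_betw_nat_finite[OF B(1)] by blast
  define n where "n = card B"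
  have b: "bij_betw b {..<n} B" using b by (simp add: n_def atLeast0LessThan)
  have bX: "b i \<in> X" if "i < n" for i
    using that b B(3) span_base[of "b i" B] by (auto simp add: bij_betw_def)
  define h where "h z = (\<Sum>i<n. s (z i) (b i))" for z
  define k where "k x = (\<lambda>i. if i < n then representation B x (b i) else 0)" for x
  have "linear_iso fun_scale (coord_space n) s X h"
  proof (rule linear_isoI[where k = k])
    show "linear_map fun_scale (coord_space n) s X h"
      unfolding linear_map_def h_def using bX
      by (auto simp add: fun_scale_def scale_left_distrib sum.distrib scale_sum_right
          intro!: fd_space_sum[OF assms] fd_space_closed(3)[OF assms])
    show "k y \<in> coord_space n" for y by (simp add: k_def coord_space_def)
    show "h (k y) = y" if "y \<in> X" for y
    proof -
      have "h (k y) = (\<Sum>i<n. s (representation B y (b i)) (b i))"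
        unfolding h_def k_def by (intro sum.cong) auto
      also have "\<dots> = (\<Sum>v\<in>B. s (representation B y v) v)"
        using sum.reindex_bij_betw[OF b, of "\<lambda>v. s (representation B y v) v"] by simp
      also have "\<dots> = y" using B that by (intro sum_representation_eq) auto
      finally show ?thesis .
    qed
    show "k (h z) = z" if z: "z \<in> coord_space n" for z
    proof
      fix i
      show "k (h z) i = z i"
      proof (cases "i < n")
        case True
        have "representation B (h z) = (\<lambda>v. \<Sum>j<n. z j * representation B (b j) v)"
          unfolding h_def using bX B(3)
          by (subst representation_sum[OF B(2)]) (auto simp add: representation_scale[OF B(2)] span_scale)
        then have "k (h z) i = (\<Sum>j<n. z j * representation B (b j) (b i))" using True by (simp add: k_def)
        also have "\<dots> = (\<Sum>j<n. if j = i then z j else 0)"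
        proof (rule sum.cong[OF refl])
          fix j assume j: "j \<in> {..<n}"
          then have "b j \<in> B" "b i = b j \<longleftrightarrow> i = j" using b True by (auto simp add: bij_betw_def inj_on_def)
          then show "z j * representation B (b j) (b i) = (if j = i then z j else 0)"
            by (auto simp add: representation_basis[OF B(2)])
        qed
        finally show ?thesis using True by simp
      next
        case False
        then show ?thesis using z by (simp add: k_def coord_space_def)
      qed
    qed
  qed
  then show ?thesis using B(4) n_def by metis
qed

lemma linear_iso_dim:
  assumes "fd_space s X" "vector_space s'" "linear_iso s X s' Y h"
  shows "fd_space s' Y" "vector_space.dim s' Y = vector_space.dim s X"
proof -
  obtain k where "linear_iso fun_scale (coord_space (vector_space.dim s X)) s X k"
    using fd_space_coord_iso[OF assms(1)] by blast
  from coord_iso_dim[OF assms(2) linear_iso_comp[OF this assms(3)]]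
  show "fd_space s' Y" "vector_space.dim s' Y = vector_space.dim s X" .
qed

lemma dim_coord: "vector_space.dim fun_scale (coord_space n :: (nat \<Rightarrow> 'f::field) set) = n"
  by (rule coord_iso_dim(2)[OF vector_space_fun_scale linear_iso_id])

lemma linear_iso_Times:
  assumes "linear_iso s X s' Y h" "linear_iso t Z t' W k"
  shows "linear_iso (prod_scale s t) (X \<times> Z) (prod_scale s' t') (Y \<times> W) (map_prod h k)"
  using assms bij_betw_map_prod[of h X Y k Z W]
  unfolding linear_iso_def linear_map_def by (auto simp add: prod_scale_def)

lemma coord_space_add_iso:
  "linear_iso fun_scale (coord_space (m + n)) (prod_scale fun_scale fun_scale)
     (coord_space m \<times> (coord_space n :: (nat \<Rightarrow> 'f::field) set))
     (\<lambda>z. (\<lambda>i. if i < m then z i else 0, \<lambda>i. if i < n then z (m + i) else 0))"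
  by (rule linear_isoI[where k = "\<lambda>(x, y). (\<lambda>i. if i < m then x i else y (i - m))"])
     (auto simp add: linear_map_def coord_space_def prod_scale_def fun_scale_def fun_eq_iff)

lemma fd_space_Times:
  assumes "fd_space s X" "fd_space s' Y"
  shows "fd_space (prod_scale s s') (X \<times> Y)"
    "vector_space.dim (prod_scale s s') (X \<times> Y) = vector_space.dim s X + vector_space.dim s' Y"
proof -
  obtain h k where "linear_iso fun_scale (coord_space (vector_space.dim s X)) s X h"
    "linear_iso fun_scale (coord_space (vector_space.dim s' Y)) s' Y k"
    using fd_space_coord_iso assms by metis
  from linear_iso_comp[OF coord_space_add_iso linear_iso_Times[OF this]]
  show "fd_space (prod_scale s s') (X \<times> Y)"
    "vector_space.dim (prod_scale s s') (X \<times> Y) = vector_space.dim s X + vector_space.dim s' Y"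
    by (intro coord_iso_dim[OF vector_space_prod_scale];
        simp add: fd_space_vector_space[OF assms(1)] fd_space_vector_space[OF assms(2)])+
qed

lemma fd_space_field: "fd_space (*) (UNIV :: 'f::field set)"
proof (rule coord_iso_dim(1)[OF vector_space_mult])
  show "linear_iso fun_scale (coord_space 1) (*) (UNIV :: 'f set) (\<lambda>z. z 0)"
    by (rule linear_isoI[where k = "\<lambda>t i. if i = 0 then t else 0"])
       (auto simp add: linear_map_def coord_space_def fun_scale_def fun_eq_iff)
qed

lemma ring_lattice_exists:
  assumes "fd_space s X" shows "\<exists>L. ring_lattice s X L"
proof -
  obtain B where "finite B" "\<not> module.dependent s B" "module.span s B = X"
    by (rule fd_space_basis[OF assms])
  then show ?thesis unfolding ring_lattice_def by blast
qed

section \<open>Quadratic spaces\<close>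

text \<open>The polar form is symmetric, so linearity in the first argument yields linearity in the
  second, and all functions in play vanish outside \<open>X\<close>. What remains are pointwise
  conditions on \<open>X\<close>.\<close>

lemma nondegenerate_formI:
  assumes "fd_space s X"
    and "\<And>c x. x \<in> X \<Longrightarrow> f (s c x) = c\<^sup>2 * f x"
    and add: "\<And>x x' y. x \<in> X \<Longrightarrow> x' \<in> X \<Longrightarrow> y \<in> X \<Longrightarrow> polar X f (x + x') y = polar X f x y + polar X f x' y"
    and sc: "\<And>c x y. x \<in> X \<Longrightarrow> y \<in> X \<Longrightarrow> polar X f (s c x) y = c * polar X f x y"
    and inj: "\<And>x. x \<in> X \<Longrightarrow> (\<And>y. y \<in> X \<Longrightarrow> polar X f x y = 0) \<Longrightarrow> x = 0"
    and surj: "\<And>u. u \<in> dual s X \<Longrightarrow> \<exists>x\<in>X. \<forall>y\<in>X. polar X f x y = u y"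
  shows "nondegenerate_form s X f"
proof -
  have sym: "polar X f x y = polar X f y x" if "x \<in> X" "y \<in> X" for x y
    using that by (simp add: polar_def algebra_simps)
  have out: "polar X f x y = 0" if "y \<notin> X" for x y using that by (simp add: polar_def)
  note cl = fd_space_closed[OF assms(1)]
  have d: "polar X f x \<in> dual s X" if x: "x \<in> X" for x
    unfolding dual_def linear_map_def
    using x cl sym[OF x] add[OF _ _ x] sc[OF _ x] out by auto
  have lin: "linear_map s X fun_scale (dual s X) (polar X f)"
    unfolding linear_map_def
  proof (intro conjI ballI allI)
    show "polar X f ` X \<subseteq> dual s X" using d by blast
    fix x y assume "x \<in> X" "y \<in> X"
    then show "polar X f (x + y) = polar X f x + polar X f y"
      using add out by (auto simp add: fun_eq_iff) (metis add_0)
  next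
    fix c x assume "x \<in> X"
    then show "polar X f (s c x) = fun_scale c (polar X f x)"
      using sc out by (auto simp add: fun_eq_iff fun_scale_def) (metis mult_zero_right)
  qed
  have "bij_betw (polar X f) X (dual s X)"
    unfolding bij_betw_def
  proof
    show "inj_on (polar X f) X"
    proof (rule inj_onI)
      fix x y assume xy: "x \<in> X" "y \<in> X" "polar X f x = polar X f y"
      have "polar X f (x - y) z = 0" if "z \<in> X" for z
        using add[OF cl(4)[OF xy(1,2)] xy(2) that] xy(3) by simp
      then show "x = y" using inj[OF cl(4)[OF xy(1,2)]] by simp
    qed
    show "polar X f ` X = dual s X"
    proof
      show "polar X f ` X \<subseteq> dual s X" using d by blast
      show "dual s X \<subseteq> polar X f ` X"
      proof
        fix u assume u: "u \<in> dual s X"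
        then obtain x where x: "x \<in> X" "\<forall>y\<in>X. polar X f x y = u y" using surj by blast
        have "polar X f x = u"
        proof
          fix y show "polar X f x y = u y"
            using x out u by (cases "y \<in> X") (auto simp add: dual_def)
        qed
        then show "u \<in> polar X f ` X" using x(1) by blast
      qed
    qed
  qed
  then show ?thesis
    unfolding nondegenerate_form_def quadratic_form_def linear_iso_def using lin assms(2) by blast
qed

lemma nondegenerate_formD:
  assumes "nondegenerate_form s X f" "fd_space s X"
  shows "\<And>c x. x \<in> X \<Longrightarrow> f (s c x) = c\<^sup>2 * f x"
    "\<And>x x' y. x \<in> X \<Longrightarrow> x' \<in> X \<Longrightarrow> polar X f (x + x') y = polar X f x y + polar X f x' y"
    "\<And>c x y. x \<in> X \<Longrightarrow> polar X f (s c x) y = c * polar X f x y"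
    "\<And>x. x \<in> X \<Longrightarrow> (\<And>y. y \<in> X \<Longrightarrow> polar X f x y = 0) \<Longrightarrow> x = 0"
    "\<And>u. u \<in> dual s X \<Longrightarrow> \<exists>x\<in>X. polar X f x = u"
proof -
  have lin: "linear_map s X fun_scale (dual s X) (polar X f)" and bij: "bij_betw (polar X f) X (dual s X)"
    using assms(1) by (simp_all add: nondegenerate_form_def linear_iso_def)
  show "\<And>c x. x \<in> X \<Longrightarrow> f (s c x) = c\<^sup>2 * f x"
    using assms(1) by (simp add: nondegenerate_form_def quadratic_form_def)
  show "polar X f (x + x') y = polar X f x y + polar X f x' y" if "x \<in> X" "x' \<in> X" for x x' y
    using linear_map_add[OF lin that] by simp
  show "polar X f (s c x) y = c * polar X f x y" if "x \<in> X" for c x y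
    using linear_map_scale[OF lin that] by (simp add: fun_scale_def)
  show "x = 0" if "x \<in> X" "\<And>y. y \<in> X \<Longrightarrow> polar X f x y = 0" for x
  proof -
    have "polar X f x y = polar X f 0 y" for y
    proof (cases "y \<in> X")
      case True
      then show ?thesis using that(2) linear_map_zero[OF assms(2) lin] by simp
    qed (simp add: polar_def)
    then have "polar X f x = polar X f 0" by (rule ext)
    then show ?thesis
      using bij that(1) fd_space_closed(1)[OF assms(2)] unfolding bij_betw_def inj_on_def by blast
  qed
  show "\<exists>x\<in>X. polar X f x = u" if "u \<in> dual s X" for u
    using bij that unfolding bij_betw_def by (metis imageE)
qed

lemma polar_commute: "x \<in> X \<Longrightarrow> y \<in> X \<Longrightarrow> polar X f x y = polar X f y x"
  by (simp add: polar_def algebra_simps)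

lemma polar_iso:
  assumes "linear_map s X s' Y h" "\<And>x. x \<in> X \<Longrightarrow> g (h x) = f x" "x \<in> X" "y \<in> X" "x + y \<in> X"
  shows "polar Y g (h x) (h y) = polar X f x y"
proof -
  have "h x + h y = h (x + y)" using linear_map_add[OF assms(1,3,4)] by simp
  then show ?thesis using assms linear_map_mem[OF assms(1)] by (simp add: polar_def)
qed

lemma nondegenerate_form_iso:
  assumes "fd_space s X" "fd_space s' Y" "linear_iso s X s' Y h" "\<And>x. x \<in> X \<Longrightarrow> g (h x) = f x"
    and "nondegenerate_form s X f"
  shows "nondegenerate_form s' Y g"
proof -
  note D = nondegenerate_formD[OF assms(5,1)]
  note l = linear_iso_map[OF assms(3)] and cl = fd_space_closed[OF assms(1)]
  have img: "h ` X = Y" using linear_iso_bij[OF assms(3)] by (simp add: bij_betw_def)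
  have P: "polar Y g (h x) (h y) = polar X f x y" if "x \<in> X" "y \<in> X" for x y
    by (rule polar_iso[where g = g, OF l]) (use assms(4) that cl(2) in auto)
  show ?thesis
  proof (rule nondegenerate_formI[OF assms(2)])
    fix c y assume "y \<in> Y"
    then obtain x where "x \<in> X" "y = h x" using img by blast
    then show "g (s' c y) = c\<^sup>2 * g y"
      using linear_map_scale[OF l, of x c] assms(4) cl(3) D(1) by metis
  next
    fix y y' z assume "y \<in> Y" "y' \<in> Y" "z \<in> Y"
    then obtain x x' w where x: "x \<in> X" "y = h x" "x' \<in> X" "y' = h x'" "w \<in> X" "z = h w"
      using img by blast
    then have "y + y' = h (x + x')" using linear_map_add[OF l] by simp
    then show "polar Y g (y + y') z = polar Y g y z + polar Y g y' z"
      using P x D(2) cl(2) by simp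
  next
    fix c y z assume "y \<in> Y" "z \<in> Y"
    then obtain x w where x: "x \<in> X" "y = h x" "w \<in> X" "z = h w" using img by blast
    then have "s' c y = h (s c x)" using linear_map_scale[OF l] by simp
    then show "polar Y g (s' c y) z = c * polar Y g y z" using P x D(3) cl(3) by simp
  next
    fix y assume "y \<in> Y" and 0: "\<And>z. z \<in> Y \<Longrightarrow> polar Y g y z = 0"
    then obtain x where x: "x \<in> X" "y = h x" using img by blast
    have "polar X f x w = 0" if "w \<in> X" for w
      using P[OF x(1) that] 0[of "h w"] x(2) linear_map_mem[OF l that] by simp
    then have "x = 0" using D(4)[OF x(1)] by blast
    then show "y = 0" using x(2) linear_map_zero[OF assms(1) l] by simp
  next
    fix u assume u: "u \<in> dual s' Y"
    define v where "v x = (if x \<in> X then u (h x) else 0)" for x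
    have "v \<in> dual s X"
      using u linear_map_add[OF l] linear_map_scale[OF l] linear_map_mem[OF l] cl
      by (auto simp add: dual_def linear_map_def v_def)
    then obtain x where x: "x \<in> X" "polar X f x = v" using D(5) by blast
    have "polar Y g (h x) y = u y" if "y \<in> Y" for y
    proof -
      obtain w where w: "w \<in> X" "y = h w" using \<open>y \<in> Y\<close> img by blast
      then show ?thesis using P[OF x(1) w(1)] x(2) by (simp add: v_def)
    qed
    then show "\<exists>y\<in>Y. \<forall>z\<in>Y. polar Y g y z = u z" using linear_map_mem[OF l x(1)] by blast
  qed
qed

lemma polar_form_sum:
  "x \<in> X \<Longrightarrow> y \<in> Y \<Longrightarrow> x' \<in> X \<Longrightarrow> y' \<in> Y \<Longrightarrow>
    polar (X \<times> Y) (form_sum f g) (x, y) (x', y') = polar X f x x' + polar Y g y y'"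
  by (simp add: polar_def form_sum_def algebra_simps)

lemma polar_zero:
  assumes "fd_space s X" "nondegenerate_form s X f" shows "polar X f 0 y = 0"
  using nondegenerate_formD(2)[OF assms(2,1), of 0 0 y] fd_space_closed(1)[OF assms(1)]
  by (metis add_0 add_cancel_right_right)

section \<open>Isometries and Witt equivalence\<close>

text \<open>A whole quadratic space as one value, so that isometries between spaces over different
  types can be chained like equations.\<close>

type_synonym ('f, 'v) quad = "('f \<Rightarrow> 'v \<Rightarrow> 'v) \<times> 'v set \<times> ('v \<Rightarrow> 'f)"

definition quad :: "('f::field, 'v::ab_group_add) quad \<Rightarrow> bool" where
  "quad A \<longleftrightarrow> (case A of (s, X, f) \<Rightarrow> fd_space s X \<and> nondegenerate_form s X f)"

definition qiso :: "('f::field, 'v::ab_group_add) quad \<Rightarrow> ('f, 'w::ab_group_add) quad \<Rightarrow> bool" where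
  "qiso A B \<longleftrightarrow> (case A of (s, X, f) \<Rightarrow> case B of (s', Y, g) \<Rightarrow> isometric s X f s' Y g)"

definition qsum :: "('f::field, 'v::ab_group_add) quad \<Rightarrow> ('f, 'w::ab_group_add) quad \<Rightarrow> ('f, 'v \<times> 'w) quad"
  where "qsum A B = (case A of (s, X, f) \<Rightarrow> case B of (s', Y, g) \<Rightarrow> (prod_scale s s', X \<times> Y, form_sum f g))"

definition qneg :: "('f::field, 'v::ab_group_add) quad \<Rightarrow> ('f, 'v) quad" where
  "qneg A = (case A of (s, X, f) \<Rightarrow> (s, X, - f))"

definition hyp :: "nat \<Rightarrow> ('f::field, nat \<Rightarrow> 'f) quad" where
  "hyp n = (fun_scale, coord_space (2 * n), hyperbolic n)"

definition line :: "'f \<Rightarrow> ('f::field, 'f) quad" where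
  "line a = ((*), UNIV, \<lambda>t. a * t\<^sup>2)"

definition qdim :: "('f::field, 'v::ab_group_add) quad \<Rightarrow> nat" where
  "qdim A = (case A of (s, X, f) \<Rightarrow> vector_space.dim s X)"

section \<open>Isometries and orthogonal sums\<close>

lemma quad_fd: "quad (s, X, f) \<Longrightarrow> fd_space s X" and quad_nondeg: "quad (s, X, f) \<Longrightarrow> nondegenerate_form s X f"
  by (simp_all add: quad_def)

lemma qisoI: "linear_iso s X s' Y h \<Longrightarrow> (\<And>x. x \<in> X \<Longrightarrow> g (h x) = f x) \<Longrightarrow> qiso (s, X, f) (s', Y, g)"
  unfolding qiso_def isometric_def by auto

lemma qisoE:
  assumes "qiso (s, X, f) (s', Y, g)"
  obtains h where "linear_iso s X s' Y h" "\<forall>x\<in>X. g (h x) = f x"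
  using assms unfolding qiso_def isometric_def by auto

lemma qiso_refl: "qiso A A"
  by (cases A) (auto intro: qisoI[OF linear_iso_id])

lemma qiso_trans [trans]:
  assumes "qiso A B" "qiso B C" shows "qiso A C"
proof -
  obtain s X f s' Y g s'' Z e where A: "A = (s, X, f)" "B = (s', Y, g)" "C = (s'', Z, e)"
    by (cases A, cases B, cases C)
  obtain h where h: "linear_iso s X s' Y h" "\<forall>x\<in>X. g (h x) = f x"
    using assms(1) unfolding A by (rule qisoE)
  obtain k where k: "linear_iso s' Y s'' Z k" "\<forall>y\<in>Y. e (k y) = g y"
    using assms(2) unfolding A by (rule qisoE)
  show ?thesis unfolding A
    by (rule qisoI[OF linear_iso_comp[OF h(1) k(1)]])
       (use h k linear_map_mem[OF linear_iso_map[OF h(1)]] in simp)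
qed

lemma qiso_sym_fd:
  assumes "fd_space s X" "qiso (s, X, f) B" shows "qiso B (s, X, f)"
proof -
  obtain s' Y g where B: "B = (s', Y, g)" by (cases B)
  obtain h where h: "linear_iso s X s' Y h" "\<forall>x\<in>X. g (h x) = f x"
    using assms(2) unfolding B by (rule qisoE)
  have b: "bij_betw h X Y" by (rule linear_iso_bij[OF h(1)])
  show ?thesis unfolding B
  proof (rule qisoI[OF linear_iso_inv[OF assms(1) h(1)]])
    fix y assume "y \<in> Y"
    then have "inv_into X h y \<in> X" "h (inv_into X h y) = y"
      using b by (auto simp add: bij_betw_def inv_into_into f_inv_into_f)
    then show "f (inv_into X h y) = g y" using h(2) by metis
  qed
qed

lemma qiso_sym: "quad A \<Longrightarrow> qiso A B \<Longrightarrow> qiso B A"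
  by (cases A) (use qiso_sym_fd quad_fd in blast)

lemma qiso_sum:
  assumes "qiso A A'" "qiso B B'" shows "qiso (qsum A B) (qsum A' B')"
proof -
  obtain s X f s' Y g where A: "A = (s, X, f)" "A' = (s', Y, g)" by (cases A, cases A')
  obtain t Z e t' W d where B: "B = (t, Z, e)" "B' = (t', W, d)" by (cases B, cases B')
  obtain h where h: "linear_iso s X s' Y h" "\<forall>x\<in>X. g (h x) = f x"
    using assms(1) unfolding A by (rule qisoE)
  obtain k where k: "linear_iso t Z t' W k" "\<forall>z\<in>Z. d (k z) = e z"
    using assms(2) unfolding B by (rule qisoE)
  show ?thesis unfolding A B qsum_def prod.case
    by (rule qisoI[OF linear_iso_Times[OF h(1) k(1)]]) (use h k in \<open>auto simp add: form_sum_def\<close>)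
qed

lemma qiso_comm: "qiso (qsum A B) (qsum B A)"
proof -
  obtain s X f s' Y g where A: "A = (s, X, f)" "B = (s', Y, g)" by (cases A, cases B)
  have "linear_iso (prod_scale s s') (X \<times> Y) (prod_scale s' s) (Y \<times> X) (\<lambda>(x, y). (y, x))"
    by (rule linear_isoI[where k = "\<lambda>(x, y). (y, x)"]) (auto simp add: linear_map_def prod_scale_def)
  then show ?thesis unfolding A qsum_def prod.case
    by (rule qisoI) (auto simp add: form_sum_def add.commute)
qed

lemma qiso_assoc: "qiso (qsum (qsum A B) C) (qsum A (qsum B C))"
  and qiso_assoc': "qiso (qsum A (qsum B C)) (qsum (qsum A B) C)"
proof -
  obtain s X f s' Y g s'' Z e where A: "A = (s, X, f)" "B = (s', Y, g)" "C = (s'', Z, e)"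
    by (cases A, cases B, cases C)
  have "linear_iso (prod_scale (prod_scale s s') s'') ((X \<times> Y) \<times> Z)
      (prod_scale s (prod_scale s' s'')) (X \<times> (Y \<times> Z)) (\<lambda>((x, y), z). (x, (y, z)))"
    by (rule linear_isoI[where k = "\<lambda>(x, (y, z)). ((x, y), z)"]) (auto simp add: linear_map_def prod_scale_def)
  then show "qiso (qsum (qsum A B) C) (qsum A (qsum B C))" unfolding A qsum_def prod.case
    by (rule qisoI) (auto simp add: form_sum_def add.assoc)
  have "linear_iso (prod_scale s (prod_scale s' s'')) (X \<times> (Y \<times> Z))
      (prod_scale (prod_scale s s') s'') ((X \<times> Y) \<times> Z) (\<lambda>(x, (y, z)). ((x, y), z))"
    by (rule linear_isoI[where k = "\<lambda>((x, y), z). (x, (y, z))"]) (auto simp add: linear_map_def prod_scale_def)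
  then show "qiso (qsum A (qsum B C)) (qsum (qsum A B) C)" unfolding A qsum_def prod.case
    by (rule qisoI) (auto simp add: form_sum_def add.assoc)
qed

lemma qiso_swap_right: "qiso (qsum (qsum A B) C) (qsum (qsum A C) B)"
proof -
  have "qiso (qsum (qsum A B) C) (qsum A (qsum B C))" by (rule qiso_assoc)
  also have "qiso \<dots> (qsum A (qsum C B))" by (rule qiso_sum[OF qiso_refl qiso_comm])
  also have "qiso \<dots> (qsum (qsum A C) B)" by (rule qiso_assoc')
  finally show ?thesis .
qed

lemma qiso_interchange: "qiso (qsum (qsum A B) (qsum C D)) (qsum (qsum A C) (qsum B D))"
proof -
  have "qiso (qsum (qsum A B) (qsum C D)) (qsum (qsum (qsum A B) C) D)" by (rule qiso_assoc')
  also have "qiso \<dots> (qsum (qsum (qsum A C) B) D)" by (rule qiso_sum[OF qiso_swap_right qiso_refl])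
  also have "qiso \<dots> (qsum (qsum A C) (qsum B D))" by (rule qiso_assoc)
  finally show ?thesis .
qed

text \<open>An isometry sees the scalar multiplication of the target only on its carrier, while
  \<open>fd_space\<close> asks for the vector space axioms on the entire type; hence the separate
  condition on \<open>fst B\<close>.\<close>

lemma quad_iso:
  assumes "quad A" "qiso A B" "vector_space (fst B)" shows "quad B" "qdim B = qdim A"
proof -
  obtain s X f s' Y g where A: "A = (s, X, f)" "B = (s', Y, g)" by (cases A, cases B)
  obtain h where h: "linear_iso s X s' Y h" "\<forall>x\<in>X. g (h x) = f x"
    using assms(2) unfolding A by (rule qisoE)
  have fd: "fd_space s X" using assms(1) unfolding A by (rule quad_fd)
  have vs: "vector_space s'" using assms(3) by (simp add: A)
  note d = linear_iso_dim[OF fd vs h(1)]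
  have "nondegenerate_form s' Y g"
    by (rule nondegenerate_form_iso[OF fd d(1) h(1)]) (use h(2) assms(1) in \<open>auto simp add: A quad_def\<close>)
  then show "quad B" "qdim B = qdim A" using d by (simp_all add: A quad_def qdim_def)
qed

lemma quad_sum:
  assumes "quad A" "quad B" shows "quad (qsum A B)" "qdim (qsum A B) = qdim A + qdim B"
proof -
  obtain s X f s' Y g where A: "A = (s, X, f)" "B = (s', Y, g)" by (cases A, cases B)
  have fd: "fd_space s X" "fd_space s' Y" using assms by (auto simp add: A quad_def)
  have nd: "nondegenerate_form s X f" "nondegenerate_form s' Y g" using assms by (auto simp add: A quad_def)
  note T = fd_space_Times[OF fd]
  note D = nondegenerate_formD[OF nd(1) fd(1)] and E = nondegenerate_formD[OF nd(2) fd(2)]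
  note cl = fd_space_closed[OF fd(1)] and dl = fd_space_closed[OF fd(2)]
  have "nondegenerate_form (prod_scale s s') (X \<times> Y) (form_sum f g)"
  proof (rule nondegenerate_formI[OF T(1)])
    show "form_sum f g (prod_scale s s' c p) = c\<^sup>2 * form_sum f g p" if "p \<in> X \<times> Y" for c p
      using that D(1) E(1) by (auto simp add: form_sum_def prod_scale_def algebra_simps)
    show "polar (X \<times> Y) (form_sum f g) (p + p') r =
        polar (X \<times> Y) (form_sum f g) p r + polar (X \<times> Y) (form_sum f g) p' r"
      if "p \<in> X \<times> Y" "p' \<in> X \<times> Y" "r \<in> X \<times> Y" for p p' r
      using that D(2) E(2) cl(2) dl(2) by (auto simp add: polar_form_sum algebra_simps)
    show "polar (X \<times> Y) (form_sum f g) (prod_scale s s' c p) r = c * polar (X \<times> Y) (form_sum f g) p r"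
      if "p \<in> X \<times> Y" "r \<in> X \<times> Y" for c p r
      using that D(3) E(3) cl(3) dl(3) by (auto simp add: polar_form_sum prod_scale_def algebra_simps)
    show "p = 0" if p: "p \<in> X \<times> Y" and 0: "\<And>r. r \<in> X \<times> Y \<Longrightarrow> polar (X \<times> Y) (form_sum f g) p r = 0" for p
    proof -
      obtain x y where xy: "p = (x, y)" "x \<in> X" "y \<in> Y" using p by auto
      have "polar X f x x' = 0" if "x' \<in> X" for x'
        using 0[of "(x', 0)"] that xy dl(1) polar_commute[OF xy(3) dl(1), of g] polar_zero[OF fd(2) nd(2)]
        by (simp add: polar_form_sum)
      then have "x = 0" using D(4)[OF xy(2)] by blast
      have "polar Y g y y' = 0" if "y' \<in> Y" for y'
        using 0[of "(0, y')"] that xy cl(1) polar_commute[OF xy(2) cl(1), of f] polar_zero[OF fd(1) nd(1)]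
        by (simp add: polar_form_sum)
      then have "y = 0" using E(4)[OF xy(3)] by blast
      then show ?thesis using xy(1) \<open>x = 0\<close> by (simp add: zero_prod_def)
    qed
    show "\<exists>p\<in>X \<times> Y. \<forall>r\<in>X \<times> Y. polar (X \<times> Y) (form_sum f g) p r = u r"
      if u: "u \<in> dual (prod_scale s s') (X \<times> Y)" for u
    proof -
      have lu: "linear_map (prod_scale s s') (X \<times> Y) (*) UNIV u" using u by (simp add: dual_def)
      interpret a: vector_space s by (rule fd_space_vector_space[OF fd(1)])
      interpret b: vector_space s' by (rule fd_space_vector_space[OF fd(2)])
      define v where "v x = (if x \<in> X then u (x, 0) else 0)" for x
      define w where "w y = (if y \<in> Y then u (0, y) else 0)" for y
      have "v \<in> dual s X"
        unfolding dual_def linear_map_def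
        using linear_map_add[OF lu, of "(_, 0)" "(_, 0)"] linear_map_scale[OF lu, of "(_, 0)"] cl dl
        by (auto simp add: v_def prod_scale_def)
      then obtain x where x: "x \<in> X" "polar X f x = v" using D(5) by blast
      have "w \<in> dual s' Y"
        unfolding dual_def linear_map_def
        using linear_map_add[OF lu, of "(0, _)" "(0, _)"] linear_map_scale[OF lu, of "(0, _)"] cl dl
        by (auto simp add: w_def prod_scale_def)
      then obtain y where y: "y \<in> Y" "polar Y g y = w" using E(5) by blast
      have "polar (X \<times> Y) (form_sum f g) (x, y) r = u r" if "r \<in> X \<times> Y" for r
      proof -
        obtain x' y' where r: "r = (x', y')" "x' \<in> X" "y' \<in> Y" using \<open>r \<in> X \<times> Y\<close> by auto
        have "u r = u (x', 0) + u (0, y')"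
          using linear_map_add[OF lu, of "(x', 0)" "(0, y')"] r cl(1) dl(1) by simp
        then show ?thesis using r x y by (simp add: polar_form_sum v_def w_def)
      qed
      then show ?thesis using x(1) y(1) by blast
    qed
  qed
  then show "quad (qsum A B)" "qdim (qsum A B) = qdim A + qdim B"
    using T by (simp_all add: A quad_def qsum_def qdim_def)
qed

lemma quad_neg: "quad A \<Longrightarrow> quad (qneg A)"
proof -
  assume q: "quad A"
  obtain s X f where A: "A = (s, X, f)" by (cases A)
  have fd: "fd_space s X" and nd: "nondegenerate_form s X f" using q by (simp_all add: A quad_def)
  note D = nondegenerate_formD[OF nd fd]
  have p: "polar X (- f) x y = - polar X f x y" for x y by (simp add: polar_def)
  have "nondegenerate_form s X (- f)"
  proof (rule nondegenerate_formI[OF fd])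
    show "\<exists>x\<in>X. \<forall>y\<in>X. polar X (- f) x y = u y" if u: "u \<in> dual s X" for u
    proof -
      obtain x where x: "x \<in> X" "polar X f x = u" using D(5)[OF u] by blast
      have "polar X (- f) (- x) y = u y" for y
      proof -
        interpret vector_space s by (rule fd_space_vector_space[OF fd])
        have "polar X f (- x) y = - polar X f x y" using D(3)[OF x(1), of "- 1" y] by simp
        then show ?thesis using x(2) by (simp add: p)
      qed
      then show ?thesis using fd_space_closed(5)[OF fd x(1)] by blast
    qed
  qed (use D(1-4) in \<open>simp_all add: p\<close>)
  then show "quad (qneg A)" using fd by (simp add: A quad_def qneg_def)
qed

lemma quad_line:
  assumes "CHAR('f::field) \<noteq> 2" "a \<noteq> 0" shows "quad (line (a :: 'f))"
proof -
  have two: "(2::'f) \<noteq> 0" by (rule two_nonzero[OF assms(1)])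
  have p: "polar UNIV (\<lambda>t. a * t\<^sup>2) x y = 2 * a * x * y" for x y
    by (simp add: polar_def power2_eq_square algebra_simps)
  have "nondegenerate_form (*) UNIV (\<lambda>t. a * t\<^sup>2)"
  proof (rule nondegenerate_formI[OF fd_space_field])
    show "x = 0" if "\<And>y. y \<in> UNIV \<Longrightarrow> polar UNIV (\<lambda>t. a * t\<^sup>2) x y = 0" for x
      using that[of 1] two assms(2) by (simp add: p)
    show "\<exists>x\<in>UNIV. \<forall>y\<in>UNIV. polar UNIV (\<lambda>t. a * t\<^sup>2) x y = u y" if u: "u \<in> dual (*) UNIV" for u
    proof -
      have uy: "u y = y * u 1" for y
      proof -
        have "u (y * 1) = y * u 1" using u unfolding dual_def linear_map_def by blast
        then show ?thesis by simp
      qed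
      have "polar UNIV (\<lambda>t. a * t\<^sup>2) (u 1 / (2 * a)) y = y * u 1" for y
        using two assms(2) by (simp add: p)
      then show ?thesis using uy by (metis UNIV_I)
    qed
  qed (simp_all add: p power_mult_distrib algebra_simps)
  then show ?thesis using fd_space_field by (simp add: quad_def line_def)
qed

section \<open>Hyperbolic spaces\<close>

lemma coord_space_0: "coord_space 0 = {0 :: nat \<Rightarrow> 'f::field}"
  by (auto simp add: coord_space_def)

lemma quad_hyp_0: "quad (hyp 0 :: ('f::field, nat \<Rightarrow> 'f) quad)"
proof -
  have fd: "fd_space fun_scale (coord_space 0 :: (nat \<Rightarrow> 'f) set)" by (rule fd_space_coord)
  have "nondegenerate_form fun_scale (coord_space 0) (hyperbolic 0 :: (nat \<Rightarrow> 'f) \<Rightarrow> 'f)"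
  proof (rule nondegenerate_formI[OF fd])
    fix u :: "(nat \<Rightarrow> 'f) \<Rightarrow> 'f" assume "u \<in> dual fun_scale (coord_space 0)"
    then have "u 0 = 0" using linear_map_zero[OF fd, of "(*)" UNIV u] by (simp add: dual_def)
    then show "\<exists>x\<in>coord_space 0. \<forall>y\<in>coord_space 0. polar (coord_space 0) (hyperbolic 0) x y = u y"
      by (simp add: coord_space_0 polar_def hyperbolic_def)
  qed (simp_all add: coord_space_0 polar_def hyperbolic_def)
  then show ?thesis using fd by (simp add: quad_def hyp_def)
qed

lemma qiso_zero_right: "quad A \<Longrightarrow> qiso A (qsum A (hyp 0))"
proof -
  assume q: "quad A"
  obtain s X f where A: "A = (s, X, f)" by (cases A)
  have "linear_iso s X (prod_scale s fun_scale) (X \<times> coord_space 0) (\<lambda>x. (x, 0))"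
    by (rule linear_isoI[where k = fst])
       (auto simp add: linear_map_def prod_scale_def coord_space_0 fun_scale_def fun_eq_iff)
  then have "qiso (s, X, f) (prod_scale s fun_scale, X \<times> coord_space 0, form_sum f (hyperbolic 0))"
    by (rule qisoI) (simp add: form_sum_def hyperbolic_def)
  then show ?thesis by (simp add: A qsum_def hyp_def)
qed

lemma qiso_zero_left: "quad A \<Longrightarrow> qiso A (qsum (hyp 0) A)"
  using qiso_trans[OF qiso_zero_right qiso_comm] .

lemma half_sum_diff:
  assumes "(2::'f::field) \<noteq> 0"
  shows "(x + y) / 2 + (x - y) / 2 = (x :: 'f)" "(x + y) / 2 - (x - y) / 2 = y"
    "(x + y + (x - y)) / 2 = x" "(x + y - (x - y)) / 2 = y"
proof -
  have e: "x + y + (x - y) = 2 * x" "x + y - (x - y) = 2 * y" unfolding mult_2 by simp_all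
  show 1: "(x + y + (x - y)) / 2 = x" "(x + y - (x - y)) / 2 = y" unfolding e using assms by simp_all
  show "(x + y) / 2 + (x - y) / 2 = x" by (simp only: add_divide_distrib[symmetric] 1(1))
  show "(x + y) / 2 - (x - y) / 2 = y" by (simp only: diff_divide_distrib[symmetric] 1(2))
qed

text \<open>The product xy is the square of (x+y)/2 minus the square of (x-y)/2. The pair split off
  is \<open>z n\<close>, \<open>z (2 * n + 1)\<close>; the remaining coordinates are renumbered
  because partners are now \<open>n\<close> apart instead of \<open>n + 1\<close>.\<close>

lemma qiso_hyp_Suc:
  assumes "CHAR('f::field) \<noteq> 2"
  shows "qiso (hyp (Suc n)) (qsum (hyp n) (qsum (line 1) (line (- 1 :: 'f))))"
proof -
  have two: "(2::'f) \<noteq> 0" by (rule two_nonzero[OF assms])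
  have h2: "(x + y) / 2 + (x - y) / 2 = x" "(x + y) / 2 - (x - y) / 2 = y" for x y :: 'f
    by (rule half_sum_diff[OF two])+
  define h :: "(nat \<Rightarrow> 'f) \<Rightarrow> (nat \<Rightarrow> 'f) \<times> ('f \<times> 'f)" where
    "h z = (\<lambda>i. if i < n then z i else if i < 2 * n then z (Suc i) else 0,
      ((z n + z (2 * n + 1)) / 2, (z n - z (2 * n + 1)) / 2))" for z
  define k :: "(nat \<Rightarrow> 'f) \<times> ('f \<times> 'f) \<Rightarrow> nat \<Rightarrow> 'f" where
    "k = (\<lambda>(x, (a, b)) i. if i < n then x i else if i = n then a + b else if i < 2 * n + 1 then x (i - 1)
      else if i = 2 * n + 1 then a - b else 0)"
  let ?Y = "(coord_space (2 * n) :: (nat \<Rightarrow> 'f) set) \<times> ((UNIV :: 'f set) \<times> (UNIV :: 'f set))"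
  have lin: "linear_map fun_scale (coord_space (2 * Suc n)) (prod_scale fun_scale (prod_scale (*) (*))) ?Y h"
    unfolding linear_map_def h_def
    by (auto simp add: coord_space_def prod_scale_def fun_scale_def fun_eq_iff add_divide_distrib
        diff_divide_distrib algebra_simps)
  have kY: "k p \<in> coord_space (2 * Suc n)" if "p \<in> ?Y" for p
    using that by (auto simp add: k_def coord_space_def)
  have kh: "k (h z) = z" if z: "z \<in> coord_space (2 * Suc n)" for z
  proof
    fix i
    consider "i < n" | "i = n" | "n < i" "i < 2 * n + 1" | "i = 2 * n + 1" | "i > 2 * n + 1" by linarith
    then show "k (h z) i = z i"
      by cases (use z h2 in \<open>auto simp add: k_def h_def coord_space_def\<close>)
  qed
  have hk: "h (k p) = p" if p: "p \<in> ?Y" for p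
  proof -
    obtain x a b where xab: "p = (x, (a, b))" "x \<in> coord_space (2 * n)" using p by auto
    have "(a + b + (a - b)) / 2 = a" "(a + b - (a - b)) / 2 = b"
      by (rule half_sum_diff[OF two])+
    then show ?thesis using xab by (auto simp add: k_def h_def coord_space_def fun_eq_iff)
  qed
  have iso: "linear_iso fun_scale (coord_space (2 * Suc n)) (prod_scale fun_scale (prod_scale (*) (*))) ?Y h"
    by (rule linear_isoI[where k = k, OF lin]) (use kY kh hk in blast)+
  have sq: "((x + y) / 2)\<^sup>2 - ((x - y) / 2)\<^sup>2 = x * y" for x y :: 'f
  proof -
    have "((x + y) / 2)\<^sup>2 - ((x - y) / 2)\<^sup>2 =
        ((x + y) / 2 + (x - y) / 2) * ((x + y) / 2 - (x - y) / 2)" by (simp add: power2_eq_square algebra_simps)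
    then show ?thesis by (simp only: h2)
  qed
  have "form_sum (hyperbolic n) (form_sum (\<lambda>t. 1 * t\<^sup>2) (\<lambda>t. - 1 * t\<^sup>2)) (h z) = hyperbolic (Suc n) z" for z
  proof -
    have "(\<Sum>i<n. (if i < n then z i else if i < 2 * n then z (Suc i) else 0) *
        (if i + n < n then z (i + n) else if i + n < 2 * n then z (Suc (i + n)) else 0)) =
        (\<Sum>i<n. z i * z (Suc (i + n)))"
      by (intro sum.cong) auto
    moreover have "Suc (n + n) = 2 * n + 1" by simp
    ultimately show ?thesis
      using sq[of "z n" "z (2 * n + 1)"] by (simp add: form_sum_def h_def hyperbolic_def mult_2)
  qed
  then show ?thesis unfolding hyp_def line_def qsum_def prod.case by (intro qisoI[OF iso]) simp
qed

text \<open>Nondegeneracy is transported from the sum of lines instead of being computed.\<close>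

lemma quad_hyp:
  assumes "CHAR('f::field) \<noteq> 2" shows "quad (hyp n :: ('f, nat \<Rightarrow> 'f) quad)"
proof (induction n)
  case (Suc n)
  have "quad (qsum (hyp n) (qsum (line 1) (line (- 1 :: 'f))))"
    using assms by (intro quad_sum Suc.IH quad_line) simp_all
  moreover have "qiso (qsum (hyp n) (qsum (line 1) (line (- 1 :: 'f)))) (hyp (Suc n))"
    using qiso_sym_fd[OF fd_space_coord qiso_hyp_Suc[OF assms, of n, unfolded hyp_def[of "Suc n"]]]
    unfolding hyp_def[of "Suc n"] .
  ultimately show ?case
    by (rule quad_iso(1)) (simp add: hyp_def vector_space_fun_scale)
qed (rule quad_hyp_0)

lemma qdim_hyp [simp]: "qdim (hyp n) = 2 * n"
  by (simp add: qdim_def hyp_def dim_coord)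

lemma qiso_hyp_add:
  assumes "CHAR('f::field) \<noteq> 2"
  shows "qiso (hyp (m + n) :: ('f, nat \<Rightarrow> 'f) quad) (qsum (hyp m) (hyp n))"
proof (induction n)
  case 0
  show ?case using qiso_zero_right[OF quad_hyp[OF assms], of m] by simp
next
  case (Suc n)
  let ?P = "qsum (line 1) (line (- 1 :: 'f))"
  have "qiso (hyp (m + Suc n)) (qsum (hyp (m + n)) ?P)" using qiso_hyp_Suc[OF assms, of "m + n"] by simp
  also have "qiso \<dots> (qsum (qsum (hyp m) (hyp n)) ?P)" by (rule qiso_sum[OF Suc.IH qiso_refl])
  also have "qiso \<dots> (qsum (hyp m) (qsum (hyp n) ?P))" by (rule qiso_assoc)
  also have "qiso \<dots> (qsum (hyp m) (hyp (Suc n)))"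
    by (rule qiso_sum[OF qiso_refl qiso_sym[OF quad_hyp[OF assms] qiso_hyp_Suc[OF assms]]])
  finally show ?case .
qed

section \<open>Reflections and Witt cancellation\<close>

lemma polar_scale_right:
  assumes "fd_space s X" "nondegenerate_form s X f" "x \<in> X" "y \<in> X"
  shows "polar X f x (s c y) = c * polar X f x y"
  using nondegenerate_formD(3)[OF assms(2,1,4), of c x] polar_commute[OF assms(3), of "s c y" f]
    polar_commute[OF assms(3,4), of f] fd_space_closed(3)[OF assms(1,4), of c] by simp

lemma form_add_polar: "x + y \<in> X \<Longrightarrow> y \<in> X \<Longrightarrow> f (x + y) = f x + f y + (polar X f x y :: 'f::field)"
  by (simp add: polar_def)

lemma polar_self:
  assumes "fd_space s X" "nondegenerate_form s X f" "x \<in> X"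
  shows "polar X f x x = 2 * f x"
proof -
  interpret vector_space s by (rule fd_space_vector_space[OF assms(1)])
  have "s 2 x = x + x" by (metis one_add_one scale_left_distrib scale_one)
  then have "f (x + x) = 2\<^sup>2 * f x" using nondegenerate_formD(1)[OF assms(2,1,3), of 2] by simp
  then show ?thesis using assms(3) by (simp add: polar_def)
qed

text \<open>The orthogonal reflection along \<open>v\<close>: since
  \<open>polar X f v v = 2 * f v\<close>, the customary factor 2 is hidden in the polar form. It
  reverses the pairing with \<open>v\<close>, so it is its own inverse.\<close>

lemma reflection_iso:
  assumes fd: "fd_space s X" and nd: "nondegenerate_form s X f" and v: "v \<in> X" "f v \<noteq> 0"
  defines "r \<equiv> \<lambda>x. x - s (polar X f x v / f v) v"
  shows "linear_iso s X s X r" "\<And>x. x \<in> X \<Longrightarrow> f (r x) = f x"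
proof -
  interpret vector_space s by (rule fd_space_vector_space[OF fd])
  note cl = fd_space_closed[OF fd] and D = nondegenerate_formD[OF nd fd]
  have rX: "r x \<in> X" if "x \<in> X" for x using that cl v(1) by (simp add: r_def)
  have pr: "polar X f (r x) v = - polar X f x v" if x: "x \<in> X" for x
  proof -
    let ?c = "- (polar X f x v / f v)"
    have "r x = x + s ?c v" by (simp add: r_def)
    then have "polar X f (r x) v = polar X f x v + ?c * polar X f v v"
      by (simp only: D(2)[OF x cl(3)[OF v(1)]] D(3)[OF v(1)])
    then show ?thesis using v(2) polar_self[OF fd nd v(1)] by simp
  qed
  have rr: "r (r x) = x" if "x \<in> X" for x
  proof -
    have e: "r y = y - s (polar X f y v / f v) v" for y by (simp only: r_def)
    have "r (r x) = r x + s (polar X f x v / f v) v"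
      unfolding e[of "r x"] pr[OF that] by simp
    then show ?thesis unfolding e[of x] by simp
  qed
  show "linear_iso s X s X r"
  proof (rule linear_isoI[where k = r])
    show "linear_map s X s X r"
      unfolding linear_map_def
    proof (intro conjI ballI allI)
      show "r ` X \<subseteq> X" using rX by blast
      show "r (x + y) = r x + r y" if "x \<in> X" "y \<in> X" for x y
        using D(2)[OF that] by (simp add: r_def add_divide_distrib scale_left_distrib)
      show "r (s c x) = s c (r x)" if "x \<in> X" for c x
        using D(3)[OF that] by (simp add: r_def scale_right_diff_distrib)
    qed
  qed (use rX rr in auto)
  show "f (r x) = f x" if x: "x \<in> X" for x
  proof -
    let ?c = "- (polar X f x v / f v)"
    have "r x = x + s ?c v" by (simp add: r_def)
    then have "f (r x) = f x + f (s ?c v) + polar X f x (s ?c v)"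
      using form_add_polar[of x "s ?c v" X f] cl x v(1) by simp
    also have "\<dots> = f x + (?c\<^sup>2 * f v + ?c * polar X f x v)"
      by (simp only: D(1)[OF v(1)] polar_scale_right[OF fd nd x v(1)] add.assoc)
    also have "?c\<^sup>2 * f v + ?c * polar X f x v = 0" using v(2) by (simp add: power2_eq_square)
    finally show ?thesis by simp
  qed
qed

text \<open>The values of \<open>f\<close> at \<open>u - w\<close> and \<open>u + w\<close> add up
  to \<open>4 * f w\<close>, so one of these vectors is anisotropic. The reflection along
  \<open>u - w\<close> takes \<open>u\<close> to \<open>w\<close>, the one along
  \<open>u + w\<close> takes it to \<open>- w\<close>.\<close>

lemma reflection_exists:
  assumes fd: "fd_space s X" and nd: "nondegenerate_form s X f" and ch: "CHAR('f::field) \<noteq> 2"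
    and u: "u \<in> X" "w \<in> X" "f u = f w" "f w \<noteq> (0 :: 'f)"
  shows "\<exists>r. linear_iso s X s X r \<and> (\<forall>x\<in>X. f (r x) = f x) \<and> (r u = w \<or> r u = - w)"
proof -
  interpret vector_space s by (rule fd_space_vector_space[OF fd])
  note cl = fd_space_closed[OF fd] and D = nondegenerate_formD[OF nd fd]
  have two: "(2::'f) \<noteq> 0" by (rule two_nonzero[OF ch])
  have *: "\<exists>r. linear_iso s X s X r \<and> (\<forall>x\<in>X. f (r x) = f x) \<and> r u = z"
    if z: "z \<in> X" "f z = f u" "f (u - z) \<noteq> 0" for z
  proof -
    have uz: "u - z \<in> X" using u(1) z(1) cl by blast
    have m: "polar X f u (- z) = - polar X f u z" using polar_scale_right[OF fd nd u(1) z(1), of "- 1"] by simp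
    have fm: "f (- z) = f z" using D(1)[OF z(1), of "- 1"] by simp
    have "f (u - z) = 2 * f u - polar X f u z"
      using form_add_polar[of u "- z" X f] uz cl(5)[OF z(1)] m fm z(2) by simp
    moreover have "polar X f u (u - z) = 2 * f u - polar X f u z"
    proof -
      have "polar X f u (u - z) = polar X f (u - z) u" by (rule polar_commute[OF u(1) uz])
      also have "\<dots> = polar X f u u + polar X f (- z) u" using D(2)[OF u(1) cl(5)[OF z(1)], of u] by simp
      also have "polar X f (- z) u = polar X f u (- z)" by (rule polar_commute[OF cl(5)[OF z(1)] u(1)])
      finally show ?thesis using m polar_self[OF fd nd u(1)] by simp
    qed
    ultimately have "u - s (polar X f u (u - z) / f (u - z)) (u - z) = z" using z(3) by simp
    then show ?thesis using reflection_iso[OF fd nd uz z(3)] by blast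
  qed
  show ?thesis
  proof (cases "f (u - w) = 0")
    case False
    then show ?thesis using *[OF u(2)] u(3) by auto
  next
    case True
    have fm: "f (- w) = f w" using D(1)[OF u(2), of "- 1"] by simp
    have m: "polar X f u (- w) = - polar X f u w" using polar_scale_right[OF fd nd u(1,2), of "- 1"] by simp
    have "f (u - w) = f u + f w - polar X f u w"
      using form_add_polar[of u "- w" X f] cl(4)[OF u(1,2)] cl(5)[OF u(2)] m fm by simp
    moreover have "f (u - - w) = f u + f w + polar X f u w"
      using form_add_polar[of u w X f] cl(2)[OF u(1,2)] u(2) by simp
    ultimately have "f (u - - w) = 2 * (2 * f w)" using True u(3) by (simp add: algebra_simps)
    then have "f (u - - w) \<noteq> 0" using two u(4) by (simp only: mult_eq_0_iff) simp
    then show ?thesis using *[OF cl(5)[OF u(2)]] fm u(3) by auto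
  qed
qed

text \<open>A reflection moves the image of \<open>(0, 1)\<close> to \<open>(0, 1)\<close> or \<open>- (0, 1)\<close>, so that the isometry
  respects the orthogonal complements of the two lines.\<close>

lemma cancel_line:
  assumes ch: "CHAR('f::field) \<noteq> 2" and a: "a \<noteq> (0 :: 'f)"
    and q: "quad A" "quad B" and iso: "qiso (qsum A (line a)) (qsum B (line a))"
  shows "qiso A B"
proof -
  obtain s X f s' Y g where A: "A = (s, X, f)" "B = (s', Y, g)" by (cases A, cases B)
  have two: "(2::'f) \<noteq> 0" by (rule two_nonzero[OF ch])
  have fd: "fd_space s X" "fd_space s' Y" and nd: "nondegenerate_form s X f" "nondegenerate_form s' Y g"
    using q by (auto simp add: A quad_def)
  note cX = fd_space_closed[OF fd(1)] and cY = fd_space_closed[OF fd(2)]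
  interpret VX: vector_space s by (rule fd_space_vector_space[OF fd(1)])
  interpret VY: vector_space s' by (rule fd_space_vector_space[OF fd(2)])
  let ?l = "\<lambda>t :: 'f. a * t\<^sup>2"
  let ?sX = "prod_scale s (*)" and ?VX = "X \<times> (UNIV :: 'f set)" and ?f = "form_sum f ?l"
  let ?sY = "prod_scale s' (*)" and ?VY = "Y \<times> (UNIV :: 'f set)" and ?g = "form_sum g ?l"
  have qY: "quad (?sY, ?VY, ?g)" "quad (?sX, ?VX, ?f)"
    using quad_sum(1)[OF q(2) quad_line[OF ch a]] quad_sum(1)[OF q(1) quad_line[OF ch a]]
    by (simp_all add: A qsum_def line_def)
  note fY = quad_fd[OF qY(1)] and nY = quad_nondeg[OF qY(1)] and fX = quad_fd[OF qY(2)]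
  have f0: "f 0 = 0" "g 0 = 0"
    using nondegenerate_formD(1)[OF nd(1) fd(1) cX(1), of 0] nondegenerate_formD(1)[OF nd(2) fd(2) cY(1), of 0]
    by simp_all
  obtain h where h: "linear_iso ?sX ?VX ?sY ?VY h" "\<forall>p\<in>?VX. ?g (h p) = ?f p"
    using iso unfolding A qsum_def line_def prod.case by (rule qisoE)
  have w: "(0, 1) \<in> ?VY" "?g (0, 1) = a" using cY(1) f0 by (auto simp add: form_sum_def)
  have e: "(0, 1) \<in> ?VX" "?f (0, 1) = a" using cX(1) f0 by (auto simp add: form_sum_def)
  have u: "h (0, 1) \<in> ?VY" "?g (h (0, 1)) = a"
    using linear_map_mem[OF linear_iso_map[OF h(1)] e(1)] h(2) e by auto
  obtain r where r: "linear_iso ?sY ?VY ?sY ?VY r" "\<forall>p\<in>?VY. ?g (r p) = ?g p"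
    "r (h (0, 1)) = (0, 1) \<or> r (h (0, 1)) = - (0, 1)"
    using reflection_exists[OF fY nY ch u(1) w(1)] u(2) w(2) a by auto
  define k where "k p = r (h p)" for p
  have k: "linear_iso ?sX ?VX ?sY ?VY k" unfolding k_def by (rule linear_iso_comp[OF h(1) r(1)])
  have km: "linear_map ?sX ?VX ?sY ?VY k" by (rule linear_iso_map[OF k])
  have kg: "?g (k p) = ?f p" if "p \<in> ?VX" for p
    unfolding k_def
    using bspec[OF r(2) linear_map_mem[OF linear_iso_map[OF h(1)] that]] bspec[OF h(2) that] by simp
  obtain c where c: "k (0, 1) = (0, c)" "c = 1 \<or> c = - 1"
    using r(3) unfolding k_def by (auto simp add: uminus_prod_def)
  \<comment> \<open>Pairing with \<open>(0, 1)\<close> and with its image \<open>(0, c)\<close>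
    shows that \<open>k\<close> respects the second coordinate up to the sign
    \<open>c\<close>.\<close>
  have snd: "c * snd (k (x, t)) = t" if x: "x \<in> X" for x t
  proof -
    obtain y t' where y: "k (x, t) = (y, t')" "y \<in> Y"
      using linear_map_mem[OF km, of "(x, t)"] x by auto
    have pl: "polar UNIV ?l b d = 2 * a * b * d" for b d
      by (simp add: polar_def power2_eq_square algebra_simps)
    have "polar ?VY ?g (k (x, t)) (k (0, 1)) = polar ?VX ?f (x, t) (0, 1)"
      by (rule polar_iso[where g = ?g, OF km]) (use kg x cX in auto)
    then have "polar Y g y 0 + 2 * a * t' * c = polar X f x 0 + 2 * a * t * 1"
      unfolding y(1) c(1) using y(2) x cX(1) cY(1) by (simp add: polar_form_sum pl)
    moreover have "polar Y g y 0 = 0" "polar X f x 0 = 0" using f0 by (simp_all add: polar_def)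
    ultimately have "t' * c = t" using two a by (simp add: mult.assoc)
    then show ?thesis using y(1) by (simp add: mult.commute)
  qed
  define h' where "h' x = fst (k (x, 0))" for x
  have k0: "k (x, 0) = (h' x, 0)" if "x \<in> X" for x
  proof -
    have "c * snd (k (x, 0)) = 0" by (rule snd[OF that])
    then have "snd (k (x, 0)) = 0" using c(2) by auto
    then show ?thesis by (simp add: h'_def prod_eq_iff)
  qed
  have h'Y: "h' x \<in> Y" if "x \<in> X" for x
    using linear_map_mem[OF km, of "(x, 0)"] that by (simp add: h'_def mem_Times_iff)
  have bij: "inj_on k ?VX" "k ` ?VX = ?VY" using linear_iso_bij[OF k] by (simp_all add: bij_betw_def)
  have "linear_iso s X s' Y h'"
    unfolding linear_iso_def
  proof
    show "linear_map s X s' Y h'"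
      unfolding linear_map_def
    proof (intro conjI ballI allI)
      show "h' ` X \<subseteq> Y" using h'Y by blast
      show "h' (x + y) = h' x + h' y" if "x \<in> X" "y \<in> X" for x y
        using linear_map_add[OF km, of "(x, 0)" "(y, 0)"] that by (simp add: h'_def)
      show "h' (s d x) = s' d (h' x)" if "x \<in> X" for d x
        using linear_map_scale[OF km, of "(x, 0)" d] that k0[OF that] k0[OF cX(3)[OF that]]
        by (simp add: prod_scale_def)
    qed
    show "bij_betw h' X Y"
      unfolding bij_betw_def
    proof
      show "inj_on h' X"
      proof (rule inj_onI)
        fix x x' assume "x \<in> X" "x' \<in> X" "h' x = h' x'"
        then have "k (x, 0) = k (x', 0)" using k0 by simp
        then show "x = x'" using bij(1) \<open>x \<in> X\<close> \<open>x' \<in> X\<close> unfolding inj_on_def by blast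
      qed
      show "h' ` X = Y"
      proof
        show "h' ` X \<subseteq> Y" using h'Y by blast
        show "Y \<subseteq> h' ` X"
        proof
          fix y assume "y \<in> Y"
          then have "(y, 0) \<in> k ` ?VX" using bij(2) by blast
          then obtain x t where x: "x \<in> X" "k (x, t) = (y, 0)" by auto
          then have "t = 0" using snd[OF x(1), of t] by simp
          then show "y \<in> h' ` X" using x k0[OF x(1)] by auto
        qed
      qed
    qed
  qed
  moreover have "g (h' x) = f x" if "x \<in> X" for x
    using kg[of "(x, 0)"] that k0[OF that] by (simp add: form_sum_def)
  ultimately show ?thesis unfolding A by (rule qisoI)
qed

text \<open>A hyperbolic plane is a sum of two lines, which are cancelled one after the
  other.\<close>

lemma cancel_hyp:
  assumes ch: "CHAR('f::field) \<noteq> 2" and q: "quad A" "quad (B :: ('f, _) quad)"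
    and "qiso (qsum A (hyp n)) (qsum B (hyp n))"
  shows "qiso A B"
  using assms(4)
proof (induction n)
  case 0
  have "qiso A (qsum A (hyp 0))" by (rule qiso_zero_right[OF q(1)])
  also note 0
  also have "qiso (qsum B (hyp 0)) B" by (rule qiso_sym[OF q(2) qiso_zero_right[OF q(2)]])
  finally show ?case .
next
  case (Suc n)
  let ?P = "qsum (line 1) (line (- 1 :: 'f))"
  have qh: "quad (hyp m :: ('f, _) quad)" for m by (rule quad_hyp[OF ch])
  have ql: "quad (line (1 :: 'f))" "quad (line (- 1 :: 'f))" by (simp_all add: quad_line ch)
  note qA = quad_sum(1)[OF q(1) qh[of n]] and qB = quad_sum(1)[OF q(2) qh[of n]]
  have split: "qiso (qsum C (hyp (Suc n))) (qsum (qsum (qsum C (hyp n)) (line 1)) (line (- 1 :: 'f)))"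
    for C :: "('f, 'c::ab_group_add) quad"
  proof -
    have "qiso (qsum C (hyp (Suc n))) (qsum C (qsum (hyp n) ?P))"
      by (rule qiso_sum[OF qiso_refl qiso_hyp_Suc[OF ch]])
    also have "qiso \<dots> (qsum (qsum C (hyp n)) ?P)" by (rule qiso_assoc')
    also have "qiso \<dots> (qsum (qsum (qsum C (hyp n)) (line 1)) (line (- 1 :: 'f)))" by (rule qiso_assoc')
    finally show ?thesis .
  qed
  have "qiso (qsum (qsum (qsum A (hyp n)) (line 1)) (line (- 1 :: 'f))) (qsum A (hyp (Suc n)))"
    by (rule qiso_sym[OF quad_sum(1)[OF q(1) qh] split])
  also note Suc.prems
  also have "qiso (qsum B (hyp (Suc n))) (qsum (qsum (qsum B (hyp n)) (line 1)) (line (- 1 :: 'f)))"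
    by (rule split)
  finally have "qiso (qsum (qsum A (hyp n)) (line 1)) (qsum (qsum B (hyp n)) (line (1 :: 'f)))"
    by (rule cancel_line[OF ch _ quad_sum(1)[OF qA ql(1)] quad_sum(1)[OF qB ql(1)], rotated]) simp
  then have "qiso (qsum A (hyp n)) (qsum B (hyp n))"
    by (rule cancel_line[OF ch _ qA qB, rotated]) simp
  then show ?case by (rule Suc.IH)
qed

text \<open>With \<open>B\<close> the polar form, \<open>f x - f y = B ((x + y) / 2) (x - y)\<close>: the coordinates of
  \<open>(x + y) / 2\<close> and the values \<open>B (unit_vec i) (x - y)\<close> are hyperbolic coordinates.\<close>

lemma qiso_neg_sum:
  assumes ch: "CHAR('f::field) \<noteq> 2" and q: "quad (fun_scale, coord_space n, f :: (nat \<Rightarrow> 'f) \<Rightarrow> 'f)"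
  shows "qiso (qsum (fun_scale, coord_space n, f) (qneg (fun_scale, coord_space n, f))) (hyp n)"
proof -
  let ?X = "coord_space n :: (nat \<Rightarrow> 'f) set"
  have two: "(2::'f) \<noteq> 0" by (rule two_nonzero[OF ch])
  have fd: "fd_space fun_scale ?X" and nd: "nondegenerate_form fun_scale ?X f"
    using q by (simp_all add: quad_def)
  interpret vector_space "fun_scale :: 'f \<Rightarrow> (nat \<Rightarrow> 'f) \<Rightarrow> _" by (rule vector_space_fun_scale)
  note cl = fd_space_closed[OF fd] and D = nondegenerate_formD[OF nd fd]
  let ?B = "polar ?X f"
  have Bsum: "?B x y = (\<Sum>i<n. x i * ?B (unit_vec i) y)" if x: "x \<in> ?X" and y: "y \<in> ?X" for x y
  proof -
    have lin: "linear_map fun_scale ?X (*) UNIV (\<lambda>x. ?B x y)"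
      using D(2,3) by (simp add: linear_map_def)
    have "?B x y = ?B (\<Sum>i<n. fun_scale (x i) (unit_vec i)) y"
      using coord_space_expand[OF x] by simp
    also have "\<dots> = (\<Sum>i<n. ?B (fun_scale (x i) (unit_vec i)) y)"
      by (rule linear_map_sum[OF fd lin]) (auto intro: cl(3) unit_vec_coord)
    also have "\<dots> = (\<Sum>i<n. x i * ?B (unit_vec i) y)"
      by (intro sum.cong refl D(3) unit_vec_coord) simp
    finally show ?thesis .
  qed
  have Badd: "?B x (y + z) = ?B x y + ?B x z" if "x \<in> ?X" "y \<in> ?X" "z \<in> ?X" for x y z
    using D(2)[OF that(2,3), of x] polar_commute[OF that(1)] that cl(2)[OF that(2,3)] by metis
  have Bsc: "?B x (fun_scale c y) = c * ?B x y" if "x \<in> ?X" "y \<in> ?X" for c x y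
    by (rule polar_scale_right[OF fd nd that])
  have Bdiff: "?B x (y - z) = ?B x y - ?B x z" if "x \<in> ?X" "y \<in> ?X" "z \<in> ?X" for x y z
    using Badd[OF that(1) cl(4)[OF that(2,3)] that(3)] by simp
  define h :: "(nat \<Rightarrow> 'f) \<times> (nat \<Rightarrow> 'f) \<Rightarrow> nat \<Rightarrow> 'f" where
    "h = (\<lambda>(x, y) i. if i < n then (x i + y i) / 2 else if i < 2 * n then ?B (unit_vec (i - n)) (x - y) else 0)"
  have lin: "linear_map (prod_scale fun_scale fun_scale) (?X \<times> ?X) fun_scale (coord_space (2 * n)) h"
    unfolding linear_map_def
  proof (intro conjI ballI allI)
    show "h ` (?X \<times> ?X) \<subseteq> coord_space (2 * n)" by (auto simp add: h_def coord_space_def)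
    show "h (p + p') = h p + h p'" if p: "p \<in> ?X \<times> ?X" "p' \<in> ?X \<times> ?X" for p p'
    proof
      obtain x y x' y' where xy: "p = (x, y)" "p' = (x', y')" "x \<in> ?X" "y \<in> ?X" "x' \<in> ?X" "y' \<in> ?X"
        using p by auto
      fix i
      have "?B (unit_vec (i - n)) ((x + x') - (y + y')) =
          ?B (unit_vec (i - n)) (x - y) + ?B (unit_vec (i - n)) (x' - y')" if "\<not> i < n" "i < 2 * n"
      proof -
        have "(x + x') - (y + y') = (x - y) + (x' - y')" by simp
        moreover have "(unit_vec (i - n) :: nat \<Rightarrow> 'f) \<in> ?X" using that by (intro unit_vec_coord) simp
        ultimately show ?thesis using Badd cl(4) xy by metis
      qed
      then show "h (p + p') i = (h p + h p') i"
        by (simp add: h_def xy add_divide_distrib)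
    qed
    show "h (prod_scale fun_scale fun_scale c p) = fun_scale c (h p)" if p: "p \<in> ?X \<times> ?X" for c p
    proof
      obtain x y where xy: "p = (x, y)" "x \<in> ?X" "y \<in> ?X" using p by auto
      fix i
      have "?B (unit_vec (i - n)) (fun_scale c x - fun_scale c y) = c * ?B (unit_vec (i - n)) (x - y)"
        if "\<not> i < n" "i < 2 * n"
      proof -
        have "fun_scale c x - fun_scale c y = fun_scale c (x - y)" by (simp add: scale_right_diff_distrib)
        moreover have "(unit_vec (i - n) :: nat \<Rightarrow> 'f) \<in> ?X" using that by (intro unit_vec_coord) simp
        ultimately show ?thesis using Bsc cl(4) xy by metis
      qed
      moreover have "fun_scale c z i = c * z i" for z :: "nat \<Rightarrow> 'f" by (simp add: fun_scale_def)
      ultimately show "h (prod_scale fun_scale fun_scale c p) i = fun_scale c (h p) i"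
        by (simp add: h_def xy prod_scale_def distrib_left)
    qed
  qed
  have iso: "linear_iso (prod_scale fun_scale fun_scale) (?X \<times> ?X) fun_scale (coord_space (2 * n)) h"
    unfolding linear_iso_def bij_betw_def
  proof (intro conjI lin)
    show "inj_on h (?X \<times> ?X)"
    proof (rule inj_onI)
      fix p p' assume p: "p \<in> ?X \<times> ?X" "p' \<in> ?X \<times> ?X" "h p = h p'"
      obtain x y x' y' where xy: "p = (x, y)" "p' = (x', y')" "x \<in> ?X" "y \<in> ?X" "x' \<in> ?X" "y' \<in> ?X"
        using p by auto
      have s: "x i + y i = x' i + y' i" for i
      proof (cases "i < n")
        case True
        then have "(x i + y i) * 2 = (x' i + y' i) * 2"
          using fun_cong[OF p(3), of i] two by (simp add: h_def xy distrib_right)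
        then show ?thesis using two by (metis mult_cancel_right)
      qed (use xy in \<open>auto simp add: coord_space_def\<close>)
      let ?d = "(x - y) - (x' - y')"
      have d: "x - y \<in> ?X" "x' - y' \<in> ?X" "?d \<in> ?X" using xy cl(4) by blast+
      have "?B (unit_vec i) ?d = 0" if "i < n" for i
        using fun_cong[OF p(3), of "n + i"] that Bdiff[OF unit_vec_coord[OF that] d(1,2)] by (simp add: h_def xy)
      then have "?B ?d z = 0" if "z \<in> ?X" for z
        using Bsum[OF that d(3)] polar_commute[OF d(3) that, of f] by simp
      then have "?d = 0" using D(4)[OF d(3)] by blast
      then have t: "x i - y i = x' i - y' i" for i by (metis eq_iff_diff_eq_0 fun_diff_def)
      have "x i = x' i" for i
      proof -
        have "2 * x i = (x i + y i) + (x i - y i)" by simp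
        also have "\<dots> = 2 * x' i" unfolding s t by simp
        finally show ?thesis using two by simp
      qed
      moreover have "y i = y' i" for i using s[of i] calculation[of i] by simp
      ultimately show "p = p'" by (simp add: xy fun_eq_iff)
    qed
    show "h ` (?X \<times> ?X) = coord_space (2 * n)"
    proof
      show "h ` (?X \<times> ?X) \<subseteq> coord_space (2 * n)" by (auto simp add: h_def coord_space_def)
      show "coord_space (2 * n) \<subseteq> h ` (?X \<times> ?X)"
      proof
        fix z :: "nat \<Rightarrow> 'f" assume z: "z \<in> coord_space (2 * n)"
        \<comment> \<open>The first half of \<open>z\<close> prescribes the half-sum
          \<open>a\<close>, the second half a functional which nondegeneracy realizes as pairing
          with some \<open>d\<close>. The preimage is the pair of vectors with half-sum
          \<open>a\<close> and difference \<open>d\<close>.\<close>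
        define a where "a = (\<lambda>i. if i < n then z i else 0)"
        define u where "u x = (if x \<in> ?X then \<Sum>i<n. x i * z (n + i) else 0)" for x
        have "u \<in> dual fun_scale ?X"
          unfolding dual_def linear_map_def
          using cl by (auto simp add: u_def fun_scale_def distrib_right sum.distrib sum_distrib_left mult.assoc)
        then obtain d where d: "d \<in> ?X" "?B d = u" using D(5) by blast
        have aX: "a \<in> ?X" by (simp add: a_def coord_space_def)
        let ?e = "fun_scale (1 / 2) d"
        have eX: "?e \<in> ?X" by (rule cl(3)[OF d(1)])
        have de: "(a + ?e) - (a - ?e) = d"
          using two by (auto simp add: fun_eq_iff fun_scale_def field_simps)
        have "h (a + ?e, a - ?e) = z"
        proof
          fix i
          consider "i < n" | "n \<le> i" "i < 2 * n" | "i \<ge> 2 * n" by linarith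
          then show "h (a + ?e, a - ?e) i = z i"
          proof cases
            case 1
            then have "h (a + ?e, a - ?e) i = (2 * z i) / 2"
              by (simp add: h_def a_def fun_scale_def)
            then show ?thesis using two by simp
          next
            case 2
            then have ui: "unit_vec (i - n) \<in> ?X" by (intro unit_vec_coord) simp
            have "h (a + ?e, a - ?e) i = ?B (unit_vec (i - n)) d" using 2 by (simp add: h_def de)
            also have "\<dots> = u (unit_vec (i - n))" using polar_commute[OF ui d(1), of f] d(2) by simp
            also have "\<dots> = (\<Sum>j<n. unit_vec (i - n) j * z (n + j))"
              using ui by (simp add: u_def)
            also have "\<dots> = (\<Sum>j<n. if j = i - n then z (n + j) else 0)"
              by (intro sum.cong) (auto simp add: unit_vec_def)
            also have "\<dots> = z i" using 2 by simp
            finally show ?thesis .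
          next
            case 3
            then show ?thesis using z by (simp add: h_def coord_space_def)
          qed
        qed
        moreover have "(a + ?e, a - ?e) \<in> ?X \<times> ?X" using aX eX cl by blast
        ultimately show "z \<in> h ` (?X \<times> ?X)" by (metis imageI)
      qed
    qed
  qed
  have "hyperbolic n (h p) = form_sum f (- f) p" if p: "p \<in> ?X \<times> ?X" for p
  proof -
    obtain x y where xy: "p = (x, y)" "x \<in> ?X" "y \<in> ?X" using p by auto
    let ?a = "fun_scale (1 / 2) (x + y)"
    have X: "x + y \<in> ?X" "x - y \<in> ?X" "?a \<in> ?X" using xy cl by blast+
    have "hyperbolic n (h p) = (\<Sum>i<n. ?a i * ?B (unit_vec i) (x - y))"
      unfolding hyperbolic_def by (intro sum.cong) (auto simp add: h_def xy fun_scale_def)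
    also have "\<dots> = ?B ?a (x - y)" using Bsum[OF X(3,2)] by simp
    also have "\<dots> = 1 / 2 * (?B x (x - y) + ?B y (x - y))"
      using D(3)[OF X(1)] D(2)[OF xy(2,3)] by simp
    also have "\<dots> = 1 / 2 * (?B x x - ?B y y)"
      using Bdiff xy polar_commute[OF xy(2,3), of f] by simp
    also have "\<dots> = f x - f y"
      unfolding polar_self[OF fd nd xy(2)] polar_self[OF fd nd xy(3)] right_diff_distrib[symmetric]
      using two by simp
    finally show ?thesis by (simp add: form_sum_def xy)
  qed
  then show ?thesis unfolding qneg_def qsum_def hyp_def prod.case by (intro qisoI[OF iso])
qed

section \<open>Stable isometry and Witt equivalence\<close>

definition weq :: "('f::field, 'v::ab_group_add) quad \<Rightarrow> ('f, 'w::ab_group_add) quad \<Rightarrow> bool" where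
  "weq A B \<longleftrightarrow> (\<exists>m n. qiso (qsum A (hyp m)) (qsum B (hyp n)))"

lemma weqI: "qiso (qsum A (hyp m)) (qsum B (hyp n)) \<Longrightarrow> weq A B"
  unfolding weq_def by blast

lemma weq_iso: "qiso A B \<Longrightarrow> weq A B"
  by (rule weqI[of _ 0 _ 0]) (rule qiso_sum[OF _ qiso_refl])

lemma weq_sym:
  assumes "CHAR('f::field) \<noteq> 2" "quad (A :: ('f, 'v::ab_group_add) quad)" "weq A B" shows "weq B A"
proof -
  obtain m n where "qiso (qsum A (hyp m)) (qsum B (hyp n))" using assms(3) unfolding weq_def by blast
  from qiso_sym[OF quad_sum(1)[OF assms(2) quad_hyp[OF assms(1)]] this] show ?thesis by (rule weqI)
qed

lemma qiso_qsum_hyp_add: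
  assumes "CHAR('f::field) \<noteq> 2"
  shows "qiso (qsum A (hyp (m + n))) (qsum (qsum (A :: ('f, _) quad) (hyp m)) (hyp n))"
  using qiso_trans[OF qiso_sum[OF qiso_refl qiso_hyp_add[OF assms]] qiso_assoc'] .

text \<open>Adding \<open>hyp k\<close> to the first isometry and \<open>hyp n\<close> to the second
  makes the middle terms agree up to the order of the summands; no cancellation is involved.\<close>

lemma weq_trans:
  assumes ch: "CHAR('f::field) \<noteq> 2" and q: "quad (A :: ('f, 'v::ab_group_add) quad)" "quad B" "quad C"
    and "weq A B" "weq B C"
  shows "weq A C"
proof -
  have qh: "quad (hyp m :: ('f, _) quad)" for m by (rule quad_hyp[OF ch])
  obtain m n where 1: "qiso (qsum A (hyp m)) (qsum B (hyp n))" using assms(5) unfolding weq_def by blast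
  obtain k l where 2: "qiso (qsum B (hyp k)) (qsum C (hyp l))" using assms(6) unfolding weq_def by blast
  have "qiso (qsum A (hyp (m + k))) (qsum (qsum A (hyp m)) (hyp k))" by (rule qiso_qsum_hyp_add[OF ch])
  also have "qiso \<dots> (qsum (qsum B (hyp n)) (hyp k))" by (rule qiso_sum[OF 1 qiso_refl])
  also have "qiso \<dots> (qsum (qsum B (hyp k)) (hyp n))" by (rule qiso_swap_right)
  also have "qiso \<dots> (qsum (qsum C (hyp l)) (hyp n))" by (rule qiso_sum[OF 2 qiso_refl])
  also have "qiso \<dots> (qsum C (hyp (l + n)))"
    by (rule qiso_sym[OF quad_sum(1)[OF q(3) qh] qiso_qsum_hyp_add[OF ch]])
  finally show ?thesis by (rule weqI)
qed

lemma weq_sum: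
  assumes ch: "CHAR('f::field) \<noteq> 2" and q: "quad (A' :: ('f, _) quad)" "quad B'"
    and "weq A A'" "weq B B'"
  shows "weq (qsum A B) (qsum A' (B' :: ('f, _) quad))"
proof -
  have qh: "quad (hyp m :: ('f, _) quad)" for m by (rule quad_hyp[OF ch])
  obtain m n where 1: "qiso (qsum A (hyp m)) (qsum A' (hyp n))" using assms(4) unfolding weq_def by blast
  obtain k l where 2: "qiso (qsum B (hyp k)) (qsum B' (hyp l))" using assms(5) unfolding weq_def by blast
  have split: "qiso (qsum (qsum C D) (hyp (i + j))) (qsum (qsum C (hyp i)) (qsum D (hyp j)))"
    for C :: "('f, 'cc::ab_group_add) quad" and D :: "('f, 'dd::ab_group_add) quad" and i j
    using qiso_trans[OF qiso_sum[OF qiso_refl qiso_hyp_add[OF ch]] qiso_interchange] .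
  have "qiso (qsum (qsum A B) (hyp (m + k))) (qsum (qsum A (hyp m)) (qsum B (hyp k)))" by (rule split)
  also have "qiso \<dots> (qsum (qsum A' (hyp n)) (qsum B' (hyp l)))" by (rule qiso_sum[OF 1 2])
  also have "qiso \<dots> (qsum (qsum A' B') (hyp (n + l)))"
    by (rule qiso_sym[OF quad_sum(1)[OF quad_sum(1)[OF q] qh] split])
  finally show ?thesis by (rule weqI)
qed

text \<open>With stabilizing ranks 0 and \<open>n\<close> the claim becomes commutativity of the
  sum.\<close>

lemma weq_hyp:
  assumes "CHAR('f::field) \<noteq> 2" shows "weq (hyp n) (hyp 0 :: ('f, _) quad)"
  by (rule weqI[of _ 0 _ n]) (rule qiso_comm)

text \<open>From a stable isometry the smaller of the two hyperbolic summands is cancelled; equality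
  of dimensions then shows that the remaining rank is the one prescribed by
  \<open>witt_equiv\<close>.\<close>

lemma witt_equiv_iff_weq:
  assumes ch: "CHAR('f::field) \<noteq> 2"
    and q: "quad (s :: 'f \<Rightarrow> _, X, f)" "quad (s', Y, g)"
  shows "witt_equiv s X f s' Y g \<longleftrightarrow> weq (s, X, f) (s', Y, g)"
proof
  have iso: "isometric t Z e t' W d \<longleftrightarrow> qiso (t, Z, e) (t', W, d)"
    for t :: "'f \<Rightarrow> 'x::ab_group_add \<Rightarrow> 'x" and Z e and t' :: "'f \<Rightarrow> 'y::ab_group_add \<Rightarrow> 'y" and W d
    by (simp add: qiso_def)
  assume "witt_equiv s X f s' Y g"
  then obtain n where "isometric s X f (prod_scale s' fun_scale) (Y \<times> coord_space (2 * n)) (form_sum g (hyperbolic n)) \<or>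
      isometric s' Y g (prod_scale s fun_scale) (X \<times> coord_space (2 * n)) (form_sum f (hyperbolic n))"
    unfolding witt_equiv_def by blast
  then consider "qiso (s, X, f) (qsum (s', Y, g) (hyp n))" | "qiso (s', Y, g) (qsum (s, X, f) (hyp n))"
    by (auto simp add: qiso_def qsum_def hyp_def)
  then show "weq (s, X, f) (s', Y, g)"
  proof cases
    case 1
    have "qiso (qsum (s, X, f) (hyp 0)) (s, X, f)" by (rule qiso_sym[OF q(1) qiso_zero_right[OF q(1)]])
    from qiso_trans[OF this 1] show ?thesis by (rule weqI)
  next
    case 2
    have "qiso (qsum (s', Y, g) (hyp 0)) (s', Y, g)" by (rule qiso_sym[OF q(2) qiso_zero_right[OF q(2)]])
    from weqI[OF qiso_trans[OF this 2]] show ?thesis by (rule weq_sym[OF ch q(2)])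
  qed
next
  let ?A = "(s, X, f)" and ?B = "(s', Y, g)"
  have qh: "quad (hyp m :: ('f, _) quad)" for m by (rule quad_hyp[OF ch])
  assume "weq ?A ?B"
  then obtain m n where 1: "qiso (qsum ?A (hyp m)) (qsum ?B (hyp n))" unfolding weq_def by blast
  have "vector_space (fst (qsum ?B (hyp n)))"
    using quad_fd[of "fst (qsum ?B (hyp n))" "fst (snd (qsum ?B (hyp n)))" "snd (snd (qsum ?B (hyp n)))"]
      quad_sum(1)[OF q(2) qh[of n]] fd_space_vector_space by auto
  from quad_iso(2)[OF quad_sum(1)[OF q(1) qh] 1 this]
  have dim: "qdim ?B + 2 * n = qdim ?A + 2 * m"
    using quad_sum(2)[OF q(1) qh[of m]] quad_sum(2)[OF q(2) qh[of n]] by simp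
  have red: "qiso C (qsum D (hyp (j - i)))"
    if "i \<le> j" "quad C" "quad D" "qiso (qsum C (hyp i)) (qsum D (hyp j))"
    for C :: "('f, 'cc::ab_group_add) quad" and D :: "('f, 'dd::ab_group_add) quad" and i j
  proof (rule cancel_hyp[OF ch that(2) quad_sum(1)[OF that(3) qh]])
    have "qiso (qsum D (hyp j)) (qsum (qsum D (hyp (j - i))) (hyp i))"
      using qiso_qsum_hyp_add[OF ch, of D "j - i" i] that(1) by simp
    from qiso_trans[OF that(4) this] show "qiso (qsum C (hyp i)) (qsum (qsum D (hyp (j - i))) (hyp i))" .
  qed
  have 2: "qiso (qsum ?B (hyp n)) (qsum ?A (hyp m))" by (rule qiso_sym[OF quad_sum(1)[OF q(1) qh] 1])
  show "witt_equiv s X f s' Y g"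
  proof (cases "m \<le> n")
    case True
    have "isometric s X f (prod_scale s' fun_scale) (Y \<times> coord_space (2 * (n - m))) (form_sum g (hyperbolic (n - m)))"
      using red[OF True q 1] by (simp add: qiso_def qsum_def hyp_def)
    then show ?thesis unfolding witt_equiv_def using dim True
      by (intro exI[of _ "n - m"]) (simp add: qdim_def)
  next
    case False
    have "isometric s' Y g (prod_scale s fun_scale) (X \<times> coord_space (2 * (m - n))) (form_sum f (hyperbolic (m - n)))"
      using red[OF _ q(2,1) 2] False by (simp add: qiso_def qsum_def hyp_def)
    then show ?thesis unfolding witt_equiv_def using dim False
      by (intro exI[of _ "m - n"]) (simp add: qdim_def)
  qed
qed

section \<open>The Weil factor under isometries and orthogonal sums\<close>

lemma (in lattice_space) omod_sum:
  assumes "omod N" "\<And>i. i \<in> I \<Longrightarrow> g i \<in> N" shows "sum g I \<in> N"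
  using assms(2)
  by (induction I rule: infinite_finite_induct)
     (auto intro: add_subgroup_zero[OF omod_subgroup[OF assms(1)]] add_subgroup_add[OF omod_subgroup[OF assms(1)]])

text \<open>The finitely many basis vectors of \<open>L\<close> are mapped into one multiple of
  \<open>M\<close>. Linear maps commute with scaling, so the shift \<open>i\<close> is the same for
  all \<open>j\<close>.\<close>

lemma (in lattice_space) linear_image_bounded:
  assumes "lattice_space s' Y M" "linear_map s X s' Y h"
  shows "\<exists>i. \<forall>j. h ` Lz j \<subseteq> lattice_space.Lz s' M (j + i)"
proof -
  interpret Y: lattice_space s' Y M by fact
  obtain B u where "lattice_basis B u" using lattice_basis_exists by blast
  note B = lattice_basisD(1,3,5,7)[OF this]
  obtain i where i: "h ` B \<subseteq> Y.Lz i"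
    using Y.finite_subset_Lz[of "h ` B"] B(1,2) linear_map_mem[OF assms(2)] by blast
  have hL: "h x \<in> Y.Lz i" if x: "x \<in> L" for x
  proof -
    have xX: "x \<in> X" using x L_subset by blast
    have "h x = h (\<Sum>b\<in>B. s (u b x) b)" using B(3)[OF xX] by simp
    also have "\<dots> = (\<Sum>b\<in>B. h (s (u b x) b))"
      using B(1,2) X_scale by (intro linear_map_sum[OF space assms(2)]) auto
    also have "\<dots> = (\<Sum>b\<in>B. s' (u b x) (h b))"
      using B(2) linear_map_scale[OF assms(2)] by (intro sum.cong) auto
    also have "\<dots> \<in> Y.Lz i"
      using i x B(4) by (intro Y.omod_sum[OF Y.omod_Lz] Y.omod_scale[OF Y.omod_Lz]) auto
    finally show ?thesis .
  qed
  have "h ` Lz j \<subseteq> Y.Lz (j + i)" for j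
  proof
    fix y assume "y \<in> h ` Lz j"
    then obtain l where l: "l \<in> L" "y = h (s (unif powi j) l)" unfolding Lz_def by blast
    then have "y = s' (unif powi j) (h l)" using linear_map_scale[OF assms(2)] L_subset by blast
    then show "y \<in> Y.Lz (j + i)" using Y.scale_Lz_iff hL[OF l(1)] by simp
  qed
  then show ?thesis by blast
qed

lemma (in lattice_space) linear_iso_image_lower:
  assumes "lattice_space s' Y M" "linear_iso s X s' Y h"
  shows "\<exists>i. \<forall>j. lattice_space.Lz s' M (j + i) \<subseteq> h ` Lz j"
proof -
  interpret Y: lattice_space s' Y M by fact
  let ?k = "inv_into X h"
  have k: "linear_iso s' Y s X ?k" by (rule linear_iso_inv[OF space assms(2)])
  obtain i where i: "\<forall>j. ?k ` Y.Lz j \<subseteq> Lz (j + i)"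
    using Y.linear_image_bounded[OF lattice_space_axioms linear_iso_map[OF k]] by blast
  have "Y.Lz (j + - i) \<subseteq> h ` Lz j" for j
  proof
    fix y assume y: "y \<in> Y.Lz (j + - i)"
    then have "?k y \<in> Lz (j + - i + i)" using i by blast
    moreover have "h (?k y) = y"
      using y Y.Lz_subset linear_iso_bij[OF assms(2)] by (auto simp add: bij_betw_def intro!: f_inv_into_f)
    ultimately show "y \<in> h ` Lz j" by (metis add.assoc add.left_inverse add.right_neutral imageI)
  qed
  then show ?thesis by blast
qed

lemma (in lattice_space) lat_linear_iso_image:
  assumes "lattice_space s' Y M" "linear_iso s X s' Y h" "lat N"
  shows "lattice_space.lat s' Y M (h ` N)"
proof -
  interpret Y: lattice_space s' Y M by fact
  note l = linear_iso_map[OF assms(2)]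
  have NX: "N \<subseteq> X" by (rule lat_subset[OF assms(3)])
  obtain k k' where kk: "Lz k \<subseteq> N" "N \<subseteq> Lz k'" using assms(3) unfolding lat_def by blast
  obtain i where i: "\<forall>j. h ` Lz j \<subseteq> Y.Lz (j + i)" using linear_image_bounded[OF assms(1) l] by blast
  obtain i' where i': "\<forall>j. Y.Lz (j + i') \<subseteq> h ` Lz j" using linear_iso_image_lower[OF assms(1,2)] by blast
  have "Y.omod (h ` N)"
    unfolding Y.omod_def add_subgroup_def
  proof (intro conjI ballI)
    show "h ` N \<subseteq> Y" using NX linear_map_mem[OF l] by blast
    show "0 \<in> h ` N" using linear_map_zero[OF space l] add_subgroup_zero[OF lat_subgroup[OF assms(3)]] by (metis imageI)
    fix x y assume "x \<in> h ` N" "y \<in> h ` N"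
    then obtain a b where ab: "a \<in> N" "b \<in> N" "x = h a" "y = h b" by blast
    then have "x - y = h (a - b)"
      using linear_map_diff[OF space l subsetD[OF NX ab(1)] subsetD[OF NX ab(2)]] by simp
    then show "x - y \<in> h ` N" using add_subgroup_diff[OF lat_subgroup[OF assms(3)] ab(1,2)] by blast
  next
    fix c :: 'f and x assume c: "c \<in> integers" and "x \<in> h ` N"
    then obtain a where a: "a \<in> N" "x = h a" by blast
    then have "s' c x = h (s c a)" using linear_map_scale[OF l subsetD[OF NX a(1)], of c] by simp
    then show "s' c x \<in> h ` N" using omod_scale[OF lat_omod[OF assms(3)] c a(1)] by blast
  qed
  moreover have "Y.Lz (k + i') \<subseteq> h ` N" using i' kk(1) by blast
  moreover have "h ` N \<subseteq> Y.Lz (k' + i)" using i kk(2) by blast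
  ultimately show ?thesis unfolding Y.lat_def by blast
qed

lemma perp_linear_iso:
  assumes "fd_space s X" "linear_iso s X s' Y h" "\<And>x. x \<in> X \<Longrightarrow> g (h x) = f x" "N \<subseteq> X"
  shows "perp chi Y g (h ` N) = h ` perp chi X f N"
proof -
  note l = linear_iso_map[OF assms(2)] and cl = fd_space_closed[OF assms(1)]
  have P: "polar Y g (h x) (h y) = polar X f x y" if "x \<in> X" "y \<in> X" for x y
    by (rule polar_iso[where g = g, OF l]) (use assms(3) that cl(2) in auto)
  have img: "h ` X = Y" using linear_iso_bij[OF assms(2)] by (simp add: bij_betw_def)
  show ?thesis
  proof (intro equalityI subsetI)
    fix y assume y: "y \<in> perp chi Y g (h ` N)"
    then obtain x where x: "x \<in> X" "y = h x" using img by (auto simp add: perp_def)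
    have "chi (polar X f z x) = 1" if "z \<in> N" for z
      using y that P[OF subsetD[OF assms(4) that] x(1)] x(2) by (auto simp add: perp_def)
    then have "x \<in> perp chi X f N" using x(1) by (simp add: perp_def)
    then show "y \<in> h ` perp chi X f N" using x(2) by blast
  next
    fix y assume "y \<in> h ` perp chi X f N"
    then obtain x where x: "x \<in> perp chi X f N" "y = h x" by blast
    then have xX: "x \<in> X" by (simp add: perp_def)
    have "chi (polar Y g (h z) y) = 1" if "z \<in> N" for z
      using x(1) that P[OF subsetD[OF assms(4) that] xX] x(2) by (auto simp add: perp_def)
    then show "y \<in> perp chi Y g (h ` N)" using img xX x(2) by (auto simp add: perp_def)
  qed
qed

lemma (in weil_space) gauss_linear_iso:
  assumes "weil_space s' Y M chi g sq" "linear_iso s X s' Y h" "\<And>x. x \<in> X \<Longrightarrow> g (h x) = f x"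
    and "good N" "quadratic_space.good s' Y M chi g (h ` N)"
  shows "gauss chi sq Y g (h ` N) = gauss chi sq X f N"
proof -
  interpret Y: weil_space s' Y M chi g sq by fact
  have N: "lat N" "pr N \<subseteq> N" "lat (pr N)" using assms(4) lat_perp by (auto simp add: good_def)
  have hN: "Y.lat (h ` N)" "Y.pr (h ` N) \<subseteq> h ` N" "Y.lat (Y.pr (h ` N))"
    using assms(5) Y.lat_perp by (auto simp add: Y.good_def)
  have NX: "N \<subseteq> X" by (rule lat_subset[OF N(1)])
  have p: "Y.pr (h ` N) = h ` pr N" by (rule perp_linear_iso[OF space assms(2) _ NX]) (rule assms(3))
  note b = linear_iso_bij[OF assms(2)]
  have d: "h x - h y \<in> Y.pr (h ` N) \<longleftrightarrow> x - y \<in> pr N" if "x \<in> N" "y \<in> N" for x y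
  proof -
    have X: "x \<in> X" "y \<in> X" "x - y \<in> X" using that NX X_diff by auto
    have "h x - h y = h (x - y)" using linear_map_diff[OF space linear_iso_map[OF assms(2)] X(1,2)] by simp
    moreover have "inj_on h X" using b by (simp add: bij_betw_def)
    ultimately show ?thesis unfolding p
      using inj_on_image_mem_iff[OF _ X(3) perp_subset, of h N] by simp
  qed
  have ci: "coset_index (h ` N) (Y.pr (h ` N)) = coset_index N (pr N)"
    by (rule coset_index_reindex[OF lat_subgroup[OF N(3)] lat_subgroup[OF N(1)] N(2)
          Y.lat_subgroup[OF hN(3)] Y.lat_subgroup[OF hN(1)] hN(2) refl d])
  \<comment> \<open>The two exponents belong to different instances of the locale; they are compared
    through the equal indices, which are powers of the same q.\<close>
  have "residue_card TYPE('f) ^ nat (Y.ex (h ` N) (Y.pr (h ` N))) = residue_card TYPE('f) ^ nat (ex N (pr N))"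
    using Y.coset_index_ex(1)[OF hN(1,3,2)] coset_index_ex(1)[OF N(1,3,2)] ci by simp
  then have "nat (Y.ex (h ` N) (Y.pr (h ` N))) = nat (ex N (pr N))"
    using power_inject_exp[OF residue_card_gt_1[where 'f = 'f]] by blast
  then have "Y.ex (h ` N) (Y.pr (h ` N)) = ex N (pr N)"
    using Y.coset_index_ex(2)[OF hN(1,3,2)] coset_index_ex(2)[OF N(1,3,2)] by linarith
  moreover have "csum (h ` N) (Y.pr (h ` N)) (\<lambda>y. chi (g y)) = csum N (pr N) (\<lambda>x. chi (f x))"
  proof -
    have "csum (h ` N) (Y.pr (h ` N)) (\<lambda>y. chi (g y)) = csum N (pr N) (\<lambda>x. chi (g (h x)))"
      by (rule csum_reindex[OF lat_subgroup[OF N(3)] lat_subgroup[OF N(1)] N(2)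
          Y.lat_subgroup[OF hN(3)] Y.lat_subgroup[OF hN(1)] hN(2) refl d Y.good_inv[OF assms(5)]])
    also have "\<dots> = csum N (pr N) (\<lambda>x. chi (f x))"
      using assms(3) NX by (intro csum_cong[OF lat_subgroup[OF N(3)] lat_subgroup[OF N(1)] N(2)]) auto
    finally show ?thesis .
  qed
  ultimately show ?thesis by (simp add: gauss_def ex_modulus Y.ex_modulus)
qed

text \<open>The lattices \<open>L\<close> and \<open>M\<close> are unrelated, so the case of the
  identity map is the independence of the normalizing lattice.\<close>

lemma (in weil_space) weil_factor_linear_iso:
  assumes "weil_space s' Y M chi g sq" "linear_iso s X s' Y h" "\<And>x. x \<in> X \<Longrightarrow> g (h x) = f x"
  shows "weil_factor chi sq s' Y M g = weil_factor chi sq s X L f"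
proof -
  interpret Y: weil_space s' Y M chi g sq by fact
  obtain k where k: "\<forall>N. lat N \<and> Lz k \<subseteq> N \<longrightarrow> good N \<and> weil_factor chi sq s X L f = gauss chi sq X f N"
    using weil_factor_gauss by blast
  obtain l where l: "\<forall>N. Y.lat N \<and> Y.Lz l \<subseteq> N \<longrightarrow>
      Y.good N \<and> weil_factor chi sq s' Y M g = gauss chi sq Y g N"
    using Y.weil_factor_gauss by blast
  obtain i where i: "\<forall>j. Y.Lz (j + i) \<subseteq> h ` Lz j"
    using linear_iso_image_lower[OF Y.lattice_space_axioms assms(2)] by blast
  define N where "N = Lz (min k (l - i))"
  have "Lz k \<subseteq> N" unfolding N_def by (rule Lz_antimono) simp
  then have N: "good N" "weil_factor chi sq s X L f = gauss chi sq X f N" using k by (auto simp add: N_def)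
  have "Y.Lz l \<subseteq> Y.Lz (min k (l - i) + i)" by (rule Y.Lz_antimono) simp
  then have "Y.Lz l \<subseteq> h ` N" using i unfolding N_def by blast
  moreover have "Y.lat (h ` N)"
    by (rule lat_linear_iso_image[OF Y.lattice_space_axioms assms(2) good_lat[OF N(1)]])
  ultimately have "Y.good (h ` N)" "weil_factor chi sq s' Y M g = gauss chi sq Y g (h ` N)" using l by auto
  then show ?thesis using gauss_linear_iso[OF assms N(1)] N(2) by simp
qed

lemma (in weil_space) weil_factor_unit: "weil_factor chi sq s X L f dvd 1"
  using weil_factor_gauss gauss_unit lat_Lz by (metis order_refl)

text \<open>Since \<open>chi (- t) = 1\<close> exactly if \<open>chi t = 1\<close>, both forms have
  the same orthogonal lattices, and the two Gauss sums are those of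
  \<open>gauss_mult_uminus\<close>.\<close>

lemma (in weil_space) weil_factor_uminus:
  assumes "weil_space s X L chi (- f) sq"
  shows "weil_factor chi sq s X L f * weil_factor chi sq s X L (- f) = 1"
proof -
  interpret m: weil_space s X L chi "- f" sq by fact
  obtain k where k: "\<forall>N. lat N \<and> Lz k \<subseteq> N \<longrightarrow> good N \<and> weil_factor chi sq s X L f = gauss chi sq X f N"
    using weil_factor_gauss by blast
  obtain l where l: "\<forall>N. lat N \<and> Lz l \<subseteq> N \<longrightarrow>
      m.good N \<and> weil_factor chi sq s X L (- f) = gauss chi sq X (- f) N"
    using m.weil_factor_gauss by blast
  define N where "N = Lz (min k l)"
  have "Lz k \<subseteq> N" "Lz l \<subseteq> N" unfolding N_def by (auto intro!: Lz_antimono)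
  then have N: "good N" "weil_factor chi sq s X L f = gauss chi sq X f N"
    "m.good N" "weil_factor chi sq s X L (- f) = gauss chi sq X (- f) N"
    using k l by (auto simp add: N_def)
  have "polar X (- f) x y = - polar X f x y" for x y by (simp add: polar_def)
  moreover have "chi (- t) = 1 \<longleftrightarrow> chi t = 1" for t using chi_uminus[of t] by auto
  ultimately have "perp chi X (- f) N = pr N" by (simp add: perp_def)
  then have "gauss chi sq X (- f) N = upow sq (ex (pr N) N) * csum N (pr N) (\<lambda>x. chi (- f x))"
    using m.gauss_eq[OF N(3), of sq] by simp
  then show ?thesis using gauss_mult_uminus[OF N(1)] N(2,4) by simp
qed

text \<open>Testing against \<open>(a, 0)\<close> and \<open>(0, b)\<close> separates the conditions
  on the two components.\<close>

lemma perp_form_sum: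
  assumes "nontrivial_character chi" "fd_space s X" "nondegenerate_form s X f"
    "fd_space s' Y" "nondegenerate_form s' Y g" "N \<subseteq> X" "N' \<subseteq> Y" "0 \<in> N" "0 \<in> N'"
  shows "perp chi (X \<times> Y) (form_sum f g) (N \<times> N') = perp chi X f N \<times> perp chi Y g N'"
proof -
  interpret nontrivial_character chi by fact
  have P: "polar (X \<times> Y) (form_sum f g) (a, b) (x, y) = polar X f a x + polar Y g b y"
    if "a \<in> N" "b \<in> N'" "x \<in> X" "y \<in> Y" for a b x y
    using that assms(6,7) by (intro polar_form_sum) auto
  have z: "polar X f 0 x = 0" "polar Y g 0 y = 0" for x y
    using polar_zero[OF assms(2,3)] polar_zero[OF assms(4,5)] by auto
  have key: "(\<forall>p\<in>N \<times> N'. chi (polar (X \<times> Y) (form_sum f g) p (x, y)) = 1) \<longleftrightarrow>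
      (\<forall>a\<in>N. chi (polar X f a x) = 1) \<and> (\<forall>b\<in>N'. chi (polar Y g b y) = 1)"
    if xy: "x \<in> X" "y \<in> Y" for x y
  proof
    assume *: "\<forall>p\<in>N \<times> N'. chi (polar (X \<times> Y) (form_sum f g) p (x, y)) = 1"
    show "(\<forall>a\<in>N. chi (polar X f a x) = 1) \<and> (\<forall>b\<in>N'. chi (polar Y g b y) = 1)"
    proof (intro conjI ballI)
      fix a assume a: "a \<in> N"
      then show "chi (polar X f a x) = 1" using bspec[OF *, of "(a, 0)"] assms(9) P[OF a assms(9) xy] z by simp
    next
      fix b assume b: "b \<in> N'"
      then show "chi (polar Y g b y) = 1" using bspec[OF *, of "(0, b)"] assms(8) P[OF assms(8) b xy] z by simp
    qed
  next
    assume "(\<forall>a\<in>N. chi (polar X f a x) = 1) \<and> (\<forall>b\<in>N'. chi (polar Y g b y) = 1)"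
    then show "\<forall>p\<in>N \<times> N'. chi (polar (X \<times> Y) (form_sum f g) p (x, y)) = 1"
      using P[OF _ _ xy] by (auto simp add: chi_add)
  qed
  show ?thesis
  proof (rule Set.set_eqI)
    fix r
    show "r \<in> perp chi (X \<times> Y) (form_sum f g) (N \<times> N') \<longleftrightarrow> r \<in> perp chi X f N \<times> perp chi Y g N'"
    proof (cases r)
      case (Pair x y)
      then show ?thesis using key[of x y] unfolding perp_def by blast
    qed
  qed
qed

text \<open>For a product lattice the Gauss sum splits, because \<open>chi\<close> turns the sum of
  the forms into a product. The lattice \<open>K\<close> of the product is unrelated to
  \<open>L\<close> and \<open>M\<close>, so a product lattice must be found that is large in all
  three senses.\<close>

lemma (in weil_space) weil_factor_form_sum:
  assumes "weil_space s' Y M chi g sq" "weil_space (prod_scale s s') (X \<times> Y) K chi (form_sum f g) sq"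
  shows "weil_factor chi sq (prod_scale s s') (X \<times> Y) K (form_sum f g) =
    weil_factor chi sq s X L f * weil_factor chi sq s' Y M g"
proof -
  interpret Y: weil_space s' Y M chi g sq by fact
  interpret P: weil_space "prod_scale s s'" "X \<times> Y" K chi "form_sum f g" sq by fact
  have linear: "linear_map (prod_scale s s') (X \<times> Y) s X fst" "linear_map (prod_scale s s') (X \<times> Y) s' Y snd"
    "linear_map s X (prod_scale s s') (X \<times> Y) (\<lambda>x. (x, 0))" "linear_map s' Y (prod_scale s s') (X \<times> Y) (\<lambda>y. (0, y))"
    using X_zero Y.X_zero by (auto simp add: linear_map_def prod_scale_def)
  obtain i1 where i1: "\<forall>j. fst ` P.Lz j \<subseteq> Lz (j + i1)"
    using P.linear_image_bounded[OF lattice_space_axioms linear(1)] by blast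
  obtain i2 where i2: "\<forall>j. snd ` P.Lz j \<subseteq> Y.Lz (j + i2)"
    using P.linear_image_bounded[OF Y.lattice_space_axioms linear(2)] by blast
  obtain i3 where i3: "\<forall>j. (\<lambda>x. (x, 0)) ` Lz j \<subseteq> P.Lz (j + i3)"
    using linear_image_bounded[OF P.lattice_space_axioms linear(3)] by blast
  obtain i4 where i4: "\<forall>j. (\<lambda>y. (0, y)) ` Y.Lz j \<subseteq> P.Lz (j + i4)"
    using Y.linear_image_bounded[OF P.lattice_space_axioms linear(4)] by blast
  obtain k where k: "\<forall>N. lat N \<and> Lz k \<subseteq> N \<longrightarrow> good N \<and> weil_factor chi sq s X L f = gauss chi sq X f N"
    using weil_factor_gauss by blast
  obtain l where l: "\<forall>N. Y.lat N \<and> Y.Lz l \<subseteq> N \<longrightarrow>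
      Y.good N \<and> weil_factor chi sq s' Y M g = gauss chi sq Y g N"
    using Y.weil_factor_gauss by blast
  obtain m where m: "\<forall>N. P.lat N \<and> P.Lz m \<subseteq> N \<longrightarrow> P.good N \<and>
      weil_factor chi sq (prod_scale s s') (X \<times> Y) K (form_sum f g) = gauss chi sq (X \<times> Y) (form_sum f g) N"
    using P.weil_factor_gauss by blast
  \<comment> \<open>The first minimum makes \<open>N\<close> and \<open>N'\<close> large for
    \<open>f\<close> and \<open>g\<close>. The second makes them contain the projections of
    \<open>P.Lz m\<close>, hence \<open>N \<times> N'\<close> contains
    \<open>P.Lz m\<close>.\<close>
  define j where "j = min (min k l) (min (m + i1) (m + i2))"
  define N where "N = Lz j"
  define N' where "N' = Y.Lz j"
  have lower: "P.Lz m \<subseteq> N \<times> N'"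
  proof -
    have "Lz (m + i1) \<subseteq> N" "Y.Lz (m + i2) \<subseteq> N'"
      unfolding N_def N'_def by (intro Lz_antimono Y.Lz_antimono, simp add: j_def)+
    moreover have "fst r \<in> Lz (m + i1)" "snd r \<in> Y.Lz (m + i2)" if "r \<in> P.Lz m" for r
      using i1 i2 that by blast+
    ultimately show ?thesis by (auto simp add: mem_Times_iff subset_iff)
  qed
  have upper: "N \<times> N' \<subseteq> P.Lz (j + min i3 i4)"
  proof clarify
    fix x y assume "x \<in> N" "y \<in> N'"
    then have "(x, 0) \<in> P.Lz (j + i3)" "(0, y) \<in> P.Lz (j + i4)" using i3 i4 unfolding N_def N'_def by blast+
    moreover have "P.Lz (j + i3) \<subseteq> P.Lz (j + min i3 i4)" "P.Lz (j + i4) \<subseteq> P.Lz (j + min i3 i4)"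
      by (auto intro!: P.Lz_antimono)
    ultimately have "(x, 0) + (0, y) \<in> P.Lz (j + min i3 i4)"
      using add_subgroup_add[OF P.omod_subgroup[OF P.omod_Lz]] by blast
    then show "(x, y) \<in> P.Lz (j + min i3 i4)" by simp
  qed
  have "P.omod (N \<times> N')"
    unfolding P.omod_def N_def N'_def
    using Lz_subset Y.Lz_subset add_subgroup_Times[OF omod_subgroup[OF omod_Lz] Y.omod_subgroup[OF Y.omod_Lz]]
      omod_scale[OF omod_Lz] Y.omod_scale[OF Y.omod_Lz]
    by (auto simp add: prod_scale_def)
  then have latP: "P.lat (N \<times> N')" unfolding P.lat_def using lower upper by blast
  have gP: "P.good (N \<times> N')" "weil_factor chi sq (prod_scale s s') (X \<times> Y) K (form_sum f g) =
      gauss chi sq (X \<times> Y) (form_sum f g) (N \<times> N')"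
    using m latP lower by auto
  have "Lz k \<subseteq> N" "Y.Lz l \<subseteq> N'" unfolding N_def N'_def by (intro Lz_antimono Y.Lz_antimono, simp add: j_def)+
  then have gN: "good N" "weil_factor chi sq s X L f = gauss chi sq X f N"
    and gN': "Y.good N'" "weil_factor chi sq s' Y M g = gauss chi sq Y g N'"
    using k l by (auto simp add: N_def N'_def)
  have N: "lat N" "pr N \<subseteq> N" "lat (pr N)" using gN(1) lat_perp by (auto simp add: good_def)
  have N': "Y.lat N'" "Y.pr N' \<subseteq> N'" "Y.lat (Y.pr N')" using gN'(1) Y.lat_perp by (auto simp add: Y.good_def)
  note A = lat_subgroup[OF N(3)] lat_subgroup[OF N(1)] N(2)
  note B = Y.lat_subgroup[OF N'(3)] Y.lat_subgroup[OF N'(1)] N'(2)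
  have p: "P.pr (N \<times> N') = pr N \<times> Y.pr N'"
    by (rule perp_form_sum[OF nontrivial_character_axioms space nondeg Y.space Y.nondeg
          lat_subset[OF N(1)] Y.lat_subset[OF N'(1)] add_subgroup_zero[OF A(2)] add_subgroup_zero[OF B(2)]])
  have PN: "P.lat (P.pr (N \<times> N'))" "P.pr (N \<times> N') \<subseteq> N \<times> N'"
    using gP(1) P.lat_perp by (auto simp add: P.good_def)
  have "residue_card TYPE('f) ^ nat (P.ex (N \<times> N') (P.pr (N \<times> N'))) =
      residue_card TYPE('f) ^ (nat (ex N (pr N)) + nat (Y.ex N' (Y.pr N')))"
    using P.coset_index_ex(1)[OF latP PN] coset_index_ex(1)[OF N(1,3,2)] Y.coset_index_ex(1)[OF N'(1,3,2)]
      coset_index_Times[OF A B] by (simp add: p power_add)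
  then have "nat (P.ex (N \<times> N') (P.pr (N \<times> N'))) = nat (ex N (pr N)) + nat (Y.ex N' (Y.pr N'))"
    using power_inject_exp[OF residue_card_gt_1[where 'f = 'f]] by blast
  then have e: "- P.ex (N \<times> N') (P.pr (N \<times> N')) = - ex N (pr N) + - Y.ex N' (Y.pr N')"
    using P.coset_index_ex(2)[OF latP PN] coset_index_ex(2)[OF N(1,3,2)] Y.coset_index_ex(2)[OF N'(1,3,2)]
    by linarith
  have "csum (N \<times> N') (P.pr (N \<times> N')) (\<lambda>z. chi (form_sum f g z)) =
      csum N (pr N) (\<lambda>x. csum N' (Y.pr N') (\<lambda>y. chi (form_sum f g (x, y))))"
    unfolding p by (rule csum_Times[OF A B]) (use P.good_inv[OF gP(1)] in \<open>simp add: p\<close>)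
  also have "\<dots> = csum N (pr N) (\<lambda>x. chi (f x)) * csum N' (Y.pr N') (\<lambda>y. chi (g y))"
    unfolding csum_def by (simp add: form_sum_def chi_add sum_product)
  finally have c: "csum (N \<times> N') (P.pr (N \<times> N')) (\<lambda>z. chi (form_sum f g z)) =
      csum N (pr N) (\<lambda>x. chi (f x)) * csum N' (Y.pr N') (\<lambda>y. chi (g y))" .
  have "gauss chi sq (X \<times> Y) (form_sum f g) (N \<times> N') = gauss chi sq X f N * gauss chi sq Y g N'"
    unfolding gauss_def ex_modulus Y.ex_modulus P.ex_modulus image_id id_apply e c upow_add[OF sq_unit]
    by (simp only: ac_simps)
  then show ?thesis using gP(2) gN(2) gN'(2) by simp
qed

section \<open>The Witt group\<close>

definition cquad :: "nat \<Rightarrow> ((nat \<Rightarrow> 'f) \<Rightarrow> 'f) \<Rightarrow> ('f::field, nat \<Rightarrow> 'f) quad" where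
  "cquad n f = (fun_scale, coord_space n, f)"

definition wclass :: "('f::field, 'v::ab_group_add) quad \<Rightarrow> 'f witt_class" where
  "wclass A = (case A of (s, X, f) \<Rightarrow> witt_class s X f)"

lemma quad_cquad: "quad (cquad n f) \<longleftrightarrow> nondegenerate_form fun_scale (coord_space n) f"
  by (simp add: quad_def cquad_def fd_space_coord)

text \<open>Classes contain only forms on coordinate spaces; this provides a member of the class of
  a form on any space.\<close>

lemma cquad_exists:
  assumes "quad (A :: ('f::field, 'v::ab_group_add) quad)"
  shows "\<exists>n g. quad (cquad n g :: ('f, _) quad) \<and> qiso A (cquad n g)"
proof -
  obtain s X f where A: "A = (s, X, f)" by (cases A)
  have fd: "fd_space s X" using assms unfolding A by (rule quad_fd)
  obtain n h where h: "linear_iso fun_scale (coord_space n) s X h" using fd_space_coord_iso[OF fd] by blast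
  have "qiso (cquad n (\<lambda>z. f (h z))) A" unfolding A cquad_def by (rule qisoI[OF h]) simp
  then have iso: "qiso A (cquad n (\<lambda>z. f (h z)))" unfolding cquad_def by (rule qiso_sym_fd[OF fd_space_coord])
  moreover have "quad (cquad n (\<lambda>z. f (h z)))"
    by (rule quad_iso(1)[OF assms iso]) (simp add: cquad_def vector_space_fun_scale)
  ultimately show ?thesis by blast
qed

context
  assumes ch: "CHAR('f::field) \<noteq> 2"
begin

lemma wclass_mem:
  assumes "quad (A :: ('f, 'v::ab_group_add) quad)"
  shows "(n, g) \<in> wclass A \<longleftrightarrow> quad (cquad n g) \<and> weq A (cquad n g)"
proof -
  obtain s X f where A: "A = (s, X, f)" by (cases A)
  show ?thesis
  proof (cases "quad (cquad n g)")
    case True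
    then have "witt_equiv s X f fun_scale (coord_space n) g \<longleftrightarrow> weq A (cquad n g)"
      using witt_equiv_iff_weq[OF ch, of s X f fun_scale "coord_space n" g] assms by (simp add: A cquad_def)
    then show ?thesis using True by (simp add: wclass_def A witt_class_def quad_cquad)
  next
    case False
    then show ?thesis by (simp add: wclass_def A witt_class_def quad_cquad)
  qed
qed

text \<open>Equal classes share a coordinate form isometric to \<open>A\<close>, which is then a
  link between \<open>A\<close> and \<open>B\<close>; the converse is transitivity.\<close>

lemma wclass_eq_iff:
  assumes "quad (A :: ('f, 'v::ab_group_add) quad)" "quad (B :: ('f, 'w::ab_group_add) quad)"
  shows "wclass A = wclass B \<longleftrightarrow> weq A B"
proof
  assume eq: "wclass A = wclass B"
  obtain n g where g: "quad (cquad n g :: ('f, _) quad)" "qiso A (cquad n g)" using cquad_exists[OF assms(1)] by blast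
  then have "(n, g) \<in> wclass A" using wclass_mem[OF assms(1)] weq_iso by blast
  then have "weq B (cquad n g)" using eq wclass_mem[OF assms(2)] by blast
  then have "weq (cquad n g) B" by (rule weq_sym[OF ch assms(2)])
  then show "weq A B" by (rule weq_trans[OF ch assms(1) g(1) assms(2) weq_iso[OF g(2)]])
next
  assume w: "weq A B"
  have w': "weq B A" by (rule weq_sym[OF ch assms(1) w])
  have "(n, g) \<in> wclass A \<longleftrightarrow> (n, g) \<in> wclass B" for n g
    unfolding wclass_mem[OF assms(1)] wclass_mem[OF assms(2)]
    using weq_trans[OF ch assms(1,2) _ w] weq_trans[OF ch assms(2,1) _ w'] by blast
  then show "wclass A = wclass B" by auto
qed

lemma carrier_witt_group:
  "carrier (witt_group :: 'f witt_class monoid) = {wclass (cquad n f) | n f. quad (cquad n f)}"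
  unfolding witt_group_def wclass_def quad_cquad by (simp add: cquad_def)

lemma wclass_carrier:
  assumes "quad (A :: ('f, 'v::ab_group_add) quad)" shows "wclass A \<in> carrier witt_group"
proof -
  obtain n g where g: "quad (cquad n g :: ('f, _) quad)" "qiso A (cquad n g)" using cquad_exists[OF assms] by blast
  then have "wclass A = wclass (cquad n g)" using wclass_eq_iff[OF assms g(1)] weq_iso by blast
  then show ?thesis unfolding carrier_witt_group using g(1) by blast
qed

text \<open>Stable isometry is compatible with sums, so every choice of members yields the same
  class and the description in \<open>witt_group\<close> is unique; existence of members gives the
  value.\<close>

lemma wclass_mult:
  assumes A: "quad (A :: ('f, 'v::ab_group_add) quad)" and B: "quad (B :: ('f, 'w::ab_group_add) quad)"
  shows "wclass A \<otimes>\<^bsub>witt_group\<^esub> wclass B = wclass (qsum A B)"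
proof -
  have *: "witt_class (prod_scale fun_scale fun_scale) (coord_space n \<times> coord_space m) (form_sum f g) = wclass (qsum A B)"
    if "(n, f) \<in> wclass A" "(m, g) \<in> wclass B" for n f m g
  proof -
    have q: "quad (cquad n f)" "weq A (cquad n f)" "quad (cquad m g)" "weq B (cquad m g)"
      using that wclass_mem[OF A] wclass_mem[OF B] by auto
    have "weq (qsum A B) (qsum (cquad n f) (cquad m g))" by (rule weq_sum[OF ch q(1,3,2,4)])
    then have "wclass (qsum A B) = wclass (qsum (cquad n f) (cquad m g))"
      using wclass_eq_iff[OF quad_sum(1)[OF A B] quad_sum(1)[OF q(1,3)]] by blast
    then show ?thesis by (simp add: wclass_def qsum_def cquad_def)
  qed
  obtain n f where f: "quad (cquad n f :: ('f, _) quad)" "qiso A (cquad n f)" using cquad_exists[OF A] by blast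
  obtain m g where g: "quad (cquad m g :: ('f, _) quad)" "qiso B (cquad m g)" using cquad_exists[OF B] by blast
  have mem: "(n, f) \<in> wclass A" "(m, g) \<in> wclass B"
    using f g wclass_mem[OF A] wclass_mem[OF B] weq_iso by blast+
  show ?thesis
    unfolding witt_group_def monoid.simps
  proof (rule the_equality)
    show "\<exists>n f m g. (n, f) \<in> wclass A \<and> (m, g) \<in> wclass B \<and> wclass (qsum A B) =
        witt_class (prod_scale fun_scale fun_scale) (coord_space n \<times> coord_space m) (form_sum f g)"
      using mem *[OF mem] by metis
  qed (use * in blast)
qed

lemma wclass_one: "\<one>\<^bsub>witt_group\<^esub> = wclass (hyp 0 :: ('f, _) quad)"
proof -
  have "(hyperbolic 0 :: (nat \<Rightarrow> 'f) \<Rightarrow> 'f) = (\<lambda>_. 0)" by (simp add: hyperbolic_def fun_eq_iff)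
  then show ?thesis by (simp add: witt_group_def wclass_def hyp_def)
qed

lemma wclass_eqI:
  assumes "quad (A :: ('f, 'v::ab_group_add) quad)" "quad (B :: ('f, 'w::ab_group_add) quad)" "qiso A B"
  shows "wclass A = wclass B"
  using wclass_eq_iff[OF assms(1,2)] weq_iso[OF assms(3)] by blast

lemma comm_group_witt_group: "comm_group (witt_group :: 'f witt_class monoid)"
proof (rule comm_groupI)
  fix x y z :: "'f witt_class"
  assume "x \<in> carrier witt_group" "y \<in> carrier witt_group"
  then obtain n f m g where x: "x = wclass (cquad n f)" "quad (cquad n f)" and y: "y = wclass (cquad m g)" "quad (cquad m g)"
    unfolding carrier_witt_group by blast
  show "x \<otimes>\<^bsub>witt_group\<^esub> y \<in> carrier witt_group"
    unfolding x(1) y(1) wclass_mult[OF x(2) y(2)] by (rule wclass_carrier[OF quad_sum(1)[OF x(2) y(2)]])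
  show "x \<otimes>\<^bsub>witt_group\<^esub> y = y \<otimes>\<^bsub>witt_group\<^esub> x"
    unfolding x(1) y(1) wclass_mult[OF x(2) y(2)] wclass_mult[OF y(2) x(2)]
    by (rule wclass_eqI[OF quad_sum(1)[OF x(2) y(2)] quad_sum(1)[OF y(2) x(2)] qiso_comm])
  assume "z \<in> carrier witt_group"
  then obtain l e where z: "z = wclass (cquad l e)" "quad (cquad l e)" unfolding carrier_witt_group by blast
  note xy = quad_sum(1)[OF x(2) y(2)] and yz = quad_sum(1)[OF y(2) z(2)]
  show "x \<otimes>\<^bsub>witt_group\<^esub> y \<otimes>\<^bsub>witt_group\<^esub> z = x \<otimes>\<^bsub>witt_group\<^esub> (y \<otimes>\<^bsub>witt_group\<^esub> z)"
    unfolding x(1) y(1) z(1) wclass_mult[OF x(2) y(2)] wclass_mult[OF y(2) z(2)]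
      wclass_mult[OF xy z(2)] wclass_mult[OF x(2) yz]
    by (rule wclass_eqI[OF quad_sum(1)[OF xy z(2)] quad_sum(1)[OF x(2) yz] qiso_assoc])
next
  show "\<one>\<^bsub>witt_group\<^esub> \<in> carrier (witt_group :: 'f witt_class monoid)"
    unfolding wclass_one by (rule wclass_carrier[OF quad_hyp_0])
  fix x :: "'f witt_class" assume "x \<in> carrier witt_group"
  then obtain n f where x: "x = wclass (cquad n f)" "quad (cquad n f)"
    unfolding carrier_witt_group by blast
  show "\<one>\<^bsub>witt_group\<^esub> \<otimes>\<^bsub>witt_group\<^esub> x = x"
    unfolding wclass_one x(1) wclass_mult[OF quad_hyp_0 x(2)]
    by (rule wclass_eqI[OF x(2) quad_sum(1)[OF quad_hyp_0 x(2)] qiso_zero_left[OF x(2)], symmetric])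
  note q = quad_neg[OF x(2)]
  have "qiso (qsum (cquad n f) (qneg (cquad n f))) (hyp n)"
    using qiso_neg_sum[OF ch] x(2) unfolding cquad_def .
  from weq_iso[OF qiso_trans[OF qiso_comm this]] have "weq (qsum (qneg (cquad n f)) (cquad n f)) (hyp 0)"
    by (rule weq_trans[OF ch quad_sum(1)[OF q x(2)] quad_hyp[OF ch] quad_hyp_0 _ weq_hyp[OF ch]])
  then have "wclass (qneg (cquad n f)) \<otimes>\<^bsub>witt_group\<^esub> x = \<one>\<^bsub>witt_group\<^esub>"
    unfolding wclass_one x(1) wclass_mult[OF q x(2)]
    using wclass_eq_iff[OF quad_sum(1)[OF q x(2)] quad_hyp_0] by blast
  then show "\<exists>y\<in>carrier witt_group. y \<otimes>\<^bsub>witt_group\<^esub> x = \<one>\<^bsub>witt_group\<^esub>"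
    using wclass_carrier[OF q] by blast
qed

end

section \<open>The Weil character\<close>

locale weil_data = nontrivial_character chi
  for chi :: "'f::nonarch_local_field \<Rightarrow> 'r::idom" +
  fixes sq :: 'r
  assumes char_ne_2: "CHAR('f) \<noteq> 2" and sq_square: "sq\<^sup>2 = of_nat (residue_card TYPE('f))"
    and sq_unit: "sq dvd 1"
begin

lemma weil_spaceI:
  assumes "quad (s, X, f)" "ring_lattice s X L" shows "weil_space s X L chi f sq"
proof -
  interpret vector_space s by (rule fd_space_vector_space[OF quad_fd[OF assms(1)]])
  show ?thesis
    by unfold_locales (use assms char_ne_2 sq_square sq_unit in \<open>auto simp add: quad_def\<close>)
qed

text \<open>Fixing some lattice makes the Weil factor a function of the quadratic space alone;
  \<open>wfac_eq\<close> removes the choice again.\<close>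

definition wfac :: "('f, 'v::ab_group_add) quad \<Rightarrow> 'r" where
  "wfac A = (case A of (s, X, f) \<Rightarrow> weil_factor chi sq s X (SOME L. ring_lattice s X L) f)"

lemma some_ring_lattice: "quad (s, X, f) \<Longrightarrow> ring_lattice s X (SOME L. ring_lattice s X L)"
  using ring_lattice_exists[OF quad_fd] by (rule someI_ex)

lemma wfac_eq:
  assumes "quad (s, X, f)" "ring_lattice s X L"
  shows "weil_factor chi sq s X L f = wfac (s, X, f)"
  unfolding wfac_def prod.case
  by (rule weil_space.weil_factor_linear_iso[OF weil_spaceI[OF assms(1) some_ring_lattice[OF assms(1)]]
      weil_spaceI[OF assms] linear_iso_id refl])

lemma wfac_iso:
  assumes "quad A" "quad B" "qiso A B" shows "wfac A = wfac B"
proof -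
  obtain s X f s' Y g where A: "A = (s, X, f)" "B = (s', Y, g)" by (cases A, cases B)
  obtain h where h: "linear_iso s X s' Y h" "\<forall>x\<in>X. g (h x) = f x"
    using assms(3) unfolding A by (rule qisoE)
  note q = assms(1)[unfolded A] assms(2)[unfolded A]
  show ?thesis
    unfolding A wfac_def prod.case
    using weil_space.weil_factor_linear_iso[OF weil_spaceI[OF q(1) some_ring_lattice[OF q(1)]]
        weil_spaceI[OF q(2) some_ring_lattice[OF q(2)]] h(1)] h(2) by auto
qed

lemma wfac_sum:
  assumes "quad A" "quad B" shows "wfac (qsum A B) = wfac A * wfac B"
proof -
  obtain s X f s' Y g where A: "A = (s, X, f)" "B = (s', Y, g)" by (cases A, cases B)
  note q = assms(1)[unfolded A] assms(2)[unfolded A]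
  have qs: "quad (prod_scale s s', X \<times> Y, form_sum f g)"
    using quad_sum(1)[OF assms] by (simp add: A qsum_def)
  show ?thesis
    unfolding A qsum_def wfac_def prod.case
    by (rule weil_space.weil_factor_form_sum[OF weil_spaceI[OF q(1) some_ring_lattice[OF q(1)]]
        weil_spaceI[OF q(2) some_ring_lattice[OF q(2)]] weil_spaceI[OF qs some_ring_lattice[OF qs]]])
qed

lemma wfac_unit:
  assumes "quad A" shows "wfac A dvd 1"
proof -
  obtain s X f where A: "A = (s, X, f)" by (cases A)
  note q = assms[unfolded A]
  show ?thesis unfolding A wfac_def prod.case
    by (rule weil_space.weil_factor_unit[OF weil_spaceI[OF q some_ring_lattice[OF q]]])
qed

lemma wfac_neg:
  assumes "quad A" shows "wfac A * wfac (qneg A) = 1"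
proof -
  obtain s X f where A: "A = (s, X, f)" by (cases A)
  note q = assms[unfolded A]
  have qn: "quad (s, X, - f)" using quad_neg[OF assms] by (simp add: A qneg_def)
  show ?thesis unfolding A qneg_def wfac_def prod.case
    by (rule weil_space.weil_factor_uminus[OF weil_spaceI[OF q some_ring_lattice[OF q]]
        weil_spaceI[OF qn some_ring_lattice[OF q]]])
qed

lemma wfac_hyp: "wfac (hyp n :: ('f, _) quad) = 1"
proof (induction n)
  case 0
  \<comment> \<open>The zero space is isometric to its double, so its factor is an idempotent; being
    a unit of a domain, it is 1.\<close>
  have "wfac (hyp 0 :: ('f, _) quad) = wfac (qsum (hyp 0 :: ('f, _) quad) (hyp 0))"
    by (rule wfac_iso[OF quad_hyp_0 quad_sum(1)[OF quad_hyp_0 quad_hyp_0] qiso_zero_right[OF quad_hyp_0]])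
  then have "wfac (hyp 0 :: ('f, _) quad) * 1 = wfac (hyp 0 :: ('f, _) quad) * wfac (hyp 0 :: ('f, _) quad)"
    by (simp add: wfac_sum[OF quad_hyp_0 quad_hyp_0])
  moreover have "wfac (hyp 0 :: ('f, _) quad) \<noteq> 0" using wfac_unit[OF quad_hyp_0[where 'f = 'f]] by auto
  ultimately show ?case by simp
next
  case (Suc n)
  have q: "quad (line (1 :: 'f))" by (simp add: quad_line char_ne_2)
  have neg: "qneg (line (1 :: 'f)) = line (- 1)"
    by (simp add: qneg_def line_def fun_eq_iff)
  have qn: "quad (line (- 1 :: 'f))" using quad_neg[OF q] by (simp add: neg)
  note qh = quad_hyp[OF char_ne_2]
  have "wfac (hyp (Suc n) :: ('f, _) quad) = wfac (qsum (hyp n) (qsum (line 1) (line (- 1 :: 'f))))"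
    by (rule wfac_iso[OF qh quad_sum(1)[OF qh quad_sum(1)[OF q qn]] qiso_hyp_Suc[OF char_ne_2]])
  also have "\<dots> = wfac (hyp n :: ('f, _) quad) * (wfac (line (1 :: 'f)) * wfac (line (- 1 :: 'f)))"
    by (simp add: wfac_sum[OF qh quad_sum(1)[OF q qn]] wfac_sum[OF q qn])
  also have "\<dots> = 1" using Suc.IH wfac_neg[OF q] by (simp add: neg)
  finally show ?case .
qed

lemma wfac_weq:
  assumes "quad A" "quad (B :: ('f, _) quad)" "weq A B" shows "wfac A = wfac B"
proof -
  obtain m n where "qiso (qsum A (hyp m)) (qsum B (hyp n))" using assms(3) unfolding weq_def by blast
  from wfac_iso[OF quad_sum(1)[OF assms(1) quad_hyp[OF char_ne_2]] quad_sum(1)[OF assms(2) quad_hyp[OF char_ne_2]] this]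
  show ?thesis
    by (simp add: wfac_sum[OF assms(1) quad_hyp[OF char_ne_2]] wfac_sum[OF assms(2) quad_hyp[OF char_ne_2]] wfac_hyp)
qed

text \<open>All members of the class and all lattices give the value \<open>wfac A\<close>, so the
  description in \<open>witt_weil\<close> has exactly one solution.\<close>

lemma witt_weil_wclass:
  assumes "quad (A :: ('f, 'v::ab_group_add) quad)" shows "witt_weil chi sq (wclass A) = wfac A"
proof -
  have *: "weil_factor chi sq fun_scale (coord_space n) L f = wfac A"
    if "(n, f) \<in> wclass A" "ring_lattice fun_scale (coord_space n) L" for n f L
  proof -
    have "quad (cquad n f)" "weq A (cquad n f)" using that(1) wclass_mem[OF char_ne_2 assms] by auto
    then have "wfac A = wfac (cquad n f)" "quad (fun_scale, coord_space n, f)"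
      by (auto simp add: wfac_weq[OF assms] cquad_def)
    then show ?thesis using wfac_eq[OF _ that(2), of f] by (simp add: cquad_def)
  qed
  obtain n f where f: "quad (cquad n f :: ('f, _) quad)" "qiso A (cquad n f)" using cquad_exists[OF assms] by blast
  then have mem: "(n, f) \<in> wclass A" using wclass_mem[OF char_ne_2 assms] weq_iso by blast
  obtain L where L: "ring_lattice (fun_scale :: 'f \<Rightarrow> _) (coord_space n) L"
    using ring_lattice_exists[OF fd_space_coord] by blast
  show ?thesis
    unfolding witt_weil_def
  proof (rule the_equality)
    show "\<exists>n f L. (n, f) \<in> wclass A \<and> ring_lattice fun_scale (coord_space n) L \<and>
        wfac A = weil_factor chi sq fun_scale (coord_space n) L f"
      using mem L *[OF mem L] by metis
  qed (use * in blast)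
qed

lemma group_hom_witt_weil: "group_hom witt_group unit_group (witt_weil chi sq)"
proof (intro group_hom.intro group_hom_axioms.intro homI)
  show "group (witt_group :: 'f witt_class monoid)"
    by (rule comm_group.axioms(2)[OF comm_group_witt_group[OF char_ne_2]])
  show "group (unit_group :: 'r monoid)" by (rule comm_group.axioms(2)[OF comm_group_unit_group])
next
  fix x :: "'f witt_class" assume "x \<in> carrier witt_group"
  then obtain n f where x: "x = wclass (cquad n f)" "quad (cquad n f)"
    unfolding carrier_witt_group[OF char_ne_2] by blast
  show "witt_weil chi sq x \<in> carrier unit_group"
    using wfac_unit[OF x(2)] by (simp add: x(1) witt_weil_wclass[OF x(2)])
  fix y :: "'f witt_class" assume "y \<in> carrier witt_group"
  then obtain m g where y: "y = wclass (cquad m g)" "quad (cquad m g)"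
    unfolding carrier_witt_group[OF char_ne_2] by blast
  show "witt_weil chi sq (x \<otimes>\<^bsub>witt_group\<^esub> y) = witt_weil chi sq x \<otimes>\<^bsub>unit_group\<^esub> witt_weil chi sq y"
    unfolding x(1) y(1) wclass_mult[OF char_ne_2 x(2) y(2)] witt_weil_wclass[OF x(2)] witt_weil_wclass[OF y(2)]
      witt_weil_wclass[OF quad_sum(1)[OF x(2) y(2)]] by (simp add: wfac_sum[OF x(2) y(2)])
qed

end

text \<open>The lattices are quantified separately, so independence of the normalization is part of
  the claim. The second conjunct ties the map on classes to the Weil factor of forms on spaces other
  than coordinate spaces.\<close>

theorem theorem4p5:
  fixes chi :: "'f::nonarch_local_field \<Rightarrow> 'r::idom" and sq :: 'r
    and s :: "'f \<Rightarrow> 'v::ab_group_add \<Rightarrow> 'v" and s' :: "'f \<Rightarrow> 'w::ab_group_add \<Rightarrow> 'w"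
  assumes "CHAR('f) \<noteq> 2"
    and "(of_nat (residue_char TYPE('f)) :: 'r) dvd 1"
    and "sq\<^sup>2 = of_nat (residue_card TYPE('f))"
    and "smooth_character chi"
    and "\<exists>x. chi x \<noteq> 1"
  shows "(\<forall>X f L Y g M.
            fd_space s X \<and> nondegenerate_form s X f \<and> ring_lattice s X L \<and>
            fd_space s' Y \<and> nondegenerate_form s' Y g \<and> ring_lattice s' Y M \<and>
            witt_equiv s X f s' Y g \<longrightarrow>
            weil_factor chi sq s X L f = weil_factor chi sq s' Y M g) \<and>
         (\<forall>X f L.
            fd_space s X \<and> nondegenerate_form s X f \<and> ring_lattice s X L \<longrightarrow>
            witt_class s X f \<in> carrier witt_group \<and>
            witt_weil chi sq (witt_class s X f) = weil_factor chi sq s X L f) \<and>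
         group_hom witt_group unit_group (witt_weil chi sq)"
proof -
  \<comment> \<open>The square of \<open>sq\<close> is q, a unit of \<open>R\<close>, so its divisor
    \<open>sq\<close> is a unit as well.\<close>
  have "sq * sq dvd 1" using residue_card_unit[OF assms(2)] assms(3) by (simp add: power2_eq_square)
  then have "sq dvd 1" by (rule dvd_mult_left)
  then interpret weil_data chi sq
    by unfold_locales (use assms in auto)
  have "weil_factor chi sq s X L f = weil_factor chi sq s' Y M g"
    if "fd_space s X" "nondegenerate_form s X f" "ring_lattice s X L"
      "fd_space s' Y" "nondegenerate_form s' Y g" "ring_lattice s' Y M" "witt_equiv s X f s' Y g"
    for X f L Y g M
  proof -
    have q: "quad (s, X, f)" "quad (s', Y, g)" using that by (simp_all add: quad_def)
    then have "weq (s, X, f) (s', Y, g)" using witt_equiv_iff_weq[OF assms(1) q] that(7) by blast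
    then show ?thesis using wfac_weq[OF q] wfac_eq[OF q(1) that(3)] wfac_eq[OF q(2) that(6)] by simp
  qed
  moreover have "witt_class s X f \<in> carrier witt_group \<and>
      witt_weil chi sq (witt_class s X f) = weil_factor chi sq s X L f"
    if "fd_space s X" "nondegenerate_form s X f" "ring_lattice s X L" for X f L
  proof -
    have q: "quad (s, X, f)" using that by (simp add: quad_def)
    show ?thesis
      using wclass_carrier[OF assms(1) q] witt_weil_wclass[OF q] wfac_eq[OF q that(3)]
      by (simp add: wclass_def)
  qed
  ultimately show ?thesis using group_hom_witt_weil by blast
qed

end
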